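(* Let $n\ge1$, $\gamma=(\gamma_1,\dots,\gamma_n)$ with $\gamma_i>0$, $|\gamma|=\sum_i\gamma_i$, let $k\in\mathbb{R}\setminus\{-1,-3,-5,\dots\}$ and $f\in S'_{ev}(\mathbb{R}^n_+)$. Then a solution $u\in S'_{ev}(\mathbb{R}^n_+)\times C^2(0,\infty)$ of the Cauchy problem $$(B_k)_tu=(\Delta_\gamma)_xu,\ x\in\mathbb{R}^n_+,\ t>0,\qquad u(x,0;k)=f(x),\quad u_t(x,0;k)=0$$ is given by $$u(x,t;k)=\frac{2^nt^{1-k}\Gamma(\frac{k+1}{2})}{\Gamma(\frac{k-n-|\gamma|+1}{2})\prod_{i=1}^n\Gamma(\frac{\gamma_i+1}{2})}\Big((t^2-|x|^2)_{+,\gamma}^{\frac{k-n-|\gamma|-1}{2}}*f(x)\Big)_\gamma .$$ This solution is unique for $k\ge0$ and not unique for $k<0$.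
   Context: $\mathbb{R}^n_+=\{x\in\mathbb{R}^n:x_i>0\ \forall i\}$; $x^\gamma=\prod_ix_i^{\gamma_i}$. $(B_\nu)_t=\partial_t^2+\frac{\nu}{t}\partial_t$; $(\Delta_\gamma)_x=\sum_{i=1}^n\big(\partial_{x_i}^2+\frac{\gamma_i}{x_i}\partial_{x_i}\big)$. $S_{ev}(\mathbb{R}^n_+)$ is the space of smooth functions on $\overline{\mathbb{R}}^n_+$, even in each variable $x_i$ (all odd-order $x_i$-derivatives vanish at $x_i=0$), with $\sup_{x\in\mathbb{R}^n_+}|x^\alpha D^\beta f(x)|<\infty$ for all multi-indices $\alpha,\beta$; $S'_{ev}(\mathbb{R}^n_+)$ is its dual, with functions $u$ identified with functionals $(u,\varphi)_\gamma=\int_{\mathbb{R}^n_+}u(x)\varphi(x)x^\gamma dx$. The notation $u\in S'_{ev}(\mathbb{R}^n_+)\times C^2(0,\infty)$ means $u$ belongs to $S'_{ev}$ in $x$ and to $C^2(0,\infty)$ in $t$. The weighted functional $(t^2-|x|^2)^\lambda_{+,\gamma}$ acts by $((t^2-|x|^2)^\lambda_{+,\gamma},\varphi)_\gamma=\int_{\{x\in\mathbb{R}^n_+:|x|<t\}}(t^2-|x|^2)^\lambda\varphi(x)x^\gamma dx$ (the normalized expression $(t^2-|x|^2)^\lambda_{+,\gamma}/\Gamma(\lambda+1)$ being understood by analytic continuation in $\lambda$ where the integral diverges). Generalized translation: ${}^{\gamma_i}T^{y_i}_{x_i}f(x)=\frac{\Gamma(\frac{\gamma_i+1}{2})}{\Gamma(\frac{\gamma_i}{2})\Gamma(\frac12)}\int_0^\pi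 f(x_1,\dots,\sqrt{x_i^2+y_i^2-2x_iy_i\cos\alpha},\dots,x_n)\sin^{\gamma_i-1}\alpha\,d\alpha$, ${}^\gamma T^y=\prod_i{}^{\gamma_i}T^{y_i}_{x_i}$; generalized convolution: $(f*g)_\gamma(x)=\int_{\mathbb{R}^n_+}f(y)\,({}^\gamma T^yg)(x)\,y^\gamma dy$. *)

theory Defs
  imports "HOL-Analysis.Analysis"
begin

text \<open>Test functions are represented by their even extension to all of R^n
 (indexed by a finite type 'n, so n = CARD('n) >= 1).\<close>

definition pd :: "'n::finite \<Rightarrow> (real^'n \<Rightarrow> real) \<Rightarrow> real^'n \<Rightarrow> real" where
  "pd i \<phi> x = deriv (\<lambda>s. \<phi> (x + s *\<^sub>R axis i 1)) 0"

fun pds :: "'n::finite list \<Rightarrow> (real^'n \<Rightarrow> real) \<Rightarrow> real^'n \<Rightarrow> real" where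
  "pds [] \<phi> = \<phi>"
| "pds (i # is) \<phi> = pd i (pds is \<phi>)"

definition smooth_fn :: "(real^'n::finite \<Rightarrow> real) \<Rightarrow> bool" where
  "smooth_fn \<phi> \<longleftrightarrow> (\<forall>is. continuous_on UNIV (pds is \<phi>) \<and>
      (\<forall>i x. (\<lambda>s. pds is \<phi> (x + s *\<^sub>R axis i 1)) differentiable (at 0)))"

definition even_fn :: "(real^'n::finite \<Rightarrow> real) \<Rightarrow> bool" where
  "even_fn \<phi> \<longleftrightarrow> (\<forall>i x. \<phi> (\<chi> j. if j = i then - (x$j) else x$j) = \<phi> x)"

definition monom :: "('n::finite \<Rightarrow> nat) \<Rightarrow> real^'n \<Rightarrow> real" where
  "monom \<alpha> x = (\<Prod>i\<in>UNIV. (x$i) ^ \<alpha> i)"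

definition rapid :: "(real^'n::finite \<Rightarrow> real) \<Rightarrow> bool" where
  "rapid \<phi> \<longleftrightarrow> (\<forall>\<alpha> is. bounded (range (\<lambda>x. monom \<alpha> x * pds is \<phi> x)))"

definition S_ev :: "(real^'n::finite \<Rightarrow> real) set" where
  "S_ev = {\<phi>. smooth_fn \<phi> \<and> even_fn \<phi> \<and> rapid \<phi>}"

definition snorm :: "('n::finite \<Rightarrow> nat) \<Rightarrow> 'n list \<Rightarrow> (real^'n \<Rightarrow> real) \<Rightarrow> real" where
  "snorm \<alpha> is \<phi> = (SUP x. \<bar>monom \<alpha> x * pds is \<phi> x\<bar>)"

definition S_ev_dual :: "((real^'n::finite \<Rightarrow> real) \<Rightarrow> real) set" where
  "S_ev_dual = {T. (\<forall>\<phi>\<in>S_ev. \<forall>\<psi>\<in>S_ev. \<forall>a b.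
        T (\<lambda>x. a * \<phi> x + b * \<psi> x) = a * T \<phi> + b * T \<psi>) \<and>
     (\<exists>C N. \<forall>\<phi>\<in>S_ev. \<bar>T \<phi>\<bar> \<le> C * (\<Sum>\<alpha>\<in>{\<alpha>. \<forall>i. \<alpha> i \<le> N}.
                                     \<Sum>is\<in>{is. length is \<le> N}. snorm \<alpha> is \<phi>))}"

definition orth :: "(real^'n::finite) set" where
  "orth = {x. \<forall>i. 0 < x$i}"

definition wgt :: "real^'n::finite \<Rightarrow> real^'n \<Rightarrow> real" where
  "wgt \<gamma> x = (\<Prod>i\<in>UNIV. (x$i) powr (\<gamma>$i))"

text \<open>Singular Bessel Laplacian (at x_i = 0 the limit value (1+gamma_i) d^2/dx_i^2).\<close>
definition bessel_lap :: "real^'n::finite \<Rightarrow> (real^'n \<Rightarrow> real) \<Rightarrow> real^'n \<Rightarrow> real" where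
  "bessel_lap \<gamma> \<phi> x = (\<Sum>i\<in>UNIV. if x$i = 0 then (1 + \<gamma>$i) * pd i (pd i \<phi>) x
        else pd i (pd i \<phi>) x + \<gamma>$i / x$i * pd i \<phi> x)"

text \<open>((t^2-|x|^2)^z_{+,gamma}, phi)_gamma for Re z > -1.\<close>
definition ker_int :: "real^'n::finite \<Rightarrow> real \<Rightarrow> complex \<Rightarrow> (real^'n \<Rightarrow> real) \<Rightarrow> complex" where
  "ker_int \<gamma> t z \<phi> = integral {x\<in>orth. norm x < t}
     (\<lambda>x. (complex_of_real (t^2 - (norm x)^2)) powr z * complex_of_real (\<phi> x * wgt \<gamma> x))"

definition ker_norm :: "real^'n::finite \<Rightarrow> real \<Rightarrow> real \<Rightarrow> (real^'n \<Rightarrow> real) \<Rightarrow> real" where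
  "ker_norm \<gamma> t lam \<phi> = Re ((THE g. g holomorphic_on UNIV \<and>
       (\<forall>z. -1 < Re z \<longrightarrow> g z = rGamma (z + 1) * ker_int \<gamma> t z \<phi>)) (complex_of_real lam))"

definition gtrans :: "real^'n::finite \<Rightarrow> real^'n \<Rightarrow> (real^'n \<Rightarrow> real) \<Rightarrow> real^'n \<Rightarrow> real" where
  "gtrans \<gamma> y \<phi> x = (\<Prod>i\<in>UNIV. Gamma ((\<gamma>$i + 1) / 2) / (Gamma (\<gamma>$i / 2) * Gamma (1/2))) *
     integral (cbox 0 (\<chi> i. pi))
       (\<lambda>a. \<phi> (\<chi> i. sqrt ((x$i)^2 + (y$i)^2 - 2 * x$i * y$i * cos (a$i))) *
            (\<Prod>i\<in>UNIV. sin (a$i) powr (\<gamma>$i - 1)))"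

definition gconv :: "real^'n::finite \<Rightarrow> ((real^'n \<Rightarrow> real) \<Rightarrow> real) \<Rightarrow> ((real^'n \<Rightarrow> real) \<Rightarrow> real)
     \<Rightarrow> (real^'n \<Rightarrow> real) \<Rightarrow> real" where
  "gconv \<gamma> K f \<phi> = f (\<lambda>y. K (gtrans \<gamma> y \<phi>))"

definition sol_formula :: "real^'n::finite \<Rightarrow> real \<Rightarrow> ((real^'n \<Rightarrow> real) \<Rightarrow> real)
     \<Rightarrow> real \<Rightarrow> (real^'n \<Rightarrow> real) \<Rightarrow> real" where
  "sol_formula \<gamma> k f t =
     (let lam = (k - real CARD('n) - (\<Sum>i\<in>UNIV. \<gamma>$i) - 1) / 2;
          c = 2 ^ CARD('n) * t powr (1 - k) * Gamma ((k + 1) / 2) /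
              (\<Prod>i\<in>UNIV. Gamma ((\<gamma>$i + 1) / 2))
      in (\<lambda>\<phi>. c * gconv \<gamma> (ker_norm \<gamma> t lam) f \<phi>))"

definition is_solution :: "real^'n::finite \<Rightarrow> real \<Rightarrow> ((real^'n \<Rightarrow> real) \<Rightarrow> real)
     \<Rightarrow> (real \<Rightarrow> (real^'n \<Rightarrow> real) \<Rightarrow> real) \<Rightarrow> bool" where
  "is_solution \<gamma> k f u \<longleftrightarrow>
     (\<forall>t>0. u t \<in> S_ev_dual) \<and>
     (\<forall>\<phi>\<in>S_ev.
        (\<forall>t>0. (\<lambda>s. u s \<phi>) differentiable (at t) \<and> deriv (\<lambda>s. u s \<phi>) differentiable (at t)) \<and>
        continuous_on {0<..} (deriv (deriv (\<lambda>s. u s \<phi>))) \<and>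
        (\<forall>t>0. deriv (deriv (\<lambda>s. u s \<phi>)) t + k / t * deriv (\<lambda>s. u s \<phi>) t
                 = u t (bessel_lap \<gamma> \<phi>)) \<and>
        ((\<lambda>s. u s \<phi>) \<longlongrightarrow> f \<phi>) (at_right 0) \<and>
        (deriv (\<lambda>s. u s \<phi>) \<longlongrightarrow> 0) (at_right 0))"

end

theory Submission
 imports Defs "HOL-Complex_Analysis.Complex_Analysis"
begin

text \<open>
 For large \<open>k\<close> the test function to which the formula applies \<open>f\<close> is an average of generalized
 translates over the unit ball; differentiating in \<open>t\<close> and integrating by parts replaces \<open>\<lambda>\<close> by
 \<open>\<lambda> + 1\<close> and \<open>\<phi>\<close> by \<open>\<Delta>\<^sub>\<gamma> \<phi>\<close>. The resulting identity
 \<open>V\<^sub>k \<phi> = V\<^sub>k\<^sub>+\<^sub>2 \<phi> + t\<^sup>2 / ((k+1)(k+3)) V\<^sub>k\<^sub>+\<^sub>4 \<Delta>\<^sub>\<gamma> \<phi>\<close> is the analytic continuation in \<open>\<lambda>\<close>, and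
 the equation and the initial conditions follow from it for all admissible \<open>k\<close>.

 For \<open>k < 0\<close> the function \<open>t\<^bsup>1-k\<^esup> \<integral> \<phi> x\<^sup>\<gamma> dx\<close> solves the problem with zero data.

 For \<open>k \<ge> 0\<close> let \<open>w\<close> solve the problem with zero data and let \<open>\<chi>\<close> be a Gaussian average of a test
 function. By Banach-Steinhaus and self-adjointness of \<open>\<Delta>\<^sub>\<gamma>\<close>, \<open>|w\<^sub>t(\<Delta>\<^sub>\<gamma>\<^sup>m \<chi>)| \<le> K C\<^sup>m m!\<close> uniformly on
 \<open>(0, T]\<close>, while \<open>2m\<close> integrations of the equation gain \<open>T\<^sup>2\<^sup>m / (2m)!\<close>; hence \<open>w\<^sub>T(\<chi>) = 0\<close>.
\<close>

text \<open>The initial datum is only a continuous functional, so every formula has to be proved for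
  the test function to which the functional is applied, with estimates in all seminorms. The
  singular terms are handled by the operator (1 / x_i) d/dx_i, which maps even test functions to
  even test functions. It also governs the translates: differentiating them closes up only if the
  exponents may be raised by 2, so kernels with arbitrary positive exponents \<delta> are treated at
  once.

  Two obstacles shape the uniqueness part. The order of the functional w_t may depend on t, and the
  iterated Laplacians of a general test function obey no fixed growth bound. Averages with profile
  \<sigma> exp(-|x|^2 / 2), \<sigma> bounded and continuous, settle both: \<sigma> ranges over a
  Banach space, where boundedness uniform in t is available, and the Laplacians fall on the
  Gaussian, where their growth is explicit. The factor m! arises because each Laplacian shifts the
  index j of s^j exp(-s) / j!, s = |x|^2, by at most one, with coefficients linear in j.\<close>

no_notation fps_nth (infixl "$" 75)

section \<open>Partial derivatives along the axes and smooth functions\<close>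

abbreviation (input) ax :: "'n::finite \<Rightarrow> real \<Rightarrow> real^'n" where
 "ax i s \<equiv> s *\<^sub>R axis i 1"

abbreviation (input) allpos :: "real^'n::finite \<Rightarrow> bool" where
 "allpos \<gamma> \<equiv> \<forall>i. 0 < \<gamma> $ i"

text \<open>\<open>pd\<close> is built from \<open>deriv\<close>, which has a value even where no
  derivative exists; here existence and value are asserted together.\<close>

definition has_pd :: "'n::finite \<Rightarrow> (real^'n \<Rightarrow> real) \<Rightarrow> (real^'n \<Rightarrow> real) \<Rightarrow> bool" where
 "has_pd i f f' \<longleftrightarrow> (\<forall>x. ((\<lambda>s. f (x + ax i s)) has_real_derivative f' x) (at 0))"

lemma has_pd_line:
 assumes "has_pd i f f'"
 shows "((\<lambda>s. f (x + ax i s)) has_real_derivative f' (x + ax i r)) (at r)"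
proof -
 have "((\<lambda>s. f (x + ax i r + ax i s)) has_real_derivative f' (x + ax i r)) (at 0)"
  using assms unfolding has_pd_def by blast
 then have "((\<lambda>s. f (x + ax i (s + r))) has_real_derivative f' (x + ax i r)) (at 0)"
  by (simp add: algebra_simps)
 then show ?thesis
  using DERIV_shift[of "\<lambda>s. f (x + ax i s)" "f' (x + ax i r)" 0 r] by simp
qed

lemma has_pd_imp_pd: "has_pd i f f' \<Longrightarrow> pd i f = f'"
 by (auto simp: has_pd_def pd_def fun_eq_iff intro!: DERIV_imp_deriv)

lemma has_pd_lin:
 "has_pd i f f' \<Longrightarrow> has_pd i g g' \<Longrightarrow> has_pd i (\<lambda>x. a * f x + b * g x) (\<lambda>x. a * f' x + b * g' x)"
 unfolding has_pd_def by (auto intro!: derivative_eq_intros)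

lemma has_pd_mult:
 "has_pd i f f' \<Longrightarrow> has_pd i g g' \<Longrightarrow> has_pd i (\<lambda>x. f x * g x) (\<lambda>x. f' x * g x + f x * g' x)"
 unfolding has_pd_def by (auto intro!: derivative_eq_intros)

lemma has_pd_const: "has_pd i (\<lambda>x. c) (\<lambda>x. 0)"
 unfolding has_pd_def by auto

lemma has_pd_coord: "has_pd i (\<lambda>x. x $ j) (\<lambda>x. if i = j then 1 else 0)"
 unfolding has_pd_def by (auto simp: axis_def intro!: derivative_eq_intros)

lemma has_pd_coord_mult:
 assumes "has_pd i g g'"
 shows "has_pd i (\<lambda>x. x $ j * g x) (\<lambda>x. (if i = j then 1 else 0) * g x + x $ j * g' x)"
 using has_pd_mult[OF has_pd_coord assms] by simp

lemma smooth_fn_has_pd: "smooth_fn \<phi> \<Longrightarrow> has_pd i (pds is \<phi>) (pds (i # is) \<phi>)"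
 by (simp add: smooth_fn_def has_pd_def pd_def DERIV_deriv_iff_real_differentiable)

lemma smooth_fn_continuous: "smooth_fn \<phi> \<Longrightarrow> continuous_on A (pds is \<phi>)"
 by (meson continuous_on_subset smooth_fn_def subset_UNIV)

lemma smooth_fn_continuous_self: "smooth_fn \<phi> \<Longrightarrow> continuous_on A \<phi>"
 using smooth_fn_continuous[of \<phi> A "[]"] by simp

lemma pds_append: "pds (is @ js) \<phi> = pds is (pds js \<phi>)"
 by (induction "is") auto

lemma smooth_fn_pds: "smooth_fn \<phi> \<Longrightarrow> smooth_fn (pds is \<phi>)"
 by (simp add: smooth_fn_def flip: pds_append)

lemma smooth_fn_pd: "smooth_fn \<phi> \<Longrightarrow> smooth_fn (pd i \<phi>)"
 using smooth_fn_pds[of \<phi> "[i]"] by simp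

text \<open>Smoothness speaks of all iterated derivatives. A class of continuous functions that
  contains a partial derivative of each member in each direction contains all iterated ones, so
  exhibiting such a class replaces an induction over lists.\<close>

lemma smooth_fn_coinduct:
 assumes "g \<in> C"
  and "\<And>g. g \<in> C \<Longrightarrow> continuous_on UNIV g"
  and "\<And>g i. g \<in> C \<Longrightarrow> \<exists>g'\<in>C. has_pd i g g'"
 shows "smooth_fn g" "pds is g \<in> C"
proof -
 have *: "pds is g \<in> C" for "is"
 proof (induction "is")
  case (Cons i "is")
  then show ?case using assms(3)[of "pds is g" i] has_pd_imp_pd by fastforce
 qed (use assms in simp)
 then show "pds is g \<in> C" .
 show "smooth_fn g"
  unfolding smooth_fn_def
 proof (intro allI conjI)
  fix "is" i x
  obtain g' where "has_pd i (pds is g) g'" using * assms(3) by blast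
  then show "(\<lambda>s. pds is g (x + ax i s)) differentiable at 0"
   unfolding has_pd_def using real_differentiable_def by blast
 qed (use * assms in auto)
qed

lemma pds_lin:
 assumes "smooth_fn f" "smooth_fn g"
 shows "pds is (\<lambda>x. a * f x + b * g x) = (\<lambda>x. a * pds is f x + b * pds is g x)"
proof (induction "is")
 case (Cons i "is")
 then show ?case
  using has_pd_imp_pd[OF has_pd_lin[OF smooth_fn_has_pd[OF assms(1), of i "is"] smooth_fn_has_pd[OF assms(2), of i "is"], of a b]]
  by simp
qed simp

lemma smooth_fn_lin:
 assumes "smooth_fn f" "smooth_fn g"
 shows "smooth_fn (\<lambda>x. a * f x + b * g x)"
proof (rule smooth_fn_coinduct(1)[where C="{(\<lambda>x. a * pds is f x + b * pds is g x) | is. True}"])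
 show "(\<lambda>x. a * f x + b * g x) \<in> {(\<lambda>x. a * pds is f x + b * pds is g x) | is. True}"
  by (auto intro!: exI[of _ "[]"])
 show "continuous_on UNIV h" if "h \<in> {(\<lambda>x. a * pds is f x + b * pds is g x) | is. True}" for h
  using that assms by (auto intro!: continuous_intros smooth_fn_continuous)
 show "\<exists>h'\<in>{(\<lambda>x. a * pds is f x + b * pds is g x) | is. True}. has_pd i h h'"
  if "h \<in> {(\<lambda>x. a * pds is f x + b * pds is g x) | is. True}" for h i
  using that has_pd_lin[OF smooth_fn_has_pd[OF assms(1)] smooth_fn_has_pd[OF assms(2)]] by blast
qed

subsection \<open>Families closed under linear combinations and multiplication by coordinates\<close>

text \<open>The members are families indexed by a parameter p rather than single functions: one
  expression for the derivative then serves all p, which is what makes the later seminorm bounds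
  uniform in p.\<close>

inductive_set pspan :: "('p \<Rightarrow> real^'n::finite \<Rightarrow> real) set \<Rightarrow> ('p \<Rightarrow> real^'n \<Rightarrow> real) set"
 for B where
  base: "G \<in> B \<Longrightarrow> G \<in> pspan B"
 | lin: "G \<in> pspan B \<Longrightarrow> H \<in> pspan B \<Longrightarrow> (\<lambda>p x. a * G p x + b * H p x) \<in> pspan B"
 | coord: "G \<in> pspan B \<Longrightarrow> (\<lambda>p x. x $ j * G p x) \<in> pspan B"

lemma pspan_scale: "G \<in> pspan B \<Longrightarrow> (\<lambda>p x. a * G p x) \<in> pspan B"
 using pspan.lin[of G B G a 0] by simp

lemma pspan_add: "G \<in> pspan B \<Longrightarrow> H \<in> pspan B \<Longrightarrow> (\<lambda>p x. G p x + H p x) \<in> pspan B"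
 using pspan.lin[of G B H 1 1] by simp

definition pd_closed :: "('p \<Rightarrow> real^'n::finite \<Rightarrow> real) set \<Rightarrow> 'p set \<Rightarrow> bool" where
 "pd_closed B P \<longleftrightarrow> (\<forall>G\<in>B. \<forall>i. \<exists>G'\<in>pspan B. \<forall>p\<in>P. has_pd i (G p) (G' p))"

lemma pspan_has_pd:
 assumes step: "pd_closed B P"
  and "G \<in> pspan B"
 shows "\<exists>G'\<in>pspan B. \<forall>p\<in>P. has_pd i (G p) (G' p)"
 using assms(2)
proof induction
 case (base G)
 then show ?case using step unfolding pd_closed_def by blast
next
 case (lin G H a b)
 then obtain G' H' where "G' \<in> pspan B" "\<forall>p\<in>P. has_pd i (G p) (G' p)"
  "H' \<in> pspan B" "\<forall>p\<in>P. has_pd i (H p) (H' p)" by blast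
 then show ?case
  by (intro bexI[of _ "\<lambda>p x. a * G' p x + b * H' p x"] ballI has_pd_lin pspan.lin) auto
next
 case (coord G j)
 then obtain G' where G': "G' \<in> pspan B" "\<forall>p\<in>P. has_pd i (G p) (G' p)" by blast
 have "(\<lambda>p x. (if i = j then 1 else 0) * G p x + 1 * (x $ j * G' p x)) \<in> pspan B"
  using coord G' by (intro pspan.lin pspan.coord) auto
 moreover have "\<forall>p\<in>P. has_pd i (\<lambda>x. x $ j * G p x)
   (\<lambda>x. (if i = j then 1 else 0) * G p x + 1 * (x $ j * G' p x))"
  using G' has_pd_coord_mult by fastforce
 ultimately show ?case by (intro bexI[of _ "\<lambda>p x. (if i = j then 1 else 0) * G p x + 1 * (x $ j * G' p x)"]) auto
qed

lemma pspan_pds: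
 assumes step: "pd_closed B P"
  and "G \<in> pspan B"
 shows "\<exists>G'\<in>pspan B. \<forall>p\<in>P. pds is (G p) = G' p"
proof (induction "is")
 case Nil
 then show ?case using assms(2) by auto
next
 case (Cons i "is")
 then obtain G' where G': "G' \<in> pspan B" "\<forall>p\<in>P. pds is (G p) = G' p" by blast
 obtain G'' where G'': "G'' \<in> pspan B" "\<forall>p\<in>P. has_pd i (G' p) (G'' p)"
  using pspan_has_pd[OF step G'(1), of i] by blast
 have "pds (i # is) (G p) = G'' p" if "p \<in> P" for p
  using G'(2) G''(2) has_pd_imp_pd[of i "G' p" "G'' p"] that by simp
 with G'' show ?case by blast
qed

lemma pspan_smooth:
 assumes step: "pd_closed B P"
  and cont: "\<And>G p. G \<in> B \<Longrightarrow> p \<in> P \<Longrightarrow> continuous_on UNIV (G p)"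
  and "G \<in> pspan B" "p \<in> P"
 shows "smooth_fn (G p)"
proof (rule smooth_fn_coinduct(1)[where C="{G p | G. G \<in> pspan B}"])
 show "G p \<in> {G p | G. G \<in> pspan B}" using assms by blast
 have "continuous_on UNIV (G p)" if "G \<in> pspan B" for G
  using that
 proof induction
  case (base G)
  then show ?case using cont assms by blast
 qed (auto intro!: continuous_intros)
 then show "continuous_on UNIV g" if "g \<in> {G p | G. G \<in> pspan B}" for g using that by auto
 show "\<exists>g'\<in>{G p | G. G \<in> pspan B}. has_pd i g g'" if g: "g \<in> {G p | G. G \<in> pspan B}" for g i
 proof -
  obtain G where G: "g = G p" "G \<in> pspan B" using g by blast
  show ?thesis using pspan_has_pd[OF step G(2), of i] assms(4) G(1) by blast
 qed
qed

text \<open>\<open>\<nu> M p\<close> measures the size of the parameter, for instance by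
  \<open>sn M \<phi>\<close>. The constant and the loss of order may depend on the monomial but not
  on p.\<close>

definition unif_bd :: "'p set \<Rightarrow> (nat \<Rightarrow> 'p \<Rightarrow> real) \<Rightarrow> ('p \<Rightarrow> real^'n::finite \<Rightarrow> real) \<Rightarrow> bool" where
 "unif_bd P \<nu> G \<longleftrightarrow> (\<forall>\<alpha>. \<exists>C M. C \<ge> 0 \<and> (\<forall>p\<in>P. \<forall>x. \<bar>monom \<alpha> x * G p x\<bar> \<le> C * \<nu> M p))"

definition norm_scale :: "'p set \<Rightarrow> (nat \<Rightarrow> 'p \<Rightarrow> real) \<Rightarrow> bool" where
 "norm_scale P \<nu> \<longleftrightarrow> (\<forall>p\<in>P. \<forall>M. 0 \<le> \<nu> M p) \<and> (\<forall>p\<in>P. \<forall>M N. M \<le> N \<longrightarrow> \<nu> M p \<le> \<nu> N p)"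

lemma unif_bd_lin:
 assumes ns: "norm_scale P \<nu>" and "unif_bd P \<nu> G" "unif_bd P \<nu> H"
 shows "unif_bd P \<nu> (\<lambda>p x. a * G p x + b * H p x)"
 unfolding unif_bd_def
proof
 fix \<alpha>
 obtain C M D N where 1: "C \<ge> 0" "\<And>p x. p\<in>P \<Longrightarrow> \<bar>monom \<alpha> x * G p x\<bar> \<le> C * \<nu> M p"
  "D \<ge> 0" "\<And>p x. p\<in>P \<Longrightarrow> \<bar>monom \<alpha> x * H p x\<bar> \<le> D * \<nu> N p"
  using assms unfolding unif_bd_def by meson
 have "\<bar>monom \<alpha> x * (a * G p x + b * H p x)\<bar> \<le> (\<bar>a\<bar> * C + \<bar>b\<bar> * D) * \<nu> (max M N) p" if p: "p \<in> P" for p x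
 proof -
  have m: "\<nu> M p \<le> \<nu> (max M N) p" "\<nu> N p \<le> \<nu> (max M N) p"
   using ns p unfolding norm_scale_def by auto
  have "monom \<alpha> x * (a * G p x + b * H p x) = a * (monom \<alpha> x * G p x) + b * (monom \<alpha> x * H p x)"
   by (simp add: algebra_simps)
  then have "\<bar>monom \<alpha> x * (a * G p x + b * H p x)\<bar> \<le> \<bar>a\<bar> * \<bar>monom \<alpha> x * G p x\<bar> + \<bar>b\<bar> * \<bar>monom \<alpha> x * H p x\<bar>"
   by (metis abs_mult abs_triangle_ineq)
  also have "... \<le> \<bar>a\<bar> * (C * \<nu> (max M N) p) + \<bar>b\<bar> * (D * \<nu> (max M N) p)"
   using 1(2)[OF p, of x] 1(4)[OF p, of x] m 1(1,3)
   by (intro add_mono mult_left_mono) (auto intro: order_trans mult_left_mono)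
  finally show ?thesis by (simp add: algebra_simps)
 qed
 then show "\<exists>C M. 0 \<le> C \<and> (\<forall>p\<in>P. \<forall>x. \<bar>monom \<alpha> x * (a * G p x + b * H p x)\<bar> \<le> C * \<nu> M p)"
  using 1 by (intro exI[of _ "\<bar>a\<bar> * C + \<bar>b\<bar> * D"] exI[of _ "max M N"]) auto
qed

lemma monom_Suc: "monom (\<alpha>(j := Suc (\<alpha> j))) x = x $ j * monom \<alpha> x"
proof -
 have "monom (\<alpha>(j := Suc (\<alpha> j))) x = x $ j ^ Suc (\<alpha> j) * (\<Prod>i\<in>UNIV - {j}. (x$i) ^ \<alpha> i)"
  unfolding monom_def by (subst prod.remove[of _ j]) (auto intro!: prod.cong)
 moreover have "monom \<alpha> x = x $ j ^ \<alpha> j * (\<Prod>i\<in>UNIV - {j}. (x$i) ^ \<alpha> i)"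
  unfolding monom_def by (subst prod.remove[of _ j]) auto
 ultimately show ?thesis by simp
qed

lemma unif_bd_coord:
 assumes "unif_bd P \<nu> G"
 shows "unif_bd P \<nu> (\<lambda>p x. x $ j * G p x)"
 unfolding unif_bd_def
proof
 fix \<alpha>
 obtain C M where "C \<ge> 0" "\<And>p x. p\<in>P \<Longrightarrow> \<bar>monom (\<alpha>(j := Suc (\<alpha> j))) x * G p x\<bar> \<le> C * \<nu> M p"
  using assms unfolding unif_bd_def by meson
 then show "\<exists>C M. 0 \<le> C \<and> (\<forall>p\<in>P. \<forall>x. \<bar>monom \<alpha> x * (x $ j * G p x)\<bar> \<le> C * \<nu> M p)"
  unfolding monom_Suc by (intro exI[of _ C] exI[of _ M]) (auto simp: ac_simps)
qed

lemma pspan_unif_bd: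
 assumes "norm_scale P \<nu>" and "\<And>G. G \<in> B \<Longrightarrow> unif_bd P \<nu> G" and "G \<in> pspan B"
 shows "unif_bd P \<nu> G"
 using assms(3) by induction (auto intro: unif_bd_lin unif_bd_coord assms)

subsection \<open>Seminorms\<close>

text \<open>The sum of seminorms that bounds a functional in \<open>S_ev_dual\<close>; as N grows
  these sums form one increasing scale.\<close>

definition sn :: "nat \<Rightarrow> (real^'n::finite \<Rightarrow> real) \<Rightarrow> real" where
 "sn N \<phi> = (\<Sum>\<alpha>\<in>{\<alpha>. \<forall>i. \<alpha> i \<le> N}. \<Sum>is\<in>{is. length is \<le> N}. snorm \<alpha> is \<phi>)"

lemma finite_multi: "finite {\<alpha>::'n::finite \<Rightarrow> nat. \<forall>i. \<alpha> i \<le> N}"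
proof -
 have "{\<alpha>::'n::finite \<Rightarrow> nat. \<forall>i. \<alpha> i \<le> N} = PiE UNIV (\<lambda>_. {..N})" by (auto simp: PiE_def Pi_def)
 then show ?thesis by (auto intro: finite_PiE)
qed

lemma finite_lists: "finite {is::'n::finite list. length is \<le> N}"
 using finite_lists_length_le[of "UNIV::'n set" N] by simp

lemma S_evD: "\<phi> \<in> S_ev \<Longrightarrow> smooth_fn \<phi>" "\<phi> \<in> S_ev \<Longrightarrow> even_fn \<phi>" "\<phi> \<in> S_ev \<Longrightarrow> rapid \<phi>"
 by (auto simp: S_ev_def)

lemma snorm_upper:
 assumes "\<phi> \<in> S_ev"
 shows "\<bar>monom \<alpha> x * pds is \<phi> x\<bar> \<le> snorm \<alpha> is \<phi>"
proof -
 have "bounded (range (\<lambda>x. monom \<alpha> x * pds is \<phi> x))"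
  using S_evD(3)[OF assms] by (auto simp: rapid_def)
 then obtain B where "\<And>x. \<bar>monom \<alpha> x * pds is \<phi> x\<bar> \<le> B"
  unfolding bounded_iff by auto
 then have "bdd_above (range (\<lambda>x. \<bar>monom \<alpha> x * pds is \<phi> x\<bar>))" by (auto intro!: bdd_aboveI2)
 then show ?thesis unfolding snorm_def by (rule cSUP_upper2[where x=x]) auto
qed

lemma snorm_nonneg: "\<phi> \<in> S_ev \<Longrightarrow> 0 \<le> snorm \<alpha> is \<phi>"
 using snorm_upper[of \<phi> \<alpha> 0 "is"] by linarith

lemma snorm_le_sn:
 assumes "\<phi> \<in> S_ev" "\<forall>i. \<alpha> i \<le> N" "length is \<le> N"
 shows "snorm \<alpha> is \<phi> \<le> sn N \<phi>"
proof -
 have "snorm \<alpha> is \<phi> \<le> (\<Sum>is\<in>{is. length is \<le> N}. snorm \<alpha> is \<phi>)"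
  by (rule member_le_sum) (use assms snorm_nonneg finite_lists in auto)
 also have "... \<le> sn N \<phi>" unfolding sn_def
  by (rule member_le_sum[where f="\<lambda>\<alpha>. \<Sum>is\<in>{is. length is \<le> N}. snorm \<alpha> is \<phi>"])
   (use assms snorm_nonneg finite_multi in \<open>auto intro!: sum_nonneg\<close>)
 finally show ?thesis .
qed

lemma sn_upper:
 assumes "\<phi> \<in> S_ev" "\<forall>i. \<alpha> i \<le> N" "length is \<le> N"
 shows "\<bar>monom \<alpha> x * pds is \<phi> x\<bar> \<le> sn N \<phi>"
 using snorm_le_sn[OF assms] snorm_upper[OF assms(1)] order_trans by blast

lemma sn_nonneg: "\<phi> \<in> S_ev \<Longrightarrow> 0 \<le> sn N \<phi>"
 unfolding sn_def by (intro sum_nonneg snorm_nonneg)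

lemma sn_mono:
 assumes "\<phi> \<in> S_ev" "M \<le> N" shows "sn M \<phi> \<le> sn N \<phi>"
proof -
 have "sn M \<phi> \<le> (\<Sum>\<alpha>\<in>{\<alpha>. \<forall>i. \<alpha> i \<le> M}. \<Sum>is\<in>{is. length is \<le> N}. snorm \<alpha> is \<phi>)"
  unfolding sn_def
  by (intro sum_mono sum_mono2 finite_lists) (use assms snorm_nonneg in auto)
 also have "... \<le> sn N \<phi>" unfolding sn_def
  by (intro sum_mono2 finite_multi) (use assms snorm_nonneg in \<open>auto intro!: sum_nonneg intro: le_trans\<close>)
 finally show ?thesis .
qed

definition sn_count :: "'n::finite itself \<Rightarrow> nat \<Rightarrow> real" where
 "sn_count _ N = real (card {\<alpha>::'n \<Rightarrow> nat. \<forall>i. \<alpha> i \<le> N}) * real (card {is::'n list. length is \<le> N})"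

lemma sn_count_nonneg: "0 \<le> sn_count T N" by (simp add: sn_count_def)

lemma sn_least:
 fixes \<phi> :: "real^'n::finite \<Rightarrow> real"
 assumes "\<And>\<alpha> is x. (\<forall>i. \<alpha> i \<le> N) \<Longrightarrow> length is \<le> N \<Longrightarrow> \<bar>monom \<alpha> x * pds is \<phi> x\<bar> \<le> B"
 shows "sn N \<phi> \<le> sn_count TYPE('n) N * B"
proof -
 have "sn N \<phi> \<le> (\<Sum>\<alpha>\<in>{\<alpha>::'n \<Rightarrow> nat. \<forall>i. \<alpha> i \<le> N}. \<Sum>is\<in>{is::'n list. length is \<le> N}. B)"
  unfolding sn_def snorm_def
  by (intro sum_mono cSUP_least) (use assms in auto)
 then show ?thesis by (simp add: sn_count_def)
qed

text \<open>The families of seminorm bounds are finite in number, so pointwise bounds with constants depending on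
 the multi-indices yield a bound for each \<^term>\<open>sn N\<close>.\<close>
lemma unif_bd_sn:
 fixes G :: "'p \<Rightarrow> real^'n::finite \<Rightarrow> real"
 assumes ns: "norm_scale P \<nu>" and "\<And>is. unif_bd P \<nu> (\<lambda>p. pds is (G p))"
 shows "\<exists>C M. C \<ge> 0 \<and> (\<forall>p\<in>P. sn N (G p) \<le> C * \<nu> M p)"
proof -
 have "\<forall>\<alpha> is. \<exists>C M. C \<ge> 0 \<and> (\<forall>p\<in>P. \<forall>x. \<bar>monom \<alpha> x * pds is (G p) x\<bar> \<le> C * \<nu> M p)"
  using assms(2) unfolding unif_bd_def by blast
 then obtain C M where CM: "\<And>\<alpha> is. C \<alpha> is \<ge> 0"
  "\<And>\<alpha> is p x. p\<in>P \<Longrightarrow> \<bar>monom \<alpha> x * pds is (G p) x\<bar> \<le> C \<alpha> is * \<nu> (M \<alpha> is) p"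
  by metis
 let ?I = "{\<alpha>::'n \<Rightarrow> nat. \<forall>i. \<alpha> i \<le> N} \<times> {is::'n list. length is \<le> N}"
 have fin: "finite ?I" using finite_multi finite_lists by blast
 define C0 where "C0 = (\<Sum>(\<alpha>,is)\<in>?I. C \<alpha> is)"
 define M0 where "M0 = (\<Sum>(\<alpha>,is)\<in>?I. M \<alpha> is)"
 have C0: "C \<alpha> is \<le> C0" "M \<alpha> is \<le> M0" if "\<forall>i. \<alpha> i \<le> N" "length is \<le> N" for \<alpha> "is"
  using member_le_sum[of "(\<alpha>,is)" ?I "\<lambda>(\<alpha>,is). C \<alpha> is"] member_le_sum[of "(\<alpha>,is)" ?I "\<lambda>(\<alpha>,is). M \<alpha> is"]
   that fin CM(1) unfolding C0_def M0_def by auto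
 have "C0 \<ge> 0" unfolding C0_def by (intro sum_nonneg) (auto simp: CM)
 have "sn N (G p) \<le> sn_count TYPE('n) N * (C0 * \<nu> M0 p)" if p: "p \<in> P" for p
 proof (rule sn_least)
  fix \<alpha> :: "'n \<Rightarrow> nat" and "is" :: "'n list" and x
  assume a: "\<forall>i. \<alpha> i \<le> N" "length is \<le> N"
  have "\<bar>monom \<alpha> x * pds is (G p) x\<bar> \<le> C \<alpha> is * \<nu> (M \<alpha> is) p" using CM p by blast
  also have "... \<le> C0 * \<nu> M0 p"
   using C0[OF a] CM(1) ns p \<open>C0 \<ge> 0\<close> unfolding norm_scale_def by (intro mult_mono) auto
  finally show "\<bar>monom \<alpha> x * pds is (G p) x\<bar> \<le> C0 * \<nu> M0 p" .
 qed
 then show ?thesis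
  by (intro exI[of _ "sn_count TYPE('n) N * C0"] exI[of _ M0]) (use \<open>C0 \<ge> 0\<close> sn_count_nonneg[of "TYPE('n)" N] in \<open>auto simp: ac_simps\<close>)
qed

lemma abs_monom_le: "\<bar>monom \<alpha> x\<bar> \<le> (1 + norm x) ^ (\<Sum>i\<in>UNIV. \<alpha> i)"
proof -
 have "\<bar>monom \<alpha> x\<bar> = (\<Prod>i\<in>UNIV. \<bar>x$i\<bar> ^ \<alpha> i)" by (simp add: monom_def abs_prod power_abs)
 also have "... \<le> (\<Prod>i\<in>UNIV. (1 + norm x) ^ \<alpha> i)"
  by (intro prod_mono conjI power_mono) (auto intro: order_trans[OF component_le_norm_cart])
 finally show ?thesis by (simp add: power_sum)
qed

text \<open>The seminorms control monomials only. The norm is therefore compared with the largest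
  coordinate in absolute value, whose power is a single monomial.\<close>

lemma norm_power_pds_le:
 fixes \<phi> :: "real^'n::finite \<Rightarrow> real"
 assumes \<phi>: "\<phi> \<in> S_ev" and "N \<le> M" "length is \<le> M"
 shows "(1 + norm x) ^ N * \<bar>pds is \<phi> x\<bar> \<le> (real CARD('n) + 1) ^ (N + 1) * sn M \<phi>"
proof -
 define m where "m = Max (range (\<lambda>i. \<bar>x $ i\<bar>))"
 have mi: "\<bar>x $ i\<bar> \<le> m" for i unfolding m_def by (auto intro: Max_ge)
 then have m0: "m \<ge> 0" using abs_ge_zero order_trans by blast
 have "m \<in> range (\<lambda>i. \<bar>x $ i\<bar>)" unfolding m_def by (rule Max_in) auto
 then obtain j where j: "\<bar>x $ j\<bar> = m" by auto
 have "norm x \<le> (\<Sum>i\<in>UNIV. \<bar>x $ i\<bar>)" by (rule norm_le_l1_cart)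
 also have "... \<le> real CARD('n) * m" using sum_mono[of UNIV "\<lambda>i. \<bar>x $ i\<bar>" "\<lambda>_. m"] mi by simp
 also have "... \<le> real CARD('n) * max 1 m" by (intro mult_left_mono) auto
 finally have nx: "1 + norm x \<le> (real CARD('n) + 1) * max 1 m" by (simp add: algebra_simps)
 have "(1 + norm x) ^ N \<le> (real CARD('n) + 1) ^ N * max 1 m ^ N"
  using power_mono[OF nx, of N] by (simp add: power_mult_distrib)
 also have "max 1 m ^ N \<le> 1 + m ^ N" using m0 by (auto simp: max_def)
 finally have 1: "(1 + norm x) ^ N \<le> (real CARD('n) + 1) ^ N * (1 + m ^ N)"
  by (simp add: mult_left_mono)
 have "\<bar>pds is \<phi> x\<bar> \<le> sn M \<phi>" using sn_upper[OF \<phi>, of "\<lambda>_. 0" M "is" x] assms by (simp add: monom_def)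
 moreover have "m ^ N * \<bar>pds is \<phi> x\<bar> \<le> sn M \<phi>"
 proof -
  have "monom (\<lambda>i. if i = j then N else 0) x = x $ j ^ N"
   unfolding monom_def by (subst prod.remove[of _ j]) auto
  then show ?thesis
   using sn_upper[OF \<phi>, of "\<lambda>i. if i = j then N else 0" M "is" x] assms j
   by (simp add: abs_mult power_abs)
 qed
 ultimately have 2: "(1 + m ^ N) * \<bar>pds is \<phi> x\<bar> \<le> 2 * sn M \<phi>" by (simp add: algebra_simps)
 have "(1 + norm x) ^ N * \<bar>pds is \<phi> x\<bar> \<le> (real CARD('n) + 1) ^ N * ((1 + m ^ N) * \<bar>pds is \<phi> x\<bar>)"
  using mult_right_mono[OF 1, of "\<bar>pds is \<phi> x\<bar>"] by (simp add: ac_simps)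
 also have "... \<le> (real CARD('n) + 1) ^ N * (2 * sn M \<phi>)" by (intro mult_left_mono 2) simp
 \<comment> \<open>The factor 2 is absorbed into one more power, as the dimension is at least
   one.\<close>
 also have "... \<le> (real CARD('n) + 1) ^ N * ((real CARD('n) + 1) * sn M \<phi>)"
  using sn_nonneg[OF \<phi>, of M] by (intro mult_left_mono mult_right_mono) (auto simp: Suc_leI)
 finally show ?thesis by (simp add: ac_simps)
qed

lemma bounded_if_power_bound:
 assumes "\<And>x. (1 + norm x) ^ (\<Sum>i\<in>UNIV. \<alpha> i) * \<bar>g x\<bar> \<le> B"
 shows "\<bar>monom \<alpha> x * g x\<bar> \<le> B"
proof -
 have "\<bar>monom \<alpha> x * g x\<bar> \<le> (1 + norm x) ^ (\<Sum>i\<in>UNIV. \<alpha> i) * \<bar>g x\<bar>"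
  unfolding abs_mult by (intro mult_right_mono abs_monom_le) auto
 then show ?thesis using assms[of x] by linarith
qed

lemma S_evI:
 assumes "smooth_fn \<phi>" "even_fn \<phi>" "\<And>\<alpha> is. \<exists>B. \<forall>x. \<bar>monom \<alpha> x * pds is \<phi> x\<bar> \<le> B"
 shows "\<phi> \<in> S_ev"
 using assms unfolding S_ev_def rapid_def bounded_iff by fastforce

text \<open>Decay has to be checked for the generators only: every iterated derivative of a member
  is again in the span, and the span inherits the bounds of its generators.\<close>

lemma pspan_S_ev:
 assumes step: "pd_closed B P"
  and cont: "\<And>G p. G \<in> B \<Longrightarrow> p \<in> P \<Longrightarrow> continuous_on UNIV (G p)"
  and ns: "norm_scale P \<nu>" and bd: "\<And>G. G \<in> B \<Longrightarrow> unif_bd P \<nu> G"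
  and G: "G \<in> pspan B"
 shows "unif_bd P \<nu> (\<lambda>p. pds is (G p))"
  and "p \<in> P \<Longrightarrow> even_fn (G p) \<Longrightarrow> G p \<in> S_ev"
proof -
 have *: "unif_bd P \<nu> (\<lambda>p. pds is (G p))" for "is"
 proof -
  obtain G' where G': "G' \<in> pspan B" "\<forall>p\<in>P. pds is (G p) = G' p"
   using pspan_pds[OF step G, of "is"] by blast
  have "unif_bd P \<nu> G'" using pspan_unif_bd[OF ns bd G'(1)] .
  then show ?thesis unfolding unif_bd_def using G'(2) by simp
 qed
 then show "unif_bd P \<nu> (\<lambda>p. pds is (G p))" .
 assume p: "p \<in> P" and ev: "even_fn (G p)"
 show "G p \<in> S_ev"
 proof (rule S_evI)
  show "smooth_fn (G p)" by (rule pspan_smooth[OF step _ G p]) (rule cont)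
  show "\<exists>B. \<forall>x. \<bar>monom \<alpha> x * pds is (G p) x\<bar> \<le> B" for \<alpha> "is"
   using *[of "is"] p unfolding unif_bd_def by blast
 qed (use ev in simp)
qed

lemma even_fn_lin: "even_fn f \<Longrightarrow> even_fn g \<Longrightarrow> even_fn (\<lambda>x. a * f x + b * g x)"
 by (simp add: even_fn_def)

lemma S_ev_lin:
 assumes "\<phi> \<in> S_ev" "\<psi> \<in> S_ev"
 shows "(\<lambda>x. a * \<phi> x + b * \<psi> x) \<in> S_ev"
proof (rule S_evI)
 show "smooth_fn (\<lambda>x. a * \<phi> x + b * \<psi> x)" "even_fn (\<lambda>x. a * \<phi> x + b * \<psi> x)"
  using assms smooth_fn_lin even_fn_lin S_evD by blast+
 fix \<alpha> "is"
 have "\<bar>monom \<alpha> x * pds is (\<lambda>x. a * \<phi> x + b * \<psi> x) x\<bar> \<le> \<bar>a\<bar> * snorm \<alpha> is \<phi> + \<bar>b\<bar> * snorm \<alpha> is \<psi>" for x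
 proof -
  have "monom \<alpha> x * pds is (\<lambda>x. a * \<phi> x + b * \<psi> x) x = a * (monom \<alpha> x * pds is \<phi> x) + b * (monom \<alpha> x * pds is \<psi> x)"
   using pds_lin[of \<phi> \<psi> "is" a b] S_evD(1)[OF assms(1)] S_evD(1)[OF assms(2)] by (simp add: algebra_simps)
  also have "\<bar>\<dots>\<bar> \<le> \<bar>a\<bar> * \<bar>monom \<alpha> x * pds is \<phi> x\<bar> + \<bar>b\<bar> * \<bar>monom \<alpha> x * pds is \<psi> x\<bar>"
   by (metis abs_mult abs_triangle_ineq)
  also have "... \<le> \<bar>a\<bar> * snorm \<alpha> is \<phi> + \<bar>b\<bar> * snorm \<alpha> is \<psi>"
   by (intro add_mono mult_left_mono snorm_upper assms) auto
  finally show ?thesis .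
 qed
 then show "\<exists>B. \<forall>x. \<bar>monom \<alpha> x * pds is (\<lambda>x. a * \<phi> x + b * \<psi> x) x\<bar> \<le> B" by blast
qed

lemma S_ev_scale: "\<phi> \<in> S_ev \<Longrightarrow> (\<lambda>x. a * \<phi> x) \<in> S_ev"
 using S_ev_lin[of \<phi> \<phi> a 0] by simp

lemma sn_lin_le:
 fixes \<phi> :: "real^'n::finite \<Rightarrow> real"
 assumes "\<phi> \<in> S_ev" "\<psi> \<in> S_ev"
 shows "sn N (\<lambda>x. a * \<phi> x + b * \<psi> x) \<le> sn_count TYPE('n) N * (\<bar>a\<bar> * sn N \<phi> + \<bar>b\<bar> * sn N \<psi>)"
proof (rule sn_least)
 fix \<alpha> :: "'n \<Rightarrow> nat" and "is" :: "'n list" and x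
 assume a: "\<forall>i. \<alpha> i \<le> N" "length is \<le> N"
 have "monom \<alpha> x * pds is (\<lambda>x. a * \<phi> x + b * \<psi> x) x = a * (monom \<alpha> x * pds is \<phi> x) + b * (monom \<alpha> x * pds is \<psi> x)"
  using pds_lin[of \<phi> \<psi> "is" a b] S_evD(1)[OF assms(1)] S_evD(1)[OF assms(2)] by (simp add: algebra_simps)
 also have "\<bar>\<dots>\<bar> \<le> \<bar>a\<bar> * \<bar>monom \<alpha> x * pds is \<phi> x\<bar> + \<bar>b\<bar> * \<bar>monom \<alpha> x * pds is \<psi> x\<bar>"
  by (metis abs_mult abs_triangle_ineq)
 also have "... \<le> \<bar>a\<bar> * sn N \<phi> + \<bar>b\<bar> * sn N \<psi>"
  by (intro add_mono mult_left_mono sn_upper assms a) auto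
 finally show "\<bar>monom \<alpha> x * pds is (\<lambda>x. a * \<phi> x + b * \<psi> x) x\<bar> \<le> \<bar>a\<bar> * sn N \<phi> + \<bar>b\<bar> * sn N \<psi>" .
qed

subsection \<open>Division of the radial derivative by the coordinate\<close>

text \<open>Scales the coordinate i by s and fixes the others. The form as a displacement along the
  axis is the one to which derivatives along lines apply.\<close>

definition sc :: "'n::finite \<Rightarrow> real \<Rightarrow> real^'n \<Rightarrow> real^'n" where
 "sc i s x = x + ax i ((s - 1) * x $ i)"

definition mirror :: "'n::finite \<Rightarrow> real^'n \<Rightarrow> real^'n" where
 "mirror i x = (\<chi> j. if j = i then - (x$j) else x$j)"

text \<open>The operator (1 / x_i) d/dx_i, continued to the hyperplane x_i = 0 by its limit on even
  functions.\<close>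

definition Dq :: "'n::finite \<Rightarrow> (real^'n \<Rightarrow> real) \<Rightarrow> real^'n \<Rightarrow> real" where
 "Dq i \<phi> x = (if x $ i = 0 then pd i (pd i \<phi>) x else pd i \<phi> x / x $ i)"

text \<open>Averages over the segment from the hyperplane x_i = 0 to x. For m = 0 and \<psi> the
  second derivative this is \<open>Dq\<close>; each further derivative in direction i brings out one
  factor s, hence the power m.\<close>

definition Jq :: "'n::finite \<Rightarrow> nat \<Rightarrow> (real^'n \<Rightarrow> real) \<Rightarrow> real^'n \<Rightarrow> real" where
 "Jq i m \<psi> x = integral (cbox 0 1) (\<lambda>s. s ^ m * \<psi> (sc i s x))"

lemma sc_line: "sc i s (x + ax j r) = sc i s x + ax j ((if j = i then s else 1) * r)"
 by (vector sc_def) (auto simp: axis_def algebra_simps)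

lemma sc_component: "sc i s x $ j = (if j = i then s * x $ j else x $ j)"
 by (auto simp: sc_def axis_def algebra_simps)

lemma continuous_on_sc [continuous_intros]:
 assumes "continuous_on A f" "continuous_on A g"
 shows "continuous_on A (\<lambda>z. sc i (f z) (g z))"
 unfolding sc_def by (intro continuous_intros assms)

lemma has_pd_Jq:
 assumes "smooth_fn \<psi>"
 shows "has_pd j (Jq i m \<psi>) (Jq i (m + (if j = i then 1 else 0)) (pd j \<psi>))"
 unfolding has_pd_def
proof
 fix x :: "real^'a"
 define w where "w = (\<lambda>s::real. if j = i then s else 1)"
 have pdj: "has_pd j \<psi> (pd j \<psi>)" using smooth_fn_has_pd[OF assms, of j "[]"] by simp
 have c: "continuous_on A \<psi>" "continuous_on A (pd j \<psi>)" for A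
  using smooth_fn_continuous_self assms smooth_fn_pd by blast+
 have 1: "((\<lambda>r. s ^ m * \<psi> (sc i s (x + ax j r))) has_field_derivative
   s ^ m * (w s * pd j \<psi> (sc i s (x + ax j r)))) (at r)" for r s
 proof -
  have "((\<lambda>r. \<psi> (sc i s x + ax j (w s * r))) has_real_derivative
    pd j \<psi> (sc i s x + ax j (w s * r)) * w s) (at r)"
   by (rule DERIV_chain'[where f="\<lambda>r. w s * r" and g="\<lambda>u. \<psi> (sc i s x + ax j u)", THEN DERIV_cong])
     (auto intro!: derivative_eq_intros has_pd_line[OF pdj])
  from DERIV_cmult[OF this, of "s ^ m"] show ?thesis
   by (cases "j = i") (simp_all add: sc_line w_def mult.commute)
 qed
 have "((\<lambda>r. integral (cbox 0 1) (\<lambda>s. s ^ m * \<psi> (sc i s (x + ax j r)))) has_field_derivative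
   integral (cbox 0 1) (\<lambda>s. s ^ m * (w s * pd j \<psi> (sc i s (x + ax j 0))))) (at 0 within UNIV)"
 proof (rule leibniz_rule_field_derivative)
  show "(\<lambda>s. s ^ m * \<psi> (sc i s (x + ax j r))) integrable_on cbox 0 1" for r
   by (intro integrable_continuous continuous_intros continuous_on_compose2[OF c(1)]) auto
  have cw: "continuous_on (UNIV \<times> cbox 0 1) (\<lambda>z :: real \<times> real. w (snd z))"
   unfolding w_def by (cases "j = i") (auto intro!: continuous_intros)
  have "continuous_on (UNIV \<times> cbox 0 1) (\<lambda>z. snd z ^ m * (w (snd z) * pd j \<psi> (sc i (snd z) (x + fst z *\<^sub>R axis j 1))))"
   by (intro continuous_intros cw continuous_on_compose2[OF c(2)]) auto
  then show "continuous_on (UNIV \<times> cbox 0 1) (\<lambda>(r, s). s ^ m * (w s * pd j \<psi> (sc i s (x + ax j r))))"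
   by (simp add: case_prod_beta)
 qed (use 1 in auto)
 moreover have "s ^ m * (w s * u) = s ^ (m + (if j = i then 1 else 0)) * u" for s u
  by (simp add: w_def)
 ultimately show "((\<lambda>s. Jq i m \<psi> (x + ax j s)) has_real_derivative
    Jq i (m + (if j = i then 1 else 0)) (pd j \<psi>) x) (at 0)"
  unfolding Jq_def by simp
qed

lemma continuous_on_Jq:
 assumes "smooth_fn \<psi>" shows "continuous_on UNIV (Jq i m \<psi>)"
proof -
 have c: "continuous_on A \<psi>" for A using smooth_fn_continuous_self assms by blast
 have "continuous_on (UNIV \<times> cbox 0 1) (\<lambda>z. snd z ^ m * \<psi> (sc i (snd z) (fst z)))"
  by (intro continuous_intros continuous_on_compose2[OF c]) auto
 then have "continuous_on UNIV (\<lambda>x. integral (cbox 0 1) (\<lambda>s. s ^ m * \<psi> (sc i s x)))"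
  by (intro integral_continuous_on_param) (simp add: case_prod_beta)
 then show ?thesis by (simp add: Jq_def[abs_def])
qed

lemma smooth_fn_Jq: "smooth_fn \<psi> \<Longrightarrow> smooth_fn (Jq i m \<psi>)"
proof (rule smooth_fn_coinduct(1)[where C="{Jq i m \<psi> | m \<psi>. smooth_fn \<psi>}"])
 show "\<exists>g'\<in>{Jq i m \<psi> | m \<psi>. smooth_fn \<psi>}. has_pd j g g'"
  if g: "g \<in> {Jq i m \<psi> | m \<psi>. smooth_fn \<psi>}" for g j
 proof -
  obtain m \<psi> where "g = Jq i m \<psi>" "smooth_fn \<psi>" using g by blast
  then show ?thesis using has_pd_Jq smooth_fn_pd by blast
 qed
qed (auto intro: continuous_on_Jq)

lemma pds_Jq: "smooth_fn \<psi> \<Longrightarrow> pds js (Jq i m \<psi>) = Jq i (m + count_list js i) (pds js \<psi>)"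
proof (induction js)
 case (Cons j js)
 then show ?case
  using has_pd_imp_pd[OF has_pd_Jq[OF smooth_fn_pds, of \<psi> j i "m + count_list js i" js]] by simp
qed simp

lemma even_fn_mirror: "even_fn \<phi> \<longleftrightarrow> (\<forall>i x. \<phi> (mirror i x) = \<phi> x)"
 by (simp add: even_fn_def mirror_def)

lemma mirror_line: "mirror j (x + ax i s) = mirror j x + ax i ((if i = j then -1 else 1) * s)"
 by (auto simp: vec_eq_iff mirror_def axis_def)

lemma mirror_component: "mirror j x $ i = (if i = j then -1 else 1) * x $ i"
 by (simp add: mirror_def)

lemma has_pd_mirror:
 assumes "has_pd i g g'" "\<And>x. g (mirror j x) = c * g x"
 shows "g' (mirror j x) = c * (if i = j then -1 else 1) * g' x"
proof -
 let ?w = "if i = j then -1 else 1 :: real"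
 have g: "g (mirror j x + ax i s) = c * g (x + ax i (?w * s))" for s
  using assms(2)[of "x + ax i (?w * s)"] unfolding mirror_line by auto
 have "((\<lambda>s. g (x + ax i (?w * s))) has_real_derivative g' (x + ax i (?w * 0)) * ?w) (at 0)"
  by (rule DERIV_chain'[where f="\<lambda>r. ?w * r" and g="\<lambda>u. g (x + ax i u)", THEN DERIV_cong])
    (rule derivative_eq_intros refl has_pd_line[OF assms(1)] | simp)+
 then have "((\<lambda>s. g (mirror j x + ax i s)) has_real_derivative c * (g' x * ?w)) (at 0)"
  unfolding g by (auto intro!: derivative_eq_intros)
 moreover have "((\<lambda>s. g (mirror j x + ax i s)) has_real_derivative g' (mirror j x)) (at 0)"
  using assms(1) unfolding has_pd_def by blast
 ultimately show ?thesis using DERIV_unique by (fastforce simp: ac_simps)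
qed

lemma pd_mirror:
 assumes "smooth_fn \<phi>" "even_fn \<phi>"
 shows "pd i \<phi> (mirror j x) = (if i = j then -1 else 1) * pd i \<phi> x"
 using has_pd_mirror[OF smooth_fn_has_pd[OF assms(1), of i "[]"], of j 1 x] assms(2)
 by (simp add: even_fn_mirror)

lemma pd_pd_mirror:
 assumes "smooth_fn \<phi>" "even_fn \<phi>"
 shows "pd i (pd i \<phi>) (mirror j x) = pd i (pd i \<phi>) x"
 using has_pd_mirror[OF smooth_fn_has_pd[OF assms(1), of i "[i]"], of j "if i = j then -1 else 1" x]
  pd_mirror[OF assms] by simp

lemma pd_zero:
 assumes "smooth_fn \<phi>" "even_fn \<phi>" "x $ i = 0"
 shows "pd i \<phi> x = 0"
proof -
 have "mirror i x = x" using assms(3) by (auto simp: vec_eq_iff mirror_def)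
 then show ?thesis using pd_mirror[OF assms(1,2), of i i x] by simp
qed

lemma even_fn_Dq: "smooth_fn \<phi> \<Longrightarrow> even_fn \<phi> \<Longrightarrow> even_fn (Dq i \<phi>)"
 unfolding even_fn_mirror[of "Dq i \<phi>"] Dq_def by (auto simp: pd_mirror pd_pd_mirror mirror_component)

text \<open>An even function has vanishing first derivative at x_i = 0, so the first derivative at x
  is the integral of the second one along the segment; after the substitution x_i appears as a
  factor and cancels the singular quotient.\<close>

lemma Dq_eq_Jq:
 assumes "smooth_fn \<phi>" "even_fn \<phi>"
 shows "Dq i \<phi> = Jq i 0 (pd i (pd i \<phi>))"
proof
 fix x :: "real^'a"
 show "Dq i \<phi> x = Jq i 0 (pd i (pd i \<phi>)) x"
 proof (cases "x $ i = 0")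
  case True
  then have "sc i s x = x" for s by (simp add: sc_def)
  then show ?thesis using True by (simp add: Dq_def Jq_def)
 next
  case False
  have pd2: "has_pd i (pd i \<phi>) (pd i (pd i \<phi>))" using smooth_fn_has_pd[OF assms(1), of i "[i]"] by simp
  have "((\<lambda>s. pd i \<phi> (sc i s x)) has_real_derivative x $ i * pd i (pd i \<phi>) (sc i s x)) (at s)" for s
  proof -
   have "((\<lambda>s. pd i \<phi> (x + ax i ((s - 1) * x $ i))) has_real_derivative
     pd i (pd i \<phi>) (x + ax i ((s - 1) * x $ i)) * x $ i) (at s)"
    by (rule DERIV_chain'[where f="\<lambda>s. (s - 1) * x $ i" and g="\<lambda>u. pd i \<phi> (x + ax i u)", THEN DERIV_cong])
      (auto intro!: derivative_eq_intros has_pd_line[OF pd2])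
   then show ?thesis by (simp add: sc_def mult.commute)
  qed
  then have I: "((\<lambda>s. x $ i * pd i (pd i \<phi>) (sc i s x)) has_integral
    pd i \<phi> (sc i 1 x) - pd i \<phi> (sc i 0 x)) {0..1}"
   by (intro fundamental_theorem_of_calculus)
     (auto simp: has_real_derivative_iff_has_vector_derivative[symmetric] intro: DERIV_subset)
  have "sc i 1 x = x" "pd i \<phi> (sc i 0 x) = 0"
   by (simp add: sc_def, rule pd_zero[OF assms], simp add: sc_component)
  with integral_unique[OF I] have "pd i \<phi> x = integral {0..1} (\<lambda>s. x $ i * pd i (pd i \<phi>) (sc i s x))"
   by simp
  then show ?thesis using False by (simp add: Dq_def Jq_def)
 qed
qed

lemma smooth_fn_Dq: "smooth_fn \<phi> \<Longrightarrow> even_fn \<phi> \<Longrightarrow> smooth_fn (Dq i \<phi>)"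
 by (simp add: Dq_eq_Jq smooth_fn_Jq smooth_fn_pd)

lemma pd_eq_Dq:
 assumes "smooth_fn \<phi>" "even_fn \<phi>" shows "pd i \<phi> = (\<lambda>x. x $ i * Dq i \<phi> x)"
 using pd_zero[OF assms] by (auto simp: Dq_def)

text \<open>The derivative of g enters on the hyperplane x_i = 0, where \<open>Dq\<close> is a
  second derivative: there g + x_i g' reduces to g.\<close>

lemma Dq_unique:
 assumes "has_pd i \<phi> (\<lambda>x. x $ i * g x)" "has_pd i g g'"
 shows "Dq i \<phi> = g"
proof
 fix x
 have 1: "pd i \<phi> = (\<lambda>x. x $ i * g x)" using has_pd_imp_pd assms(1) by blast
 then have "pd i (pd i \<phi>) = (\<lambda>x. g x + x $ i * g' x)"
  using has_pd_imp_pd[OF has_pd_coord_mult[OF assms(2)], of i] by simp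
 with 1 show "Dq i \<phi> x = g x" by (simp add: Dq_def)
qed

text \<open>The lists obtained by deleting one occurrence of i; they index the lower-order terms of
  the Leibniz rule for multiplication by x_i.\<close>

fun rml :: "'a \<Rightarrow> 'a list \<Rightarrow> 'a list list" where
 "rml i [] = []"
| "rml i (j # js) = (if j = i then [js] else []) @ map ((#) j) (rml i js)"

lemma pds_coord_mult:
 assumes "smooth_fn g"
 shows "pds js (\<lambda>x. x $ i * g x) = (\<lambda>x. x $ i * pds js g x + (\<Sum>l\<leftarrow>rml i js. pds l g x))"
proof (induction js)
 case (Cons j js)
 have s: "has_pd j (\<lambda>x. \<Sum>l\<leftarrow>ls. pds l g x) (\<lambda>x. \<Sum>l\<leftarrow>ls. pds (j # l) g x)" for ls
 proof (induction ls)
  case (Cons l ls)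
  show ?case using has_pd_lin[OF smooth_fn_has_pd[OF assms, of j l] Cons.IH, of 1 1] by simp
 qed (simp add: has_pd_const)
 have "has_pd j (\<lambda>x. x $ i * pds js g x + (\<Sum>l\<leftarrow>rml i js. pds l g x))
   (\<lambda>x. ((if j = i then 1 else 0) * pds js g x + x $ i * pds (j # js) g x) + (\<Sum>l\<leftarrow>rml i js. pds (j # l) g x))"
  using has_pd_lin[OF has_pd_coord_mult[OF smooth_fn_has_pd[OF assms, of j js], of i] s[of "rml i js"], of 1 1] by simp
 from has_pd_imp_pd[OF this] show ?case
  unfolding pds.simps Cons by (auto simp: comp_def fun_eq_iff)
qed simp

section \<open>Continuous operators on the test functions and the Bessel Laplacian\<close>

lemma norm_scale_S_ev: "norm_scale S_ev sn"
 unfolding norm_scale_def using sn_nonneg sn_mono by blast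

text \<open>Continuity of an operator in the topology of the seminorms: each norm of the image is
  controlled by some, possibly higher, norm of the argument.\<close>

definition cop :: "((real^'n::finite \<Rightarrow> real) \<Rightarrow> (real^'n \<Rightarrow> real)) \<Rightarrow> bool" where
 "cop T \<longleftrightarrow> (\<forall>\<phi>\<in>S_ev. T \<phi> \<in> S_ev) \<and> (\<forall>N. \<exists>C M. C \<ge> 0 \<and> (\<forall>\<phi>\<in>S_ev. sn N (T \<phi>) \<le> C * sn M \<phi>))"

lemma cop_unif_bd:
 assumes "cop T"
 shows "unif_bd S_ev sn (\<lambda>\<phi>. pds is (T \<phi>))"
 unfolding unif_bd_def
proof
 fix \<alpha> :: "'a \<Rightarrow> nat"
 define N where "N = Max (range \<alpha>) + length is"
 have N: "\<forall>i. \<alpha> i \<le> N" "length is \<le> N"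
  unfolding N_def by (auto intro: trans_le_add1 Max_ge)
 obtain C M where "C \<ge> 0" "\<forall>\<phi>\<in>S_ev. sn N (T \<phi>) \<le> C * sn M \<phi>" using assms unfolding cop_def by meson
 moreover have "\<forall>\<phi>\<in>S_ev. \<forall>x. \<bar>monom \<alpha> x * pds is (T \<phi>) x\<bar> \<le> sn N (T \<phi>)"
  using sn_upper N assms unfolding cop_def by blast
 ultimately show "\<exists>C M. 0 \<le> C \<and> (\<forall>\<phi>\<in>S_ev. \<forall>x. \<bar>monom \<alpha> x * pds is (T \<phi>) x\<bar> \<le> C * sn M \<phi>)"
  by (meson order_trans)
qed

lemma copI:
 assumes "\<And>\<phi>. \<phi> \<in> S_ev \<Longrightarrow> T \<phi> \<in> S_ev" "\<And>is. unif_bd S_ev sn (\<lambda>\<phi>. pds is (T \<phi>))"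
 shows "cop T"
 unfolding cop_def using unif_bd_sn[OF norm_scale_S_ev assms(2)] assms(1) by blast

lemma cop_id: "cop (\<lambda>\<phi>. \<phi>)"
 unfolding cop_def
proof (intro conjI allI)
 show "\<exists>C M. 0 \<le> C \<and> (\<forall>\<phi>\<in>S_ev. sn N \<phi> \<le> C * sn M \<phi>)" for N
  by (rule exI[of _ 1], rule exI[of _ N]) simp
qed simp

lemma cop_comp:
 assumes "cop S" "cop T" shows "cop (\<lambda>\<phi>. S (T \<phi>))"
 unfolding cop_def
proof (intro conjI allI)
 fix N
 obtain C M where C: "C \<ge> 0" "\<forall>\<phi>\<in>S_ev. sn N (S \<phi>) \<le> C * sn M \<phi>" using assms unfolding cop_def by meson
 obtain D L where D: "D \<ge> 0" "\<forall>\<phi>\<in>S_ev. sn M (T \<phi>) \<le> D * sn L \<phi>" using assms unfolding cop_def by meson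
 have "sn N (S (T \<phi>)) \<le> (C * D) * sn L \<phi>" if "\<phi> \<in> S_ev" for \<phi>
 proof -
  have "sn N (S (T \<phi>)) \<le> C * sn M (T \<phi>)" using C that assms unfolding cop_def by blast
  also have "... \<le> C * (D * sn L \<phi>)" using C D that by (intro mult_left_mono) auto
  finally show ?thesis by (simp add: ac_simps)
 qed
 then show "\<exists>C M. 0 \<le> C \<and> (\<forall>\<phi>\<in>S_ev. sn N (S (T \<phi>)) \<le> C * sn M \<phi>)"
  using C D by (intro exI[of _ "C * D"] exI[of _ L]) auto
qed (use assms in \<open>auto simp: cop_def\<close>)

text \<open>The integral representation gives no decay in \<^term>\<open>x $ i\<close>; it is recovered from
 \<^term>\<open>pd i \<phi> x = x $ i * Dq i \<phi> x\<close>, by induction on the power of \<^term>\<open>x $ i\<close>.\<close>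
lemma unif_bd_Dq: "unif_bd S_ev sn (\<lambda>\<phi>. pds js (Dq i \<phi>))"
proof -
 let ?P = "\<lambda>T. \<exists>C M. 0 \<le> C \<and> (\<forall>\<phi>\<in>S_ev. \<forall>x. \<bar>T \<phi> x\<bar> \<le> C * sn M \<phi>)"
 have diff: "?P (\<lambda>\<phi> x. S \<phi> x - T \<phi> x)" if S: "?P S" and T: "?P T" for S T :: "(real^'a \<Rightarrow> real) \<Rightarrow> real^'a \<Rightarrow> real"
 proof -
  obtain C M where C: "C \<ge> 0" "\<forall>\<phi>\<in>S_ev. \<forall>x. \<bar>S \<phi> x\<bar> \<le> C * sn M \<phi>" using S by blast
  obtain D L where D: "D \<ge> 0" "\<forall>\<phi>\<in>S_ev. \<forall>x. \<bar>T \<phi> x\<bar> \<le> D * sn L \<phi>" using T by blast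
  have "\<bar>S \<phi> x - T \<phi> x\<bar> \<le> (C + D) * sn (max M L) \<phi>" if \<phi>: "\<phi> \<in> S_ev" for \<phi> x
  proof -
   have "C * sn M \<phi> \<le> C * sn (max M L) \<phi>" "D * sn L \<phi> \<le> D * sn (max M L) \<phi>"
    using C D sn_mono[OF \<phi>] by (auto intro!: mult_left_mono)
   moreover have "\<bar>S \<phi> x\<bar> \<le> C * sn M \<phi>" "\<bar>T \<phi> x\<bar> \<le> D * sn L \<phi>" using C D \<phi> by auto
   ultimately show ?thesis by (simp add: distrib_right)
  qed
  then show ?thesis using C D by (intro exI[of _ "C + D"] exI[of _ "max M L"]) auto
 qed
 have zero: "?P (\<lambda>\<phi> x. 0)" using sn_nonneg by (intro exI[of _ 0]) auto
 have "\<forall>\<alpha> js. \<alpha> i = a \<longrightarrow> ?P (\<lambda>\<phi> x. monom \<alpha> x * pds js (Dq i \<phi>) x)" for a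
 proof (induction a)
  case 0
  show ?case
  proof (intro allI impI)
   fix \<alpha> :: "'a \<Rightarrow> nat" and js :: "'a list"
   assume a0: "\<alpha> i = 0"
   \<comment> \<open>A monomial free of x_i is constant along the segment, so it may be moved under
     the integral and evaluated together with the derivative of \<phi>.\<close>
   have inv: "monom \<alpha> (sc i s x) = monom \<alpha> x" for s x
    unfolding monom_def by (rule prod.cong) (auto simp: sc_component a0)
   obtain C M where CM: "C \<ge> 0" "\<forall>\<phi>\<in>S_ev. \<forall>x. \<bar>monom \<alpha> x * pds (js @ [i, i]) \<phi> x\<bar> \<le> C * sn M \<phi>"
    using cop_unif_bd[OF cop_id, of "js @ [i, i]"] unfolding unif_bd_def by meson
   have "\<bar>monom \<alpha> x * pds js (Dq i \<phi>) x\<bar> \<le> C * sn M \<phi>" if \<phi>: "\<phi> \<in> S_ev" for \<phi> x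
   proof -
    let ?\<psi> = "pds (js @ [i, i]) \<phi>"
    have sm: "smooth_fn \<phi>" "even_fn \<phi>" using S_evD \<phi> by blast+
    then have "monom \<alpha> x * pds js (Dq i \<phi>) x = monom \<alpha> x * Jq i (count_list js i) ?\<psi> x"
     using pds_Jq[of "pd i (pd i \<phi>)" js i 0] by (simp add: Dq_eq_Jq smooth_fn_pd pds_append)
    also have "... = integral (cbox 0 1) (\<lambda>s. s ^ count_list js i * (monom \<alpha> (sc i s x) * ?\<psi> (sc i s x)))"
     unfolding Jq_def inv by (subst integral_mult_right[symmetric]) (simp add: ac_simps)
    also have "norm \<dots> \<le> C * sn M \<phi> * measure lborel (cbox 0 (1::real))"
    proof (rule integrable_bound)
     show "0 \<le> C * sn M \<phi>" using CM(1) sn_nonneg[OF \<phi>] by simp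
     have c: "continuous_on A ?\<psi>" for A using smooth_fn_continuous sm by blast
     show "(\<lambda>s. s ^ count_list js i * (monom \<alpha> (sc i s x) * ?\<psi> (sc i s x))) integrable_on cbox 0 1"
      unfolding inv
      by (intro integrable_continuous continuous_intros continuous_on_compose2[OF c]) auto
     fix s :: real assume s: "s \<in> cbox 0 1"
     have "\<bar>s ^ count_list js i\<bar> * \<bar>monom \<alpha> (sc i s x) * ?\<psi> (sc i s x)\<bar> \<le> 1 * (C * sn M \<phi>)"
      using s CM \<phi> by (intro mult_mono) (auto simp: power_le_one)
     then show "norm (s ^ count_list js i * (monom \<alpha> (sc i s x) * ?\<psi> (sc i s x))) \<le> C * sn M \<phi>"
      by (simp add: abs_mult)
    qed
    finally show ?thesis by simp
   qed
   then show "?P (\<lambda>\<phi> x. monom \<alpha> x * pds js (Dq i \<phi>) x)" using CM by blast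
  qed
 next
  case (Suc a)
  show ?case
  proof (intro allI impI)
   fix \<alpha> :: "'a \<Rightarrow> nat" and js :: "'a list"
   assume aS: "\<alpha> i = Suc a"
   define \<beta> where "\<beta> = \<alpha>(i := a)"
   have \<alpha>: "\<alpha> = \<beta>(i := Suc (\<beta> i))" and \<beta>: "\<beta> i = a" by (auto simp: \<beta>_def aS)
   have ls: "?P (\<lambda>\<phi> x. \<Sum>l\<leftarrow>ls. monom \<beta> x * pds l (Dq i \<phi>) x)" for ls
   proof (induction ls)
    case (Cons l ls)
    have "?P (\<lambda>\<phi> x. monom \<beta> x * pds l (Dq i \<phi>) x)" using Suc \<beta> by blast
    from diff[OF this diff[OF zero Cons.IH]] show ?case by simp
   qed (use zero in simp)
   have base: "?P (\<lambda>\<phi> x. monom \<beta> x * pds (js @ [i]) \<phi> x)"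
    using cop_unif_bd[OF cop_id, of "js @ [i]"] unfolding unif_bd_def by blast
   \<comment> \<open>The Leibniz rule for x_i times \<open>Dq i \<phi>\<close>, solved for the term
     that carries the factor x_i. All other terms have one power of x_i less and fall under the
     induction hypothesis.\<close>
   have "monom \<alpha> x * pds js (Dq i \<phi>) x =
    monom \<beta> x * pds (js @ [i]) \<phi> x - (\<Sum>l\<leftarrow>rml i js. monom \<beta> x * pds l (Dq i \<phi>) x)"
    if \<phi>: "\<phi> \<in> S_ev" for \<phi> x
   proof -
    have sm: "smooth_fn \<phi>" "even_fn \<phi>" using S_evD \<phi> by blast+
    have "pds (js @ [i]) \<phi> x = pds js (\<lambda>x. x $ i * Dq i \<phi> x) x"
     using pd_eq_Dq[OF sm, of i] by (simp add: pds_append)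
    also have "... = x $ i * pds js (Dq i \<phi>) x + (\<Sum>l\<leftarrow>rml i js. pds l (Dq i \<phi>) x)"
     using pds_coord_mult[OF smooth_fn_Dq[OF sm]] by simp
    finally have "pds (js @ [i]) \<phi> x = \<dots>" .
    moreover have "monom \<alpha> x = x $ i * monom \<beta> x" by (subst \<alpha>) (rule monom_Suc)
    ultimately show ?thesis by (simp add: sum_list_const_mult algebra_simps)
   qed
   with diff[OF base ls[of "rml i js"]] show "?P (\<lambda>\<phi> x. monom \<alpha> x * pds js (Dq i \<phi>) x)"
    by simp
  qed
 qed
 then show ?thesis unfolding unif_bd_def by blast
qed

lemma cop_Dq: "cop (Dq i)"
proof (rule copI)
 show "unif_bd S_ev sn (\<lambda>\<phi>. pds is (Dq i \<phi>))" for "is" by (rule unif_bd_Dq)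
 show "Dq i \<phi> \<in> S_ev" if \<phi>: "\<phi> \<in> S_ev" for \<phi>
 proof (rule S_evI)
  show "smooth_fn (Dq i \<phi>)" "even_fn (Dq i \<phi>)" using smooth_fn_Dq even_fn_Dq S_evD \<phi> by blast+
  show "\<exists>B. \<forall>x. \<bar>monom \<alpha> x * pds is (Dq i \<phi>) x\<bar> \<le> B" for \<alpha> "is"
   using unif_bd_Dq[of "is" i] \<phi> unfolding unif_bd_def by blast
 qed
qed

lemma Dq_S_ev: "\<phi> \<in> S_ev \<Longrightarrow> Dq i \<phi> \<in> S_ev"
 using cop_Dq cop_def by blast

lemma has_pd_S_ev: "\<phi> \<in> S_ev \<Longrightarrow> has_pd i \<phi> (\<lambda>x. x $ i * Dq i \<phi> x)"
 using smooth_fn_has_pd[of \<phi> i "[]"] pd_eq_Dq[of \<phi> i] S_evD[of \<phi>] by auto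

lemma Dq_lin:
 assumes "\<phi> \<in> S_ev" "\<psi> \<in> S_ev"
 shows "Dq i (\<lambda>x. a * \<phi> x + b * \<psi> x) = (\<lambda>x. a * Dq i \<phi> x + b * Dq i \<psi> x)"
proof (rule Dq_unique)
 show "has_pd i (\<lambda>x. a * \<phi> x + b * \<psi> x) (\<lambda>x. x $ i * (a * Dq i \<phi> x + b * Dq i \<psi> x))"
  using has_pd_lin[OF has_pd_S_ev[OF assms(1)] has_pd_S_ev[OF assms(2)], of i a b]
  by (simp add: algebra_simps)
 show "has_pd i (\<lambda>x. a * Dq i \<phi> x + b * Dq i \<psi> x)
  (\<lambda>x. a * (x $ i * Dq i (Dq i \<phi>) x) + b * (x $ i * Dq i (Dq i \<psi>) x))"
  by (intro has_pd_lin has_pd_S_ev Dq_S_ev assms)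
qed

text \<open>With D for \<open>Dq i\<close>, the first derivative is x_i D \<phi> and the second one
  is D \<phi> + x_i^2 D^2 \<phi>. This form has no division and no case distinction at x_i = 0, and
  all later computations start from it.\<close>

lemma bessel_lap_eq:
 assumes "\<phi> \<in> S_ev"
 shows "bessel_lap \<gamma> \<phi> x = (\<Sum>i\<in>UNIV. (1 + \<gamma> $ i) * Dq i \<phi> x + (x $ i)\<^sup>2 * Dq i (Dq i \<phi>) x)"
 unfolding bessel_lap_def
proof (rule sum.cong)
 fix i
 have 1: "pd i \<phi> = (\<lambda>x. x $ i * Dq i \<phi> x)" using has_pd_imp_pd has_pd_S_ev assms by blast
 have 2: "pd i (pd i \<phi>) = (\<lambda>x. Dq i \<phi> x + x $ i * (x $ i * Dq i (Dq i \<phi>) x))"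
  unfolding 1 using has_pd_imp_pd[OF has_pd_coord_mult[OF has_pd_S_ev[OF Dq_S_ev[OF assms]], of i i i]]
  by simp
 show "(if x $ i = 0 then (1 + \<gamma> $ i) * pd i (pd i \<phi>) x else pd i (pd i \<phi>) x + \<gamma> $ i / x $ i * pd i \<phi> x) =
   (1 + \<gamma> $ i) * Dq i \<phi> x + (x $ i)\<^sup>2 * Dq i (Dq i \<phi>) x"
  unfolding 2 by (simp add: 1 power2_eq_square algebra_simps)
qed simp

lemma pspan_sum: "finite A \<Longrightarrow> A \<noteq> {} \<Longrightarrow> (\<And>j. j \<in> A \<Longrightarrow> G j \<in> pspan B) \<Longrightarrow> (\<lambda>p x. \<Sum>j\<in>A. G j p x) \<in> pspan B"
 by (induction A rule: finite_ne_induct) (auto intro: pspan_add)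

lemma cop_bessel_lap: "cop (bessel_lap \<gamma>)"
proof -
 \<comment> \<open>All derivatives of images under continuous operators: a set closed under
   differentiation whose span, thanks to multiplication by coordinates, contains the
   Laplacian.\<close>
 define B where "B = {(\<lambda>\<phi>. pds is (T \<phi>)) | is T. cop (T :: (real^'a \<Rightarrow> real) \<Rightarrow> real^'a \<Rightarrow> real)}"
 define G where "G = (\<lambda>\<phi> x. \<Sum>i\<in>UNIV. (1 + \<gamma> $ i) * Dq i \<phi> x + (x $ i)\<^sup>2 * Dq i (Dq i \<phi>) x)"
 have pc: "pd_closed B S_ev"
  unfolding pd_closed_def
 proof (intro ballI allI)
  fix G i assume "G \<in> B"
  then obtain "is" T where G: "G = (\<lambda>\<phi>. pds is (T \<phi>))" "cop T" unfolding B_def by blast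
  then have "(\<lambda>\<phi>. pds (i # is) (T \<phi>)) \<in> B" unfolding B_def by blast
  moreover have "has_pd i (G \<phi>) (pds (i # is) (T \<phi>))" if "\<phi> \<in> S_ev" for \<phi>
   unfolding G(1) by (rule smooth_fn_has_pd) (use G(2) that S_evD(1) in \<open>auto simp: cop_def\<close>)
  ultimately show "\<exists>G'\<in>pspan B. \<forall>p\<in>S_ev. has_pd i (G p) (G' p)"
   by (intro bexI[of _ "\<lambda>\<phi>. pds (i # is) (T \<phi>)"] ballI pspan.base) auto
 qed
 have cont: "continuous_on UNIV (G \<phi>)" if G: "G \<in> B" and "\<phi> \<in> S_ev" for G \<phi>
 proof -
  obtain "is" T where "G = (\<lambda>\<phi>. pds is (T \<phi>))" "cop T" using G unfolding B_def by blast
  then show ?thesis using \<open>\<phi> \<in> S_ev\<close> by (auto simp: cop_def intro!: smooth_fn_continuous S_evD)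
 qed
 have bd: "unif_bd S_ev sn G" if G: "G \<in> B" for G
  using G unfolding B_def by (auto intro!: cop_unif_bd)
 have cB: "T \<in> pspan B" if "cop T" for T
 proof -
  have "T = (\<lambda>\<phi>. pds [] (T \<phi>))" by simp
  then have "T \<in> B" using that unfolding B_def by blast
  then show ?thesis by (rule pspan.base)
 qed
 have GB: "G \<in> pspan B" unfolding G_def
 proof (intro pspan_sum)
  fix i
  have 1: "Dq i \<in> pspan B" by (rule cB[OF cop_Dq])
  have 2: "(\<lambda>\<phi> x. x $ i * (x $ i * Dq i (Dq i \<phi>) x)) \<in> pspan B"
   by (rule pspan.coord[OF pspan.coord[OF cB[OF cop_comp[OF cop_Dq cop_Dq]]]])
  show "(\<lambda>\<phi> x. (1 + \<gamma> $ i) * Dq i \<phi> x + (x $ i)\<^sup>2 * Dq i (Dq i \<phi>) x) \<in> pspan B"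
   using pspan.lin[OF 1 2, of "1 + \<gamma> $ i" 1] by (simp add: power2_eq_square ac_simps)
 qed auto
 have eq: "bessel_lap \<gamma> \<phi> = G \<phi>" if "\<phi> \<in> S_ev" for \<phi>
  using bessel_lap_eq[OF that] by (simp add: G_def fun_eq_iff)
 have ev: "even_fn (G \<phi>)" if \<phi>: "\<phi> \<in> S_ev" for \<phi>
 proof -
  have "Dq i \<phi> (mirror j x) = Dq i \<phi> x" "Dq i (Dq i \<phi>) (mirror j x) = Dq i (Dq i \<phi>) x" for i j x
   using Dq_S_ev[OF \<phi>] Dq_S_ev[OF Dq_S_ev[OF \<phi>]] S_evD(2) even_fn_mirror by blast+
  moreover have "(mirror j x $ i)\<^sup>2 = (x $ i)\<^sup>2" for i j and x :: "real^'a"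
   by (simp add: mirror_component)
  ultimately show ?thesis unfolding even_fn_mirror G_def by simp
 qed
 show ?thesis
 proof (rule copI)
  show "bessel_lap \<gamma> \<phi> \<in> S_ev" if "\<phi> \<in> S_ev" for \<phi>
   unfolding eq[OF that]
   by (rule pspan_S_ev(2)[where B=B and P=S_ev and \<nu>=sn and G=G and p=\<phi>])
    (use pc cont norm_scale_S_ev bd GB that ev in auto)
  have "unif_bd S_ev sn (\<lambda>\<phi>. pds is (G \<phi>))" for "is"
   by (rule pspan_S_ev(1)[where B=B and P=S_ev and \<nu>=sn and G=G])
    (use pc cont norm_scale_S_ev bd GB in auto)
  then show "unif_bd S_ev sn (\<lambda>\<phi>. pds is (bessel_lap \<gamma> \<phi>))" for "is"
   unfolding unif_bd_def by (simp add: eq)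
 qed
qed

lemma bessel_lap_S_ev: "\<phi> \<in> S_ev \<Longrightarrow> bessel_lap \<gamma> \<phi> \<in> S_ev"
 using cop_bessel_lap cop_def by blast

lemma bessel_lap_lin:
 assumes "\<phi> \<in> S_ev" "\<psi> \<in> S_ev"
 shows "bessel_lap \<gamma> (\<lambda>x. a * \<phi> x + b * \<psi> x) = (\<lambda>x. a * bessel_lap \<gamma> \<phi> x + b * bessel_lap \<gamma> \<psi> x)"
 using assms
 by (auto simp: fun_eq_iff bessel_lap_eq S_ev_lin Dq_lin Dq_S_ev sum_distrib_left algebra_simps simp flip: sum.distrib
   intro!: sum.cong)

subsection \<open>Integration along coordinate lines\<close>

lemma nn_integral_lborel_shift:
 fixes f :: "'a::euclidean_space \<Rightarrow> ennreal"
 assumes "f \<in> borel_measurable borel"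
 shows "(\<integral>\<^sup>+x. f (c + x) \<partial>lborel) = (\<integral>\<^sup>+x. f x \<partial>lborel)"
proof -
 have "(\<integral>\<^sup>+x. f x \<partial>lborel) = (\<integral>\<^sup>+x. f x \<partial>distr lborel borel ((+) c))"
  by (simp add: lborel_distr_plus)
 also have "... = (\<integral>\<^sup>+x. f (c + x) \<partial>lborel)"
  using assms by (subst nn_integral_distr) auto
 finally show ?thesis by simp
qed

lemma integral_lborel_shift:
 fixes f :: "'a::euclidean_space \<Rightarrow> 'b::{banach, second_countable_topology}"
 assumes "f \<in> borel_measurable borel"
 shows "(LBINT x. f (c + x)) = (LBINT x. f x)"
proof -
 have "(LBINT x. f x) = (\<integral>x. f x \<partial>distr lborel borel ((+) c))"
  by (simp add: lborel_distr_plus)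
 also have "... = (LBINT x. f (c + x))"
  using assms by (subst integral_distr) auto
 finally show ?thesis by simp
qed

lemma axis_scale_measurable [measurable]: "(\<lambda>s::real. s *\<^sub>R axis i 1 :: real^'n::finite) \<in> borel_measurable borel"
 by (intro borel_measurable_continuous_onI continuous_intros)

lemma vec_nth_measurable [measurable]: "(\<lambda>x::real^'n::finite. x $ i) \<in> borel_measurable borel"
 by (intro borel_measurable_continuous_onI continuous_intros)

lemma nn_integral_unit_interval_shift:
 fixes a :: real
 shows "(\<integral>\<^sup>+s. ennreal (indicator {0..1} (a - s)) \<partial>lborel) = 1"
proof -
 have "(\<integral>\<^sup>+s. ennreal (indicator {0..1} (a - s)) \<partial>lborel) = (\<integral>\<^sup>+s. indicator {a-1..a} s \<partial>lborel)"
  by (intro nn_integral_cong) (auto split: split_indicator)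
 then show ?thesis by simp
qed

text \<open>Insert \<open>1 = \<integral> \<psi> (x $ i - s) ds\<close> with \<open>\<psi>\<close> the indicator of the unit interval and translate \<open>x\<close> by
 \<open>s\<close> in direction \<open>i\<close>: the integral of \<open>F\<close> becomes an average of its integrals along lines.\<close>
lemma line_integral_zero:
 fixes F :: "real^'n::finite \<Rightarrow> 'b::{banach, second_countable_topology}"
 assumes int: "integrable lborel F"
  and z: "\<And>x. x $ i = 0 \<Longrightarrow> integrable lborel (\<lambda>s. F (x + ax i s)) \<Longrightarrow>
    (LBINT s. F (x + ax i s)) = 0"
 shows "(LBINT x. F x) = 0"
proof -
 let ?e = "axis i 1 :: real^'n"
 let ?\<psi> = "indicator {0..1} :: real \<Rightarrow> real"
 have F[measurable]: "F \<in> borel_measurable borel" using int by simp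
 define G where "G = (\<lambda>(s::real, x::real^'n). ?\<psi> (x $ i) *\<^sub>R F (x + s *\<^sub>R ?e))"
 define H where "H = (\<lambda>(s::real, x::real^'n). ?\<psi> (x $ i - s) *\<^sub>R F x)"
 have Gm[measurable]: "G \<in> borel_measurable (lborel \<Otimes>\<^sub>M lborel)" unfolding G_def by measurable
 have Hm[measurable]: "H \<in> borel_measurable (lborel \<Otimes>\<^sub>M lborel)" unfolding H_def by measurable
 have swap: "(\<integral>\<^sup>+s. \<integral>\<^sup>+x. norm (H (s,x)) \<partial>lborel \<partial>lborel) = (\<integral>\<^sup>+x. norm (F x) \<partial>lborel)"
 proof -
  have "(\<integral>\<^sup>+s. \<integral>\<^sup>+x. norm (H (s,x)) \<partial>lborel \<partial>lborel) = (\<integral>\<^sup>+x. \<integral>\<^sup>+s. norm (H (s,x)) \<partial>lborel \<partial>lborel)"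
   using lborel_pair.Fubini[of "\<lambda>p. ennreal (norm (H p))"] by simp
  also have "... = (\<integral>\<^sup>+x. \<integral>\<^sup>+s. ennreal (norm (F x)) * ennreal (?\<psi> (x $ i - s)) \<partial>lborel \<partial>lborel)"
   unfolding H_def by (intro nn_integral_cong) (auto simp flip: ennreal_mult simp: ac_simps)
  also have "... = (\<integral>\<^sup>+x. norm (F x) \<partial>lborel)"
   by (subst nn_integral_cmult) (auto simp: nn_integral_unit_interval_shift)
  finally show ?thesis .
 qed
 have shift: "(\<integral>\<^sup>+x. norm (G (s,x)) \<partial>lborel) = (\<integral>\<^sup>+x. norm (H (s,x)) \<partial>lborel)" for s
 proof -
  have "(\<integral>\<^sup>+x. norm (H (s,x)) \<partial>lborel) = (\<integral>\<^sup>+x. norm (H (s, s *\<^sub>R ?e + x)) \<partial>lborel)"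
   by (rule nn_integral_lborel_shift[symmetric]) (unfold H_def prod.case, measurable)
  also have "... = (\<integral>\<^sup>+x. norm (G (s,x)) \<partial>lborel)"
   unfolding G_def H_def by (intro nn_integral_cong) (simp add: add.commute)
  finally show ?thesis by simp
 qed
 have fin: "(\<integral>\<^sup>+x. norm (F x) \<partial>lborel) < \<infinity>" using int by (simp add: integrable_iff_bounded)
 have Gi: "integrable (lborel \<Otimes>\<^sub>M lborel) G"
  by (rule integrableI_bounded) (auto simp flip: lborel.nn_integral_fst simp: shift swap fin[simplified])
 have Hi: "integrable (lborel \<Otimes>\<^sub>M lborel) H"
  by (rule integrableI_bounded) (auto simp flip: lborel.nn_integral_fst simp: swap fin[simplified])
 have "(LBINT x. F x) = (\<integral>x. \<integral>s. ?\<psi> (x $ i - s) *\<^sub>R F x \<partial>lborel \<partial>lborel)"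
 proof (rule Bochner_Integration.integral_cong)
  fix x
  have i: "integrable lborel (\<lambda>s. ?\<psi> (x $ i - s))"
   by (rule integrableI_bounded) (auto simp: nn_integral_unit_interval_shift)
  have "(LBINT s. ?\<psi> (x $ i - s)) = 1"
   by (subst integral_eq_nn_integral) (auto simp: nn_integral_unit_interval_shift)
  then show "F x = (LBINT s. ?\<psi> (x $ i - s) *\<^sub>R F x)"
   using i by simp
 qed simp
 also have "... = (\<integral>s. \<integral>x. ?\<psi> (x $ i - s) *\<^sub>R F x \<partial>lborel \<partial>lborel)"
  using lborel_pair.Fubini_integral[of "\<lambda>s x. ?\<psi> (x $ i - s) *\<^sub>R F x"] Hi unfolding H_def by simp
 also have "... = (\<integral>s. \<integral>x. ?\<psi> (x $ i) *\<^sub>R F (x + s *\<^sub>R ?e) \<partial>lborel \<partial>lborel)"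
 proof (rule Bochner_Integration.integral_cong)
  fix s :: real
  show "(LBINT x. ?\<psi> (x $ i - s) *\<^sub>R F x) = (LBINT x. ?\<psi> (x $ i) *\<^sub>R F (x + s *\<^sub>R ?e))"
   using integral_lborel_shift[of "\<lambda>x. ?\<psi> (x $ i - s) *\<^sub>R F x" "s *\<^sub>R ?e"] by (simp add: add.commute)
 qed simp
 also have "... = (\<integral>x. \<integral>s. ?\<psi> (x $ i) *\<^sub>R F (x + s *\<^sub>R ?e) \<partial>lborel \<partial>lborel)"
  using lborel_pair.Fubini_integral[of "\<lambda>s x. ?\<psi> (x $ i) *\<^sub>R F (x + s *\<^sub>R ?e)"] Gi unfolding G_def by simp
 also have "... = (\<integral>x. 0 \<partial>(lborel :: (real^'n) measure))"
 proof (rule Bochner_Integration.integral_cong)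
  fix x :: "real^'n"
  \<comment> \<open>The base point is moved along the line into the hyperplane x_i = 0, where the
    hypothesis on line integrals is stated.\<close>
  define y where "y = x - (x $ i) *\<^sub>R ?e"
  have y: "y $ i = 0" by (simp add: y_def)
  have "(LBINT s. F (x + s *\<^sub>R ?e)) = (LBINT s. F (y + (x $ i + s) *\<^sub>R ?e))"
   by (simp add: y_def algebra_simps)
  also have "... = (LBINT s. F (y + s *\<^sub>R ?e))"
   by (rule integral_lborel_shift[of "\<lambda>s. F (y + s *\<^sub>R ?e)"]) measurable
  \<comment> \<open>Along a line on which F is not integrable the integral is 0 by default, so the
    hypothesis may assume integrability.\<close>
  also have "... = 0" using z[OF y] not_integrable_integral_eq by blast
  finally show "(LBINT s. ?\<psi> (x $ i) *\<^sub>R F (x + s *\<^sub>R ?e)) = 0" by simp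
 qed simp
 finally show ?thesis by simp
qed

text \<open>The integral over \<open>{0..n}\<close> is F n, which tends to 0, while dominated
  convergence gives the integral over the half line. The finite set S admits the point where a line
  crosses the sphere in the application to balls.\<close>

lemma integral_derivative_half_line:
 fixes F f :: "real \<Rightarrow> 'b::euclidean_space"
 assumes cont: "continuous_on {0..} F" and "F 0 = 0" and lim: "(F \<longlongrightarrow> 0) at_top"
  and "finite S" and deriv: "\<And>s. s > 0 \<Longrightarrow> s \<notin> S \<Longrightarrow> (F has_vector_derivative f s) (at s)"
  and int: "integrable lborel (\<lambda>s. indicator {0<..} s *\<^sub>R f s)"
 shows "(LBINT s. indicator {0<..} s *\<^sub>R f s) = 0"
proof -
 define g where "g = (\<lambda>s. indicator {0<..} s *\<^sub>R f s)"
 have g: "integrable lborel g" using int by (simp add: g_def)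
 then have [measurable]: "g \<in> borel_measurable borel" by simp
 have "(\<lambda>n. \<integral>s. indicator {0..real n} s *\<^sub>R g s \<partial>lborel) \<longlonglongrightarrow> (LBINT s. g s)"
 proof (rule integral_dominated_convergence[where w="\<lambda>s. norm (g s)"])
  show "AE s in lborel. (\<lambda>n. indicator {0..real n} s *\<^sub>R g s) \<longlonglongrightarrow> g s"
  proof (rule AE_I2)
   fix s :: real
   have "eventually (\<lambda>n. indicator {0..real n} s *\<^sub>R g s = g s) sequentially"
    using eventually_ge_at_top[of "nat \<lceil>s\<rceil>"]
    by eventually_elim (auto simp: indicator_def g_def)
   then show "(\<lambda>n. indicator {0..real n} s *\<^sub>R g s) \<longlonglongrightarrow> g s"
    by (rule tendsto_eventually)
  qed
 qed (use g in \<open>auto split: split_indicator\<close>)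
 moreover have "(LBINT s. indicator {0..real n} s *\<^sub>R g s) = F (real n)" for n
 proof -
  have "(f has_integral (F (real n) - F 0)) {0..real n}"
   by (rule fundamental_theorem_of_calculus_interior_strong[OF \<open>finite S\<close>])
     (use deriv cont in \<open>auto intro: continuous_on_subset\<close>)
  then have "(g has_integral F (real n)) {0..real n}"
   using \<open>F 0 = 0\<close> by (intro has_integral_spike[of "{0}" "{0..real n}" g f]) (auto simp: g_def split: split_indicator)
  then have 1: "integral {0..real n} g = F (real n)" by (rule integral_unique)
  have "set_integrable lborel {0..real n} g"
   unfolding set_integrable_def using g
   by (rule Bochner_Integration.integrable_bound) (auto split: split_indicator)
  from set_borel_integral_eq_integral(2)[OF this] 1 show ?thesis
   by (simp add: set_lebesgue_integral_def)
 qed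
 moreover have "(\<lambda>n. F (real n)) \<longlonglongrightarrow> 0"
  using filterlim_compose[OF lim filterlim_real_sequentially] by simp
 ultimately show ?thesis unfolding g_def[symmetric] using LIMSEQ_unique by auto
qed

lemma orth_line:
 assumes "x $ i = 0"
 shows "x + ax i s \<in> orth \<longleftrightarrow> 0 < s \<and> (\<forall>j. j \<noteq> i \<longrightarrow> 0 < x $ j)"
proof -
 have "(x + ax i s) $ j = (if j = i then s else x $ j)" for j using assms by (auto simp: axis_def)
 then show ?thesis unfolding orth_def by (simp only: mem_Collect_eq) metis
qed

lemma orth_measurable [measurable]: "orth \<in> sets borel"
 unfolding orth_def by measurable

text \<open>\<Phi>' is the derivative of \<Phi> in direction i inside the orthant, and \<Phi>
  vanishes on the face x_i = 0 and at infinity. Lines with some other coordinate nonpositive miss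
  the orthant.\<close>

lemma orth_divergence_zero:
 fixes \<Phi> \<Phi>' :: "real^'n::finite \<Rightarrow> 'b::euclidean_space"
 assumes int: "integrable lborel (\<lambda>x. indicator orth x *\<^sub>R \<Phi>' x)"
  and line: "\<And>x. x $ i = 0 \<Longrightarrow> (\<And>j. j \<noteq> i \<Longrightarrow> 0 < x $ j) \<Longrightarrow>
    continuous_on {0..} (\<lambda>s. \<Phi> (x + ax i s)) \<and> \<Phi> x = 0 \<and>
    ((\<lambda>s. \<Phi> (x + ax i s)) \<longlongrightarrow> 0) at_top \<and>
    (\<exists>S. finite S \<and> (\<forall>s. s > 0 \<longrightarrow> s \<notin> S \<longrightarrow>
     ((\<lambda>s. \<Phi> (x + ax i s)) has_vector_derivative \<Phi>' (x + ax i s)) (at s)))"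
 shows "(LBINT x. indicator orth x *\<^sub>R \<Phi>' x) = 0"
proof (rule line_integral_zero[OF int])
 fix x :: "real^'n"
 assume x: "x $ i = 0" and li: "integrable lborel (\<lambda>s. indicator orth (x + ax i s) *\<^sub>R \<Phi>' (x + ax i s))"
 show "(LBINT s. indicator orth (x + ax i s) *\<^sub>R \<Phi>' (x + ax i s)) = 0"
 proof (cases "\<forall>j. j \<noteq> i \<longrightarrow> 0 < x $ j")
  case True
  then have ind: "indicator orth (x + ax i s) = (indicator {0<..} s :: real)" for s
   by (simp add: orth_line[OF x] indicator_def)
  have l: "continuous_on {0..} (\<lambda>s. \<Phi> (x + ax i s))" "\<Phi> x = 0"
    "((\<lambda>s. \<Phi> (x + ax i s)) \<longlongrightarrow> 0) at_top"
   and "\<exists>S. finite S \<and> (\<forall>s. s > 0 \<longrightarrow> s \<notin> S \<longrightarrow>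
     ((\<lambda>s. \<Phi> (x + ax i s)) has_vector_derivative \<Phi>' (x + ax i s)) (at s))"
   using line[OF x] True by auto
  then obtain S where S: "finite S"
   "\<And>s. s > 0 \<Longrightarrow> s \<notin> S \<Longrightarrow>
     ((\<lambda>s. \<Phi> (x + ax i s)) has_vector_derivative \<Phi>' (x + ax i s)) (at s)" by blast
  show ?thesis unfolding ind
   by (rule integral_derivative_half_line[OF l(1) _ l(3) S]) (use l li ind in auto)
 next
  case False
  then have "indicator orth (x + ax i s) = (0::real)" for s
   by (auto simp: orth_line[OF x] indicator_def)
  then show ?thesis by simp
 qed
qed

subsection \<open>Differentiation under the integral\<close>

text \<open>A Lipschitz bound against the single point u0 already dominates the difference
  quotients. The field is left general so that the lemma serves real derivatives as well as
  holomorphy in the exponent.\<close>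

lemma deriv_under_integral:
 fixes F :: "'k::{real_normed_field, banach, second_countable_topology} \<Rightarrow> 'z \<Rightarrow> 'k"
 assumes d: "d > 0"
  and int: "\<And>u. dist u u0 < d \<Longrightarrow> integrable M (F u)"
  and der: "\<And>z. z \<in> space M \<Longrightarrow> ((\<lambda>u. F u z) has_field_derivative F' z) (at u0)"
  and lip: "\<And>u z. dist u u0 < d \<Longrightarrow> z \<in> space M \<Longrightarrow> norm (F u z - F u0 z) \<le> B z * norm (u - u0)"
  and B: "integrable M B"
 shows "((\<lambda>u. \<integral>z. F u z \<partial>M) has_field_derivative (\<integral>z. F' z \<partial>M)) (at u0)"
proof -
 have main: "(\<lambda>n. (\<integral>z. F (X n) z \<partial>M - (\<integral>z. F u0 z \<partial>M)) / (X n - u0)) \<longlonglongrightarrow> (\<integral>z. F' z \<partial>M)"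
  if X: "\<And>n. X n \<noteq> u0" "\<And>n. dist (X n) u0 < d" "X \<longlonglongrightarrow> u0" for X
 proof -
  have q: "(\<lambda>n. (F (X n) z - F u0 z) / (X n - u0)) \<longlonglongrightarrow> F' z" if "z \<in> space M" for z
   using der[OF that] X unfolding has_field_derivative_iff tendsto_at_iff_sequentially comp_def by auto
  have i0: "integrable M (F u0)" using int d by simp
  have m: "(\<lambda>z. (F (X n) z - F u0 z) / (X n - u0)) \<in> borel_measurable M" for n
   using int[OF X(2)] i0 by measurable
  have m': "F' \<in> borel_measurable M"
   by (rule borel_measurable_LIMSEQ_metric[where f="\<lambda>n z. (F (X n) z - F u0 z) / (X n - u0)"]) (use q m in auto)
  have "(\<lambda>n. \<integral>z. (F (X n) z - F u0 z) / (X n - u0) \<partial>M) \<longlonglongrightarrow> (\<integral>z. F' z \<partial>M)"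
  proof (rule integral_dominated_convergence[OF m' m B])
   show "AE z in M. (\<lambda>n. (F (X n) z - F u0 z) / (X n - u0)) \<longlonglongrightarrow> F' z" using q by auto
   show "AE z in M. norm ((F (X n) z - F u0 z) / (X n - u0)) \<le> B z" for n
    using lip[OF X(2)[of n]] X(1)[of n] by (auto simp: norm_divide divide_le_eq)
  qed
  moreover have "(\<integral>z. (F (X n) z - F u0 z) / (X n - u0) \<partial>M) = (\<integral>z. F (X n) z \<partial>M - (\<integral>z. F u0 z \<partial>M)) / (X n - u0)" for n
   using int[OF X(2)] i0 by simp
  ultimately show ?thesis by (simp only:)
 qed
 show ?thesis
  unfolding has_field_derivative_iff tendsto_at_iff_sequentially comp_def
 proof (intro allI impI)
  fix X :: "nat \<Rightarrow> 'k" assume X: "\<forall>n. X n \<in> UNIV - {u0}" "X \<longlonglongrightarrow> u0"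
  obtain N where N: "\<And>n. n \<ge> N \<Longrightarrow> dist (X n) u0 < d" using X(2) d metric_LIMSEQ_D by blast
  have "(\<lambda>n. (\<integral>z. F (X (n + N)) z \<partial>M - (\<integral>z. F u0 z \<partial>M)) / (X (n + N) - u0)) \<longlonglongrightarrow> (\<integral>z. F' z \<partial>M)"
   by (rule main) (use X N LIMSEQ_ignore_initial_segment[OF X(2)] in auto)
  then show "(\<lambda>n. (\<integral>z. F (X n) z \<partial>M - (\<integral>z. F u0 z \<partial>M)) / (X n - u0)) \<longlonglongrightarrow> (\<integral>z. F' z \<partial>M)"
   by (rule LIMSEQ_offset)
 qed
qed

lemma has_pd_integral:
 fixes F :: "'z \<Rightarrow> real^'n::finite \<Rightarrow> real"
 assumes int: "\<And>x. integrable M (\<lambda>z. F z x)"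
  and der: "\<And>z. z \<in> space M \<Longrightarrow> has_pd i (F z) (F' z)"
  and bd: "\<And>x. \<exists>B. integrable M B \<and> (\<forall>z\<in>space M. \<forall>r. \<bar>r\<bar> \<le> 1 \<longrightarrow> \<bar>F' z (x + ax i r)\<bar> \<le> B z)"
 shows "has_pd i (\<lambda>x. \<integral>z. F z x \<partial>M) (\<lambda>x. \<integral>z. F' z x \<partial>M)"
 unfolding has_pd_def
proof
 fix x
 obtain B where B: "integrable M B" "\<And>z r. z \<in> space M \<Longrightarrow> \<bar>r\<bar> \<le> 1 \<Longrightarrow> \<bar>F' z (x + ax i r)\<bar> \<le> B z"
  using bd[of x] by blast
 show "((\<lambda>s. \<integral>z. F z (x + ax i s) \<partial>M) has_real_derivative (\<integral>z. F' z x \<partial>M)) (at 0)"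
 proof (rule deriv_under_integral[where d=1 and B=B])
  fix u :: real and z assume u: "dist u 0 < 1" and z: "z \<in> space M"
  have "norm (F z (x + ax i u) - F z (x + ax i 0)) \<le> B z * norm (u - 0)"
  proof (rule field_differentiable_bound[where S="ball 0 1" and f'="\<lambda>r. F' z (x + ax i r)"])
   show "((\<lambda>s. F z (x + ax i s)) has_field_derivative F' z (x + ax i r)) (at r within ball 0 1)" for r
    using has_pd_line[OF der[OF z]] DERIV_subset by blast
   show "norm (F' z (x + ax i r)) \<le> B z" if "r \<in> ball 0 1" for r using B(2)[OF z] that by auto
  qed (use u in auto)
  then show "norm (F z (x + ax i u) - F z (x + ax i 0)) \<le> B z * norm (u - 0)" .
 qed (use int B(1) der in \<open>auto simp: has_pd_def\<close>)
qed

subsection \<open>The angular measure\<close>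

lemma nn_integral_prod_cart:
 fixes f :: "'n::finite \<Rightarrow> real \<Rightarrow> ennreal"
 assumes [measurable]: "\<And>i. f i \<in> borel_measurable borel"
 shows "(\<integral>\<^sup>+x. (\<Prod>i\<in>UNIV. f i (x $ i)) \<partial>(lborel :: (real^'n) measure)) = (\<Prod>i\<in>UNIV. \<integral>\<^sup>+s. f i s \<partial>lborel)"
proof -
 define ix :: "real^'n \<Rightarrow> 'n" where "ix = (\<lambda>b. THE i. b = axis i 1)"
 have ix: "ix (axis i 1) = i" for i unfolding ix_def by (auto simp: axis_eq_axis)
 have B: "(Basis :: (real^'n) set) = range (\<lambda>i. axis i 1)" by (auto simp: Basis_vec_def)
 have inj: "inj (\<lambda>i. axis i 1 :: real^'n)" by (auto simp: inj_def axis_eq_axis)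
 have p: "(\<Prod>b\<in>(Basis :: (real^'n) set). h b) = (\<Prod>i\<in>UNIV. h (axis i 1))" for h :: "real^'n \<Rightarrow> ennreal"
  unfolding B by (simp add: prod.reindex[OF inj])
 have "(\<integral>\<^sup>+x. (\<Prod>b\<in>Basis. f (ix b) (x \<bullet> b)) \<partial>(lborel :: (real^'n) measure)) = (\<Prod>b\<in>(Basis :: (real^'n) set). \<integral>\<^sup>+s. f (ix b) s \<partial>lborel)"
  by (rule nn_integral_lborel_prod) auto
 then show ?thesis by (simp add: p ix inner_axis)
qed

text \<open>The substitution u = (1 - cos a) / 2 gives 2^(\<delta> - 1) times the Beta function at
  (\<delta>/2, \<delta>/2); the duplication formula of Legendre brings this to the form of the
  constant in \<open>gtrans\<close>.\<close>

lemma sin_power_nn_integral: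
 fixes \<delta> :: real
 assumes "\<delta> > 0"
 shows "(\<integral>\<^sup>+s. ennreal (indicator {0<..<pi} s * sin s powr (\<delta> - 1)) \<partial>lborel) =
  ennreal (Gamma (\<delta>/2) * Gamma (1/2) / Gamma ((\<delta>+1)/2))"
proof -
 define f where "f = (\<lambda>u::real. 2 powr (\<delta> - 1) * (u powr (\<delta>/2 - 1) * (1 - u) powr (\<delta>/2 - 1)))"
 define g where "g = (\<lambda>a::real. (1 - cos a) / 2)"
 have 0: "f (g a) * (sin a / 2) = sin a powr (\<delta> - 1)" if "a \<in> {0..pi}" for a
 proof -
  have s0: "sin a \<ge> 0" using that by (intro sin_ge_zero) auto
  have "1 - g a = (1 + cos a) / 2" unfolding g_def by (simp add: field_simps)
  moreover have "g a \<ge> 0" "1 + cos a \<ge> 0" using cos_le_one[of a] cos_ge_minus_one[of a] by (simp add: g_def, linarith)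
  ultimately have "g a powr (\<delta>/2 - 1) * (1 - g a) powr (\<delta>/2 - 1) = (g a * (1 - g a)) powr (\<delta>/2 - 1)"
   by (subst powr_mult) auto
  also have "g a * (1 - g a) = (sin a / 2)\<^sup>2"
   unfolding g_def by (simp add: field_simps power2_eq_square sin_squared_eq[unfolded power2_eq_square])
  also have "((sin a / 2)\<^sup>2) powr (\<delta>/2 - 1) = (sin a / 2) powr (\<delta> - 2)"
   using s0 by (cases "sin a = 0") (simp_all add: powr_powr flip: powr_numeral)
  finally have "f (g a) * (sin a / 2) = 2 powr (\<delta> - 1) * ((sin a / 2) powr (\<delta> - 2) * (sin a / 2))"
   unfolding f_def by simp
  also have "(sin a / 2) powr (\<delta> - 2) * (sin a / 2) = (sin a / 2) powr (\<delta> - 1)"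
   using s0 powr_add[of "sin a / 2" "\<delta> - 2" 1] by (cases "sin a = 0") auto
  also have "2 powr (\<delta> - 1) * (sin a / 2) powr (\<delta> - 1) = sin a powr (\<delta> - 1)"
   using s0 by (subst powr_mult[symmetric]) auto
  finally show ?thesis .
 qed
 have "(\<integral>\<^sup>+s. ennreal (indicator {0<..<pi} s * sin s powr (\<delta> - 1)) \<partial>lborel) =
  (\<integral>\<^sup>+s. ennreal (f (g s) * (sin s / 2) * indicator {0..pi} s) \<partial>lborel)"
 proof (rule nn_integral_cong)
  fix s
  show "ennreal (indicator {0<..<pi} s * sin s powr (\<delta> - 1)) = ennreal (f (g s) * (sin s / 2) * indicator {0..pi} s)"
  proof (cases "s \<in> {0..pi}")
   case True
   then have "s = 0 \<or> s = pi \<or> s \<in> {0<..<pi}" by auto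
   then show ?thesis using 0[OF True] by auto
  qed auto
 qed
 also have "... = (\<integral>\<^sup>+s. ennreal (f s * indicator {g 0..g pi} s) \<partial>lborel)"
 proof (rule nn_integral_substitution[symmetric])
  show "set_borel_measurable borel {g 0..g pi} f" unfolding set_borel_measurable_def f_def by measurable
  show "(g has_real_derivative sin x / 2) (at x)" for x unfolding g_def by (auto intro!: derivative_eq_intros)
  show "continuous_on {0..pi} (\<lambda>x. sin x / 2)" by (intro continuous_intros) auto
 qed (auto intro: sin_ge_zero)
 also have "... = ennreal (2 powr (\<delta> - 1) * Beta (\<delta>/2) (\<delta>/2))"
 proof -
  have "(f has_integral 2 powr (\<delta> - 1) * Beta (\<delta>/2) (\<delta>/2)) {0..1}"
   unfolding f_def using has_integral_Beta_real[of "\<delta>/2" "\<delta>/2"] assms by (intro has_integral_mult_right) auto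
  from nn_integral_has_integral_lebesgue[OF _ this] show ?thesis
   by (simp add: g_def f_def mult.commute)
 qed
 also have "2 powr (\<delta> - 1) * Beta (\<delta>/2) (\<delta>/2) = Gamma (\<delta>/2) * Gamma (1/2) / Gamma ((\<delta>+1)/2)"
 proof -
  let ?z = "complex_of_real (\<delta>/2)"
  have nz: "?z \<notin> \<int>\<^sub>\<le>\<^sub>0" "?z + 1/2 \<notin> \<int>\<^sub>\<le>\<^sub>0"
   using assms by (auto elim!: nonpos_Ints_cases simp: complex_eq_iff)
  have "Gamma ?z * Gamma (?z + 1/2) = exp ((1 - 2*?z) * of_real (ln 2)) * of_real (sqrt pi) * Gamma (2*?z)"
   by (rule Gamma_legendre_duplication[OF nz])
  moreover have "?z + 1/2 = complex_of_real ((\<delta>+1)/2)" "2 * ?z = complex_of_real \<delta>"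
   "exp ((1 - 2*?z) * of_real (ln 2)) = complex_of_real (exp ((1 - \<delta>) * ln 2))"
   by (simp_all add: field_simps flip: exp_of_real)
  ultimately have "complex_of_real (Gamma (\<delta>/2) * Gamma ((\<delta>+1)/2)) = complex_of_real (exp ((1-\<delta>) * ln 2) * sqrt pi * Gamma \<delta>)"
   by (simp only: Gamma_complex_of_real of_real_mult)
  then have dup: "Gamma (\<delta>/2) * Gamma ((\<delta>+1)/2) = 2 powr (1-\<delta>) * sqrt pi * Gamma \<delta>"
   unfolding of_real_eq_iff by (simp add: powr_def mult.commute)
  have pos: "Gamma (\<delta>/2) > 0" "Gamma ((\<delta>+1)/2) > 0" "Gamma \<delta> > 0" using assms by (auto intro!: Gamma_real_pos)
  have "2 powr (\<delta> - 1) * (2 powr (1 - \<delta>)) = (1::real)" by (simp flip: powr_add)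
  then have "2 powr (\<delta> - 1) * (Gamma (\<delta>/2) * Gamma ((\<delta>+1)/2)) = sqrt pi * Gamma \<delta>"
   unfolding dup by (metis mult.assoc mult_1)
  then have "2 powr (\<delta> - 1) * (Gamma (\<delta>/2) * Gamma (\<delta>/2)) * Gamma ((\<delta>+1)/2) = Gamma (\<delta>/2) * sqrt pi * Gamma \<delta>"
   by (simp add: ac_simps)
  then show ?thesis using pos unfolding Beta_def by (simp add: field_simps Gamma_one_half_real)
 qed
 finally show ?thesis .
qed

definition sinw :: "real^'n::finite \<Rightarrow> real^'n \<Rightarrow> real" where
 "sinw \<delta> a = (\<Prod>i\<in>UNIV. indicator {0<..<pi} (a$i) * sin (a$i) powr (\<delta>$i - 1))"

definition nu :: "real^'n::finite \<Rightarrow> (real^'n) measure" where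
 "nu \<delta> = density lborel (\<lambda>a. ennreal (sinw \<delta> a))"

text \<open>The total mass of \<open>nu\<close>, which is the reciprocal of the normalizing constant
  in \<open>gtrans\<close>.\<close>

definition nu_mass :: "real^'n::finite \<Rightarrow> real" where
 "nu_mass \<delta> = (\<Prod>i\<in>UNIV. Gamma (\<delta>$i/2) * Gamma (1/2) / Gamma ((\<delta>$i+1)/2))"

lemma sinw_nonneg: "0 \<le> sinw \<delta> a"
 unfolding sinw_def by (intro prod_nonneg) auto

lemma sinw_measurable [measurable]: "sinw \<delta> \<in> borel_measurable borel"
 unfolding sinw_def[abs_def] by measurable

lemma sets_nu [simp, measurable_cong]: "sets (nu \<delta>) = sets borel" by (simp add: nu_def)

lemma space_nu [simp]: "space (nu \<delta>) = UNIV" by (simp add: nu_def)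

lemma sin_power_mass_pos: "(0::real) < d \<Longrightarrow> 0 < Gamma (d/2) * Gamma (1/2) / Gamma ((d+1)/2)"
 by (intro divide_pos_pos mult_pos_pos Gamma_real_pos) auto

lemma emeasure_nu:
 fixes \<delta> :: "real^'n::finite"
 assumes "allpos \<delta>"
 shows "emeasure (nu \<delta>) UNIV = ennreal (nu_mass \<delta>)"
proof -
 have "emeasure (nu \<delta>) UNIV = (\<integral>\<^sup>+a. (\<Prod>i\<in>UNIV. ennreal (indicator {0<..<pi} (a$i) * sin (a$i) powr (\<delta>$i - 1))) \<partial>lborel)"
  unfolding nu_def by (subst emeasure_density) (auto simp: sinw_def prod_ennreal)
 also have "... = (\<Prod>i\<in>UNIV. ennreal (Gamma (\<delta>$i/2) * Gamma (1/2) / Gamma ((\<delta>$i+1)/2)))"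
  by (subst nn_integral_prod_cart) (use assms in \<open>auto simp: sin_power_nn_integral\<close>)
 also have "... = ennreal (nu_mass \<delta>)"
  unfolding nu_mass_def by (rule prod_ennreal) (use assms in \<open>auto intro!: less_imp_le[OF sin_power_mass_pos]\<close>)
 finally show ?thesis .
qed

lemma nu_mass_pos: "allpos \<delta> \<Longrightarrow> 0 < nu_mass \<delta>"
 unfolding nu_mass_def by (intro prod_pos) (auto intro!: sin_power_mass_pos)

lemma finite_measure_nu: "allpos \<delta> \<Longrightarrow> finite_measure (nu \<delta>)"
 by (rule finite_measureI) (simp add: emeasure_nu)

lemma measure_nu: "allpos \<delta> \<Longrightarrow> measure (nu \<delta>) UNIV = nu_mass \<delta>"
 by (simp add: measure_def emeasure_nu less_imp_le[OF nu_mass_pos])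

lemma integral_nu:
 fixes f :: "real^'n::finite \<Rightarrow> real"
 assumes "f \<in> borel_measurable borel"
 shows "(\<integral>a. f a \<partial>nu \<delta>) = (LBINT a. sinw \<delta> a * f a)"
 unfolding nu_def using assms by (subst integral_density) (auto simp: sinw_nonneg)

lemma integrable_nu:
 fixes f :: "real^'n::finite \<Rightarrow> real"
 assumes "allpos \<delta>" "f \<in> borel_measurable borel" "\<And>a. \<bar>f a\<bar> \<le> B"
 shows "integrable (nu \<delta>) f"
 by (rule finite_measure.integrable_const_bound[OF finite_measure_nu[OF assms(1)], where B=B])
  (use assms in auto)

lemma integrable_nu_lborel:
 fixes f :: "real^'n::finite \<Rightarrow> real"
 assumes "allpos \<delta>" "f \<in> borel_measurable borel" "\<And>a. \<bar>f a\<bar> \<le> B"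
 shows "integrable lborel (\<lambda>a. sinw \<delta> a * f a)"
 using integrable_nu[OF assms] assms(2) unfolding nu_def
 by (subst (asm) integrable_density) (auto simp: sinw_nonneg)

text \<open>A factor sin^2 in direction i is the same as raising the exponent \<delta>_i by 2.
  Through this identity derivatives of translates stay within the family of kernels.\<close>

lemma nu_sin_squared:
 fixes f :: "real^'n::finite \<Rightarrow> real"
 assumes [measurable]: "f \<in> borel_measurable borel"
 shows "(\<integral>a. (sin (a$i))\<^sup>2 * f a \<partial>nu \<delta>) = (\<integral>a. f a \<partial>nu (\<delta> + ax i 2))"
proof -
 have "sinw \<delta> a * ((sin (a$i))\<^sup>2 * f a) = sinw (\<delta> + ax i 2) a * f a" for a
 proof -
  have "sinw (\<delta> + ax i 2) a = (sin (a$i))\<^sup>2 * sinw \<delta> a"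
  proof -
   have 1: "indicator {0<..<pi} (a$i) * sin (a$i) powr ((\<delta> + ax i 2)$i - 1) =
    (sin (a$i))\<^sup>2 * (indicator {0<..<pi} (a$i) * sin (a$i) powr (\<delta>$i - 1))"
   proof (cases "0 < a$i \<and> a$i < pi")
    case True
    then have "sin (a$i) > 0" by (intro sin_gt_zero) auto
    then have "sin (a$i) powr (2 + (\<delta>$i - 1)) = (sin (a$i))\<^sup>2 * sin (a$i) powr (\<delta>$i - 1)"
     by (subst powr_add) simp
    moreover have "(\<delta> + ax i 2)$i - 1 = 2 + (\<delta>$i - 1)" by simp
    ultimately show ?thesis by (simp only: mult.left_commute)
   qed (auto simp: indicator_def)
   have 2: "(\<Prod>j\<in>UNIV - {i}. indicator {0<..<pi} (a$j) * sin (a$j) powr ((\<delta> + ax i 2)$j - 1)) =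
     (\<Prod>j\<in>UNIV - {i}. indicator {0<..<pi} (a$j) * sin (a$j) powr (\<delta>$j - 1))"
    by (rule prod.cong) (auto simp: axis_def)
   show ?thesis unfolding sinw_def
    by (subst (1 2) prod.remove[of UNIV i]) (simp_all only: finite UNIV_I 1 2 ac_simps)
  qed
  then show ?thesis by simp
 qed
 moreover have "(\<lambda>a. (sin (a$i))\<^sup>2 * f a) \<in> borel_measurable borel" by measurable
 ultimately show ?thesis by (simp only: integral_nu assms)
qed

text \<open>The boundary terms vanish because of the factor
 \<open>sin\<^bsup>\<delta>\<^esup>\<close> with positive exponent.\<close>
lemma nu_ibp:
 fixes \<psi> \<psi>' :: "real^'n::finite \<Rightarrow> real"
 assumes \<delta>: "allpos \<delta>"
  and c: "continuous_on UNIV \<psi>" "continuous_on UNIV \<psi>'"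
  and b: "\<And>a. \<bar>\<psi> a\<bar> \<le> B" "\<And>a. \<bar>\<psi>' a\<bar> \<le> B"
  and d: "has_pd i \<psi> \<psi>'"
 shows "\<delta>$i * (\<integral>a. cos (a$i) * \<psi> a \<partial>nu \<delta>) = - (\<integral>a. sin (a$i) * \<psi>' a \<partial>nu \<delta>)"
proof -
 have [measurable]: "\<psi> \<in> borel_measurable borel" "\<psi>' \<in> borel_measurable borel"
  using c by (auto intro: borel_measurable_continuous_onI)
 have B0: "B \<ge> 0" using b(1)[of 0] by linarith
 have mb: "\<bar>u * v\<bar> \<le> B" if "\<bar>u\<bar> \<le> 1" "\<bar>v\<bar> \<le> B" for u v :: real
  using mult_mono[OF that] B0 by (simp add: abs_mult)
 have i1: "integrable (nu \<delta>) (\<lambda>a. cos (a$i) * \<psi> a)"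
  by (rule integrable_nu[OF \<delta>, where B=B])
    (measurable, rule mb[OF abs_cos_le_one b(1)])
 have i2: "integrable (nu \<delta>) (\<lambda>a. sin (a$i) * \<psi>' a)"
  by (rule integrable_nu[OF \<delta>, where B=B])
    (measurable, rule mb[OF abs_sin_le_one b(2)])
 \<comment> \<open>Along a line in direction i, inside the cube, this is the derivative of
   sin(a_i)^\<delta>_i \<psi> times the weights of the other angles.\<close>
 define F where "F = (\<lambda>a. sinw \<delta> a * (\<delta>$i * (cos (a$i) * \<psi> a) + sin (a$i) * \<psi>' a))"
 have Fi: "integrable lborel F"
  unfolding F_def
 proof (rule integrable_nu_lborel[OF \<delta>, where B="\<delta>$i * B + B"])
  fix a
  have "\<bar>\<delta>$i * (cos (a$i) * \<psi> a) + sin (a$i) * \<psi>' a\<bar> \<le> \<delta>$i * (\<bar>cos (a$i)\<bar> * \<bar>\<psi> a\<bar>) + \<bar>sin (a$i)\<bar> * \<bar>\<psi>' a\<bar>"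
   using \<delta> by (intro order_trans[OF abs_triangle_ineq]) (auto simp: abs_mult less_imp_le)
  also have "... \<le> \<delta>$i * (1 * B) + 1 * B"
   using \<delta> b B0 by (intro add_mono mult_left_mono mult_mono) (auto simp: less_imp_le)
  finally show "\<bar>\<delta>$i * (cos (a$i) * \<psi> a) + sin (a$i) * \<psi>' a\<bar> \<le> \<delta>$i * B + B" by simp
 qed measurable
 have "(LBINT a. F a) = 0"
 proof (rule line_integral_zero[OF Fi])
  fix x :: "real^'n"
  assume x: "x $ i = 0" and li: "integrable lborel (\<lambda>s. F (x + ax i s))"
  define W where "W = (\<Prod>j\<in>UNIV - {i}. indicator {0<..<pi} (x$j) * sin (x$j) powr (\<delta>$j - 1))"
  have comp: "(x + ax i s) $ j = (if j = i then s else x $ j)" for j s using x by (auto simp: axis_def)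
  have sw: "sinw \<delta> (x + ax i s) = indicator {0<..<pi} s * sin s powr (\<delta>$i - 1) * W" for s
  proof -
   have "(\<Prod>j\<in>UNIV - {i}. indicator {0<..<pi} ((x + ax i s)$j) * sin ((x + ax i s)$j) powr (\<delta>$j - 1)) = W"
    unfolding W_def comp by (rule prod.cong) auto
   then show ?thesis unfolding sinw_def
    by (subst prod.remove[of UNIV i]) (simp_all only: finite UNIV_I comp if_True simp_thms)
  qed
  have li0: "set_integrable lborel {0<..<pi} (\<lambda>s. F (x + ax i s))"
   unfolding set_integrable_def using li
   by (rule Bochner_Integration.integrable_bound) (use li in \<open>auto split: split_indicator\<close>)
  have hi: "((\<lambda>s. F (x + ax i s)) has_integral
    (sin pi powr \<delta>$i * (W * \<psi> (x + ax i pi)) - sin 0 powr \<delta>$i * (W * \<psi> (x + ax i 0)))) {0..pi}"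
  proof (rule fundamental_theorem_of_calculus_interior)
   show "continuous_on {0..pi} (\<lambda>s. sin s powr \<delta>$i * (W * \<psi> (x + ax i s)))"
    using \<delta> by (intro continuous_intros continuous_on_powr' continuous_on_compose2[OF c(1)]) (auto intro: sin_ge_zero)
   fix s assume s: "s \<in> {0<..<pi}"
   then have ss: "sin s > 0" by (intro sin_gt_zero) auto
   have "((\<lambda>s. sin s powr \<delta>$i) has_real_derivative \<delta>$i * sin s powr (\<delta>$i - 1) * cos s) (at s)"
    using ss by (auto intro!: derivative_eq_intros)
   then have "((\<lambda>s. sin s powr \<delta>$i * (W * \<psi> (x + ax i s))) has_real_derivative
     (\<delta>$i * sin s powr (\<delta>$i - 1) * cos s) * (W * \<psi> (x + ax i s))
     + (W * \<psi>' (x + ax i s)) * sin s powr \<delta>$i) (at s)"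
    by (intro DERIV_mult DERIV_cmult has_pd_line[OF d])
   moreover have "sin s powr \<delta>$i = sin s powr (\<delta>$i - 1) * sin s"
    using ss powr_add[of "sin s" "\<delta>$i - 1" 1] by simp
   ultimately show "((\<lambda>s. sin s powr \<delta>$i * (W * \<psi> (x + ax i s))) has_vector_derivative F (x + ax i s)) (at s)"
    unfolding has_real_derivative_iff_has_vector_derivative[symmetric] F_def sw
    by (elim DERIV_cong) (use s in \<open>simp add: x algebra_simps\<close>)
  qed auto
  have "(LBINT s. F (x + ax i s)) = (LINT s:{0<..<pi}|lborel. F (x + ax i s))"
   unfolding set_lebesgue_integral_def
   by (rule Bochner_Integration.integral_cong) (auto simp: F_def sw split: split_indicator)
  also have "... = integral {0<..<pi} (\<lambda>s. F (x + ax i s))"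
   by (rule set_borel_integral_eq_integral(2)[OF li0])
  also have "... = integral {0..pi} (\<lambda>s. F (x + ax i s))"
   by (rule integral_open_interval_real[symmetric])
  also have "... = 0" using integral_unique[OF hi] \<delta> by simp
  finally show "(LBINT s. F (x + ax i s)) = 0" .
 qed
 then have "(\<integral>a. \<delta>$i * (cos (a$i) * \<psi> a) + sin (a$i) * \<psi>' a \<partial>nu \<delta>) = 0"
  unfolding F_def by (subst integral_nu) measurable
 then show ?thesis using i1 i2 by simp
qed

subsection \<open>The translation kernel\<close>

text \<open>The law of cosines in each coordinate: the third side of a triangle with sides x_i, y_i
  and enclosed angle a_i.\<close>

definition gdist :: "real^'n::finite \<Rightarrow> real^'n \<Rightarrow> real^'n \<Rightarrow> real^'n" where
 "gdist x y a = (\<chi> i. sqrt ((x$i)^2 + (y$i)^2 - 2 * x$i * y$i * cos (a$i)))"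

text \<open>\<open>nu_mass\<close> times the generalized translation, as a function of both points
  (see \<open>gtrans_eq\<close>). Without the normalizing constant the exponents can be changed
  without Gamma quotients.\<close>

definition TK :: "real^'n::finite \<Rightarrow> (real^'n \<Rightarrow> real) \<Rightarrow> real^'n \<Rightarrow> real^'n \<Rightarrow> real" where
 "TK \<delta> \<phi> x y = (\<integral>a. \<phi> (gdist x y a) \<partial>nu \<delta>)"

lemma cos_law_nonneg: "0 \<le> (x::real)\<^sup>2 + y\<^sup>2 - 2 * x * y * cos a"
proof -
 have "\<bar>2 * x * y * cos a\<bar> \<le> \<bar>2 * x * y\<bar>" by (simp add: abs_mult mult_left_le)
 from abs_le_D1[OF this] have "2 * x * y * cos a \<le> 2 * \<bar>x\<bar> * \<bar>y\<bar>" by (simp add: abs_mult ac_simps)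
 moreover have "0 \<le> (\<bar>x\<bar> - \<bar>y\<bar>)\<^sup>2" by simp
 ultimately show ?thesis by (simp add: power2_diff)
qed

lemma abs_le_cos_law: "\<bar>y\<bar> \<le> sqrt ((x::real)\<^sup>2 + y\<^sup>2 - 2 * x * y * cos a) + \<bar>x\<bar>"
proof -
 have "\<bar>2 * x * y * cos a\<bar> \<le> \<bar>2 * x * y\<bar>" by (simp add: abs_mult mult_left_le)
 from abs_le_D1[OF this] have "2 * x * y * cos a \<le> 2 * \<bar>x\<bar> * \<bar>y\<bar>" by (simp add: abs_mult ac_simps)
 then have "2 * x * y * cos a \<le> 2 * (\<bar>y\<bar> * \<bar>x\<bar>)" by (simp add: ac_simps)
 then have "(\<bar>y\<bar> - \<bar>x\<bar>)\<^sup>2 \<le> x\<^sup>2 + y\<^sup>2 - 2 * x * y * cos a" by (simp add: power2_diff)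
 then have "\<bar>\<bar>y\<bar> - \<bar>x\<bar>\<bar> \<le> sqrt (x\<^sup>2 + y\<^sup>2 - 2 * x * y * cos a)"
  by (metis real_sqrt_abs real_sqrt_le_mono)
 then show ?thesis by linarith
qed

lemma gdist_commute: "gdist x y a = gdist y x a"
 by (simp add: gdist_def algebra_simps)

lemma norm_le_gdist: "norm y \<le> norm (gdist x y a) + norm x"
proof -
 have "norm y \<le> norm (\<chi> i. \<bar>gdist x y a $ i\<bar> + \<bar>x $ i\<bar>)"
 proof (rule norm_le_componentwise_cart)
  fix i
  show "norm (y $ i) \<le> norm ((\<chi> i. \<bar>gdist x y a $ i\<bar> + \<bar>x $ i\<bar>) $ i)"
   using abs_le_cos_law[of "y$i" "x$i" "a$i"] by (simp add: gdist_def)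
 qed
 also have "(\<chi> i. \<bar>gdist x y a $ i\<bar> + \<bar>x $ i\<bar>) = (\<chi> i. \<bar>gdist x y a $ i\<bar>) + (\<chi> i. \<bar>x $ i\<bar>)"
  by (simp add: vec_eq_iff)
 also have "norm \<dots> \<le> norm (\<chi> i. \<bar>gdist x y a $ i\<bar>) + norm (\<chi> i. \<bar>x $ i\<bar>)" by (rule norm_triangle_ineq)
 also have "... = norm (gdist x y a) + norm x" by (simp add: norm_vec_def)
 finally show ?thesis .
qed

text \<open>The multiplicative form can be raised to powers: decay of \<phi> at
  \<open>gdist x y a\<close> becomes decay in y at the price of polynomial growth in x.\<close>

lemma norm_le_gdist_mult: "1 + norm y \<le> (1 + norm (gdist x y a)) * (1 + norm x)"
proof -
 have "0 \<le> norm (gdist x y a) * norm x" by simp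
 then show ?thesis using norm_le_gdist[of y x a] unfolding distrib_left distrib_right by linarith
qed

lemma continuous_on_gdist [continuous_intros]:
 fixes A :: "'z::t2_space set"
 assumes "continuous_on A f" "continuous_on A g" "continuous_on A h"
 shows "continuous_on A (\<lambda>z. gdist (f z) (g z) (h z))"
 unfolding gdist_def by (intro continuous_intros continuous_on_cos assms)

lemma gdist_measurable [measurable]: "(\<lambda>a. gdist x y a) \<in> borel_measurable borel"
 by (intro borel_measurable_continuous_onI continuous_intros)

lemma S_ev_continuous: "\<phi> \<in> S_ev \<Longrightarrow> continuous_on A \<phi>"
 using smooth_fn_continuous_self S_evD by blast

lemma S_ev_measurable: "\<phi> \<in> S_ev \<Longrightarrow> \<phi> \<in> borel_measurable borel"
 by (intro borel_measurable_continuous_onI S_ev_continuous)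

lemma S_ev_bounded: "\<phi> \<in> S_ev \<Longrightarrow> \<bar>\<phi> x\<bar> \<le> sn 0 \<phi>"
 using sn_upper[of \<phi> "\<lambda>_. 0" 0 "[]" x] by (simp add: monom_def)

lemma S_ev_decay: "\<phi> \<in> S_ev \<Longrightarrow> (1 + norm x) ^ N * \<bar>\<phi> x\<bar> \<le> (real CARD('n) + 1) ^ (N + 1) * sn N \<phi>"
 for x :: "real^'n::finite"
 using norm_power_pds_le[of \<phi> N N "[]" x] by simp

lemma has_pd_S_ev_line:
 assumes "\<phi> \<in> S_ev" "z $ i = 0"
 shows "((\<lambda>s. \<phi> (z + ax i s)) has_real_derivative r * Dq i \<phi> (z + ax i r)) (at r)"
 using has_pd_line[OF has_pd_S_ev[OF assms(1), of i], of z r] assms(2) by simp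

text \<open>The chain rule survives where the argument of the square root vanishes: there its derivative
 vanishes as well, and \<open>\<phi>\<close> is even.\<close>
lemma S_ev_sqrt_chain:
 fixes c :: "real^'n::finite"
 assumes \<phi>: "\<phi> \<in> S_ev" and q: "\<And>s. 0 \<le> q s" and dq: "(q has_real_derivative q') (at s0)"
 shows "((\<lambda>s. \<phi> (\<chi> j. if j = i then sqrt (q s) else c$j)) has_real_derivative
   (q' / 2) * Dq i \<phi> (\<chi> j. if j = i then sqrt (q s0) else c$j)) (at s0)"
proof -
 define z where "z = (\<chi> j. if j = i then 0 else c$j)"
 have zi: "z $ i = 0" by (simp add: z_def)
 have zr: "(\<chi> j. if j = i then r else c$j) = z + ax i r" for r
  by (auto simp: vec_eq_iff z_def axis_def)
 note h = has_pd_S_ev_line[OF \<phi> zi]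
 show ?thesis
 proof (cases "q s0 = 0")
  case False
  then have pos: "q s0 > 0" using q[of s0] by linarith
  then have "((\<lambda>s. sqrt (q s)) has_real_derivative q' / (2 * sqrt (q s0))) (at s0)"
   using dq by (auto intro!: derivative_eq_intros simp: field_simps)
  from DERIV_chain2[OF h this] show ?thesis
   unfolding zr using pos by (simp add: field_simps)
 next
  case True
  have q0: "q' = 0"
   by (rule DERIV_local_min[OF dq, of 1]) (use q True in auto)
  define C where "C = sn 0 (Dq i \<phi>)"
  have C: "\<bar>Dq i \<phi> x\<bar> \<le> C" for x unfolding C_def by (rule S_ev_bounded[OF Dq_S_ev[OF \<phi>]])
  \<comment> \<open>Along the axis the derivative at r is r times a bounded function, so \<phi>
    changes by at most C r^2, which is C q for r the square root of q.\<close>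
  have bd: "\<bar>\<phi> (z + ax i r) - \<phi> (z + ax i 0)\<bar> \<le> (r * C) * \<bar>r - 0\<bar>" if "r \<ge> 0" for r
   unfolding real_norm_def[symmetric]
  proof (rule field_differentiable_bound[where S="{0..r}" and f'="\<lambda>r. r * Dq i \<phi> (z + ax i r)"])
   fix u assume u: "u \<in> {0..r}"
   show "((\<lambda>s. \<phi> (z + ax i s)) has_field_derivative u * Dq i \<phi> (z + ax i u)) (at u within {0..r})"
    using h DERIV_subset by blast
   show "norm (u * Dq i \<phi> (z + ax i u)) \<le> r * C"
    using u C that by (auto simp: abs_mult intro!: mult_mono)
  qed (use that in auto)
  have "((\<lambda>s. (\<phi> (z + sqrt (q s) *\<^sub>R axis i 1) - \<phi> (z + sqrt (q s0) *\<^sub>R axis i 1)) / (s - s0)) \<longlongrightarrow> 0) (at s0)"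
  proof (rule Lim_null_comparison)
   show "((\<lambda>s. C * \<bar>(q s - q s0) / (s - s0)\<bar>) \<longlongrightarrow> 0) (at s0)"
   proof -
    have "((\<lambda>s. (q s - q s0) / (s - s0)) \<longlongrightarrow> 0) (at s0)"
     using dq unfolding has_field_derivative_iff q0 .
    from tendsto_mult_right_zero[OF tendsto_rabs_zero[OF this]] show ?thesis .
   qed
   show "\<forall>\<^sub>F s in at s0. norm ((\<phi> (z + sqrt (q s) *\<^sub>R axis i 1) - \<phi> (z + sqrt (q s0) *\<^sub>R axis i 1)) / (s - s0))
     \<le> C * \<bar>(q s - q s0) / (s - s0)\<bar>"
   proof (rule always_eventually, rule allI)
    fix s
    have "\<bar>\<phi> (z + sqrt (q s) *\<^sub>R axis i 1) - \<phi> (z + sqrt (q s0) *\<^sub>R axis i 1)\<bar> \<le> C * q s"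
     using bd[of "sqrt (q s)"] q[of s] True by (simp add: ac_simps)
    then show "norm ((\<phi> (z + sqrt (q s) *\<^sub>R axis i 1) - \<phi> (z + sqrt (q s0) *\<^sub>R axis i 1)) / (s - s0))
     \<le> C * \<bar>(q s - q s0) / (s - s0)\<bar>"
     using q[of s] True by (simp add: abs_divide divide_right_mono)
   qed
  qed
  then show ?thesis unfolding zr has_field_derivative_iff q0 by simp
 qed
qed

lemma gdist_line_y:
 "gdist x (y + ax i s) a = (\<chi> j. if j = i then sqrt ((x$i)\<^sup>2 + (y$i + s)\<^sup>2 - 2 * x$i * (y$i + s) * cos (a$i)) else gdist x y a $ j)"
 by (auto simp: gdist_def vec_eq_iff axis_def)

lemma gdist_line_a:
 "gdist x y (a + ax i s) = (\<chi> j. if j = i then sqrt ((x$i)\<^sup>2 + (y$i)\<^sup>2 - 2 * x$i * y$i * cos (a$i + s)) else gdist x y a $ j)"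
 by (auto simp: gdist_def vec_eq_iff axis_def)

lemma gdist_self: "(\<chi> j. if j = i then sqrt ((x$i)\<^sup>2 + (y$i)\<^sup>2 - 2 * x$i * y$i * cos (a$i)) else gdist x y a $ j) = gdist x y a"
 by (auto simp: gdist_def vec_eq_iff)

lemma has_pd_gdist_y:
 assumes "\<phi> \<in> S_ev"
 shows "has_pd i (\<lambda>y. \<phi> (gdist x y a)) (\<lambda>y. (y$i - x$i * cos (a$i)) * Dq i \<phi> (gdist x y a))"
 unfolding has_pd_def
proof
 fix y
 have d: "((\<lambda>s. (x$i)\<^sup>2 + (y$i + s)\<^sup>2 - 2 * x$i * (y$i + s) * cos (a$i)) has_real_derivative 2 * (y$i - x$i * cos (a$i))) (at 0)"
  by (auto intro!: derivative_eq_intros simp: algebra_simps)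
 show "((\<lambda>s. \<phi> (gdist x (y + ax i s) a)) has_real_derivative (y$i - x$i * cos (a$i)) * Dq i \<phi> (gdist x y a)) (at 0)"
  using S_ev_sqrt_chain[OF assms cos_law_nonneg d, of i "gdist x y a"]
  unfolding gdist_line_y add_0_right gdist_self by (elim DERIV_cong) (simp add: field_simps)
qed

lemma has_pd_gdist_a:
 assumes "\<phi> \<in> S_ev"
 shows "has_pd i (\<lambda>a. \<phi> (gdist x y a)) (\<lambda>a. x$i * y$i * sin (a$i) * Dq i \<phi> (gdist x y a))"
 unfolding has_pd_def
proof
 fix a
 have d: "((\<lambda>s. (x$i)\<^sup>2 + (y$i)\<^sup>2 - 2 * x$i * y$i * cos (a$i + s)) has_real_derivative 2 * (x$i * y$i * sin (a$i))) (at 0)"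
  by (auto intro!: derivative_eq_intros simp: algebra_simps)
 show "((\<lambda>s. \<phi> (gdist x y (a + ax i s))) has_real_derivative x$i * y$i * sin (a$i) * Dq i \<phi> (gdist x y a)) (at 0)"
  using S_ev_sqrt_chain[OF assms cos_law_nonneg d, of i "gdist x y a"]
  unfolding gdist_line_a add_0_right gdist_self by simp
qed

lemma S_ev_gdist_measurable: "\<phi> \<in> S_ev \<Longrightarrow> (\<lambda>a. \<phi> (gdist x y a)) \<in> borel_measurable borel"
 by (intro borel_measurable_continuous_onI continuous_intros continuous_on_compose2[OF S_ev_continuous[of \<phi> UNIV]]) auto

lemma integrable_TK: "allpos \<delta> \<Longrightarrow> \<phi> \<in> S_ev \<Longrightarrow> integrable (nu \<delta>) (\<lambda>a. \<phi> (gdist x y a))"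
 by (rule integrable_nu[where B="sn 0 \<phi>"]) (auto intro: S_ev_bounded S_ev_gdist_measurable)

lemma TK_lin:
 assumes "allpos \<delta>" "\<phi> \<in> S_ev" "\<psi> \<in> S_ev"
 shows "TK \<delta> (\<lambda>x. a * \<phi> x + b * \<psi> x) x y = a * TK \<delta> \<phi> x y + b * TK \<delta> \<psi> x y"
 unfolding TK_def using integrable_TK[OF assms(1,2)] integrable_TK[OF assms(1,3)] by simp

lemma TK_commute: "TK \<delta> \<phi> x y = TK \<delta> \<phi> y x"
 by (simp add: TK_def gdist_commute)

text \<open>The angular derivative of \<phi> at \<open>gdist x y a\<close> is x_i y_i sin(a_i) times
  \<open>Dq i \<phi>\<close>. Integration by parts adds another sine, and sin^2 raises the exponent
  by 2.\<close>

lemma TK_ibp: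
 assumes \<delta>: "allpos \<delta>" and \<phi>: "\<phi> \<in> S_ev"
 shows "(\<integral>a. cos (a$i) * \<phi> (gdist x y a) \<partial>nu \<delta>) = - (x$i * y$i / \<delta>$i) * TK (\<delta> + ax i 2) (Dq i \<phi>) x y"
proof -
 define B where "B = sn 0 \<phi> + \<bar>x$i * y$i\<bar> * sn 0 (Dq i \<phi>)"
 have n: "0 \<le> sn 0 \<phi>" "0 \<le> sn 0 (Dq i \<phi>)" using sn_nonneg \<phi> Dq_S_ev by blast+
 have c: "continuous_on UNIV \<phi>" "continuous_on UNIV (Dq i \<phi>)" using S_ev_continuous \<phi> Dq_S_ev by blast+
 have "\<delta>$i * (\<integral>a. cos (a$i) * \<phi> (gdist x y a) \<partial>nu \<delta>) = - (\<integral>a. sin (a$i) * (x$i * y$i * sin (a$i) * Dq i \<phi> (gdist x y a)) \<partial>nu \<delta>)"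
 proof (rule nu_ibp[OF \<delta> _ _ _ _ has_pd_gdist_a[OF \<phi>]])
  show "continuous_on UNIV (\<lambda>a. \<phi> (gdist x y a))"
   by (intro continuous_intros continuous_on_compose2[OF c(1)]) auto
  show "continuous_on UNIV (\<lambda>a. x$i * y$i * sin (a$i) * Dq i \<phi> (gdist x y a))"
   by (intro continuous_intros continuous_on_compose2[OF c(2)]) auto
  fix a
  have "\<bar>\<phi> (gdist x y a)\<bar> \<le> sn 0 \<phi>" by (rule S_ev_bounded[OF \<phi>])
  then show "\<bar>\<phi> (gdist x y a)\<bar> \<le> B" unfolding B_def using n by (simp add: add_increasing2)
  have "\<bar>x$i * y$i\<bar> * (\<bar>sin (a$i)\<bar> * \<bar>Dq i \<phi> (gdist x y a)\<bar>) \<le> \<bar>x$i * y$i\<bar> * (1 * sn 0 (Dq i \<phi>))"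
   using n by (intro mult_left_mono mult_mono S_ev_bounded[OF Dq_S_ev[OF \<phi>]]) auto
  then show "\<bar>x$i * y$i * sin (a$i) * Dq i \<phi> (gdist x y a)\<bar> \<le> B"
   unfolding B_def using n by (simp add: abs_mult mult.assoc)
 qed
 also have "(\<integral>a. sin (a$i) * (x$i * y$i * sin (a$i) * Dq i \<phi> (gdist x y a)) \<partial>nu \<delta>) =
   (\<integral>a. x$i * y$i * ((sin (a$i))\<^sup>2 * Dq i \<phi> (gdist x y a)) \<partial>nu \<delta>)"
  by (simp add: power2_eq_square ac_simps)
 also have "... = x$i * y$i * TK (\<delta> + ax i 2) (Dq i \<phi>) x y"
  using nu_sin_squared[OF S_ev_gdist_measurable[OF Dq_S_ev[OF \<phi>, of i], of x y], of \<delta> i]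
  by (simp add: TK_def)
 finally show ?thesis using \<delta>[rule_format, of i] by (simp add: field_simps)
qed

lemma shift_exponent_pos:
 fixes \<delta> :: "real^'n::finite"
 shows "allpos \<delta> \<Longrightarrow> \<forall>j. 0 < (\<delta> + ax i 2)$j"
proof
 fix j assume "allpos \<delta>"
 then have "0 < \<delta>$j" by blast
 then show "0 < (\<delta> + ax i 2)$j" by (cases "j = i") (auto simp: axis_def)
qed

text \<open>The chain rule gives the factor y_i - x_i cos(a_i). \<open>TK_ibp\<close> turns the
  cosine term into another multiple of y_i, so the derivative is y_i times kernels of the same kind,
  with the exponent \<delta>_i or \<delta>_i + 2.\<close>

lemma has_pd_TK:
 assumes \<delta>: "allpos \<delta>" and \<phi>: "\<phi> \<in> S_ev"
 shows "has_pd i (TK \<delta> \<phi> x) (\<lambda>y. y$i * (TK \<delta> (Dq i \<phi>) x y + (x$i)\<^sup>2 / \<delta>$i * TK (\<delta> + ax i 2) (Dq i (Dq i \<phi>)) x y))"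
proof -
 have D: "Dq i \<phi> \<in> S_ev" using Dq_S_ev \<phi> by blast
 have "has_pd i (\<lambda>y. \<integral>a. \<phi> (gdist x y a) \<partial>nu \<delta>) (\<lambda>y. \<integral>a. (y$i - x$i * cos (a$i)) * Dq i \<phi> (gdist x y a) \<partial>nu \<delta>)"
 proof (rule has_pd_integral)
  show "integrable (nu \<delta>) (\<lambda>a. \<phi> (gdist x y a))" for y by (rule integrable_TK[OF \<delta> \<phi>])
  show "has_pd i (\<lambda>y. \<phi> (gdist x y a)) (\<lambda>y. (y$i - x$i * cos (a$i)) * Dq i \<phi> (gdist x y a))" for a
   by (rule has_pd_gdist_y[OF \<phi>])
  fix y
  have bd: "\<bar>((y + ax i r)$i - x$i * cos (a$i)) * Dq i \<phi> (gdist x (y + ax i r) a)\<bar> \<le> (\<bar>y$i\<bar> + 1 + \<bar>x$i\<bar>) * sn 0 (Dq i \<phi>)"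
   if "\<bar>r\<bar> \<le> 1" for r a
   unfolding abs_mult
  proof (rule mult_mono)
   have "\<bar>x$i * cos (a$i)\<bar> \<le> \<bar>x$i\<bar>" by (simp add: abs_mult mult_left_le)
   then show "\<bar>(y + ax i r)$i - x$i * cos (a$i)\<bar> \<le> \<bar>y$i\<bar> + 1 + \<bar>x$i\<bar>"
    using that by simp
  qed (use S_ev_bounded[OF D] in auto)
  have "integrable (nu \<delta>) (\<lambda>a. (\<bar>y$i\<bar> + 1 + \<bar>x$i\<bar>) * sn 0 (Dq i \<phi>))"
   by (rule integrable_nu[OF \<delta>]) auto
  with bd show "\<exists>B. integrable (nu \<delta>) B \<and> (\<forall>a\<in>space (nu \<delta>). \<forall>r. \<bar>r\<bar> \<le> 1 \<longrightarrow>
    \<bar>((y + ax i r)$i - x$i * cos (a$i)) * Dq i \<phi> (gdist x (y + ax i r) a)\<bar> \<le> B a)"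
   by (intro exI[of _ "\<lambda>a. (\<bar>y$i\<bar> + 1 + \<bar>x$i\<bar>) * sn 0 (Dq i \<phi>)"]) auto
 qed
 moreover have "(\<integral>a. (y$i - x$i * cos (a$i)) * Dq i \<phi> (gdist x y a) \<partial>nu \<delta>) =
   y$i * (TK \<delta> (Dq i \<phi>) x y + (x$i)\<^sup>2 / \<delta>$i * TK (\<delta> + ax i 2) (Dq i (Dq i \<phi>)) x y)" for y
 proof -
  have i2: "integrable (nu \<delta>) (\<lambda>a. cos (a$i) * Dq i \<phi> (gdist x y a))"
  proof (rule integrable_nu[OF \<delta>, where B="sn 0 (Dq i \<phi>)"])
   show "(\<lambda>a. cos (a$i) * Dq i \<phi> (gdist x y a)) \<in> borel_measurable borel"
    using S_ev_gdist_measurable[OF D] by measurable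
   show "\<bar>cos (a$i) * Dq i \<phi> (gdist x y a)\<bar> \<le> sn 0 (Dq i \<phi>)" for a
    using mult_mono[OF abs_cos_le_one[of "a$i"] S_ev_bounded[OF D, of "gdist x y a"]] by (simp add: abs_mult)
  qed
  have "(\<integral>a. (y$i - x$i * cos (a$i)) * Dq i \<phi> (gdist x y a) \<partial>nu \<delta>) =
    (\<integral>a. y$i * Dq i \<phi> (gdist x y a) - x$i * (cos (a$i) * Dq i \<phi> (gdist x y a)) \<partial>nu \<delta>)"
   by (simp add: algebra_simps)
  also have "... = y$i * TK \<delta> (Dq i \<phi>) x y - x$i * (\<integral>a. cos (a$i) * Dq i \<phi> (gdist x y a) \<partial>nu \<delta>)"
   unfolding TK_def using integrable_TK[OF \<delta> D] i2 by simp
  finally show ?thesis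
   unfolding TK_ibp[OF \<delta> D] by (simp add: algebra_simps power2_eq_square)
 qed
 ultimately show ?thesis by (simp add: TK_def[abs_def])
qed

lemma TK_decay:
 fixes \<phi> :: "real^'n::finite \<Rightarrow> real"
 assumes \<delta>: "allpos \<delta>" and \<phi>: "\<phi> \<in> S_ev"
 shows "(1 + norm y) ^ N * \<bar>TK \<delta> \<phi> x y\<bar> \<le> nu_mass \<delta> * (real CARD('n) + 1) ^ (N + 1) * (1 + norm x) ^ N * sn N \<phi>"
proof -
 define C where "C = (real CARD('n) + 1) ^ (N + 1) * (1 + norm x) ^ N * sn N \<phi>"
 have bd: "\<bar>(1 + norm y) ^ N * \<phi> (gdist x y a)\<bar> \<le> C" for a
 proof -
  have "(1 + norm y) ^ N \<le> (1 + norm (gdist x y a)) ^ N * (1 + norm x) ^ N"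
   using power_mono[OF norm_le_gdist_mult[of y x a], of N] by (simp add: power_mult_distrib)
  then have "(1 + norm y) ^ N * \<bar>\<phi> (gdist x y a)\<bar> \<le> (1 + norm x) ^ N * ((1 + norm (gdist x y a)) ^ N * \<bar>\<phi> (gdist x y a)\<bar>)"
   by (subst mult.left_commute[of "(1 + norm x) ^ N"], subst mult.assoc[symmetric], intro mult_right_mono)
    (auto simp: mult.commute)
  also have "... \<le> (1 + norm x) ^ N * ((real CARD('n) + 1) ^ (N + 1) * sn N \<phi>)"
   by (intro mult_left_mono S_ev_decay[OF \<phi>]) auto
  finally show ?thesis by (simp add: C_def abs_mult ac_simps)
 qed
 have "(1 + norm y) ^ N * \<bar>TK \<delta> \<phi> x y\<bar> = \<bar>\<integral>a. (1 + norm y) ^ N * \<phi> (gdist x y a) \<partial>nu \<delta>\<bar>"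
  by (simp add: TK_def abs_mult)
 also have "... \<le> (\<integral>a. \<bar>(1 + norm y) ^ N * \<phi> (gdist x y a)\<bar> \<partial>nu \<delta>)" by (rule integral_abs_bound)
 also have "... \<le> (\<integral>a. C \<partial>nu \<delta>)"
  by (intro integral_mono integrable_abs Bochner_Integration.integrable_mult_right integrable_TK \<delta> \<phi> bd integrable_nu[OF \<delta>]) auto
 also have "... = nu_mass \<delta> * C" using measure_nu[OF \<delta>] by simp
 finally show ?thesis by (simp add: C_def ac_simps)
qed

lemma TK_bounded:
 fixes \<phi> :: "real^'n::finite \<Rightarrow> real"
 assumes \<delta>: "allpos \<delta>" and \<phi>: "\<phi> \<in> S_ev"
 shows "\<bar>TK \<delta> \<phi> x y\<bar> \<le> nu_mass \<delta> * (real CARD('n) + 1) * sn 0 \<phi>"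
 using TK_decay[OF assms, of y 0 x] by simp

lemma continuous_on_integral_bounded:
 fixes F :: "'x::metric_space \<Rightarrow> 'z \<Rightarrow> real"
 assumes c: "\<And>z. z \<in> space M \<Longrightarrow> continuous_on S (\<lambda>x. F x z)"
  and m: "\<And>x. x \<in> S \<Longrightarrow> F x \<in> borel_measurable M"
  and b: "integrable M B" "\<And>x z. x \<in> S \<Longrightarrow> z \<in> space M \<Longrightarrow> \<bar>F x z\<bar> \<le> B z"
 shows "continuous_on S (\<lambda>x. \<integral>z. F x z \<partial>M)"
 unfolding continuous_on_sequentially comp_def
proof (intro allI ballI impI, elim conjE)
 fix X :: "nat \<Rightarrow> 'x" and a assume a: "a \<in> S" and XS: "\<forall>n. X n \<in> S" and X: "X \<longlonglongrightarrow> a"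
 show "(\<lambda>n. \<integral>z. F (X n) z \<partial>M) \<longlonglongrightarrow> (\<integral>z. F a z \<partial>M)"
 proof (rule integral_dominated_convergence[OF m m b(1)])
  show "AE z in M. (\<lambda>n. F (X n) z) \<longlonglongrightarrow> F a z"
   using c X XS a by (intro AE_I2) (auto simp: continuous_on_sequentially comp_def)
 qed (use b(2) XS a in auto)
qed

lemma continuous_on_TK:
 assumes \<delta>: "allpos \<delta>" and \<phi>: "\<phi> \<in> S_ev"
 shows "continuous_on UNIV (\<lambda>(x, y). TK \<delta> \<phi> x y)"
proof -
 have "continuous_on UNIV (\<lambda>p. \<integral>a. \<phi> (gdist (fst p) (snd p) a) \<partial>nu \<delta>)"
 proof (rule continuous_on_integral_bounded)
  show "continuous_on UNIV (\<lambda>p. \<phi> (gdist (fst p) (snd p) a))" for a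
   by (intro continuous_intros continuous_on_compose2[OF S_ev_continuous[OF \<phi>, of UNIV]]) auto
  show "integrable (nu \<delta>) (\<lambda>a. sn 0 \<phi>)" by (rule integrable_nu[OF \<delta>]) auto
 qed (use S_ev_gdist_measurable[OF \<phi>] S_ev_bounded[OF \<phi>] in auto)
 then show ?thesis by (simp add: TK_def case_prod_beta)
qed

lemma continuous_on_TK' [continuous_intros]:
 assumes "allpos \<delta>" "\<phi> \<in> S_ev" "continuous_on A f" "continuous_on A g"
 shows "continuous_on A (\<lambda>z. TK \<delta> \<phi> (f z) (g z))"
 using continuous_on_compose2[OF continuous_on_TK[OF assms(1,2)] continuous_on_Pair[OF assms(3,4)]] by auto

text \<open>Reflecting \<open>y\<close> amounts to replacing the angle by its supplement.\<close>
lemma TK_mirror: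
 fixes \<delta> :: "real^'n::finite"
 assumes \<phi>: "\<phi> \<in> S_ev"
 shows "TK \<delta> \<phi> x (mirror j y) = TK \<delta> \<phi> x y"
proof -
 define T :: "real^'n \<Rightarrow> real^'n" where "T = (\<lambda>a. \<chi> i. if i = j then pi - a$i else a$i)"
 have B: "(Basis :: (real^'n) set) = range (\<lambda>i. axis i 1)" by (auto simp: Basis_vec_def)
 have inj: "inj (\<lambda>i. axis i 1 :: real^'n)" by (auto simp: inj_def axis_eq_axis)
 define c :: "real^'n \<Rightarrow> real" where "c = (\<lambda>b. if b = axis j 1 then -1 else 1)"
 have T: "T a = ax j pi + (\<Sum>b\<in>Basis. (c b * (a \<bullet> b)) *\<^sub>R b)" for a
 proof -
  have "(\<Sum>b\<in>Basis. (c b * (a \<bullet> b)) *\<^sub>R b) = (\<Sum>i\<in>UNIV. ax i (c (axis i 1) * a$i))"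
   unfolding B by (simp add: sum.reindex[OF inj] inner_axis)
  also have "... = (\<chi> i. c (axis i 1) * a$i)"
   by (simp add: vec_eq_iff sum_component axis_def if_distrib[of "\<lambda>u. _ * u"] sum.delta cong: if_cong)
  finally show ?thesis by (auto simp: vec_eq_iff T_def c_def axis_eq_axis axis_def)
 qed
 have "lborel = density (distr lborel borel (\<lambda>a. pi *\<^sub>R axis j 1 + (\<Sum>b\<in>Basis. (c b * (a \<bullet> b)) *\<^sub>R b))) (\<lambda>_. (\<Prod>b\<in>Basis. \<bar>c b\<bar>))"
  by (rule lborel_affine_euclidean) (auto simp: c_def)
 moreover have "(\<Prod>b\<in>Basis. \<bar>c b\<bar>) = 1" by (rule prod.neutral) (auto simp: c_def)
 ultimately have L: "lborel = distr lborel borel T" by (simp add: T[abs_def] density_1)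
 have Tm[measurable]: "T \<in> borel_measurable borel"
  unfolding T_def
 proof (intro borel_measurable_continuous_onI continuous_on_vec_lambda)
  show "continuous_on UNIV (\<lambda>a. if i = j then pi - a$i else a$i)" for i
   by (cases "i = j") (auto intro!: continuous_intros)
 qed
 have s: "sinw \<delta> (T a) = sinw \<delta> a" for a
  unfolding sinw_def by (rule prod.cong) (auto simp: T_def indicator_def)
 have g: "gdist x (mirror j y) (T a) = gdist x y a" for a
  by (auto simp: gdist_def mirror_def T_def vec_eq_iff)
 have "TK \<delta> \<phi> x (mirror j y) = (\<integral>a. sinw \<delta> a * \<phi> (gdist x (mirror j y) a) \<partial>distr lborel borel T)"
  unfolding TK_def by (subst integral_nu[OF S_ev_gdist_measurable[OF \<phi>]]) (simp flip: L)
 also have "... = (LBINT a. sinw \<delta> (T a) * \<phi> (gdist x (mirror j y) (T a)))"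
  using S_ev_gdist_measurable[OF \<phi>] by (intro integral_distr) measurable
 also have "... = TK \<delta> \<phi> x y"
  unfolding s g TK_def by (subst integral_nu[OF S_ev_gdist_measurable[OF \<phi>]]) simp
 finally show ?thesis .
qed

subsection \<open>Averages of translates\<close>

definition Dl :: "'n::finite list \<Rightarrow> (real^'n \<Rightarrow> real) \<Rightarrow> real^'n \<Rightarrow> real" where
 "Dl js \<phi> = foldr Dq js \<phi>"

lemma Dl_simps [simp]: "Dl [] \<phi> = \<phi>" "Dl (i # js) \<phi> = Dq i (Dl js \<phi>)"
 by (simp_all add: Dl_def)

lemma cop_Dl: "cop (Dl js)"
proof (induction js)
 case Nil
 have "Dl [] = (\<lambda>\<phi>::real^'a \<Rightarrow> real. \<phi>)" by (rule ext) simp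
 then show ?case using cop_id by simp
next
 case (Cons i js)
 have "Dl (i # js) = (\<lambda>\<phi>. Dq i (Dl js \<phi>))" by (rule ext) simp
 then show ?case using cop_comp[OF cop_Dq[of i] Cons] by simp
qed

lemma Dl_S_ev: "\<phi> \<in> S_ev \<Longrightarrow> Dl js \<phi> \<in> S_ev"
 using cop_Dl cop_def by blast

text \<open>Finite moments of all orders, because the decay of \<open>TK\<close> in y is bought by
  powers of the norm of x.\<close>

definition moments :: "(real^'n::finite) measure \<Rightarrow> bool" where
 "moments \<mu> \<longleftrightarrow> sets \<mu> = sets borel \<and> (\<forall>N. integrable \<mu> (\<lambda>x. (1 + norm x) ^ N))"

text \<open>The parameter is a scale t, a density \<sigma> bounded by 1 and a test function \<phi>.
  The indices record what derivatives in y bring out of \<open>TK\<close> at t x: by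
  \<open>has_pd_TK\<close> a factor (t x_i)^2, which goes into j and \<alpha>, a raised exponent
  \<delta>, and further operators \<open>Dq\<close> listed in js.\<close>

definition gint :: "nat \<Rightarrow> ('n::finite \<Rightarrow> nat) \<Rightarrow> real^'n \<Rightarrow> 'n list \<Rightarrow>
  real \<times> (real^'n \<Rightarrow> real) \<times> (real^'n \<Rightarrow> real) \<Rightarrow> real^'n \<Rightarrow> real^'n \<Rightarrow> real" where
 "gint j \<alpha> \<delta> js = (\<lambda>(t, \<sigma>, \<phi>) x y. \<sigma> x * (t ^ j * monom \<alpha> x * TK \<delta> (Dl js \<phi>) (t *\<^sub>R x) y))"

definition gen :: "(real^'n) measure \<Rightarrow> nat \<Rightarrow> ('n::finite \<Rightarrow> nat) \<Rightarrow> real^'n \<Rightarrow> 'n list \<Rightarrow>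
  real \<times> (real^'n \<Rightarrow> real) \<times> (real^'n \<Rightarrow> real) \<Rightarrow> real^'n \<Rightarrow> real" where
 "gen \<mu> j \<alpha> \<delta> js p y = (\<integral>x. gint j \<alpha> \<delta> js p x y \<partial>\<mu>)"

definition prm :: "(real \<times> (real^'n::finite \<Rightarrow> real) \<times> (real^'n \<Rightarrow> real)) set" where
 "prm = {(t, \<sigma>, \<phi>). \<sigma> \<in> borel_measurable borel \<and> (\<forall>x. \<bar>\<sigma> x\<bar> \<le> 1) \<and> \<phi> \<in> S_ev}"

definition prmR :: "real \<Rightarrow> (real \<times> (real^'n::finite \<Rightarrow> real) \<times> (real^'n \<Rightarrow> real)) set" where
 "prmR R = {p \<in> prm. \<bar>fst p\<bar> \<le> R}"

lemma prmD:
 assumes "(t, \<sigma>, \<phi>) \<in> prm"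
 shows "\<sigma> \<in> borel_measurable borel" "\<bar>\<sigma> x\<bar> \<le> 1" "\<phi> \<in> S_ev"
 using assms by (auto simp: prm_def)

lemma continuous_on_monom [continuous_intros]: "continuous_on A (\<lambda>x. monom \<alpha> x)"
 unfolding monom_def by (intro continuous_intros)

lemma gint_bound:
 fixes \<delta> :: "real^'n::finite"
 assumes \<delta>: "allpos \<delta>" and p: "(t, \<sigma>, \<phi>) \<in> prm" and t: "\<bar>t\<bar> \<le> R"
 shows "(1 + norm y) ^ N * \<bar>gint j \<alpha> \<delta> js (t, \<sigma>, \<phi>) x y\<bar> \<le>
  ((1 + R) ^ (j + N) * nu_mass \<delta> * (real CARD('n) + 1) ^ (N + 1)) * (1 + norm x) ^ ((\<Sum>i\<in>UNIV. \<alpha> i) + N) * sn N (Dl js \<phi>)"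
proof -
 have R: "R \<ge> 0" using t by linarith
 have \<phi>: "Dl js \<phi> \<in> S_ev" using Dl_S_ev prmD[OF p] by blast
 define K where "K = nu_mass \<delta> * (real CARD('n) + 1) ^ (N + 1) * (1 + norm (t *\<^sub>R x)) ^ N * sn N (Dl js \<phi>)"
 have K: "(1 + norm y) ^ N * \<bar>TK \<delta> (Dl js \<phi>) (t *\<^sub>R x) y\<bar> \<le> K"
  unfolding K_def by (rule TK_decay[OF \<delta> \<phi>])
 have nm: "nu_mass \<delta> \<ge> 0" using nu_mass_pos[OF \<delta>] by simp
 have "1 + norm (t *\<^sub>R x) \<le> (1 + R) * (1 + norm x)"
  using mult_right_mono[OF t norm_ge_zero[of x]] R norm_ge_zero[of x]
  unfolding distrib_left distrib_right norm_scaleR by linarith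
 then have "(1 + norm (t *\<^sub>R x)) ^ N \<le> (1 + R) ^ N * (1 + norm x) ^ N"
  unfolding power_mult_distrib[symmetric] by (rule power_mono) simp
 then have K2: "K \<le> nu_mass \<delta> * (real CARD('n) + 1) ^ (N + 1) * ((1 + R) ^ N * (1 + norm x) ^ N) * sn N (Dl js \<phi>)"
  unfolding K_def using nm sn_nonneg[OF \<phi>] by (intro mult_right_mono mult_left_mono) auto
 have "\<bar>t\<bar> ^ j \<le> R ^ j" using t by (intro power_mono) auto
 also have "... \<le> (1 + R) ^ j" using R by (intro power_mono) auto
 finally have tj: "\<bar>t\<bar> ^ j \<le> (1 + R) ^ j" .
 have "(1 + norm y) ^ N * \<bar>gint j \<alpha> \<delta> js (t, \<sigma>, \<phi>) x y\<bar> =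
   \<bar>\<sigma> x\<bar> * (\<bar>t\<bar> ^ j * (\<bar>monom \<alpha> x\<bar> * ((1 + norm y) ^ N * \<bar>TK \<delta> (Dl js \<phi>) (t *\<^sub>R x) y\<bar>)))"
  by (simp add: gint_def abs_mult power_abs ac_simps)
 also have "... \<le> 1 * ((1 + R) ^ j * ((1 + norm x) ^ (\<Sum>i\<in>UNIV. \<alpha> i) * K))"
  using R K by (intro mult_mono prmD(2)[OF p] tj abs_monom_le) (auto intro!: mult_nonneg_nonneg order_trans[OF _ K])
 also have "... \<le> 1 * ((1 + R) ^ j * ((1 + norm x) ^ (\<Sum>i\<in>UNIV. \<alpha> i) *
   (nu_mass \<delta> * (real CARD('n) + 1) ^ (N + 1) * ((1 + R) ^ N * (1 + norm x) ^ N) * sn N (Dl js \<phi>))))"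
  using R K2 by (intro mult_left_mono) auto
 finally show ?thesis by (simp add: power_add ac_simps)
qed

lemma gint_bound_uniform:
 fixes \<delta> :: "real^'n::finite"
 assumes \<delta>: "allpos \<delta>" and p: "p \<in> prm"
 shows "\<exists>C. \<forall>x y. \<bar>gint j \<alpha> \<delta> js p x y\<bar> \<le> C * (1 + norm x) ^ (\<Sum>i\<in>UNIV. \<alpha> i)"
proof -
 obtain t \<sigma> \<phi> where pe: "p = (t, \<sigma>, \<phi>)" by (cases p)
 show ?thesis
  using gint_bound[OF \<delta> p[unfolded pe] order_refl, of _ 0 j \<alpha> js]
  by (intro exI[of _ "(1 + \<bar>t\<bar>) ^ j * nu_mass \<delta> * (real CARD('n) + 1) * sn 0 (Dl js \<phi>)"])
   (simp add: pe ac_simps)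
qed

lemma gint_measurable:
 assumes \<delta>: "allpos \<delta>" and p: "p \<in> prm" and \<mu>: "sets \<mu> = sets borel"
 shows "(\<lambda>x. gint j \<alpha> \<delta> js p x y) \<in> borel_measurable \<mu>"
proof -
 obtain t \<sigma> \<phi> where pe: "p = (t, \<sigma>, \<phi>)" by (cases p)
 have \<phi>: "Dl js \<phi> \<in> S_ev" using Dl_S_ev prmD p pe by blast
 have [measurable]: "\<sigma> \<in> borel_measurable borel" using prmD p pe by blast
 have [measurable]: "(\<lambda>x. t ^ j * monom \<alpha> x * TK \<delta> (Dl js \<phi>) (t *\<^sub>R x) y) \<in> borel_measurable borel"
  by (intro borel_measurable_continuous_onI continuous_intros \<delta> \<phi>)
 have "(\<lambda>x. gint j \<alpha> \<delta> js p x y) \<in> borel_measurable borel"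
  unfolding pe gint_def prod.case by measurable
 then show ?thesis using measurable_cong_sets[OF \<mu> refl] by blast
qed

lemma gint_integrable:
 assumes \<delta>: "allpos \<delta>" and p: "p \<in> prm" and \<mu>: "moments \<mu>"
 shows "integrable \<mu> (\<lambda>x. gint j \<alpha> \<delta> js p x y)"
proof -
 obtain t \<sigma> \<phi> where pe: "p = (t, \<sigma>, \<phi>)" by (cases p)
 have \<phi>: "Dl js \<phi> \<in> S_ev" using Dl_S_ev prmD p pe by blast
 let ?C = "(1 + \<bar>t\<bar>) ^ (j + 0) * nu_mass \<delta> * (real CARD('a) + 1) ^ (0 + 1)"
 show ?thesis
 proof (rule Bochner_Integration.integrable_bound)
  show "integrable \<mu> (\<lambda>x. ?C * sn 0 (Dl js \<phi>) * (1 + norm x) ^ ((\<Sum>i\<in>UNIV. \<alpha> i) + 0))"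
   using \<mu> unfolding moments_def by (intro Bochner_Integration.integrable_mult_right) blast
  show "AE x in \<mu>. norm (gint j \<alpha> \<delta> js p x y) \<le> norm (?C * sn 0 (Dl js \<phi>) * (1 + norm x) ^ ((\<Sum>i\<in>UNIV. \<alpha> i) + 0))"
   using gint_bound[OF \<delta> p[unfolded pe] order_refl, of y 0 j \<alpha> js]
   by (intro AE_I2) (simp add: pe ac_simps order_trans[OF _ abs_ge_self])
 qed (rule gint_measurable, use \<delta> p \<mu> in \<open>auto simp: moments_def\<close>)
qed

definition gens :: "(real^'n) measure \<Rightarrow> (real \<times> (real^'n::finite \<Rightarrow> real) \<times> (real^'n \<Rightarrow> real) \<Rightarrow> real^'n \<Rightarrow> real) set" where
 "gens \<mu> = {gen \<mu> j \<alpha> \<delta> js | j \<alpha> \<delta> js. allpos \<delta>}"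

definition up2 :: "'n \<Rightarrow> ('n \<Rightarrow> nat) \<Rightarrow> 'n \<Rightarrow> nat" where
 "up2 i \<alpha> = \<alpha>(i := Suc (Suc (\<alpha> i)))"

lemma monom_up2: "monom (up2 i \<alpha>) x = (x$i)\<^sup>2 * monom \<alpha> x"
 using monom_Suc[of "\<alpha>(i := Suc (\<alpha> i))" i x] monom_Suc[of \<alpha> i x] by (simp add: up2_def power2_eq_square)

lemma has_pd_gint:
 assumes \<delta>: "allpos \<delta>" and p: "p \<in> prm"
 shows "has_pd i (gint j \<alpha> \<delta> js p x) (\<lambda>y. y$i * (gint j \<alpha> \<delta> (i # js) p x y +
   1 / \<delta>$i * gint (j + 2) (up2 i \<alpha>) (\<delta> + ax i 2) (i # i # js) p x y))"
proof -
 obtain t \<sigma> \<phi> where pe: "p = (t, \<sigma>, \<phi>)" by (cases p)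
 have \<phi>: "Dl js \<phi> \<in> S_ev" using Dl_S_ev prmD p pe by blast
 have c: "has_pd i (\<lambda>y. a * f y) (\<lambda>y. a * f' y)" if "has_pd i f f'" for a f f'
  using has_pd_lin[OF that that, of a 0] by simp
 show ?thesis
  using c[OF c[OF has_pd_TK[OF \<delta> \<phi>, of i "t *\<^sub>R x"], of "t ^ j * monom \<alpha> x"], of "\<sigma> x"]
  by (simp add: pe gint_def monom_up2 power2_eq_square power_add algebra_simps)
qed

lemma has_pd_gen:
 assumes \<delta>: "allpos \<delta>" and p: "p \<in> prm" and \<mu>: "moments \<mu>"
 shows "has_pd i (gen \<mu> j \<alpha> \<delta> js p) (\<lambda>y. y$i * (gen \<mu> j \<alpha> \<delta> (i # js) p y +
   1 / \<delta>$i * gen \<mu> (j + 2) (up2 i \<alpha>) (\<delta> + ax i 2) (i # i # js) p y))"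
proof -
 let ?\<delta>' = "\<delta> + ax i 2"
 note \<delta>' = shift_exponent_pos[OF \<delta>, of i]
 let ?G = "\<lambda>x y. gint j \<alpha> \<delta> (i # js) p x y + 1 / \<delta>$i * gint (j + 2) (up2 i \<alpha>) ?\<delta>' (i # i # js) p x y"
 obtain t \<sigma> \<phi> where pe: "p = (t, \<sigma>, \<phi>)" by (cases p)
 have m: "integrable \<mu> (\<lambda>x. (1 + norm x) ^ N)" for N using \<mu> by (simp add: moments_def)
 have "has_pd i (\<lambda>y. \<integral>x. gint j \<alpha> \<delta> js p x y \<partial>\<mu>) (\<lambda>y. \<integral>x. y$i * ?G x y \<partial>\<mu>)"
 proof (rule has_pd_integral)
  show "integrable \<mu> (\<lambda>x. gint j \<alpha> \<delta> js p x y)" for y by (rule gint_integrable[OF \<delta> p \<mu>])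
  show "has_pd i (gint j \<alpha> \<delta> js p x) (\<lambda>y. y$i * ?G x y)" for x by (rule has_pd_gint[OF \<delta> p])
  fix y
  obtain C1 where C1: "\<And>x y. \<bar>gint j \<alpha> \<delta> (i # js) p x y\<bar> \<le> C1 * (1 + norm x) ^ (\<Sum>i\<in>UNIV. \<alpha> i)"
   using gint_bound_uniform[OF \<delta> p, of j \<alpha> "i # js"] by blast
  obtain C2 where C2: "\<And>x y. \<bar>gint (j + 2) (up2 i \<alpha>) ?\<delta>' (i # i # js) p x y\<bar> \<le> C2 * (1 + norm x) ^ (\<Sum>k\<in>UNIV. up2 i \<alpha> k)"
   using gint_bound_uniform[OF \<delta>' p, of "j + 2" "up2 i \<alpha>" "i # i # js"] by blast
  define B where "B = (\<lambda>x::real^'a. (\<bar>y$i\<bar> + 1) * (C1 * (1 + norm x) ^ (\<Sum>i\<in>UNIV. \<alpha> i)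
    + 1 / \<delta>$i * (C2 * (1 + norm x) ^ (\<Sum>k\<in>UNIV. up2 i \<alpha> k))))"
  have "integrable \<mu> B" unfolding B_def
   by (intro Bochner_Integration.integrable_mult_right Bochner_Integration.integrable_add m)
  moreover have "\<bar>(y + ax i r)$i * ?G x (y + ax i r)\<bar> \<le> B x" if r: "\<bar>r\<bar> \<le> 1" for x r
  proof -
   let ?y = "y + ax i r"
   have di: "1 / \<delta>$i \<ge> 0" using \<delta>[rule_format, of i] by simp
   have "\<bar>?G x ?y\<bar> \<le> \<bar>gint j \<alpha> \<delta> (i # js) p x ?y\<bar> + 1 / \<delta>$i * \<bar>gint (j + 2) (up2 i \<alpha>) ?\<delta>' (i # i # js) p x ?y\<bar>"
    using abs_triangle_ineq[of "gint j \<alpha> \<delta> (i # js) p x ?y" "1 / \<delta>$i * gint (j + 2) (up2 i \<alpha>) ?\<delta>' (i # i # js) p x ?y"]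
    unfolding abs_mult[of "1 / \<delta>$i"] abs_of_nonneg[OF di] .
   also have "... \<le> C1 * (1 + norm x) ^ (\<Sum>i\<in>UNIV. \<alpha> i) + 1 / \<delta>$i * (C2 * (1 + norm x) ^ (\<Sum>k\<in>UNIV. up2 i \<alpha> k))"
    by (rule add_mono[OF C1 mult_left_mono[OF C2 di]])
   finally show ?thesis unfolding B_def abs_mult
    using r by (intro mult_mono) auto
  qed
  ultimately show "\<exists>B. integrable \<mu> B \<and> (\<forall>x\<in>space \<mu>. \<forall>r. \<bar>r\<bar> \<le> 1 \<longrightarrow>
    \<bar>(y + ax i r)$i * ?G x (y + ax i r)\<bar> \<le> B x)" by blast
 qed
 moreover have "(\<integral>x. y$i * ?G x y \<partial>\<mu>) = y$i * (gen \<mu> j \<alpha> \<delta> (i # js) p y + 1 / \<delta>$i * gen \<mu> (j + 2) (up2 i \<alpha>) ?\<delta>' (i # i # js) p y)" for y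
  unfolding gen_def using gint_integrable[OF \<delta> p \<mu>] gint_integrable[OF \<delta>' p \<mu>] by simp
 ultimately show ?thesis unfolding gen_def[abs_def] by (simp only:)
qed

lemma pd_closed_gens:
 assumes \<mu>: "moments \<mu>" and P: "P \<subseteq> prm"
 shows "pd_closed (gens \<mu>) P"
 unfolding pd_closed_def
proof (intro ballI allI)
 fix G i assume "G \<in> gens \<mu>"
 then obtain j \<alpha> \<delta> js where G: "G = gen \<mu> j \<alpha> \<delta> js" and \<delta>: "allpos \<delta>" unfolding gens_def by blast
 have 1: "gen \<mu> j \<alpha> \<delta> (i # js) \<in> pspan (gens \<mu>)"
  by (rule pspan.base) (use \<delta> in \<open>auto simp: gens_def\<close>)
 have 2: "gen \<mu> (j + 2) (up2 i \<alpha>) (\<delta> + ax i 2) (i # i # js) \<in> pspan (gens \<mu>)"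
  by (rule pspan.base) (use shift_exponent_pos[OF \<delta>, of i] in \<open>unfold gens_def, blast\<close>)
 show "\<exists>G'\<in>pspan (gens \<mu>). \<forall>p\<in>P. has_pd i (G p) (G' p)"
 proof (rule bexI, rule ballI)
  fix p assume "p \<in> P"
  show "has_pd i (G p) (\<lambda>y. y$i * (1 * gen \<mu> j \<alpha> \<delta> (i # js) p y +
   1 / \<delta>$i * gen \<mu> (j + 2) (up2 i \<alpha>) (\<delta> + ax i 2) (i # i # js) p y))"
   unfolding G using has_pd_gen[OF \<delta> subsetD[OF P \<open>p \<in> P\<close>] \<mu>, of i j \<alpha> js] by simp
 qed (rule pspan.coord[OF pspan.lin[OF 1 2]])
qed

lemma gen_continuous:
 assumes \<delta>: "allpos \<delta>" and p: "\<And>t. (t, \<sigma>, \<phi>) \<in> prm" and \<mu>: "moments \<mu>"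
 shows "continuous_on UNIV (\<lambda>(t, y). gen \<mu> j \<alpha> \<delta> js (t, \<sigma>, \<phi>) y)"
proof -
 have \<phi>: "Dl js \<phi> \<in> S_ev" using Dl_S_ev prmD p by blast
 \<comment> \<open>A dominating function is available for bounded t only, so continuity is proved on
   open strips and glued.\<close>
 have "continuous_on ({- R<..<R} \<times> UNIV) (\<lambda>z. \<integral>x. gint j \<alpha> \<delta> js (fst z, \<sigma>, \<phi>) x (snd z) \<partial>\<mu>)" for R
 proof (rule continuous_on_integral_bounded)
  let ?C = "(1 + R) ^ (j + 0) * nu_mass \<delta> * (real CARD('a) + 1) ^ (0 + 1)"
  show "integrable \<mu> (\<lambda>x. ?C * sn 0 (Dl js \<phi>) * (1 + norm x) ^ ((\<Sum>i\<in>UNIV. \<alpha> i) + 0))"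
   using \<mu> unfolding moments_def by (intro Bochner_Integration.integrable_mult_right) blast
  show "continuous_on ({- R<..<R} \<times> UNIV) (\<lambda>z. gint j \<alpha> \<delta> js (fst z, \<sigma>, \<phi>) x (snd z))" for x
   unfolding gint_def prod.case by (intro continuous_intros \<delta> \<phi>)
  show "(\<lambda>x. gint j \<alpha> \<delta> js (fst z, \<sigma>, \<phi>) x (snd z)) \<in> borel_measurable \<mu>" for z
   using gint_measurable[OF \<delta> p] \<mu> by (simp add: moments_def)
  fix z x assume "z \<in> {- R<..<R} \<times> (UNIV :: (real^'a) set)"
  then have "\<bar>fst z\<bar> \<le> R" by auto
  from gint_bound[OF \<delta> p this, of "snd z" 0 j \<alpha> js x]
  show "\<bar>gint j \<alpha> \<delta> js (fst z, \<sigma>, \<phi>) x (snd z)\<bar> \<le> ?C * sn 0 (Dl js \<phi>) * (1 + norm x) ^ ((\<Sum>i\<in>UNIV. \<alpha> i) + 0)"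
   by (simp add: ac_simps)
 qed
 then have "continuous_on (\<Union>R::real. {- R<..<R} \<times> UNIV) (\<lambda>(t, y). gen \<mu> j \<alpha> \<delta> js (t, \<sigma>, \<phi>) y)"
  by (intro continuous_on_open_UN open_Times) (auto simp: gen_def case_prod_beta)
 moreover have "(\<Union>R::real. {- R<..<R} \<times> (UNIV :: (real^'a) set)) = UNIV"
 proof -
  have "z \<in> {- (\<bar>fst z\<bar> + 1)<..<\<bar>fst z\<bar> + 1} \<times> UNIV" for z :: "real \<times> (real^'a)"
   by (cases z) auto
  then have "z \<in> (\<Union>R::real. {- R<..<R} \<times> (UNIV :: (real^'a) set))" for z by (rule UN_I[OF UNIV_I])
  then show ?thesis by (intro set_eqI iffI UNIV_I)
 qed
 ultimately show ?thesis by simp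
qed

lemma pspan_gens_continuous:
 assumes p: "\<And>t. (t, \<sigma>, \<phi>) \<in> prm" and \<mu>: "moments \<mu>" and G: "G \<in> pspan (gens \<mu>)"
 shows "continuous_on UNIV (\<lambda>z. G (fst z, \<sigma>, \<phi>) (snd z))"
 using G
proof induction
 case (base G)
 then obtain j \<alpha> \<delta> js where "G = gen \<mu> j \<alpha> \<delta> js" "allpos \<delta>" unfolding gens_def by blast
 then show ?case using gen_continuous[OF _ p \<mu>] by (simp add: case_prod_beta)
qed (auto intro!: continuous_intros)

definition psn :: "nat \<Rightarrow> real \<times> (real^'n::finite \<Rightarrow> real) \<times> (real^'n \<Rightarrow> real) \<Rightarrow> real" where
 "psn M p = sn M (snd (snd p))"

lemma norm_scale_prmR: "norm_scale (prmR R) psn"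
 unfolding norm_scale_def psn_def prmR_def prm_def using sn_nonneg sn_mono by auto

lemma gens_unif_bd:
 assumes \<mu>: "moments \<mu>" and G: "G \<in> gens \<mu>" and R: "R \<ge> 0"
 shows "unif_bd (prmR R) psn G"
 unfolding unif_bd_def
proof
 fix \<beta> :: "'a \<Rightarrow> nat"
 obtain j \<alpha> \<delta> js where Ge: "G = gen \<mu> j \<alpha> \<delta> js" and \<delta>: "allpos \<delta>" using G unfolding gens_def by blast
 define N where "N = (\<Sum>i\<in>UNIV. \<beta> i)"
 define C where "C = (1 + R) ^ (j + N) * nu_mass \<delta> * (real CARD('a) + 1) ^ (N + 1)"
 define I where "I = (\<integral>x. (1 + norm x) ^ ((\<Sum>i\<in>UNIV. \<alpha> i) + N) \<partial>\<mu>)"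
 have mi: "integrable \<mu> (\<lambda>x. (1 + norm x) ^ ((\<Sum>i\<in>UNIV. \<alpha> i) + N))" using \<mu> unfolding moments_def by blast
 have C: "C \<ge> 0" "I \<ge> 0" unfolding C_def I_def using R nu_mass_pos[OF \<delta>] by auto
 obtain D M where D: "D \<ge> 0" "\<forall>\<phi>\<in>S_ev. sn N (Dl js \<phi>) \<le> D * sn M \<phi>" using cop_Dl[of js] unfolding cop_def by meson
 have "\<bar>monom \<beta> y * G p y\<bar> \<le> C * I * D * psn M p" if pR: "p \<in> prmR R" for p y
 proof (rule bounded_if_power_bound)
  fix y
  obtain t \<sigma> \<phi> where pe: "p = (t, \<sigma>, \<phi>)" by (cases p)
  have p: "(t, \<sigma>, \<phi>) \<in> prm" "\<bar>t\<bar> \<le> R" using pR by (auto simp: prmR_def pe)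
  have \<phi>: "\<phi> \<in> S_ev" using prmD p by blast
  have i: "integrable \<mu> (\<lambda>x. gint j \<alpha> \<delta> js p x y)" by (rule gint_integrable[OF \<delta> _ \<mu>]) (use p pe in simp)
  have "(1 + norm y) ^ (\<Sum>i\<in>UNIV. \<beta> i) * \<bar>G p y\<bar> = \<bar>\<integral>x. (1 + norm y) ^ N * gint j \<alpha> \<delta> js p x y \<partial>\<mu>\<bar>"
   by (simp add: Ge gen_def N_def abs_mult)
  also have "... \<le> (\<integral>x. \<bar>(1 + norm y) ^ N * gint j \<alpha> \<delta> js p x y\<bar> \<partial>\<mu>)" by (rule integral_abs_bound)
  also have "... \<le> (\<integral>x. (C * sn N (Dl js \<phi>)) * (1 + norm x) ^ ((\<Sum>i\<in>UNIV. \<alpha> i) + N) \<partial>\<mu>)"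
  proof (rule integral_mono)
   show "integrable \<mu> (\<lambda>x. \<bar>(1 + norm y) ^ N * gint j \<alpha> \<delta> js p x y\<bar>)"
    using i by (intro integrable_abs Bochner_Integration.integrable_mult_right)
   show "\<bar>(1 + norm y) ^ N * gint j \<alpha> \<delta> js p x y\<bar> \<le> (C * sn N (Dl js \<phi>)) * (1 + norm x) ^ ((\<Sum>i\<in>UNIV. \<alpha> i) + N)" for x
    using gint_bound[OF \<delta> p, of y N j \<alpha> js x] unfolding C_def pe by (simp add: abs_mult ac_simps)
  qed (use mi in simp)
  also have "... = C * I * sn N (Dl js \<phi>)" unfolding I_def by simp
  also have "... \<le> C * I * (D * sn M \<phi>)" using C D \<phi> by (intro mult_left_mono) auto
  finally show "(1 + norm y) ^ (\<Sum>i\<in>UNIV. \<beta> i) * \<bar>G p y\<bar> \<le> C * I * D * psn M p"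
   by (simp add: psn_def pe)
 qed
 then show "\<exists>C M. 0 \<le> C \<and> (\<forall>p\<in>prmR R. \<forall>y. \<bar>monom \<beta> y * G p y\<bar> \<le> C * psn M p)"
  using C D by (intro exI[of _ "C * I * D"] exI[of _ M]) auto
qed

section \<open>Averages and single translates as test functions\<close>

definition avg :: "(real^'n::finite) measure \<Rightarrow> real^'n \<Rightarrow> real \<times> (real^'n \<Rightarrow> real) \<times> (real^'n \<Rightarrow> real) \<Rightarrow> real^'n \<Rightarrow> real" where
 "avg \<mu> \<delta> p y = (\<integral>x. (fst (snd p)) x * TK \<delta> (snd (snd p)) (fst p *\<^sub>R x) y \<partial>\<mu>)"

lemma avg_gen: "avg \<mu> \<delta> p = gen \<mu> 0 (\<lambda>_. 0) \<delta> [] p"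
 by (cases p) (auto simp: avg_def gen_def gint_def monom_def fun_eq_iff)

lemma avg_in_gens:
 assumes "allpos \<delta>" shows "avg \<mu> \<delta> \<in> gens \<mu>"
proof -
 have "avg \<mu> \<delta> = gen \<mu> 0 (\<lambda>_. 0) \<delta> []" by (rule ext) (rule avg_gen)
 then show ?thesis unfolding gens_def using assms by blast
qed

lemma gen_even:
 assumes "(t, \<sigma>, \<phi>) \<in> prm" shows "even_fn (gen \<mu> j \<alpha> \<delta> js (t, \<sigma>, \<phi>))"
 by (simp add: even_fn_mirror gen_def gint_def TK_mirror[OF Dl_S_ev[OF prmD(3)[OF assms]]])

lemma prm_cong_t: "(t, \<sigma>, \<phi>) \<in> prm \<Longrightarrow> (s, \<sigma>, \<phi>) \<in> prm" by (simp add: prm_def)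

lemma gen_S_ev:
 assumes \<delta>: "allpos \<delta>" and \<mu>: "moments \<mu>" and p: "p \<in> prm"
 shows "gen \<mu> j \<alpha> \<delta> js p \<in> S_ev"
proof -
 obtain t \<sigma> \<phi> where pe: "p = (t, \<sigma>, \<phi>)" by (cases p)
 show ?thesis
 proof (rule pspan_S_ev(2)[where B="gens \<mu>" and P="prmR \<bar>t\<bar>" and \<nu>=psn])
  show "pd_closed (gens \<mu>) (prmR \<bar>t\<bar>)" by (rule pd_closed_gens[OF \<mu>]) (auto simp: prmR_def)
  show "norm_scale (prmR \<bar>t\<bar>) psn" by (rule norm_scale_prmR)
  show "unif_bd (prmR \<bar>t\<bar>) psn G" if "G \<in> gens \<mu>" for G by (rule gens_unif_bd[OF \<mu> that]) simp
  show "gen \<mu> j \<alpha> \<delta> js \<in> pspan (gens \<mu>)" by (rule pspan.base) (use \<delta> in \<open>auto simp: gens_def\<close>)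
  show "p \<in> prmR \<bar>t\<bar>" using p pe by (simp add: prmR_def)
  show "even_fn (gen \<mu> j \<alpha> \<delta> js p)" unfolding pe by (rule gen_even[OF p[unfolded pe]])
  fix G and q :: "real \<times> (real^'a \<Rightarrow> real) \<times> (real^'a \<Rightarrow> real)"
  assume G: "G \<in> gens \<mu>" and q: "q \<in> prmR \<bar>t\<bar>"
  obtain s \<tau> \<psi> where qe: "q = (s, \<tau>, \<psi>)" by (cases q)
  have "continuous_on UNIV (\<lambda>z. G (fst z, \<tau>, \<psi>) (snd z))"
   by (rule pspan_gens_continuous[OF _ \<mu> pspan.base[OF G]]) (use q prm_cong_t in \<open>auto simp: prmR_def qe\<close>)
  moreover have "continuous_on UNIV (\<lambda>y::real^'a. (s, y))" by (intro continuous_intros)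
  ultimately show "continuous_on UNIV (G q)"
   using continuous_on_compose2[of UNIV _ UNIV "\<lambda>y. (s, y)"] by (force simp: qe)
 qed
qed

lemma avg_S_ev: "allpos \<delta> \<Longrightarrow> moments \<mu> \<Longrightarrow> p \<in> prm \<Longrightarrow> avg \<mu> \<delta> p \<in> S_ev"
 unfolding avg_gen by (rule gen_S_ev)

lemma avg_bound:
 assumes \<delta>: "allpos \<delta>" and \<mu>: "moments \<mu>" and R: "R \<ge> 0"
 shows "\<exists>C M. C \<ge> 0 \<and> (\<forall>t \<sigma> \<phi>. (t, \<sigma>, \<phi>) \<in> prm \<longrightarrow> \<bar>t\<bar> \<le> R \<longrightarrow> sn N (avg \<mu> \<delta> (t, \<sigma>, \<phi>)) \<le> C * sn M \<phi>)"
proof -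
 have pc: "pd_closed (gens \<mu>) (prmR R)" by (rule pd_closed_gens[OF \<mu>]) (auto simp: prmR_def)
 have "unif_bd (prmR R) psn (\<lambda>p. pds is (avg \<mu> \<delta> p))" for "is"
 proof -
  obtain G' where G': "G' \<in> pspan (gens \<mu>)" "\<forall>p\<in>prmR R. pds is (avg \<mu> \<delta> p) = G' p"
   using pspan_pds[OF pc pspan.base[OF avg_in_gens[OF \<delta>]], of "is"] by blast
  have "unif_bd (prmR R) psn G'"
   by (rule pspan_unif_bd[OF norm_scale_prmR _ G'(1)]) (rule gens_unif_bd[OF \<mu> _ R])
  then show ?thesis unfolding unif_bd_def using G'(2) by simp
 qed
 from unif_bd_sn[OF norm_scale_prmR this, of N]
 obtain C M where "C \<ge> 0" "\<forall>p\<in>prmR R. sn N (avg \<mu> \<delta> p) \<le> C * psn M p" by blast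
 then show ?thesis by (intro exI[of _ C] exI[of _ M]) (auto simp: prmR_def psn_def)
qed

lemma avg_pds_continuous:
 assumes \<delta>: "allpos \<delta>" and \<mu>: "moments \<mu>" and p: "\<And>t. (t, \<sigma>, \<phi>) \<in> prm"
 shows "continuous_on UNIV (\<lambda>z. pds is (avg \<mu> \<delta> (fst z, \<sigma>, \<phi>)) (snd z))"
proof -
 obtain G' where G': "G' \<in> pspan (gens \<mu>)" "\<forall>p\<in>prm. pds is (avg \<mu> \<delta> p) = G' p"
  using pspan_pds[OF pd_closed_gens[OF \<mu> order_refl] pspan.base[OF avg_in_gens[OF \<delta>]], of "is"] by blast
 show ?thesis using pspan_gens_continuous[OF p \<mu> G'(1)] G'(2) p by simp
qed

lemma avg_integrable:
 assumes \<delta>: "allpos \<delta>" and \<mu>: "moments \<mu>" and p: "(t, \<sigma>, \<phi>) \<in> prm"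
 shows "integrable \<mu> (\<lambda>x. \<sigma> x * TK \<delta> \<phi> (t *\<^sub>R x) y)"
 using gint_integrable[OF \<delta> p \<mu>, of 0 "\<lambda>_. 0" "[]" y] by (simp add: gint_def monom_def)

lemma TK_S_ev:
 assumes \<delta>: "allpos \<delta>" and \<phi>: "\<phi> \<in> S_ev"
 shows "TK \<delta> \<phi> x \<in> S_ev" "(\<lambda>y. TK \<delta> \<phi> y x) \<in> S_ev"
proof -
 \<comment> \<open>A point mass at x: the average then is the kernel itself.\<close>
 let ?r = "distr (count_space {()}) borel (\<lambda>_. x)"
 have m: "moments ?r"
  unfolding moments_def
 proof (intro conjI allI)
  show "integrable ?r (\<lambda>x. (1 + norm x) ^ N)" for N
   by (subst integrable_distr_eq) (auto simp: integrable_count_space)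
 qed simp
 have p: "(1, \<lambda>_. 1, \<phi>) \<in> prm" using \<phi> by (simp add: prm_def)
 have "(\<lambda>u. TK \<delta> \<phi> u y) \<in> borel_measurable borel" for y
  by (intro borel_measurable_continuous_onI continuous_intros \<delta> \<phi>)
 then have "avg ?r \<delta> (1, \<lambda>_. 1, \<phi>) = TK \<delta> \<phi> x"
  by (auto simp: avg_def fun_eq_iff integral_distr lebesgue_integral_count_space_finite)
 then show *: "TK \<delta> \<phi> x \<in> S_ev" using avg_S_ev[OF \<delta> m p] by simp
 then show "(\<lambda>y. TK \<delta> \<phi> y x) \<in> S_ev" by (simp add: TK_commute[of \<delta> \<phi> _ x])
qed

subsection \<open>The Bessel Laplacian commutes with translation\<close>

lemma Dq_TK:
 assumes \<delta>: "allpos \<delta>" and \<phi>: "\<phi> \<in> S_ev"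
 shows "Dq i (TK \<delta> \<phi> x) = (\<lambda>y. TK \<delta> (Dq i \<phi>) x y + (x$i)\<^sup>2 / \<delta>$i * TK (\<delta> + ax i 2) (Dq i (Dq i \<phi>)) x y)"
proof (rule Dq_unique[OF has_pd_TK[OF \<delta> \<phi>]])
 show "has_pd i (\<lambda>y. TK \<delta> (Dq i \<phi>) x y + (x$i)\<^sup>2 / \<delta>$i * TK (\<delta> + ax i 2) (Dq i (Dq i \<phi>)) x y)
  (\<lambda>y. y$i * (TK \<delta> (Dq i (Dq i \<phi>)) x y + (x$i)\<^sup>2 / \<delta>$i * TK (\<delta> + ax i 2) (Dq i (Dq i (Dq i \<phi>))) x y)
   + (x$i)\<^sup>2 / \<delta>$i * (y$i * (TK (\<delta> + ax i 2) (Dq i (Dq i (Dq i \<phi>))) x y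
    + (x$i)\<^sup>2 / (\<delta> + ax i 2)$i * TK (\<delta> + ax i 2 + ax i 2) (Dq i (Dq i (Dq i (Dq i \<phi>)))) x y)))"
  using has_pd_lin[OF has_pd_TK[OF \<delta> Dq_S_ev[OF \<phi>, of i], where i=i and x=x]
   has_pd_TK[OF shift_exponent_pos[OF \<delta>, of i] Dq_S_ev[OF Dq_S_ev[OF \<phi>, of i], of i], where i=i and x=x],
   where a=1 and b="(x$i)\<^sup>2 / \<delta>$i"]
  by simp
qed

lemma integrable_cos_TK:
 assumes \<delta>: "allpos \<delta>" and \<phi>: "\<phi> \<in> S_ev"
 shows "integrable (nu \<delta>) (\<lambda>a. cos (a$i) * \<phi> (gdist x y a))"
proof (rule integrable_nu[OF \<delta>, where B="sn 0 \<phi>"])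
 show "(\<lambda>a. cos (a$i) * \<phi> (gdist x y a)) \<in> borel_measurable borel"
  using S_ev_gdist_measurable[OF \<phi>] by measurable
 show "\<bar>cos (a$i) * \<phi> (gdist x y a)\<bar> \<le> sn 0 \<phi>" for a
  using mult_mono[OF abs_cos_le_one[of "a$i"] S_ev_bounded[OF \<phi>, of "gdist x y a"]] by (simp add: abs_mult)
qed

text \<open>Split 1 = sin^2 + cos^2. The sine part is the kernel with raised exponent, and the
  cosine part is integrated by parts twice. The identity compares kernels with different exponents,
  which the Laplacian of a translate mixes.\<close>

lemma TK_raise_exponent:
 assumes \<delta>: "allpos \<delta>" and \<phi>: "\<phi> \<in> S_ev"
 shows "TK \<delta> \<phi> x y = (1 + 1 / \<delta>$i) * TK (\<delta> + ax i 2) \<phi> x y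
  + (x$i * y$i)\<^sup>2 / (\<delta>$i * (\<delta>$i + 2)) * TK (\<delta> + ax i 2 + ax i 2) (Dq i (Dq i \<phi>)) x y"
proof -
 let ?\<delta>' = "\<delta> + ax i 2"
 let ?\<psi> = "\<lambda>a. \<phi> (gdist x y a)" and ?D = "\<lambda>a. Dq i \<phi> (gdist x y a)"
 have D: "Dq i \<phi> \<in> S_ev" using Dq_S_ev \<phi> by blast
 have m[measurable]: "?\<psi> \<in> borel_measurable borel" "?D \<in> borel_measurable borel"
  using S_ev_gdist_measurable \<phi> D by blast+
 define f where "f = (\<lambda>a::real^'a. - sin (a$i) * ?\<psi> a + cos (a$i) * (x$i * y$i * sin (a$i) * ?D a))"
 have n: "0 \<le> sn 0 \<phi>" "0 \<le> sn 0 (Dq i \<phi>)" using sn_nonneg \<phi> D by blast+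
 define B where "B = sn 0 \<phi> + \<bar>x$i * y$i\<bar> * sn 0 (Dq i \<phi>)"
 have b1: "\<bar>u * ?\<psi> a\<bar> \<le> sn 0 \<phi>" "\<bar>u * ?D a\<bar> \<le> sn 0 (Dq i \<phi>)" if "\<bar>u\<bar> \<le> 1" for u a
  using mult_mono[OF that S_ev_bounded[OF \<phi>, of "gdist x y a"]] mult_mono[OF that S_ev_bounded[OF D, of "gdist x y a"]]
  by (simp_all add: abs_mult)
 have cs: "\<bar>cos (a$i) * sin (a$i)\<bar> \<le> 1" for a :: "real^'a"
  using mult_mono[OF abs_cos_le_one[of "a$i"] abs_sin_le_one[of "a$i"]] by (simp add: abs_mult)
 have c: "continuous_on UNIV \<phi>" "continuous_on UNIV (Dq i \<phi>)" using S_ev_continuous \<phi> D by blast+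
 have 1: "\<delta>$i * (\<integral>a. cos (a$i) * (cos (a$i) * ?\<psi> a) \<partial>nu \<delta>) = - (\<integral>a. sin (a$i) * f a \<partial>nu \<delta>)"
 proof (rule nu_ibp[OF \<delta>])
  show "continuous_on UNIV (\<lambda>a. cos (a$i) * ?\<psi> a)"
   by (intro continuous_intros continuous_on_compose2[OF c(1)]) auto
  show "continuous_on UNIV f" unfolding f_def
   by (intro continuous_intros continuous_on_compose2[OF c(1)] continuous_on_compose2[OF c(2)]) auto
  show "\<bar>cos (a$i) * ?\<psi> a\<bar> \<le> B" for a
   using b1(1)[of "cos (a$i)" a] n unfolding B_def by (smt (verit) abs_cos_le_one mult_nonneg_nonneg abs_ge_zero)
  show "\<bar>f a\<bar> \<le> B" for a
  proof -
   have "f a = (- sin (a$i)) * ?\<psi> a + (x$i * y$i) * ((cos (a$i) * sin (a$i)) * ?D a)"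
    by (simp add: f_def)
   then have "\<bar>f a\<bar> \<le> \<bar>(- sin (a$i)) * ?\<psi> a\<bar> + \<bar>x$i * y$i\<bar> * \<bar>(cos (a$i) * sin (a$i)) * ?D a\<bar>"
    by (metis abs_mult abs_triangle_ineq)
   also have "... \<le> B" unfolding B_def
    by (intro add_mono mult_left_mono b1 cs) auto
   finally show ?thesis .
  qed
  have "has_pd i (\<lambda>a::real^'a. cos (a$i)) (\<lambda>a. - sin (a$i))"
   unfolding has_pd_def by (auto intro!: derivative_eq_intros)
  from has_pd_mult[OF this has_pd_gdist_a[OF \<phi>, of i x y]]
  show "has_pd i (\<lambda>a. cos (a$i) * ?\<psi> a) f" unfolding f_def .
 qed
 have sin_int: "integrable (nu \<delta>) (\<lambda>a. (sin (a$i))\<^sup>2 * ?\<psi> a)"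
  by (rule integrable_nu[OF \<delta>, where B="sn 0 \<phi>"]) (measurable, rule b1(1), simp add: abs_square_le_1)
 have cos_int: "integrable (nu \<delta>) (\<lambda>a. cos (a$i) * (cos (a$i) * ?\<psi> a))"
 proof (rule integrable_nu[OF \<delta>, where B="sn 0 \<phi>"])
  show "\<bar>cos (a$i) * (cos (a$i) * ?\<psi> a)\<bar> \<le> sn 0 \<phi>" for a
   using b1(1)[of "cos (a$i) * cos (a$i)" a] mult_mono[OF abs_cos_le_one[of "a$i"] abs_cos_le_one[of "a$i"]]
   by (simp add: abs_mult mult.assoc)
 qed measurable
 have D_int: "integrable (nu \<delta>) (\<lambda>a. (sin (a$i))\<^sup>2 * (cos (a$i) * ?D a))"
 proof (rule integrable_nu[OF \<delta>, where B="sn 0 (Dq i \<phi>)"])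
  show "\<bar>(sin (a$i))\<^sup>2 * (cos (a$i) * ?D a)\<bar> \<le> sn 0 (Dq i \<phi>)" for a
   using b1(2)[of "(sin (a$i))\<^sup>2 * cos (a$i)" a] mult_mono[of "\<bar>(sin (a$i))\<^sup>2\<bar>" 1 "\<bar>cos (a$i)\<bar>" 1]
   by (simp add: abs_mult mult.assoc abs_square_le_1)
 qed measurable
 have 2: "(\<integral>a. sin (a$i) * f a \<partial>nu \<delta>) = - TK ?\<delta>' \<phi> x y + x$i * y$i * (\<integral>a. cos (a$i) * ?D a \<partial>nu ?\<delta>')"
 proof -
  have "(\<integral>a. sin (a$i) * f a \<partial>nu \<delta>) = (\<integral>a. x$i * y$i * ((sin (a$i))\<^sup>2 * (cos (a$i) * ?D a)) - (sin (a$i))\<^sup>2 * ?\<psi> a \<partial>nu \<delta>)"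
   by (simp add: f_def power2_eq_square algebra_simps)
  also have "... = x$i * y$i * (\<integral>a. (sin (a$i))\<^sup>2 * (cos (a$i) * ?D a) \<partial>nu \<delta>) - (\<integral>a. (sin (a$i))\<^sup>2 * ?\<psi> a \<partial>nu \<delta>)"
   using D_int sin_int by simp
  also have "(\<integral>a. (sin (a$i))\<^sup>2 * (cos (a$i) * ?D a) \<partial>nu \<delta>) = (\<integral>a. cos (a$i) * ?D a \<partial>nu ?\<delta>')"
   by (rule nu_sin_squared) measurable
  also have "(\<integral>a. (sin (a$i))\<^sup>2 * ?\<psi> a \<partial>nu \<delta>) = TK ?\<delta>' \<phi> x y"
   unfolding TK_def by (rule nu_sin_squared) measurable
  finally show ?thesis by simp
 qed
 have 3: "TK \<delta> \<phi> x y = TK ?\<delta>' \<phi> x y + (\<integral>a. cos (a$i) * (cos (a$i) * ?\<psi> a) \<partial>nu \<delta>)"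
 proof -
  have "TK \<delta> \<phi> x y = (\<integral>a. (sin (a$i))\<^sup>2 * ?\<psi> a + cos (a$i) * (cos (a$i) * ?\<psi> a) \<partial>nu \<delta>)"
  proof -
   have "?\<psi> a = (sin (a$i))\<^sup>2 * ?\<psi> a + cos (a$i) * (cos (a$i) * ?\<psi> a)" for a
    using sin_cos_squared_add[of "a$i"] by (metis distrib_right mult.assoc mult_1 power2_eq_square)
   then show ?thesis unfolding TK_def by simp
  qed
  also have "... = (\<integral>a. (sin (a$i))\<^sup>2 * ?\<psi> a \<partial>nu \<delta>) + (\<integral>a. cos (a$i) * (cos (a$i) * ?\<psi> a) \<partial>nu \<delta>)"
   using sin_int cos_int by simp
  also have "(\<integral>a. (sin (a$i))\<^sup>2 * ?\<psi> a \<partial>nu \<delta>) = TK ?\<delta>' \<phi> x y"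
   unfolding TK_def by (rule nu_sin_squared) measurable
  finally show ?thesis .
 qed
 have 4: "(\<integral>a. cos (a$i) * ?D a \<partial>nu ?\<delta>') = - (x$i * y$i / (\<delta>$i + 2)) * TK (?\<delta>' + ax i 2) (Dq i (Dq i \<phi>)) x y"
  using TK_ibp[OF shift_exponent_pos[OF \<delta>, of i] D, where i=i and x=x and y=y] by simp
 have d: "\<delta>$i > 0" using \<delta> by blast
 from 1 have "(\<integral>a. cos (a$i) * (cos (a$i) * ?\<psi> a) \<partial>nu \<delta>) = - (\<integral>a. sin (a$i) * f a \<partial>nu \<delta>) / \<delta>$i"
  using d by (simp add: field_simps)
 moreover have "P + - (- P + u * (- (u / e) * Q)) / d = (1 + 1 / d) * P + u\<^sup>2 / (d * e) * Q"
  if "d > 0" "e > 0" for P Q u d e :: real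
  using that by (simp add: field_simps power2_eq_square)
 ultimately show ?thesis unfolding 3 2 4 using d by simp
qed

text \<open>By the law of cosines the squared coordinate in the Laplacian at
  \<open>gdist x y a\<close> is x_i^2 + y_i^2 - 2 x_i y_i cos(a_i). Both sides are then expanded
  direction by direction in kernels with exponents \<delta>_i, \<delta>_i + 2 and \<delta>_i + 4;
  only the x_i^2 term has to be raised.\<close>

lemma TK_bessel_lap:
 assumes \<delta>: "allpos \<delta>" and \<phi>: "\<phi> \<in> S_ev"
 shows "bessel_lap \<delta> (TK \<delta> \<phi> x) y = TK \<delta> (bessel_lap \<delta> \<phi>) x y"
proof -
 \<comment> \<open>Here d = \<delta>_i, e = d + 2, X = x_i, Y = y_i. A and B are the kernels of the
   first and second power of \<open>Dq i\<close> at exponent d; P and R those of the second and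
   third at d + 2; Q that of the fourth at d + 4.\<close>
 have alg: "(1 + d) * A + X\<^sup>2 * ((1 + 1 / d) * P + (X * Y)\<^sup>2 / (d * e) * Q) + Y\<^sup>2 * B + 2 * X\<^sup>2 * Y\<^sup>2 / d * R
   = (1 + d) * (A + X\<^sup>2 / d * P) + Y\<^sup>2 * (B + 2 * X\<^sup>2 / d * R + X\<^sup>2 / d * (X\<^sup>2 / e) * Q)"
  if "d > 0" "e > 0" for A B P Q R X Y d e :: real
  using that by (simp add: field_simps power2_eq_square)
 have D1: "Dq i \<phi> \<in> S_ev" and D2: "Dq i (Dq i \<phi>) \<in> S_ev" for i using Dq_S_ev \<phi> by blast+
 define E where "E = (\<lambda>i a. (1 + \<delta>$i) * Dq i \<phi> (gdist x y a) +
   (((x$i)\<^sup>2 + (y$i)\<^sup>2) * Dq i (Dq i \<phi>) (gdist x y a) - 2 * x$i * y$i * (cos (a$i) * Dq i (Dq i \<phi>) (gdist x y a))))"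
 have Ei: "integrable (nu \<delta>) (E i)" for i
  unfolding E_def by (intro Bochner_Integration.integrable_add Bochner_Integration.integrable_diff
    Bochner_Integration.integrable_mult_right integrable_TK integrable_cos_TK \<delta> D1 D2)
 have "bessel_lap \<delta> \<phi> (gdist x y a) = (\<Sum>i\<in>UNIV. E i a)" for a
  unfolding bessel_lap_eq[OF \<phi>] E_def
 proof (rule sum.cong)
  fix i
  have g2: "(gdist x y a $ i)\<^sup>2 = (x$i)\<^sup>2 + (y$i)\<^sup>2 - 2 * x$i * y$i * cos (a$i)"
   using cos_law_nonneg[of "x$i" "y$i" "a$i"] by (simp add: gdist_def)
  show "(1 + \<delta>$i) * Dq i \<phi> (gdist x y a) + (gdist x y a $ i)\<^sup>2 * Dq i (Dq i \<phi>) (gdist x y a) =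
   (1 + \<delta>$i) * Dq i \<phi> (gdist x y a) + (((x$i)\<^sup>2 + (y$i)\<^sup>2) * Dq i (Dq i \<phi>) (gdist x y a)
    - 2 * x$i * y$i * (cos (a$i) * Dq i (Dq i \<phi>) (gdist x y a)))"
   unfolding g2 by (simp add: algebra_simps)
 qed simp
 then have "TK \<delta> (bessel_lap \<delta> \<phi>) x y = (\<Sum>i\<in>UNIV. \<integral>a. E i a \<partial>nu \<delta>)"
  unfolding TK_def using Ei by simp
 also have "... = bessel_lap \<delta> (TK \<delta> \<phi> x) y"
  unfolding bessel_lap_eq[OF TK_S_ev(1)[OF \<delta> \<phi>]]
 proof (rule sum.cong)
  fix i
  let ?\<delta>' = "\<delta> + ax i 2"
  let ?\<delta>'' = "\<delta> + ax i 2 + ax i 2"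
  note \<delta>' = shift_exponent_pos[OF \<delta>, of i]
  have d: "\<delta>$i > 0" using \<delta> by blast
  have A: "Dq i (TK \<delta> \<phi> x) = (\<lambda>y. 1 * TK \<delta> (Dq i \<phi>) x y + (x$i)\<^sup>2 / \<delta>$i * TK ?\<delta>' (Dq i (Dq i \<phi>)) x y)"
   using Dq_TK[OF \<delta> \<phi>] by simp
  have B: "Dq i (Dq i (TK \<delta> \<phi> x)) y = TK \<delta> (Dq i (Dq i \<phi>)) x y + 2 * (x$i)\<^sup>2 / \<delta>$i * TK ?\<delta>' (Dq i (Dq i (Dq i \<phi>))) x y
    + (x$i)\<^sup>2 / \<delta>$i * ((x$i)\<^sup>2 / (\<delta>$i + 2)) * TK ?\<delta>'' (Dq i (Dq i (Dq i (Dq i \<phi>)))) x y"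
   unfolding A Dq_lin[OF TK_S_ev(1)[OF \<delta> D1] TK_S_ev(1)[OF \<delta>' D2]] Dq_TK[OF \<delta> D1] Dq_TK[OF \<delta>' D2]
   by (simp add: algebra_simps)
  have "(\<integral>a. E i a \<partial>nu \<delta>) = (1 + \<delta>$i) * TK \<delta> (Dq i \<phi>) x y + (((x$i)\<^sup>2 + (y$i)\<^sup>2) * TK \<delta> (Dq i (Dq i \<phi>)) x y
    - 2 * x$i * y$i * (\<integral>a. cos (a$i) * Dq i (Dq i \<phi>) (gdist x y a) \<partial>nu \<delta>))"
   unfolding E_def TK_def using integrable_TK[OF \<delta> D1] integrable_TK[OF \<delta> D2] integrable_cos_TK[OF \<delta> D2] by simp
  also have "... = (1 + \<delta>$i) * TK \<delta> (Dq i \<phi>) x y + (x$i)\<^sup>2 * TK \<delta> (Dq i (Dq i \<phi>)) x y + (y$i)\<^sup>2 * TK \<delta> (Dq i (Dq i \<phi>)) x y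
    + 2 * (x$i)\<^sup>2 * (y$i)\<^sup>2 / \<delta>$i * TK ?\<delta>' (Dq i (Dq i (Dq i \<phi>))) x y"
   unfolding TK_ibp[OF \<delta> D2] by (simp add: algebra_simps power2_eq_square)
  also have "(x$i)\<^sup>2 * TK \<delta> (Dq i (Dq i \<phi>)) x y = (x$i)\<^sup>2 * ((1 + 1 / \<delta>$i) * TK ?\<delta>' (Dq i (Dq i \<phi>)) x y
  + (x$i * y$i)\<^sup>2 / (\<delta>$i * (\<delta>$i + 2)) * TK ?\<delta>'' (Dq i (Dq i (Dq i (Dq i \<phi>)))) x y)"
   using TK_raise_exponent[OF \<delta> D2[of i], where i=i and x=x and y=y] by simp
  finally show "(\<integral>a. E i a \<partial>nu \<delta>) = (1 + \<delta>$i) * Dq i (TK \<delta> \<phi> x) y + (y$i)\<^sup>2 * Dq i (Dq i (TK \<delta> \<phi> x)) y"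
   unfolding B unfolding A mult_1 by (rule trans) (rule alg, use d in auto)
 qed simp
 finally show ?thesis by simp
qed

lemma TK_bessel_lap':
 assumes \<delta>: "allpos \<delta>" and \<phi>: "\<phi> \<in> S_ev"
 shows "bessel_lap \<delta> (\<lambda>x. TK \<delta> \<phi> x y) x = TK \<delta> (bessel_lap \<delta> \<phi>) x y"
 using TK_bessel_lap[OF assms, of y x] by (simp add: TK_commute[of _ _ _ y])

lemma Dq_gen:
 assumes \<delta>: "allpos \<delta>" and p: "p \<in> prm" and \<mu>: "moments \<mu>"
 shows "Dq i (gen \<mu> j \<alpha> \<delta> js p) = (\<lambda>y. gen \<mu> j \<alpha> \<delta> (i # js) p y +
   1 / \<delta>$i * gen \<mu> (j + 2) (up2 i \<alpha>) (\<delta> + ax i 2) (i # i # js) p y)"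
proof (rule Dq_unique[OF has_pd_gen[OF assms]])
 let ?\<delta>' = "\<delta> + ax i 2"
 show "has_pd i (\<lambda>y. gen \<mu> j \<alpha> \<delta> (i # js) p y + 1 / \<delta>$i * gen \<mu> (j + 2) (up2 i \<alpha>) ?\<delta>' (i # i # js) p y)
  (\<lambda>y. 1 * (y$i * (gen \<mu> j \<alpha> \<delta> (i # i # js) p y +
   1 / \<delta>$i * gen \<mu> (j + 2) (up2 i \<alpha>) ?\<delta>' (i # i # i # js) p y)) + 1 / \<delta>$i *
   (y$i * (gen \<mu> (j + 2) (up2 i \<alpha>) ?\<delta>' (i # i # i # js) p y +
   1 / ?\<delta>'$i * gen \<mu> (j + 2 + 2) (up2 i (up2 i \<alpha>)) (?\<delta>' + ax i 2) (i # i # i # i # js) p y)))"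
  using has_pd_lin[OF has_pd_gen[OF \<delta> p \<mu>, where i=i and j=j and \<alpha>=\<alpha> and js="i # js"] has_pd_gen[OF shift_exponent_pos[OF \<delta>, of i] p \<mu>, where i=i and j="j + 2" and \<alpha>="up2 i \<alpha>" and js="i # i # js"], where a=1 and b="1 / \<delta>$i"]
  by simp
qed

text \<open>The first two applications of \<open>Dq\<close> to an average are known explicitly, and
  their integrands are those of the single translates; so the Laplacian passes under the integral,
  where it commutes with translation.\<close>

lemma avg_bessel_lap:
 assumes \<delta>: "allpos \<delta>" and \<mu>: "moments \<mu>" and p: "(t, \<sigma>, \<phi>) \<in> prm"
 shows "bessel_lap \<delta> (avg \<mu> \<delta> (t, \<sigma>, \<phi>)) y = avg \<mu> \<delta> (t, \<sigma>, bessel_lap \<delta> \<phi>) y"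
proof -
 let ?p = "(t, \<sigma>, \<phi>)"
 have \<phi>: "\<phi> \<in> S_ev" using prmD p by blast
 have K: "TK \<delta> \<phi> x \<in> S_ev" for x by (rule TK_S_ev(1)[OF \<delta> \<phi>])
 have i1: "integrable \<mu> (\<lambda>x. \<sigma> x * Dq i (TK \<delta> \<phi> (t *\<^sub>R x)) y)"
  and e1: "Dq i (avg \<mu> \<delta> ?p) y = (\<integral>x. \<sigma> x * Dq i (TK \<delta> \<phi> (t *\<^sub>R x)) y \<partial>\<mu>)"
  and i2: "integrable \<mu> (\<lambda>x. \<sigma> x * Dq i (Dq i (TK \<delta> \<phi> (t *\<^sub>R x))) y)"
  and e2: "Dq i (Dq i (avg \<mu> \<delta> ?p)) y = (\<integral>x. \<sigma> x * Dq i (Dq i (TK \<delta> \<phi> (t *\<^sub>R x))) y \<partial>\<mu>)" for i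
 proof -
  let ?\<delta>' = "\<delta> + ax i 2"
  let ?\<delta>'' = "\<delta> + ax i 2 + ax i 2"
  let ?z = "\<lambda>_::'a. 0::nat"
  note \<delta>' = shift_exponent_pos[OF \<delta>, of i] and \<delta>'' = shift_exponent_pos[OF shift_exponent_pos[OF \<delta>, of i], of i]
  have D1: "Dq i \<phi> \<in> S_ev" and D2: "Dq i (Dq i \<phi>) \<in> S_ev" using Dq_S_ev \<phi> by blast+
  define g0 where "g0 = gen \<mu> 0 ?z \<delta> [] ?p"
  define g1 where "g1 = gen \<mu> 0 ?z \<delta> [i] ?p"
  define g2 where "g2 = gen \<mu> 2 (up2 i ?z) ?\<delta>' [i,i] ?p"
  have A: "Dq i (avg \<mu> \<delta> ?p) = (\<lambda>y. 1 * g1 y + 1 / \<delta>$i * g2 y)"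
   unfolding avg_gen Dq_gen[OF \<delta> p \<mu>] g1_def g2_def by (simp add: numeral_2_eq_2)
  have D1g: "Dq i g1 = (\<lambda>y. gen \<mu> 0 ?z \<delta> [i,i] ?p y + 1 / \<delta>$i * gen \<mu> 2 (up2 i ?z) ?\<delta>' [i,i,i] ?p y)"
   using Dq_gen[OF \<delta> p \<mu>, where i=i and j=0 and \<alpha>="?z" and js="[i]"] unfolding g1_def by (simp add: numeral_2_eq_2)
  have D2g: "Dq i g2 = (\<lambda>y. gen \<mu> 2 (up2 i ?z) ?\<delta>' [i,i,i] ?p y + 1 / ?\<delta>'$i * gen \<mu> 4 (up2 i (up2 i ?z)) ?\<delta>'' [i,i,i,i] ?p y)"
   using Dq_gen[OF \<delta>' p \<mu>, where i=i and j=2 and \<alpha>="up2 i ?z" and js="[i,i]"] unfolding g2_def by simp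
  have "g1 \<in> S_ev" "g2 \<in> S_ev" unfolding g1_def g2_def by (rule gen_S_ev[OF \<delta> \<mu> p] gen_S_ev[OF \<delta>' \<mu> p])+
  then have B: "Dq i (Dq i (avg \<mu> \<delta> ?p)) = (\<lambda>y. 1 * Dq i g1 y + 1 / \<delta>$i * Dq i g2 y)"
   unfolding A by (rule Dq_lin)
  have I: "integrable \<mu> (\<lambda>x. gint j \<alpha> \<delta> js ?p x y)" "integrable \<mu> (\<lambda>x. gint j \<alpha> ?\<delta>' js ?p x y)"
   "integrable \<mu> (\<lambda>x. gint j \<alpha> ?\<delta>'' js ?p x y)" for j \<alpha> js
   by (rule gint_integrable[OF _ p \<mu>], fact)+
  have f1: "\<sigma> x * Dq i (TK \<delta> \<phi> (t *\<^sub>R x)) y = 1 * gint 0 ?z \<delta> [i] ?p x y + 1 / \<delta>$i * gint 2 (up2 i ?z) ?\<delta>' [i,i] ?p x y" for x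
   unfolding Dq_TK[OF \<delta> \<phi>] gint_def prod.case monom_up2 by (simp add: monom_def power2_eq_square algebra_simps)
  have "Dq i (Dq i (TK \<delta> \<phi> x)) y = TK \<delta> (Dq i (Dq i \<phi>)) x y + 2 * (x$i)\<^sup>2 / \<delta>$i * TK ?\<delta>' (Dq i (Dq i (Dq i \<phi>))) x y
    + (x$i)\<^sup>2 / \<delta>$i * ((x$i)\<^sup>2 / (\<delta>$i + 2)) * TK ?\<delta>'' (Dq i (Dq i (Dq i (Dq i \<phi>)))) x y" for x
  proof -
   have A: "Dq i (TK \<delta> \<phi> x) = (\<lambda>y. 1 * TK \<delta> (Dq i \<phi>) x y + (x$i)\<^sup>2 / \<delta>$i * TK ?\<delta>' (Dq i (Dq i \<phi>)) x y)"
    using Dq_TK[OF \<delta> \<phi>] by simp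
   show ?thesis
    unfolding A Dq_lin[OF TK_S_ev(1)[OF \<delta> D1] TK_S_ev(1)[OF \<delta>' D2]] Dq_TK[OF \<delta> D1] Dq_TK[OF \<delta>' D2]
    by (simp add: algebra_simps)
  qed
  then have f2: "\<sigma> x * Dq i (Dq i (TK \<delta> \<phi> (t *\<^sub>R x))) y = 1 * (gint 0 ?z \<delta> [i,i] ?p x y + 1 / \<delta>$i * gint 2 (up2 i ?z) ?\<delta>' [i,i,i] ?p x y)
    + 1 / \<delta>$i * (gint 2 (up2 i ?z) ?\<delta>' [i,i,i] ?p x y + 1 / ?\<delta>'$i * gint 4 (up2 i (up2 i ?z)) ?\<delta>'' [i,i,i,i] ?p x y)" for x
   unfolding gint_def prod.case monom_up2
   by (simp add: monom_def power2_eq_square power4_eq_xxxx algebra_simps)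
  show "integrable \<mu> (\<lambda>x. \<sigma> x * Dq i (TK \<delta> \<phi> (t *\<^sub>R x)) y)" unfolding f1
   by (intro Bochner_Integration.integrable_add Bochner_Integration.integrable_mult_right I)
  show "integrable \<mu> (\<lambda>x. \<sigma> x * Dq i (Dq i (TK \<delta> \<phi> (t *\<^sub>R x))) y)" unfolding f2
   by (intro Bochner_Integration.integrable_add Bochner_Integration.integrable_mult_right I)
  show "Dq i (avg \<mu> \<delta> ?p) y = (\<integral>x. \<sigma> x * Dq i (TK \<delta> \<phi> (t *\<^sub>R x)) y \<partial>\<mu>)"
   unfolding f1 A g1_def g2_def gen_def using I by simp
  show "Dq i (Dq i (avg \<mu> \<delta> ?p)) y = (\<integral>x. \<sigma> x * Dq i (Dq i (TK \<delta> \<phi> (t *\<^sub>R x))) y \<partial>\<mu>)"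
   unfolding f2 B D1g D2g gen_def using I by simp
 qed
 have "bessel_lap \<delta> (avg \<mu> \<delta> ?p) y = (\<Sum>i\<in>UNIV. \<integral>x. (1 + \<delta>$i) * (\<sigma> x * Dq i (TK \<delta> \<phi> (t *\<^sub>R x)) y)
   + (y$i)\<^sup>2 * (\<sigma> x * Dq i (Dq i (TK \<delta> \<phi> (t *\<^sub>R x))) y) \<partial>\<mu>)"
  unfolding bessel_lap_eq[OF avg_S_ev[OF \<delta> \<mu> p]] e1 e2 using i1 i2 by simp
 also have "... = (\<integral>x. (\<Sum>i\<in>UNIV. (1 + \<delta>$i) * (\<sigma> x * Dq i (TK \<delta> \<phi> (t *\<^sub>R x)) y)
   + (y$i)\<^sup>2 * (\<sigma> x * Dq i (Dq i (TK \<delta> \<phi> (t *\<^sub>R x))) y)) \<partial>\<mu>)"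
  using i1 i2 by (intro Bochner_Integration.integral_sum[symmetric]) auto
 also have "... = (\<integral>x. \<sigma> x * bessel_lap \<delta> (TK \<delta> \<phi> (t *\<^sub>R x)) y \<partial>\<mu>)"
  unfolding bessel_lap_eq[OF K] by (simp add: sum_distrib_left algebra_simps)
 also have "... = avg \<mu> \<delta> (t, \<sigma>, bessel_lap \<delta> \<phi>) y"
  unfolding avg_def by (simp add: TK_bessel_lap[OF \<delta> \<phi>])
 finally show ?thesis .
qed

subsection \<open>The weight on the orthant\<close>

definition ow :: "real^'n::finite \<Rightarrow> real^'n \<Rightarrow> real" where
 "ow \<gamma> x = indicator orth x * wgt \<gamma> x"

text \<open>The degree of homogeneity of the measure x^\<gamma> dx; it plays the part of the
  dimension.\<close>

definition hdim :: "real^'n::finite \<Rightarrow> real" where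
 "hdim \<gamma> = real CARD('n) + (\<Sum>i\<in>UNIV. \<gamma>$i)"

lemma ow_nonneg: "0 \<le> ow \<gamma> x"
 by (simp add: ow_def wgt_def prod_nonneg)

lemma wgt_measurable [measurable]: "wgt \<gamma> \<in> borel_measurable borel"
 unfolding wgt_def[abs_def] by measurable

lemma ow_measurable [measurable]: "ow \<gamma> \<in> borel_measurable borel"
 unfolding ow_def[abs_def] by measurable

lemma ow_prod: "ow \<gamma> x = (\<Prod>i\<in>UNIV. indicator {0<..} (x$i) * (x$i) powr (\<gamma>$i))"
proof (cases "x \<in> orth")
 case True
 then have "indicator {0<..} (x$i) = (1::real)" for i by (simp add: orth_def)
 then show ?thesis using True by (simp add: ow_def wgt_def)
next
 case False
 then obtain i where "\<not> 0 < x$i" by (auto simp: orth_def)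
 then have "(\<Prod>i\<in>UNIV. indicator {0<..} (x$i) * (x$i) powr (\<gamma>$i)) = 0"
  by (intro prod_zero) (auto intro!: exI[of _ i])
 then show ?thesis using False by (simp add: ow_def)
qed

lemma orth_scaleR: "c > 0 \<Longrightarrow> c *\<^sub>R x \<in> orth \<longleftrightarrow> x \<in> orth"
 by (simp add: orth_def zero_less_mult_iff)

lemma ow_scaleR:
 assumes "c > 0"
 shows "ow \<gamma> (c *\<^sub>R x) = c powr (\<Sum>i\<in>UNIV. \<gamma>$i) * ow \<gamma> x"
proof (cases "x \<in> orth")
 case True
 then have "wgt \<gamma> (c *\<^sub>R x) = (\<Prod>i\<in>UNIV. c powr (\<gamma>$i) * (x$i) powr (\<gamma>$i))"
  unfolding wgt_def using assms by (intro prod.cong) (auto simp: orth_def powr_mult less_imp_le)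
 also have "... = c powr (\<Sum>i\<in>UNIV. \<gamma>$i) * wgt \<gamma> x"
  using assms by (simp add: prod.distrib wgt_def powr_sum)
 finally show ?thesis using True assms by (simp add: ow_def orth_scaleR)
qed (use assms in \<open>simp add: ow_def orth_scaleR\<close>)

lemma ow_bound:
 assumes "allpos \<gamma>"
 shows "ow \<gamma> x \<le> (1 + norm x) ^ nat \<lceil>\<Sum>i\<in>UNIV. \<gamma>$i\<rceil>"
proof (cases "x \<in> orth")
 case True
 have "wgt \<gamma> x \<le> (\<Prod>i\<in>UNIV. (1 + norm x) powr (\<gamma>$i))"
  unfolding wgt_def
 proof (intro prod_mono conjI powr_mono2)
  fix i
  show "0 \<le> \<gamma>$i" using assms less_imp_le by blast
  show "0 \<le> x$i" using True by (simp add: orth_def less_imp_le)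
  show "x$i \<le> 1 + norm x" using component_le_norm_cart[of x i] by simp
 qed auto
 also have "... = (1 + norm x) powr (\<Sum>i\<in>UNIV. \<gamma>$i)"
  by (simp add: powr_sum add_nonneg_eq_0_iff)
 also have "... \<le> (1 + norm x) powr (real (nat \<lceil>\<Sum>i\<in>UNIV. \<gamma>$i\<rceil>))"
  by (intro powr_mono) (auto simp: real_nat_ceiling_ge)
 also have "... = (1 + norm x) ^ nat \<lceil>\<Sum>i\<in>UNIV. \<gamma>$i\<rceil>"
  by (rule powr_realpow) (simp add: add_pos_nonneg)
 finally show ?thesis using True by (simp add: ow_def)
qed (simp add: ow_def)

text \<open>Comparison with the product of 1 / (1 + x_i^2), whose integral factorizes; the exponent
  is the degree of that product.\<close>

lemma integrable_inverse_power_norm: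
 "integrable lborel (\<lambda>x::real^'n::finite. 1 / (1 + norm x) ^ (2 * CARD('n)))"
proof (rule Bochner_Integration.integrable_bound)
 have s: "set_integrable lborel (einterval (-\<infinity>) \<infinity>) (\<lambda>s::real. 1 / (1 + s\<^sup>2))"
 proof (rule interval_integral_FTC_nonneg(1)[where F=arctan])
  show "DERIV arctan x :> 1 / (1 + x\<^sup>2)" for x by (auto intro!: derivative_eq_intros simp: inverse_eq_divide)
  show "isCont (\<lambda>s::real. 1 / (1 + s\<^sup>2)) x" for x by (intro continuous_intros) (simp add: add_nonneg_eq_0_iff)
  show "((arctan \<circ> real_of_ereal) \<longlongrightarrow> - (pi/2)) (at_right (-\<infinity>))"
   by (simp add: ereal_tendsto_simps tendsto_arctan_at_bot)
  show "((arctan \<circ> real_of_ereal) \<longlongrightarrow> pi/2) (at_left \<infinity>)"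
   by (simp add: ereal_tendsto_simps tendsto_arctan_at_top)
 qed auto
 then have "integrable lborel (\<lambda>s::real. 1 / (1 + s\<^sup>2))" by (simp add: set_integrable_def)
 then have fin: "(\<integral>\<^sup>+s. ennreal (1 / (1 + s\<^sup>2)) \<partial>(lborel :: real measure)) < \<infinity>"
  by (simp add: integrable_iff_bounded)
 have "(\<integral>\<^sup>+x. ennreal (\<Prod>i\<in>UNIV. 1 / (1 + (x$i)\<^sup>2)) \<partial>(lborel :: (real^'n) measure)) = (\<Prod>i\<in>(UNIV::'n set). \<integral>\<^sup>+s. ennreal (1 / (1 + s\<^sup>2)) \<partial>(lborel :: real measure))"
  by (subst nn_integral_prod_cart[symmetric]) (auto simp: prod_ennreal)
 also have "... < \<infinity>" using fin by (simp add: power_less_top_ennreal)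
 finally show "integrable lborel (\<lambda>x::real^'n. \<Prod>i\<in>UNIV. 1 / (1 + (x$i)\<^sup>2))"
  by (intro integrableI_bounded) (auto simp: prod_nonneg abs_prod)
 show "(\<lambda>x::real^'n. 1 / (1 + norm x) ^ (2 * CARD('n))) \<in> borel_measurable lborel" by measurable
 show "AE x in lborel. norm (1 / (1 + norm x) ^ (2 * CARD('n))) \<le> norm (\<Prod>i\<in>UNIV. 1 / (1 + ((x::real^'n)$i)\<^sup>2))"
 proof (rule AE_I2)
  fix x :: "real^'n"
  have "(\<Prod>i\<in>UNIV. 1 + (x$i)\<^sup>2) \<le> (\<Prod>i\<in>(UNIV::'n set). (1 + norm x)\<^sup>2)"
  proof (intro prod_mono conjI)
   fix i
   have "(x$i)\<^sup>2 \<le> (norm x)\<^sup>2" using component_le_norm_cart[of x i] by (metis abs_ge_zero power2_abs power_mono)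
   then show "1 + (x$i)\<^sup>2 \<le> (1 + norm x)\<^sup>2" using norm_ge_zero[of x] by (simp add: power2_sum, linarith)
  qed simp
  also have "... = (1 + norm x) ^ (2 * CARD('n))" by (simp add: power_mult)
  finally have "(\<Prod>i\<in>UNIV. 1 + (x$i)\<^sup>2) \<le> (1 + norm x) ^ (2 * CARD('n))" .
  moreover have "0 < (\<Prod>i\<in>UNIV. 1 + (x$i)\<^sup>2)" by (intro prod_pos) (auto intro: add_pos_nonneg)
  ultimately show "norm (1 / (1 + norm x) ^ (2 * CARD('n))) \<le> norm (\<Prod>i\<in>UNIV. 1 / (1 + (x$i)\<^sup>2))"
   by (simp add: prod_dividef frac_le)
 qed
qed

lemma integrable_ow:
 fixes f :: "real^'n::finite \<Rightarrow> 'b::{banach, second_countable_topology}"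
 assumes \<gamma>: "allpos \<gamma>" and [measurable]: "f \<in> borel_measurable borel"
  and bd: "\<And>N. \<exists>C. \<forall>x. (1 + norm x) ^ N * norm (f x) \<le> C"
 shows "integrable lborel (\<lambda>x. ow \<gamma> x *\<^sub>R f x)"
proof -
 define m where "m = nat \<lceil>\<Sum>i\<in>UNIV. \<gamma>$i\<rceil>"
 obtain C where C: "\<And>x. (1 + norm x) ^ (m + 2 * CARD('n)) * norm (f x) \<le> C" using bd by blast
 show ?thesis
 proof (rule Bochner_Integration.integrable_bound)
  show "integrable lborel (\<lambda>x::real^'n. C * (1 / (1 + norm x) ^ (2 * CARD('n))))"
   by (intro Bochner_Integration.integrable_mult_right integrable_inverse_power_norm)
  show "AE x in lborel. norm (ow \<gamma> x *\<^sub>R f x) \<le> norm (C * (1 / (1 + norm x) ^ (2 * CARD('n))))"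
  proof (rule AE_I2)
   fix x :: "real^'n"
   have p: "0 < (1 + norm x) ^ (2 * CARD('n))" by (simp add: add_pos_nonneg)
   have "norm (ow \<gamma> x *\<^sub>R f x) * (1 + norm x) ^ (2 * CARD('n)) \<le> (1 + norm x) ^ m * norm (f x) * (1 + norm x) ^ (2 * CARD('n))"
    unfolding m_def using ow_bound[OF \<gamma>, of x] ow_nonneg[of \<gamma> x]
    by (intro mult_right_mono) (auto intro: mult_right_mono)
   also have "... \<le> C" using C[of x] by (simp add: power_add ac_simps)
   finally have "norm (ow \<gamma> x *\<^sub>R f x) \<le> C * (1 / (1 + norm x) ^ (2 * CARD('n)))"
    using p by (simp add: pos_le_divide_eq)
   also have "... \<le> norm \<dots>" unfolding real_norm_def by (rule abs_ge_self)
   finally show "norm (ow \<gamma> x *\<^sub>R f x) \<le> norm (C * (1 / (1 + norm x) ^ (2 * CARD('n))))" .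
  qed
 qed measurable
qed

lemma nn_integral_lborel_scale:
 fixes f :: "real^'n::finite \<Rightarrow> ennreal"
 assumes [measurable]: "f \<in> borel_measurable borel" and "c > 0"
 shows "(\<integral>\<^sup>+x. f x \<partial>lborel) = ennreal (c ^ CARD('n)) * (\<integral>\<^sup>+x. f (c *\<^sub>R x) \<partial>lborel)"
proof -
 have "(\<integral>\<^sup>+x. f x \<partial>lborel) = (\<integral>\<^sup>+x. f x \<partial>density (distr lborel borel (\<lambda>x. 0 + c *\<^sub>R x)) (\<lambda>_. \<bar>c\<bar>^DIM(real^'n)))"
  using assms by (subst lborel_affine[of c 0]) auto
 also have "... = ennreal (c ^ CARD('n)) * (\<integral>\<^sup>+x. f (c *\<^sub>R x) \<partial>lborel)"
  using assms by (simp add: nn_integral_density nn_integral_distr nn_integral_cmult)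
 finally show ?thesis .
qed

lemma integral_lborel_scale:
 fixes f :: "real^'n::finite \<Rightarrow> 'b::{banach, second_countable_topology}"
 assumes [measurable]: "f \<in> borel_measurable borel" and "c > 0"
 shows "(LBINT x. f x) = (c ^ CARD('n)) *\<^sub>R (LBINT x. f (c *\<^sub>R x))"
proof -
 have "(LBINT x. f x) = (\<integral>x. f x \<partial>density (distr lborel borel (\<lambda>x. 0 + c *\<^sub>R x)) (\<lambda>_. ennreal (\<bar>c\<bar>^DIM(real^'n))))"
  using assms by (subst lborel_affine[of c 0]) (auto simp: ennreal_power)
 also have "... = (c ^ CARD('n)) *\<^sub>R (LBINT x. f (c *\<^sub>R x))"
  using assms by (simp add: integral_density integral_distr)
 finally show ?thesis .
qed

lemma Gamma_nn_integral:
 assumes "(a::real) > -1"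
 shows "(\<integral>\<^sup>+s. ennreal (indicator {0<..} s * (s powr a * exp (- s))) \<partial>lborel) = ennreal (Gamma (a + 1))"
proof -
 have "ennreal (Gamma (a + 1)) = (\<integral>\<^sup>+s. ennreal (s powr a / exp s) * indicator {0..} s \<partial>lborel)"
  using nn_integral_has_integral_lebesgue'[OF _ Gamma_integral_real[of "a + 1"]] assms by simp
 also have "... = (\<integral>\<^sup>+s. ennreal (indicator {0<..} s * (s powr a * exp (- s))) \<partial>lborel)"
  by (intro nn_integral_cong) (auto simp: indicator_def exp_minus divide_inverse)
 finally show ?thesis by simp
qed

text \<open>The substitution v = u^2 is carried out on bounded intervals, and monotone convergence
  on both sides gives the half line.\<close>

lemma half_gaussian_nn_integral:
 assumes "(g::real) > -1"
 shows "(\<integral>\<^sup>+u. ennreal (indicator {0<..} u * (u powr g * exp (- (u\<^sup>2)))) \<partial>lborel) = ennreal (Gamma ((g + 1) / 2) / 2)"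
proof -
 define f where "f = (\<lambda>v::real. (1/2) * (v powr ((g - 1) / 2) * exp (- v)))"
 have f0: "f v \<ge> 0" for v by (simp add: f_def)
 have fm[measurable]: "f \<in> borel_measurable borel" unfolding f_def by measurable
 have sub: "(\<integral>\<^sup>+v. ennreal (f v * indicator {0..(real n)\<^sup>2} v) \<partial>lborel) =
   (\<integral>\<^sup>+u. ennreal (f (u\<^sup>2) * (2 * u) * indicator {0..real n} u) \<partial>lborel)" for n :: nat
 proof -
  have "(\<integral>\<^sup>+v. ennreal (f v * indicator {0\<^sup>2..(real n)\<^sup>2} v) \<partial>lborel) =
   (\<integral>\<^sup>+u. ennreal (f (u\<^sup>2) * (2 * u) * indicator {0..real n} u) \<partial>lborel)"
  proof (rule nn_integral_substitution)
   show "((\<lambda>u. u\<^sup>2) has_real_derivative 2 * u) (at u)" for u :: real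
    by (auto intro!: derivative_eq_intros)
  qed (auto simp: set_borel_measurable_def intro!: continuous_intros)
  then show ?thesis by simp
 qed
 have lim1: "(\<lambda>n. \<integral>\<^sup>+v. ennreal (f v * indicator {0..(real n)\<^sup>2} v) \<partial>lborel) \<longlonglongrightarrow> (\<integral>\<^sup>+v. ennreal (f v * indicator {0..} v) \<partial>lborel)"
 proof (rule nn_integral_LIMSEQ)
  show "incseq (\<lambda>n v. ennreal (f v * indicator {0..(real n)\<^sup>2} v))"
   by (auto simp: incseq_def le_fun_def indicator_def f0 intro!: ennreal_leI) (meson of_nat_0_le_iff of_nat_mono order_trans power_mono)
  fix v
  have "eventually (\<lambda>n. f v * indicator {0..(real n)\<^sup>2} v = f v * indicator {0..} v) sequentially"
   using eventually_ge_at_top[of "nat \<lceil>v\<rceil> + 1"]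
  proof eventually_elim
   case (elim n)
   then have "v \<le> real n" "1 \<le> real n" by linarith+
   then have "v \<le> (real n)\<^sup>2" using self_le_power[OF \<open>1 \<le> real n\<close>, of 2] by linarith
   then show ?case by (simp add: indicator_def)
  qed
  then have "eventually (\<lambda>n. ennreal (f v * indicator {0..(real n)\<^sup>2} v) = ennreal (f v * indicator {0..} v)) sequentially"
   by eventually_elim (simp only:)
  then show "(\<lambda>n. ennreal (f v * indicator {0..(real n)\<^sup>2} v)) \<longlonglongrightarrow> ennreal (f v * indicator {0..} v)"
   by (rule tendsto_eventually)
 qed auto
 have f2: "f (u\<^sup>2) * (2 * u) * indicator A u = indicator A u * (u powr g * exp (- (u\<^sup>2)))" if "A \<subseteq> {0..}" for A and u :: real
 proof (cases "u > 0")
  case True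
  have "(u\<^sup>2) powr ((g - 1) / 2) = u powr (2 * ((g - 1) / 2))"
   using True by (simp only: powr_powr flip: powr_numeral)
  also have "2 * ((g - 1) / 2) = g - 1" by simp
  finally have "(u\<^sup>2) powr ((g - 1) / 2) = u powr (g - 1)" .
  moreover have "u powr (g - 1) * u = u powr g" using True powr_add[of u "g - 1" 1] by simp
  ultimately show ?thesis unfolding f_def by (simp add: ac_simps)
 next
  case False
  then have "u = 0 \<or> u \<notin> A" using that by fastforce
  then show ?thesis by (auto simp: f_def)
 qed
 have lim2: "(\<lambda>n. \<integral>\<^sup>+u. ennreal (f (u\<^sup>2) * (2 * u) * indicator {0..real n} u) \<partial>lborel) \<longlonglongrightarrow>
   (\<integral>\<^sup>+u. ennreal (indicator {0..} u * (u powr g * exp (- (u\<^sup>2)))) \<partial>lborel)"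
 proof (rule nn_integral_LIMSEQ)
  show "incseq (\<lambda>n u. ennreal (f (u\<^sup>2) * (2 * u) * indicator {0..real n} u))"
   by (auto simp: incseq_def le_fun_def indicator_def f0 intro!: ennreal_leI)
  fix u
  have "eventually (\<lambda>n. ennreal (f (u\<^sup>2) * (2 * u) * indicator {0..real n} u) = ennreal (indicator {0..} u * (u powr g * exp (- (u\<^sup>2))))) sequentially"
   using eventually_ge_at_top[of "nat \<lceil>u\<rceil>"]
  proof eventually_elim
   case (elim n)
   then have "u \<le> real n" by linarith
   then show ?case by (subst f2) (auto simp: indicator_def)
  qed
  then show "(\<lambda>n. ennreal (f (u\<^sup>2) * (2 * u) * indicator {0..real n} u)) \<longlonglongrightarrow> ennreal (indicator {0..} u * (u powr g * exp (- (u\<^sup>2))))"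
   by (rule tendsto_eventually)
 qed auto
 have "(\<integral>\<^sup>+u. ennreal (indicator {0<..} u * (u powr g * exp (- (u\<^sup>2)))) \<partial>lborel) = (\<integral>\<^sup>+u. ennreal (indicator {0..} u * (u powr g * exp (- (u\<^sup>2)))) \<partial>lborel)"
  by (intro nn_integral_cong) (auto simp: indicator_def)
 also have "... = (\<integral>\<^sup>+v. ennreal (f v * indicator {0..} v) \<partial>lborel)"
  using LIMSEQ_unique[OF lim1 lim2[folded sub]] by simp
 also have "... = (\<integral>\<^sup>+v. ennreal (1/2) * ennreal (indicator {0<..} v * (v powr ((g - 1) / 2) * exp (- v))) \<partial>lborel)"
  by (intro nn_integral_cong, subst ennreal_mult[symmetric]) (auto simp: indicator_def f_def)
 also have "... = ennreal (1/2) * ennreal (Gamma ((g - 1) / 2 + 1))"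
  using assms by (subst nn_integral_cmult) (auto simp: Gamma_nn_integral)
 also have "... = ennreal (1/2 * Gamma ((g - 1) / 2 + 1))"
 proof (rule ennreal_mult[symmetric])
  show "0 \<le> Gamma ((g - 1) / 2 + 1)" by (rule less_imp_le, rule Gamma_real_pos) (use assms in \<open>simp add: field_simps\<close>)
 qed simp
 also have "(g - 1) / 2 + 1 = (g + 1) / 2" by (simp add: field_simps)
 also have "1/2 * Gamma ((g + 1) / 2) = Gamma ((g + 1) / 2) / 2" by simp
 finally show ?thesis .
qed

text \<open>The integral of exp(-|x|^2) against x^\<gamma> over the orthant (see
  \<open>ow_gaussian_nn_integral\<close>).\<close>

definition gmass :: "real^'n::finite \<Rightarrow> real" where
 "gmass \<gamma> = (\<Prod>i\<in>UNIV. Gamma ((\<gamma>$i + 1) / 2) / 2)"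

lemma gmass_pos: "allpos \<gamma> \<Longrightarrow> 0 < gmass \<gamma>"
 unfolding gmass_def by (intro prod_pos ballI divide_pos_pos Gamma_real_pos) (auto intro: add_pos_pos)

lemma ow_gaussian_nn_integral:
 assumes "allpos \<gamma>"
 shows "(\<integral>\<^sup>+x. ennreal (ow \<gamma> x * exp (- (norm x)\<^sup>2)) \<partial>(lborel :: (real^'n::finite) measure)) = ennreal (gmass \<gamma>)"
proof -
 have "ow \<gamma> x * exp (- (norm x)\<^sup>2) = (\<Prod>i\<in>UNIV. indicator {0<..} (x$i) * ((x$i) powr (\<gamma>$i) * exp (- (x$i)\<^sup>2)))" for x :: "real^'n"
 proof -
  have "(norm x)\<^sup>2 = (\<Sum>i\<in>UNIV. (x$i)\<^sup>2)" by (simp add: norm_vec_def L2_set_def sum_nonneg)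
  then have "exp (- (norm x)\<^sup>2) = (\<Prod>i\<in>UNIV. exp (- (x$i)\<^sup>2))"
   by (simp add: sum_negf[symmetric] exp_sum)
  then show ?thesis by (simp add: ow_prod prod.distrib ac_simps)
 qed
 then have "(\<integral>\<^sup>+x. ennreal (ow \<gamma> x * exp (- (norm x)\<^sup>2)) \<partial>(lborel :: (real^'n::finite) measure)) =
   (\<integral>\<^sup>+x. (\<Prod>i\<in>UNIV. ennreal (indicator {0<..} (x$i) * ((x$i) powr (\<gamma>$i) * exp (- (x$i)\<^sup>2)))) \<partial>(lborel :: (real^'n) measure))"
  by (simp add: prod_ennreal)
 also have "... = (\<Prod>i\<in>UNIV. ennreal (Gamma ((\<gamma>$i + 1) / 2) / 2))"
 proof (subst nn_integral_prod_cart)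
  have "\<gamma>$i > -1" for i using assms[rule_format, of i] by linarith
  then show "(\<Prod>i\<in>UNIV. \<integral>\<^sup>+s. ennreal (indicator {0<..} s * (s powr (\<gamma>$i) * exp (- s\<^sup>2))) \<partial>lborel) =
    (\<Prod>i\<in>UNIV. ennreal (Gamma ((\<gamma>$i + 1) / 2) / 2))"
   by (intro prod.cong half_gaussian_nn_integral refl)
 qed measurable
 also have "... = ennreal (gmass \<gamma>)"
  unfolding gmass_def
 proof (rule prod_ennreal)
  fix i
  have "\<gamma>$i > 0" using assms by blast
  then show "0 \<le> Gamma ((\<gamma>$i + 1) / 2) / 2" by (intro divide_nonneg_nonneg Gamma_real_nonneg) auto
 qed
 finally show ?thesis .
qed

text \<open>The kernel of the ball scaled to radius one; \<open>bw 0\<close> is the indicator of the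
  open unit ball.\<close>

definition bw :: "real \<Rightarrow> real^'n::finite \<Rightarrow> real" where
 "bw lm x = (if norm x < 1 then (1 - (norm x)\<^sup>2) powr lm else 0)"

lemma bw_measurable [measurable]: "bw lm \<in> borel_measurable borel"
 unfolding bw_def[abs_def] by measurable

lemma bw_nonneg: "0 \<le> bw lm x" by (simp add: bw_def)

definition bmass :: "real^'n::finite \<Rightarrow> real \<Rightarrow> real" where
 "bmass \<gamma> lm = gmass \<gamma> * Gamma (lm + 1) / Gamma (lm + 1 + hdim \<gamma> / 2)"

text \<open>Both sides of \<open>\<Gamma>(lm + 1 + d/2) M = \<Gamma>(lm + 1) \<integral> e\<^bsup>-|x|\<^sup>2\<^esup>\<close> compute
 the integral of \<open>e\<^bsup>-s\<^esup> (s - |x|\<^sup>2)\<^sub>+\<^bsup>\<lambda>\<^esup>\<close> over \<open>s\<close> and \<open>x\<close>.\<close>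
lemma ow_ball_nn_integral:
 fixes \<gamma> :: "real^'n::finite"
 assumes \<gamma>: "allpos \<gamma>" and l: "lm > -1"
 shows "(\<integral>\<^sup>+x. ennreal (ow \<gamma> x * bw lm x) \<partial>lborel) = ennreal (bmass \<gamma> lm)"
proof -
 define h where "h = (\<lambda>(s::real) (x::real^'n). ow \<gamma> x * (if (norm x)\<^sup>2 < s then (s - (norm x)\<^sup>2) powr lm * exp (- s) else 0))"
 define M where "M = (\<integral>\<^sup>+x. ennreal (ow \<gamma> x * bw lm x) \<partial>lborel)"
 have gs: "(\<Sum>i\<in>UNIV. \<gamma>$i) \<ge> 0" using \<gamma> by (intro sum_nonneg) (simp add: less_imp_le)
 then have hd: "hdim \<gamma> \<ge> 0" by (simp add: hdim_def)
 have pos: "Gamma (lm + 1) > 0" "Gamma (lm + 1 + hdim \<gamma> / 2) > 0"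
  using l hd by (auto intro!: Gamma_real_pos add_pos_nonneg)
 have hm[measurable]: "(\<lambda>(s, x). ennreal (h s x)) \<in> borel_measurable (lborel \<Otimes>\<^sub>M lborel)"
  unfolding h_def by measurable
 have "(\<integral>\<^sup>+x. ennreal (h s x) \<partial>lborel) = ennreal (indicator {0<..} s * (s powr (lm + hdim \<gamma> / 2) * exp (- s))) * M" for s
 proof (cases "s > 0")
  case False
  then have "h s x = 0" for x unfolding h_def using order_trans[of s 0 "(norm x)\<^sup>2"] by auto
  then show ?thesis using False by simp
 next
  case True
  have hs: "h s (sqrt s *\<^sub>R x) = (s powr ((\<Sum>i\<in>UNIV. \<gamma>$i) / 2) * s powr lm * exp (- s)) * (ow \<gamma> x * bw lm x)" for x
  proof -
   have n: "(norm (sqrt s *\<^sub>R x))\<^sup>2 = s * (norm x)\<^sup>2" using True by (simp add: power_mult_distrib)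
   have c: "s * (norm x)\<^sup>2 < s \<longleftrightarrow> norm x < 1"
    using True by (simp add: power_less_one_iff abs_square_less_1)
   have o: "ow \<gamma> (sqrt s *\<^sub>R x) = s powr ((\<Sum>i\<in>UNIV. \<gamma>$i) / 2) * ow \<gamma> x"
    using True by (simp add: ow_scaleR powr_powr flip: powr_half_sqrt)
   have "(s - s * (norm x)\<^sup>2) powr lm = s powr lm * (1 - (norm x)\<^sup>2) powr lm" if "norm x < 1"
   proof -
    have "(norm x)\<^sup>2 \<le> 1" using that by (simp add: power_le_one)
    then show ?thesis using True by (subst powr_mult[symmetric]) (auto simp: algebra_simps)
   qed
   then show ?thesis unfolding h_def n c o bw_def by auto
  qed
  have "(\<integral>\<^sup>+x. ennreal (h s x) \<partial>lborel) = ennreal (sqrt s ^ CARD('n)) * (\<integral>\<^sup>+x. ennreal (h s (sqrt s *\<^sub>R x)) \<partial>lborel)"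
   using True by (intro nn_integral_lborel_scale) (auto simp: h_def)
  also have "... = ennreal (sqrt s ^ CARD('n)) * (ennreal (s powr ((\<Sum>i\<in>UNIV. \<gamma>$i) / 2) * s powr lm * exp (- s)) * M)"
   unfolding hs M_def using True
   by (subst nn_integral_cmult[symmetric]) (auto simp: ennreal_mult'' ow_nonneg bw_nonneg ennreal_mult)
  also have "... = ennreal (sqrt s ^ CARD('n) * (s powr ((\<Sum>i\<in>UNIV. \<gamma>$i) / 2) * s powr lm * exp (- s))) * M"
   using True by (subst ennreal_mult) (auto simp: mult.assoc)
  also have "sqrt s ^ CARD('n) = s powr (real CARD('n) / 2)"
   using True by (simp add: powr_powr flip: powr_half_sqrt powr_realpow)
  also have "s powr (real CARD('n) / 2) * (s powr ((\<Sum>i\<in>UNIV. \<gamma>$i) / 2) * s powr lm * exp (- s)) = s powr (lm + hdim \<gamma> / 2) * exp (- s)"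
   by (simp add: hdim_def add_divide_distrib powr_add)
  finally show ?thesis using True by simp
 qed
 then have 1: "(\<integral>\<^sup>+s. \<integral>\<^sup>+x. ennreal (h s x) \<partial>lborel \<partial>lborel) = ennreal (Gamma (lm + hdim \<gamma> / 2 + 1)) * M"
  using l hd by (simp add: nn_integral_multc Gamma_nn_integral add_nonneg_pos)
 have "(\<integral>\<^sup>+s. ennreal (h s x) \<partial>lborel) = ennreal (Gamma (lm + 1)) * ennreal (ow \<gamma> x * exp (- (norm x)\<^sup>2))" for x
 proof -
  let ?r = "(norm x)\<^sup>2"
  have "(\<integral>\<^sup>+s. ennreal (h s x) \<partial>lborel) = (\<integral>\<^sup>+s. ennreal (h (?r + s) x) \<partial>lborel)"
   by (rule nn_integral_lborel_shift[symmetric]) (unfold h_def, measurable)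
  also have "... = (\<integral>\<^sup>+s. ennreal (ow \<gamma> x * exp (- ?r)) * ennreal (indicator {0<..} s * (s powr lm * exp (- s))) \<partial>lborel)"
   by (intro nn_integral_cong) (auto simp: h_def indicator_def ow_nonneg exp_add exp_diff exp_minus divide_inverse simp flip: ennreal_mult)
  also have "... = ennreal (ow \<gamma> x * exp (- ?r)) * ennreal (Gamma (lm + 1))"
   using l by (subst nn_integral_cmult) (auto simp: Gamma_nn_integral)
  finally show ?thesis by (simp add: mult.commute)
 qed
 then have 2: "(\<integral>\<^sup>+x. \<integral>\<^sup>+s. ennreal (h s x) \<partial>lborel \<partial>lborel) = ennreal (Gamma (lm + 1)) * ennreal (gmass \<gamma>)"
  by (simp add: nn_integral_cmult ow_gaussian_nn_integral[OF \<gamma>])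
 have "ennreal (Gamma (lm + 1 + hdim \<gamma> / 2)) * M = ennreal (Gamma (lm + 1)) * ennreal (gmass \<gamma>)"
  using lborel_pair.Fubini[OF hm] 1 2 by (simp add: ac_simps)
 also have "... = ennreal (Gamma (lm + 1 + hdim \<gamma> / 2)) * ennreal (bmass \<gamma> lm)"
  using pos gmass_pos[OF \<gamma>] by (simp add: bmass_def ennreal_mult[symmetric] field_simps)
 finally show ?thesis
  using pos unfolding M_def[symmetric] by (simp add: ennreal_mult_cancel_left)
qed

subsection \<open>Integration by parts on the orthant\<close>

lemma wgt_line:
 assumes "x $ i = 0"
 shows "wgt \<gamma> (x + ax i s) = s powr (\<gamma>$i) * (\<Prod>j\<in>UNIV - {i}. (x$j) powr (\<gamma>$j))"
proof -
 have comp: "(x + ax i s) $ j = (if j = i then s else x $ j)" for j using assms by (auto simp: axis_def)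
 have "(\<Prod>j\<in>UNIV - {i}. ((x + ax i s)$j) powr (\<gamma>$j)) = (\<Prod>j\<in>UNIV - {i}. (x$j) powr (\<gamma>$j))"
  unfolding comp by (rule prod.cong) auto
 then show ?thesis unfolding wgt_def
  by (subst prod.remove[of UNIV i]) (simp_all only: finite UNIV_I comp if_True simp_thms)
qed

lemma norm_line_sq:
 assumes "x $ i = 0"
 shows "(norm (x + ax i s :: real^'n::finite))\<^sup>2 = (norm x)\<^sup>2 + s\<^sup>2"
proof -
 have "x \<bullet> axis i 1 = 0" "axis i 1 \<bullet> x = 0" "axis i 1 \<bullet> (axis i 1 :: real^'n) = 1"
  using assms by (simp_all add: inner_axis inner_axis')
 then show ?thesis
  unfolding power2_norm_eq_inner by (simp add: inner_add_left inner_add_right power2_eq_square)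
qed

lemma norm_line_ge:
 assumes "x $ i = 0" shows "\<bar>s\<bar> \<le> norm (x + ax i s :: real^'n::finite)"
 using component_le_norm_cart[of "x + ax i s" i] assms by simp

lemma powr_weight_deriv:
 assumes "s > 0"
 shows "((\<lambda>s. s * s powr g) has_real_derivative (1 + g) * s powr g) (at s)"
proof -
 have "((\<lambda>s. s * s powr g) has_real_derivative 1 * s powr g + s * (g * s powr (g - 1))) (at s)"
  using assms by (auto intro!: derivative_eq_intros)
 moreover have "s * s powr (g - 1) = s powr g" using assms powr_add[of s "g - 1" 1] by (simp add: mult.commute)
 ultimately show ?thesis by (simp add: algebra_simps)
qed

lemma powr_weight_cont: "g > 0 \<Longrightarrow> continuous_on {0..} (\<lambda>s::real. s * s powr g)"
 by (intro continuous_intros continuous_on_powr') auto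

text \<open>The integrand is the derivative in direction i of x_i x^\<gamma> G. The extra factor
  x_i, natural for functions obtained from \<open>Dq\<close>, makes this vanish on the face x_i =
  0.\<close>

lemma orth_ibp:
 fixes G G' :: "real^'n::finite \<Rightarrow> real"
 assumes \<gamma>: "allpos \<gamma>" and d: "has_pd i G G'"
  and c: "continuous_on UNIV G" "continuous_on UNIV G'"
  and bd: "\<And>N. \<exists>C. \<forall>x. (1 + norm x) ^ N * \<bar>G x\<bar> \<le> C" "\<And>N. \<exists>C. \<forall>x. (1 + norm x) ^ N * \<bar>G' x\<bar> \<le> C"
 shows "(LBINT x. ow \<gamma> x * ((1 + \<gamma>$i) * G x + x$i * G' x)) = 0"
proof -
 define \<Phi> where "\<Phi> = (\<lambda>x. x$i * wgt \<gamma> x * G x)"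
 define \<Phi>' where "\<Phi>' = (\<lambda>x. wgt \<gamma> x * ((1 + \<gamma>$i) * G x + x$i * G' x))"
 have g: "\<gamma>$i > 0" using \<gamma> by blast
 have m[measurable]: "G \<in> borel_measurable borel" "G' \<in> borel_measurable borel"
  using c by (auto intro: borel_measurable_continuous_onI)
 have "integrable lborel (\<lambda>x. ow \<gamma> x *\<^sub>R ((1 + \<gamma>$i) * G x + x$i * G' x))"
 proof (rule integrable_ow[OF \<gamma>])
  fix N
  obtain C D where C: "\<And>x. (1 + norm x) ^ N * \<bar>G x\<bar> \<le> C" "\<And>x. (1 + norm x) ^ Suc N * \<bar>G' x\<bar> \<le> D"
   using bd(1)[of N] bd(2)[of "Suc N"] by blast
  have "(1 + norm x) ^ N * norm ((1 + \<gamma>$i) * G x + x$i * G' x) \<le> (1 + \<gamma>$i) * C + D" for x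
  proof -
   have xi: "\<bar>x$i\<bar> \<le> 1 + norm x" using component_le_norm_cart[of x i] by simp
   have "\<bar>(1 + \<gamma>$i) * G x + x$i * G' x\<bar> \<le> (1 + \<gamma>$i) * \<bar>G x\<bar> + (1 + norm x) * \<bar>G' x\<bar>"
    using abs_triangle_ineq[of "(1 + \<gamma>$i) * G x" "x$i * G' x"] mult_right_mono[OF xi abs_ge_zero[of "G' x"]] g
    by (simp add: abs_mult)
   then have "(1 + norm x) ^ N * \<bar>(1 + \<gamma>$i) * G x + x$i * G' x\<bar> \<le> (1 + norm x) ^ N * ((1 + \<gamma>$i) * \<bar>G x\<bar> + (1 + norm x) * \<bar>G' x\<bar>)"
    by (rule mult_left_mono) simp
   also have "... = (1 + \<gamma>$i) * ((1 + norm x) ^ N * \<bar>G x\<bar>) + (1 + norm x) ^ Suc N * \<bar>G' x\<bar>"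
    by (simp add: algebra_simps)
   also have "... \<le> (1 + \<gamma>$i) * C + D" using C g by (intro add_mono mult_left_mono) auto
   finally show ?thesis by simp
  qed
  then show "\<exists>C. \<forall>x. (1 + norm x) ^ N * norm ((1 + \<gamma>$i) * G x + x$i * G' x) \<le> C" by blast
 qed measurable
 then have int: "integrable lborel (\<lambda>x. indicator orth x *\<^sub>R \<Phi>' x)"
  by (simp add: \<Phi>'_def ow_def mult.assoc)
 have "(LBINT x. indicator orth x *\<^sub>R \<Phi>' x) = 0"
 proof (rule orth_divergence_zero[OF int, where \<Phi>=\<Phi> and i=i], intro conjI)
  fix x :: "real^'n" assume x: "x $ i = 0"
  define W where "W = (\<Prod>j\<in>UNIV - {i}. (x$j) powr (\<gamma>$j))"
  have P: "\<Phi> (x + ax i s) = W * ((s * s powr (\<gamma>$i)) * G (x + ax i s))" for s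
   unfolding \<Phi>_def wgt_line[OF x] W_def[symmetric] by (simp add: x)
  show "continuous_on {0..} (\<lambda>s. \<Phi> (x + ax i s))"
   unfolding P by (intro continuous_intros powr_weight_cont g continuous_on_compose2[OF c(1)]) auto
  show "\<Phi> x = 0" by (simp add: \<Phi>_def x)
  show "((\<lambda>s. \<Phi> (x + ax i s)) \<longlongrightarrow> 0) at_top"
  proof -
   \<comment> \<open>A decay of order k + 2 beats s times s^\<gamma>_i and leaves a factor 1 /
     s.\<close>
   define k where "k = nat \<lceil>\<gamma>$i\<rceil>"
   obtain C where C: "\<And>x. (1 + norm x) ^ (k + 2) * \<bar>G x\<bar> \<le> C" using bd(1) by blast
   have "((\<lambda>s. \<bar>W\<bar> * (C / s)) \<longlongrightarrow> 0) at_top"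
    by (auto intro!: tendsto_mult_right_zero tendsto_divide_0[OF tendsto_const] filterlim_at_top_imp_at_infinity filterlim_ident)
   moreover have "\<forall>\<^sub>F s in at_top. norm (\<Phi> (x + ax i s)) \<le> \<bar>W\<bar> * (C / s)"
    using eventually_ge_at_top[of 1]
   proof eventually_elim
    case (elim s)
    let ?y = "x + ax i s"
    have "s \<le> 1 + norm ?y" using norm_line_ge[OF x, of s] by simp
    then have "s ^ (k + 2) \<le> (1 + norm ?y) ^ (k + 2)" using elim by (intro power_mono) auto
    then have "s ^ (k + 2) * \<bar>G ?y\<bar> \<le> C"
     using C[of ?y] mult_right_mono[of "s ^ (k + 2)" _ "\<bar>G ?y\<bar>"] by (meson abs_ge_zero order_trans)
    moreover have "s powr (\<gamma>$i) \<le> s ^ k"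
    proof -
     have "s powr (\<gamma>$i) \<le> s powr (real k)" using elim by (intro powr_mono) (auto simp: k_def real_nat_ceiling_ge)
     then show ?thesis using elim by (simp add: powr_realpow)
    qed
    then have "s * s * (s powr (\<gamma>$i) * \<bar>G ?y\<bar>) \<le> s * s * (s ^ k * \<bar>G ?y\<bar>)"
     using elim by (intro mult_left_mono mult_right_mono) auto
    ultimately have "s * (s * s powr (\<gamma>$i) * \<bar>G ?y\<bar>) \<le> C"
     by (simp add: power_add power2_eq_square ac_simps)
    then have "s * s powr (\<gamma>$i) * \<bar>G ?y\<bar> \<le> C / s" using elim by (simp add: field_simps)
    from mult_left_mono[OF this abs_ge_zero[of W]] show ?case unfolding P using elim by (simp add: abs_mult)
   qed
   ultimately show ?thesis by (rule Lim_null_comparison[rotated])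
  qed
  have "((\<lambda>s. \<Phi> (x + ax i s)) has_vector_derivative \<Phi>' (x + ax i s)) (at s)" if s: "s > 0" for s
  proof -
   have "((\<lambda>s. W * ((s * s powr (\<gamma>$i)) * G (x + ax i s))) has_real_derivative
     W * ((1 + \<gamma>$i) * s powr (\<gamma>$i) * G (x + ax i s) + G' (x + ax i s) * (s * s powr (\<gamma>$i)))) (at s)"
    by (intro DERIV_cmult DERIV_mult powr_weight_deriv s has_pd_line[OF d])
   then show ?thesis
    unfolding P \<Phi>'_def wgt_line[OF x] W_def[symmetric] has_real_derivative_iff_has_vector_derivative[symmetric]
    by (elim DERIV_cong) (simp add: x algebra_simps)
  qed
  then show "\<exists>S. finite S \<and> (\<forall>s. s > 0 \<longrightarrow> s \<notin> S \<longrightarrow>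
    ((\<lambda>s. \<Phi> (x + ax i s)) has_vector_derivative \<Phi>' (x + ax i s)) (at s))"
   by (intro exI[of _ "{}"]) auto
 qed
 then show ?thesis by (simp add: \<Phi>'_def ow_def mult.assoc)
qed

lemma S_ev_rapid: "\<phi> \<in> S_ev \<Longrightarrow> \<exists>C. \<forall>x. (1 + norm x) ^ N * \<bar>pds is \<phi> x\<bar> \<le> C"
 using norm_power_pds_le[of \<phi> N "max N (length is)" "is"] by (meson max.cobounded1 max.cobounded2)

lemma S_ev_rapid0: "\<phi> \<in> S_ev \<Longrightarrow> \<exists>C. \<forall>x. (1 + norm x) ^ N * \<bar>\<phi> x\<bar> \<le> C"
 using S_ev_rapid[of \<phi> N "[]"] by simp

lemma integrable_ow_S_ev:
 assumes "allpos \<gamma>" "\<phi> \<in> S_ev" shows "integrable lborel (\<lambda>x. ow \<gamma> x * \<phi> x)"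
 using integrable_ow[OF assms(1) S_ev_measurable[OF assms(2)]] S_ev_rapid0[OF assms(2)] by simp

text \<open>Each summand of \<open>bessel_lap_eq\<close> is the integrand of \<open>orth_ibp\<close>
  with G = \<open>Dq i \<phi>\<close>. Hence integration against x^\<gamma> is annihilated by the
  Laplacian, which is what the null solution for k < 0 rests on.\<close>

lemma bessel_lap_integral_zero:
 assumes \<gamma>: "allpos \<gamma>" and \<phi>: "\<phi> \<in> S_ev"
 shows "(LBINT x. ow \<gamma> x * bessel_lap \<gamma> \<phi> x) = 0"
proof -
 let ?E = "\<lambda>i x. (1 + \<gamma>$i) * Dq i \<phi> x + x$i * (x$i * Dq i (Dq i \<phi>) x)"
 have D: "Dq i \<phi> \<in> S_ev" for i using Dq_S_ev \<phi> by blast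
 have p: "pd i (Dq i \<phi>) = (\<lambda>x. x$i * Dq i (Dq i \<phi>) x)" for i using has_pd_imp_pd[OF has_pd_S_ev[OF D]] .
 have z: "(LBINT x. ow \<gamma> x * ?E i x) = 0" for i
 proof (rule orth_ibp[OF \<gamma> has_pd_S_ev[OF D]])
  show "continuous_on UNIV (Dq i \<phi>)" by (rule S_ev_continuous[OF D])
  show "continuous_on UNIV (\<lambda>x. x$i * Dq i (Dq i \<phi>) x)"
   by (intro continuous_intros S_ev_continuous Dq_S_ev D)
  show "\<exists>C. \<forall>x. (1 + norm x) ^ N * \<bar>Dq i \<phi> x\<bar> \<le> C" for N by (rule S_ev_rapid0[OF D])
  show "\<exists>C. \<forall>x. (1 + norm x) ^ N * \<bar>x$i * Dq i (Dq i \<phi>) x\<bar> \<le> C" for N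
   using S_ev_rapid[OF D[of i], of N "[i]"] p by simp
 qed
 have i: "integrable lborel (\<lambda>x. ow \<gamma> x * ?E i x)" for i
 proof -
  have m: "pd i (Dq i \<phi>) \<in> borel_measurable borel"
   using smooth_fn_continuous[OF S_evD(1)[OF D[of i]], of UNIV "[i]"] by (intro borel_measurable_continuous_onI) simp
  have m2: "(\<lambda>x. x$i * pd i (Dq i \<phi>) x) \<in> borel_measurable borel" using m by measurable
  have "\<exists>C. \<forall>x. (1 + norm x) ^ N * norm (x$i * pd i (Dq i \<phi>) x) \<le> C" for N
  proof -
   obtain C where C: "\<And>x. (1 + norm x) ^ Suc N * \<bar>pd i (Dq i \<phi>) x\<bar> \<le> C"
    using S_ev_rapid[OF D[of i], of "Suc N" "[i]"] by auto
   have "(1 + norm x) ^ N * norm (x$i * pd i (Dq i \<phi>) x) \<le> C" for x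
   proof -
    have xi: "\<bar>x$i\<bar> \<le> 1 + norm x" using component_le_norm_cart[of x i] by simp
    have "(1 + norm x) ^ N * (\<bar>x$i\<bar> * \<bar>pd i (Dq i \<phi>) x\<bar>) \<le> (1 + norm x) ^ N * ((1 + norm x) * \<bar>pd i (Dq i \<phi>) x\<bar>)"
     by (intro mult_left_mono mult_right_mono xi) auto
    then show ?thesis using C[of x] by (simp add: abs_mult ac_simps)
   qed
   then show ?thesis by blast
  qed
  from integrable_ow[OF \<gamma> m2 this]
  have "integrable lborel (\<lambda>x. ow \<gamma> x * (x$i * (x$i * Dq i (Dq i \<phi>) x)))" by (simp add: p)
  moreover have "integrable lborel (\<lambda>x. (1 + \<gamma>$i) * (ow \<gamma> x * Dq i \<phi> x))"
   by (intro Bochner_Integration.integrable_mult_right integrable_ow_S_ev \<gamma> D)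
  ultimately have "integrable lborel (\<lambda>x. (1 + \<gamma>$i) * (ow \<gamma> x * Dq i \<phi> x) + ow \<gamma> x * (x$i * (x$i * Dq i (Dq i \<phi>) x)))"
   by (rule Bochner_Integration.integrable_add[rotated])
  then show ?thesis by (simp add: algebra_simps)
 qed
 have "(LBINT x. ow \<gamma> x * bessel_lap \<gamma> \<phi> x) = (LBINT x. (\<Sum>i\<in>UNIV. ow \<gamma> x * ?E i x))"
  by (simp add: bessel_lap_eq[OF \<phi>] sum_distrib_left power2_eq_square mult.assoc)
 also have "... = 0" using i z by simp
 finally show ?thesis .
qed

subsection \<open>Complex powers on the ball\<close>

definition cpow :: "complex \<Rightarrow> real \<Rightarrow> complex" where
 "cpow z u = (if u > 0 then of_real u powr z else 0)"

lemma norm_cpow: "norm (cpow z u) = (if u > 0 then u powr Re z else 0)"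
 by (simp add: cpow_def norm_powr_real_powr)

lemma cpow_add_one: "of_real u * cpow z u = cpow (z + 1) u"
 by (auto simp: cpow_def powr_add)

lemma cpow_of_real: "cpow (of_real a) u = of_real (if u > 0 then u powr a else 0)"
 by (auto simp: cpow_def powr_of_real)

lemma cpow_measurable [measurable]: "cpow z \<in> borel_measurable borel"
proof -
 have "(\<lambda>u. indicator {0<..} u *\<^sub>R (of_real u powr z :: complex)) \<in> borel_measurable borel"
  by (rule borel_measurable_continuous_on_indicator) (auto intro!: continuous_intros simp: complex_nonpos_Reals_iff)
 moreover have "cpow z = (\<lambda>u. indicator {0<..} u *\<^sub>R (of_real u powr z :: complex))"
  by (auto simp: cpow_def fun_eq_iff)
 ultimately show ?thesis by simp
qed

lemma has_vector_derivative_cpow: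
 assumes "u \<noteq> 0"
 shows "(cpow (z + 1) has_vector_derivative (z + 1) * cpow z u) (at u)"
proof (cases "u > 0")
 case True
 have "((\<lambda>w::complex. w powr (z + 1)) has_field_derivative (z + 1) * of_real u powr z) (at (of_real u))"
  using True by (auto intro!: derivative_eq_intros simp: complex_nonpos_Reals_iff)
 from has_vector_derivative_real_field[OF this]
 have "((\<lambda>u. of_real u powr (z + 1) :: complex) has_vector_derivative (z + 1) * cpow z u) (at u)"
  using True by (simp add: cpow_def)
 then show ?thesis
  by (rule has_vector_derivative_transform_within_open[where S="{0<..}"]) (use True in \<open>auto simp: cpow_def\<close>)
next
 case False
 have "((\<lambda>u. 0 :: complex) has_vector_derivative (z + 1) * cpow z u) (at u)"
  using False by (simp add: cpow_def)
 then show ?thesis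
  by (rule has_vector_derivative_transform_within_open[where S="{..<0}"]) (use False assms in \<open>auto simp: cpow_def\<close>)
qed

lemma continuous_cpow:
 assumes "Re z > 0" shows "continuous_on UNIV (cpow z)"
proof -
 have "isCont (cpow z) u" for u
 proof (cases "u = 0")
  case False
  have "(cpow (z - 1 + 1) has_vector_derivative (z - 1 + 1) * cpow (z - 1) u) (at u)"
   by (rule has_vector_derivative_cpow[OF False])
  then show ?thesis using has_vector_derivative_continuous by fastforce
 next
  case True
  have "((\<lambda>u. norm (cpow z u)) \<longlongrightarrow> 0) (at 0)"
  proof (rule Lim_null_comparison)
   show "((\<lambda>u. \<bar>u\<bar> powr Re z) \<longlongrightarrow> 0) (at (0::real))"
    using assms tendsto_powr2[OF tendsto_rabs_zero[OF tendsto_ident_at[of "0::real" UNIV]] tendsto_const[of "Re z"]] by simp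
  qed (auto simp: norm_cpow intro!: always_eventually)
  then have "(cpow z \<longlongrightarrow> 0) (at 0)" by (rule tendsto_norm_zero_cancel)
  then show ?thesis unfolding True isCont_def by (simp add: cpow_def)
 qed
 then show ?thesis by (simp add: continuous_at_imp_continuous_on)
qed

text \<open>\<open>ker_int\<close> as a Lebesgue integral over the whole space: the orthant sits in
  \<open>ow\<close> and the ball in the positive part \<open>cpow\<close>.\<close>

definition bint :: "real^'n::finite \<Rightarrow> real \<Rightarrow> complex \<Rightarrow> (real^'n \<Rightarrow> real) \<Rightarrow> complex" where
 "bint \<gamma> t z h = (LBINT x. (ow \<gamma> x * h x) *\<^sub>R cpow z (t\<^sup>2 - (norm x)\<^sup>2))"

lemma ball_pos_iff: "t > 0 \<Longrightarrow> 0 < t\<^sup>2 - (norm x)\<^sup>2 \<longleftrightarrow> norm x < t"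
 using abs_le_square_iff[of t "norm x"] abs_of_nonneg[OF norm_ge_zero[of x]] by (simp add: linorder_not_le[symmetric])

lemma bint_integrable:
 fixes \<gamma> :: "real^'n::finite"
 assumes \<gamma>: "allpos \<gamma>" and t: "t > 0" and z: "Re z > -1"
  and [measurable]: "h \<in> borel_measurable borel" and bd: "\<And>x. norm x < t \<Longrightarrow> \<bar>h x\<bar> \<le> B"
 shows "integrable lborel (\<lambda>x. (ow \<gamma> x * h x) *\<^sub>R cpow z (t\<^sup>2 - (norm x)\<^sup>2))"
proof -
 have B0: "B \<ge> 0" using bd[of 0] t by simp
 \<comment> \<open>Scaling by t reduces the claim to the unit ball, where the mass is finite because
   Re z > -1.\<close>
 have sc: "norm (ow \<gamma> (t *\<^sub>R x) *\<^sub>R cpow z (t\<^sup>2 - (norm (t *\<^sub>R x))\<^sup>2)) =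
   (t powr (\<Sum>i\<in>UNIV. \<gamma>$i) * (t\<^sup>2) powr Re z) * (ow \<gamma> x * bw (Re z) x)" for x :: "real^'n"
 proof -
  define v where "v = 1 - (norm x)\<^sup>2"
  have e: "t\<^sup>2 - (norm (t *\<^sub>R x))\<^sup>2 = t\<^sup>2 * v" by (simp add: v_def power_mult_distrib algebra_simps)
  have v: "0 < v \<longleftrightarrow> norm x < 1" using ball_pos_iff[of 1 x] by (simp add: v_def)
  have p: "0 < t\<^sup>2 * v \<longleftrightarrow> norm x < 1"
   using t v by (simp add: zero_less_mult_iff)
  have "(t\<^sup>2 * v) powr Re z = (t\<^sup>2) powr Re z * v powr Re z" if "norm x < 1"
   using that v by (subst powr_mult) auto
  then show ?thesis unfolding e unfolding norm_scaleR norm_cpow p bw_def v_def[symmetric]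
   using t ow_nonneg[of \<gamma> x] by (auto simp: ow_scaleR abs_mult)
 qed
 have "(\<integral>\<^sup>+x. ennreal (norm (ow \<gamma> x *\<^sub>R cpow z (t\<^sup>2 - (norm x)\<^sup>2))) \<partial>lborel) =
   ennreal (t ^ CARD('n)) * (\<integral>\<^sup>+x. ennreal (norm (ow \<gamma> (t *\<^sub>R x) *\<^sub>R cpow z (t\<^sup>2 - (norm (t *\<^sub>R x))\<^sup>2))) \<partial>lborel)"
  by (rule nn_integral_lborel_scale[OF _ t]) measurable
 also have "... = ennreal (t ^ CARD('n)) * (ennreal (t powr (\<Sum>i\<in>UNIV. \<gamma>$i) * (t\<^sup>2) powr Re z) * ennreal (bmass \<gamma> (Re z)))"
  unfolding sc by (subst ennreal_mult) (auto simp: ow_nonneg bw_nonneg nn_integral_cmult ow_ball_nn_integral[OF \<gamma> z])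
 also have "... < \<infinity>" by (simp add: ennreal_mult_less_top)
 finally have "integrable lborel (\<lambda>x. ow \<gamma> x *\<^sub>R cpow z (t\<^sup>2 - (norm x)\<^sup>2))"
  by (intro integrableI_bounded) auto
 then have "integrable lborel (\<lambda>x. B *\<^sub>R (ow \<gamma> x *\<^sub>R cpow z (t\<^sup>2 - (norm x)\<^sup>2)))"
  by (rule Bochner_Integration.integrable_scaleR_right)
 then show ?thesis
 proof (rule Bochner_Integration.integrable_bound)
  show "AE x in lborel. norm ((ow \<gamma> x * h x) *\<^sub>R cpow z (t\<^sup>2 - (norm x)\<^sup>2)) \<le> norm (B *\<^sub>R (ow \<gamma> x *\<^sub>R cpow z (t\<^sup>2 - (norm x)\<^sup>2)))"
  proof (rule AE_I2)
   fix x :: "real^'n"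
   show "norm ((ow \<gamma> x * h x) *\<^sub>R cpow z (t\<^sup>2 - (norm x)\<^sup>2)) \<le> norm (B *\<^sub>R (ow \<gamma> x *\<^sub>R cpow z (t\<^sup>2 - (norm x)\<^sup>2)))"
   proof (cases "norm x < t")
    case True
    then show ?thesis using bd[OF True] B0 ow_nonneg[of \<gamma> x]
     by (simp add: abs_mult mult.left_commute[of B] mult.assoc) (intro mult_left_mono mult_right_mono, auto)
   next
    case False
    then have "cpow z (t\<^sup>2 - (norm x)\<^sup>2) = 0" using ball_pos_iff[OF t, of x] by (simp add: cpow_def)
    then show ?thesis by simp
   qed
  qed
 qed measurable
qed

text \<open>As \<open>orth_ibp\<close>, with the kernel as an additional factor: its derivative in
  direction i is - 2 (z + 1) x_i times the kernel of exponent z. At exponent z + 1 the kernel is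
  continuous across the sphere, so no boundary term arises there; differentiability fails at one
  point of each line at most.\<close>

lemma ball_ibp:
 fixes G G' :: "real^'n::finite \<Rightarrow> real"
 assumes \<gamma>: "allpos \<gamma>" and t: "t > 0" and z: "Re z > -1" and d: "has_pd i G G'"
  and c: "continuous_on UNIV G" "continuous_on UNIV G'"
  and bd: "\<And>x. norm x < t \<Longrightarrow> \<bar>G x\<bar> \<le> B" "\<And>x. norm x < t \<Longrightarrow> \<bar>G' x\<bar> \<le> B"
 shows "(LBINT x. (ow \<gamma> x * ((1 + \<gamma>$i) * G x + x$i * G' x)) *\<^sub>R cpow (z + 1) (t\<^sup>2 - (norm x)\<^sup>2)) = 2 * (z + 1) * (LBINT x. (ow \<gamma> x * ((x$i)\<^sup>2 * G x)) *\<^sub>R cpow z (t\<^sup>2 - (norm x)\<^sup>2))"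
proof -
 let ?u = "\<lambda>x::real^'n. t\<^sup>2 - (norm x)\<^sup>2"
 have g: "\<gamma>$i > 0" using \<gamma> by blast
 have B0: "B \<ge> 0" using bd(1)[of 0] t by simp
 have [measurable]: "G \<in> borel_measurable borel" "G' \<in> borel_measurable borel"
  using c by (auto intro: borel_measurable_continuous_onI)
 have xi: "\<bar>x$i\<bar> \<le> t" if "norm x < t" for x :: "real^'n" using component_le_norm_cart[of x i] that by linarith
 have i1: "integrable lborel (\<lambda>x. (ow \<gamma> x * ((1 + \<gamma>$i) * G x + x$i * G' x)) *\<^sub>R cpow (z + 1) (?u x))"
 proof (rule bint_integrable[OF \<gamma> t, where B="(1 + \<gamma>$i) * B + t * B"])
  fix x :: "real^'n" assume x: "norm x < t"
  have "\<bar>(1 + \<gamma>$i) * G x + x$i * G' x\<bar> \<le> (1 + \<gamma>$i) * \<bar>G x\<bar> + \<bar>x$i\<bar> * \<bar>G' x\<bar>"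
   using abs_triangle_ineq[of "(1 + \<gamma>$i) * G x" "x$i * G' x"] g by (simp add: abs_mult)
  also have "... \<le> (1 + \<gamma>$i) * B + t * B"
   using bd x xi g t by (intro add_mono mult_left_mono mult_mono) auto
  finally show "\<bar>(1 + \<gamma>$i) * G x + x$i * G' x\<bar> \<le> (1 + \<gamma>$i) * B + t * B" .
 qed (use z in simp, measurable)
 have i2: "integrable lborel (\<lambda>x. (ow \<gamma> x * ((x$i)\<^sup>2 * G x)) *\<^sub>R cpow z (?u x))"
 proof (rule bint_integrable[OF \<gamma> t z, where B="t\<^sup>2 * B"])
  fix x :: "real^'n" assume x: "norm x < t"
  have "(x$i)\<^sup>2 \<le> t\<^sup>2" using xi[OF x] t by (metis abs_ge_zero power2_abs power_mono)
  then show "\<bar>(x$i)\<^sup>2 * G x\<bar> \<le> t\<^sup>2 * B" using bd(1)[OF x] by (simp add: abs_mult mult_mono)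
 qed measurable
 define \<Phi> where "\<Phi> = (\<lambda>x. (x$i * wgt \<gamma> x * G x) *\<^sub>R cpow (z + 1) (?u x))"
 define \<Phi>' where "\<Phi>' = (\<lambda>x. (wgt \<gamma> x * ((1 + \<gamma>$i) * G x + x$i * G' x)) *\<^sub>R cpow (z + 1) (?u x)
   - (2 * (z + 1)) * ((wgt \<gamma> x * ((x$i)\<^sup>2 * G x)) *\<^sub>R cpow z (?u x)))"
 have eq: "indicator orth x *\<^sub>R \<Phi>' x = (ow \<gamma> x * ((1 + \<gamma>$i) * G x + x$i * G' x)) *\<^sub>R cpow (z + 1) (?u x)
   - (2 * (z + 1)) * ((ow \<gamma> x * ((x$i)\<^sup>2 * G x)) *\<^sub>R cpow z (?u x))" for x
  by (auto simp: \<Phi>'_def ow_def indicator_def)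
 have int: "integrable lborel (\<lambda>x. indicator orth x *\<^sub>R \<Phi>' x)"
  unfolding eq using i1 i2 by (intro Bochner_Integration.integrable_diff Bochner_Integration.integrable_mult_right)
 have "(LBINT x. indicator orth x *\<^sub>R \<Phi>' x) = 0"
 proof (rule orth_divergence_zero[OF int, where \<Phi>=\<Phi> and i=i], intro conjI)
  fix x :: "real^'n" assume x: "x $ i = 0"
  define W where "W = (\<Prod>j\<in>UNIV - {i}. (x$j) powr (\<gamma>$j))"
  define r where "r = t\<^sup>2 - (norm x)\<^sup>2"
  have u: "?u (x + ax i s) = r - s\<^sup>2" for s unfolding norm_line_sq[OF x] r_def by simp
  have P: "\<Phi> (x + ax i s) = (W * ((s * s powr (\<gamma>$i)) * G (x + ax i s))) *\<^sub>R cpow (z + 1) (r - s\<^sup>2)" for s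
   unfolding \<Phi>_def u wgt_line[OF x] W_def[symmetric] by (simp add: x ac_simps)
  have cc: "continuous_on UNIV (cpow (z + 1))" using z by (intro continuous_cpow) simp
  show "continuous_on {0..} (\<lambda>s. \<Phi> (x + ax i s))"
   unfolding P by (intro continuous_intros powr_weight_cont g continuous_on_compose2[OF c(1)] continuous_on_compose2[OF cc]) auto
  show "\<Phi> x = 0" by (simp add: \<Phi>_def x)
  have "\<forall>\<^sub>F s in at_top. \<Phi> (x + ax i s) = 0"
   using eventually_ge_at_top[of t]
  proof eventually_elim
   case (elim s)
   have "t\<^sup>2 \<le> s\<^sup>2" using elim t by (intro power_mono) auto
   then have "r - s\<^sup>2 \<le> 0" by (simp add: r_def) (smt (verit) zero_le_power2)
   then show ?case unfolding P by (simp add: cpow_def)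
  qed
  then show "((\<lambda>s. \<Phi> (x + ax i s)) \<longlongrightarrow> 0) at_top" by (rule tendsto_eventually)
  have "((\<lambda>s. \<Phi> (x + ax i s)) has_vector_derivative \<Phi>' (x + ax i s)) (at s)" if s: "s > 0" "s \<notin> {sqrt r}" for s
  proof -
   have rs: "r - s\<^sup>2 \<noteq> 0" using s by (metis eq_iff_diff_eq_0 insertI1 real_sqrt_abs abs_of_pos)
   have 1: "((\<lambda>s. W * ((s * s powr (\<gamma>$i)) * G (x + ax i s))) has_real_derivative
     W * ((1 + \<gamma>$i) * s powr (\<gamma>$i) * G (x + ax i s) + G' (x + ax i s) * (s * s powr (\<gamma>$i)))) (at s)"
    by (intro DERIV_cmult DERIV_mult powr_weight_deriv s has_pd_line[OF d])
   have "((\<lambda>s. r - s\<^sup>2) has_vector_derivative - (2 * s)) (at s)"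
    unfolding has_real_derivative_iff_has_vector_derivative[symmetric] by (auto intro!: derivative_eq_intros)
   from vector_diff_chain_at[OF this has_vector_derivative_cpow[OF rs]]
   have 2: "((\<lambda>s. cpow (z + 1) (r - s\<^sup>2)) has_vector_derivative (- (2 * s)) *\<^sub>R ((z + 1) * cpow z (r - s\<^sup>2))) (at s)"
    by (simp add: comp_def)
   from has_vector_derivative_scaleR[OF 1 2]
   have "((\<lambda>s. \<Phi> (x + ax i s)) has_vector_derivative
     (W * ((s * s powr (\<gamma>$i)) * G (x + ax i s))) *\<^sub>R ((- (2 * s)) *\<^sub>R ((z + 1) * cpow z (r - s\<^sup>2)))
     + (W * ((1 + \<gamma>$i) * s powr (\<gamma>$i) * G (x + ax i s) + G' (x + ax i s) * (s * s powr (\<gamma>$i)))) *\<^sub>R cpow (z + 1) (r - s\<^sup>2)) (at s)"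
    unfolding P .
   moreover have "(W * ((s * s powr (\<gamma>$i)) * G (x + ax i s))) *\<^sub>R ((- (2 * s)) *\<^sub>R ((z + 1) * cpow z (r - s\<^sup>2)))
     + (W * ((1 + \<gamma>$i) * s powr (\<gamma>$i) * G (x + ax i s) + G' (x + ax i s) * (s * s powr (\<gamma>$i)))) *\<^sub>R cpow (z + 1) (r - s\<^sup>2)
     = \<Phi>' (x + ax i s)"
   proof -
    define y where "y = x + ax i s"
    have y: "y $ i = s" "wgt \<gamma> y = s powr (\<gamma>$i) * W" "?u y = r - s\<^sup>2"
     unfolding y_def u wgt_line[OF x] W_def by (simp_all add: x)
    show ?thesis unfolding \<Phi>'_def y_def[symmetric] y
     by (simp add: scaleR_conv_of_real algebra_simps power2_eq_square)
   qed
   ultimately show ?thesis by simp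
  qed
  then show "\<exists>S. finite S \<and> (\<forall>s. s > 0 \<longrightarrow> s \<notin> S \<longrightarrow>
    ((\<lambda>s. \<Phi> (x + ax i s)) has_vector_derivative \<Phi>' (x + ax i s)) (at s))"
   by (intro exI[of _ "{sqrt r}"]) auto
 qed
 then show ?thesis
  unfolding eq Bochner_Integration.integral_diff[OF i1 Bochner_Integration.integrable_mult_right[OF i2]]
   integral_mult_right_zero
  by (simp only: right_minus_eq)
qed

subsection \<open>Analytic continuation of the ball integral\<close>

lemma continuous_bounded_ball:
 fixes h :: "real^'n::finite \<Rightarrow> real"
 assumes "continuous_on UNIV h"
 shows "\<exists>B. \<forall>x. norm x < t \<longrightarrow> \<bar>h x\<bar> \<le> B"
proof -
 have "compact (h ` cball 0 t)"
  by (intro compact_continuous_image continuous_on_subset[OF assms]) auto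
 then obtain B where "\<And>y. y \<in> h ` cball 0 t \<Longrightarrow> norm y \<le> B" using compact_imp_bounded bounded_iff by metis
 then show ?thesis by (intro exI[of _ B]) auto
qed

lemma bint_integrable':
 assumes "allpos \<gamma>" "t > 0" "Re z > -1" "continuous_on UNIV h"
 shows "integrable lborel (\<lambda>x. (ow \<gamma> x * h x) *\<^sub>R cpow z (t\<^sup>2 - (norm x)\<^sup>2))"
proof -
 obtain B where "\<And>x. norm x < t \<Longrightarrow> \<bar>h x\<bar> \<le> B" using continuous_bounded_ball[OF assms(4)] by blast
 then show ?thesis by (intro bint_integrable assms borel_measurable_continuous_onI) auto
qed

lemma bint_sum:
 assumes "allpos \<gamma>" "t > 0" "Re z > -1" "\<And>i. continuous_on UNIV (E i)"
 shows "bint \<gamma> t z (\<lambda>x. \<Sum>i\<in>UNIV. E (i::'i::finite) x) = (\<Sum>i\<in>UNIV. bint \<gamma> t z (E i))"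
proof -
 have "bint \<gamma> t z (\<lambda>x. \<Sum>i\<in>UNIV. E i x) = (LBINT x. (\<Sum>i\<in>UNIV. (ow \<gamma> x * E i x) *\<^sub>R cpow z (t\<^sup>2 - (norm x)\<^sup>2)))"
  unfolding bint_def by (simp add: sum_distrib_left scaleR_sum_left)
 also have "... = (\<Sum>i\<in>UNIV. bint \<gamma> t z (E i))"
  unfolding bint_def by (intro Bochner_Integration.integral_sum bint_integrable' assms)
 finally show ?thesis .
qed

lemma bint_scale: "bint \<gamma> t z (\<lambda>x. c * h x) = of_real c * bint \<gamma> t z h"
proof -
 have "bint \<gamma> t z (\<lambda>x. c * h x) = (LBINT x. of_real c * ((ow \<gamma> x * h x) *\<^sub>R cpow z (t\<^sup>2 - (norm x)\<^sup>2)))"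
  unfolding bint_def by (simp add: scaleR_conv_of_real ac_simps)
 then show ?thesis unfolding bint_def integral_mult_right_zero .
qed

lemma bint_add:
 assumes "allpos \<gamma>" "t > 0" "Re z > -1" "continuous_on UNIV f" "continuous_on UNIV g"
 shows "bint \<gamma> t z (\<lambda>x. f x + g x) = bint \<gamma> t z f + bint \<gamma> t z g"
proof -
 have "bint \<gamma> t z (\<lambda>x. f x + g x) = (LBINT x. (ow \<gamma> x * f x) *\<^sub>R cpow z (t\<^sup>2 - (norm x)\<^sup>2) + (ow \<gamma> x * g x) *\<^sub>R cpow z (t\<^sup>2 - (norm x)\<^sup>2))"
  unfolding bint_def by (simp add: distrib_left scaleR_left_distrib)
 then show ?thesis unfolding bint_def
  by (simp only: Bochner_Integration.integral_add[OF bint_integrable'[OF assms(1-4)] bint_integrable'[OF assms(1-3,5)]])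
qed

lemma bint_ibp:
 assumes \<gamma>: "allpos \<gamma>" and t: "t > 0" and z: "Re z > -1" and G: "G \<in> S_ev"
 shows "bint \<gamma> t (z + 1) (\<lambda>x. (1 + \<gamma>$i) * G x + (x$i)\<^sup>2 * Dq i G x) = 2 * (z + 1) * bint \<gamma> t z (\<lambda>x. (x$i)\<^sup>2 * G x)"
proof -
 have c: "continuous_on UNIV G" "continuous_on UNIV (\<lambda>x. x$i * Dq i G x)"
  by (intro continuous_intros S_ev_continuous Dq_S_ev G)+
 obtain B1 B2 where B: "\<And>x. norm x < t \<Longrightarrow> \<bar>G x\<bar> \<le> B1" "\<And>x. norm x < t \<Longrightarrow> \<bar>x$i * Dq i G x\<bar> \<le> B2"
  using continuous_bounded_ball[OF c(1), of t] continuous_bounded_ball[OF c(2), of t] by metis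
 have "(LBINT x. (ow \<gamma> x * ((1 + \<gamma>$i) * G x + x$i * (x$i * Dq i G x))) *\<^sub>R cpow (z + 1) (t\<^sup>2 - (norm x)\<^sup>2))
  = 2 * (z + 1) * (LBINT x. (ow \<gamma> x * ((x$i)\<^sup>2 * G x)) *\<^sub>R cpow z (t\<^sup>2 - (norm x)\<^sup>2))"
  by (rule ball_ibp[OF \<gamma> t z has_pd_S_ev[OF G] c, where B="max B1 B2"]) (use B in \<open>auto simp: le_max_iff_disj\<close>)
 then show ?thesis by (simp add: bint_def power2_eq_square mult.assoc)
qed

text \<open>The Euler operator x . grad, since x_i^2 \<open>Dq i\<close> is x_i d/dx_i.\<close>

definition Lop :: "(real^'n::finite \<Rightarrow> real) \<Rightarrow> real^'n \<Rightarrow> real" where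
 "Lop h x = (\<Sum>i\<in>UNIV. (x$i)\<^sup>2 * Dq i h x)"

lemma continuous_Lop: "h \<in> S_ev \<Longrightarrow> continuous_on UNIV (Lop h)"
 unfolding Lop_def[abs_def] by (intro continuous_intros S_ev_continuous Dq_S_ev)

text \<open>\<open>bint_ibp\<close> with G = \<open>Dq i h\<close>, summed over i: a Laplacian at
  exponent z + 1 becomes an Euler operator at exponent z.\<close>

lemma bint_bessel_lap:
 assumes \<gamma>: "allpos \<gamma>" and t: "t > 0" and z: "Re z > -1" and h: "h \<in> S_ev"
 shows "bint \<gamma> t (z + 1) (bessel_lap \<gamma> h) = 2 * (z + 1) * bint \<gamma> t z (Lop h)"
proof -
 have z1: "Re (z + 1) > -1" using z by simp
 have D: "Dq i h \<in> S_ev" for i by (rule Dq_S_ev[OF h])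
 have "bint \<gamma> t (z + 1) (bessel_lap \<gamma> h) = bint \<gamma> t (z + 1) (\<lambda>x. \<Sum>i\<in>UNIV. (1 + \<gamma>$i) * Dq i h x + (x$i)\<^sup>2 * Dq i (Dq i h) x)"
  using bessel_lap_eq[OF h, of \<gamma>] by (simp add: bint_def)
 also have "... = (\<Sum>i\<in>UNIV. bint \<gamma> t (z + 1) (\<lambda>x. (1 + \<gamma>$i) * Dq i h x + (x$i)\<^sup>2 * Dq i (Dq i h) x))"
  by (intro bint_sum \<gamma> t z1 continuous_intros S_ev_continuous Dq_S_ev D)
 also have "... = (\<Sum>i\<in>UNIV. 2 * (z + 1) * bint \<gamma> t z (\<lambda>x. (x$i)\<^sup>2 * Dq i h x))"
  by (intro sum.cong refl bint_ibp[OF \<gamma> t z D])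
 also have "... = 2 * (z + 1) * (\<Sum>i\<in>UNIV. bint \<gamma> t z (\<lambda>x. (x$i)\<^sup>2 * Dq i h x))"
  by (rule sum_distrib_left[symmetric])
 also have "(\<Sum>i\<in>UNIV. bint \<gamma> t z (\<lambda>x. (x$i)\<^sup>2 * Dq i h x)) = bint \<gamma> t z (Lop h)"
  unfolding Lop_def[abs_def]
  by (intro bint_sum[symmetric] \<gamma> t z continuous_intros S_ev_continuous Dq_S_ev D)
 finally show ?thesis .
qed

text \<open>\<open>bint_ibp\<close> with G = h, summed over i, produces |x|^2 h. Writing |x|^2 as
  t^2 - (t^2 - |x|^2) leaves the exponent z with the factor t^2 and moves the rest to z + 1.\<close>

lemma bint_euler:
 assumes \<gamma>: "allpos \<gamma>" and t: "t > 0" and z: "Re z > -1" and h: "h \<in> S_ev"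
 shows "2 * (z + 1) * of_real (t\<^sup>2) * bint \<gamma> t z h =
  (2 * (z + 1) + of_real (hdim \<gamma>)) * bint \<gamma> t (z + 1) h + bint \<gamma> t (z + 1) (Lop h)"
proof -
 have z1: "Re (z + 1) > -1" using z by simp
 have c: "continuous_on UNIV h" by (rule S_ev_continuous[OF h])
 have n2: "(\<Sum>i\<in>UNIV. (x$i)\<^sup>2) = (norm x)\<^sup>2" for x :: "real^'a"
  by (simp add: norm_vec_def L2_set_def sum_nonneg)
 have "(\<Sum>i\<in>UNIV. bint \<gamma> t (z + 1) (\<lambda>x. (1 + \<gamma>$i) * h x + (x$i)\<^sup>2 * Dq i h x)) =
   (\<Sum>i\<in>UNIV. 2 * (z + 1) * bint \<gamma> t z (\<lambda>x. (x$i)\<^sup>2 * h x))"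
  by (intro sum.cong refl bint_ibp[OF \<gamma> t z h])
 also have "... = 2 * (z + 1) * (\<Sum>i\<in>UNIV. bint \<gamma> t z (\<lambda>x. (x$i)\<^sup>2 * h x))"
  by (rule sum_distrib_left[symmetric])
 also have "(\<Sum>i\<in>UNIV. bint \<gamma> t z (\<lambda>x. (x$i)\<^sup>2 * h x)) = bint \<gamma> t z (\<lambda>x. \<Sum>i\<in>UNIV. (x$i)\<^sup>2 * h x)"
  by (intro bint_sum[symmetric] \<gamma> t z continuous_intros c)
 also have "... = bint \<gamma> t z (\<lambda>x. (norm x)\<^sup>2 * h x)"
  by (simp add: n2 flip: sum_distrib_right)
 also have "(\<Sum>i\<in>UNIV. bint \<gamma> t (z + 1) (\<lambda>x. (1 + \<gamma>$i) * h x + (x$i)\<^sup>2 * Dq i h x)) =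
   bint \<gamma> t (z + 1) (\<lambda>x. \<Sum>i\<in>UNIV. (1 + \<gamma>$i) * h x + (x$i)\<^sup>2 * Dq i h x)"
  by (intro bint_sum[symmetric] \<gamma> t z1 continuous_intros S_ev_continuous Dq_S_ev h)
 also have "(\<lambda>x. \<Sum>i\<in>UNIV. (1 + \<gamma>$i) * h x + (x$i)\<^sup>2 * Dq i h x) = (\<lambda>x. hdim \<gamma> * h x + Lop h x)"
  by (simp add: fun_eq_iff Lop_def sum.distrib hdim_def flip: sum_distrib_right)
 also have "bint \<gamma> t (z + 1) \<dots> = bint \<gamma> t (z + 1) (\<lambda>x. hdim \<gamma> * h x) + bint \<gamma> t (z + 1) (Lop h)"
  by (intro bint_add \<gamma> t z1 continuous_intros c continuous_Lop h)
 finally have 1: "of_real (hdim \<gamma>) * bint \<gamma> t (z + 1) h + bint \<gamma> t (z + 1) (Lop h) = 2 * (z + 1) * bint \<gamma> t z (\<lambda>x. (norm x)\<^sup>2 * h x)"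
  by (simp add: bint_scale)
 have "of_real (t\<^sup>2) * bint \<gamma> t z h = bint \<gamma> t z (\<lambda>x. t\<^sup>2 * h x)"
  by (rule bint_scale[symmetric])
 also have "(\<lambda>x. t\<^sup>2 * h x) = (\<lambda>x. (norm x)\<^sup>2 * h x + (t\<^sup>2 - (norm x)\<^sup>2) * h x)"
  by (simp add: fun_eq_iff algebra_simps)
 also have "bint \<gamma> t z \<dots> = bint \<gamma> t z (\<lambda>x. (norm x)\<^sup>2 * h x) + bint \<gamma> t z (\<lambda>x. (t\<^sup>2 - (norm x)\<^sup>2) * h x)"
  by (intro bint_add \<gamma> t z continuous_intros c)
 also have "bint \<gamma> t z (\<lambda>x. (t\<^sup>2 - (norm x)\<^sup>2) * h x) = bint \<gamma> t (z + 1) h"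
  unfolding bint_def by (subst cpow_add_one[symmetric]) (simp add: scaleR_conv_of_real ac_simps)
 finally have 2: "of_real (t\<^sup>2) * bint \<gamma> t z h = bint \<gamma> t z (\<lambda>x. (norm x)\<^sup>2 * h x) + bint \<gamma> t (z + 1) h" .
 have "2 * (z + 1) * of_real (t\<^sup>2) * bint \<gamma> t z h = 2 * (z + 1) * (of_real (t\<^sup>2) * bint \<gamma> t z h)" by (simp only: mult.assoc)
 also have "... = 2 * (z + 1) * bint \<gamma> t z (\<lambda>x. (norm x)\<^sup>2 * h x) + 2 * (z + 1) * bint \<gamma> t (z + 1) h"
  unfolding 2 by (rule distrib_left)
 finally show ?thesis unfolding 1[symmetric] by (simp add: algebra_simps)
qed

text \<open>The analytic continuation of the normalized kernel, unfolded m times. The right-hand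
  side uses the exponents z + 1 and z + 2 only, so each step moves the half plane of validity one
  unit to the left.\<close>

fun GG :: "real^'n::finite \<Rightarrow> real \<Rightarrow> nat \<Rightarrow> complex \<Rightarrow> (real^'n \<Rightarrow> real) \<Rightarrow> complex" where
 "GG \<gamma> t 0 z h = rGamma (z + 1) * bint \<gamma> t z h"
| "GG \<gamma> t (Suc m) z h = ((2 * (z + 1) + of_real (hdim \<gamma>)) * GG \<gamma> t m (z + 1) h
   + GG \<gamma> t m (z + 2) (bessel_lap \<gamma> h) / 2) / (2 * of_real (t\<^sup>2))"

text \<open>\<open>Lop\<close> is eliminated between \<open>bint_euler\<close> at z and
  \<open>bint_bessel_lap\<close> at z + 1. The factors z + 1 and z + 2 are absorbed by the
  functional equation of \<open>rGamma\<close>, which is how the normalization removes the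
  poles.\<close>

lemma GG_base_step:
 assumes \<gamma>: "allpos \<gamma>" and t: "t > 0" and z: "Re z > -1" and h: "h \<in> S_ev"
 shows "GG \<gamma> t (Suc 0) z h = GG \<gamma> t 0 z h"
proof -
 have z1: "Re (z + 1) > -1" using z by simp
 have r1: "rGamma (z + 1) = (z + 1) * rGamma (z + 2)"
  using rGamma_plus1[of "z + 1"] by (simp add: add.assoc)
 have r2: "rGamma (z + 2) = (z + 2) * rGamma (z + 3)"
  using rGamma_plus1[of "z + 2"] by (simp add: add.assoc)
 have t2: "complex_of_real (t\<^sup>2) \<noteq> 0" using t by simp
 have b: "bint \<gamma> t (z + 2) (bessel_lap \<gamma> h) = 2 * (z + 2) * bint \<gamma> t (z + 1) (Lop h)"
  using bint_bessel_lap[OF \<gamma> t z1 h] by (simp add: add.assoc)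
 have "2 * of_real (t\<^sup>2) * GG \<gamma> t 0 z h = rGamma (z + 2) * (2 * (z + 1) * of_real (t\<^sup>2) * bint \<gamma> t z h)"
  unfolding GG.simps r1 by (simp add: algebra_simps)
 also have "... = rGamma (z + 2) * ((2 * (z + 1) + of_real (hdim \<gamma>)) * bint \<gamma> t (z + 1) h + bint \<gamma> t (z + 1) (Lop h))"
  unfolding bint_euler[OF \<gamma> t z h] ..
 also have "... = (2 * (z + 1) + of_real (hdim \<gamma>)) * (rGamma (z + 2) * bint \<gamma> t (z + 1) h) + (rGamma (z + 3) * bint \<gamma> t (z + 2) (bessel_lap \<gamma> h)) / 2"
  unfolding b r2 by (simp add: algebra_simps)
 also have "... = (2 * (z + 1) + of_real (hdim \<gamma>)) * GG \<gamma> t 0 (z + 1) h + GG \<gamma> t 0 (z + 2) (bessel_lap \<gamma> h) / 2"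
  by (simp add: add.assoc)
 finally show ?thesis unfolding GG.simps(2) using t2 by (simp add: field_simps del: of_real_power)
qed

lemma GG_step:
 assumes \<gamma>: "allpos \<gamma>" and t: "t > 0"
 shows "Re z > - 1 - real m \<Longrightarrow> h \<in> S_ev \<Longrightarrow> GG \<gamma> t (Suc m) z h = GG \<gamma> t m z h"
proof (induction m arbitrary: z h)
 case 0
 then show ?case using GG_base_step[OF \<gamma> t] by simp
next
 case (Suc m)
 have "GG \<gamma> t (Suc m) (z + 1) h = GG \<gamma> t m (z + 1) h"
  "GG \<gamma> t (Suc m) (z + 2) (bessel_lap \<gamma> h) = GG \<gamma> t m (z + 2) (bessel_lap \<gamma> h)"
  using Suc.prems by (auto intro!: Suc.IH bessel_lap_S_ev simp del: GG.simps)
 then show ?case by (simp only: GG.simps(2)[of \<gamma> t "Suc m"] GG.simps(2)[of \<gamma> t m z h])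
qed

lemma GG_stable:
 assumes \<gamma>: "allpos \<gamma>" and t: "t > 0" and h: "h \<in> S_ev" and z: "Re z > - 1 - real m" and "m \<le> m'"
 shows "GG \<gamma> t m' z h = GG \<gamma> t m z h"
 using assms(5)
proof (induction m' rule: dec_induct)
 case (step n)
 then have "Re z > - 1 - real n" using z by simp
 then show ?case using GG_step[OF \<gamma> t _ h] step by (simp del: GG.simps)
qed simp

lemma cpow_has_field_derivative:
 "((\<lambda>z. cpow z u) has_field_derivative cpow z u * of_real (ln u)) (at z)"
proof (cases "u > 0")
 case True
 then have "((\<lambda>z. of_real u powr z :: complex) has_field_derivative of_real u powr z * Ln (of_real u)) (at z)"
  by (auto intro!: derivative_eq_intros)
 then show ?thesis using True by (simp add: cpow_def Ln_of_real)
qed (simp add: cpow_def)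

text \<open>Dominates the derivative of u^s in the exponent. For small u half a power pays for the
  logarithm, hence s > 1/2; for u > 1 the logarithm is at most T.\<close>

lemma log_power_bound:
 fixes u :: real
 assumes "0 < u" "u \<le> T" "1 \<le> T" "1/2 < s" "s \<le> S"
 shows "u powr s * \<bar>ln u\<bar> \<le> 2 + T powr (S + 1)"
proof (cases "u \<le> 1")
 case True
 have "- ln u / 2 \<le> u powr (-1/2)"
  using ln_le_minus_one[of "u powr (-1/2)"] assms by (simp add: ln_powr)
 then have "u powr (1/2) * \<bar>ln u\<bar> \<le> u powr (1/2) * (2 * u powr (-1/2))"
  using True assms by (intro mult_left_mono) (auto simp: ln_le_zero_iff)
 also have "... = 2" using assms by (simp flip: powr_add)
 finally have "u powr (1/2) * \<bar>ln u\<bar> \<le> 2" .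
 moreover have "u powr s \<le> u powr (1/2)" using True assms by (intro powr_mono') auto
 ultimately have "u powr s * \<bar>ln u\<bar> \<le> 2" using mult_right_mono[of "u powr s" "u powr (1/2)" "\<bar>ln u\<bar>"] by linarith
 then show ?thesis by (smt (verit) powr_ge_zero)
next
 case False
 have "u powr s * \<bar>ln u\<bar> \<le> T powr S * T"
 proof (rule mult_mono)
  have "u powr s \<le> u powr S" using False assms by (intro powr_mono) auto
  also have "... \<le> T powr S" using assms by (intro powr_mono2) auto
  finally show "u powr s \<le> T powr S" .
  show "\<bar>ln u\<bar> \<le> T" using ln_le_minus_one[of u] False assms by auto
 qed (use assms in auto)
 also have "... = T powr (S + 1)" using assms by (simp add: powr_add)
 finally show ?thesis by simp
qed

text \<open>For Re z0 > 1 the ball of radius 1/2 around z0 stays in the range of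
  \<open>log_power_bound\<close>. Smaller real parts are reached by the recursion
  \<open>GG\<close>.\<close>

lemma bint_holomorphic:
 assumes \<gamma>: "allpos \<gamma>" and t: "t > 0" and h: "h \<in> S_ev"
 shows "(\<lambda>z. bint \<gamma> t z h) holomorphic_on {z. Re z > 1}"
proof -
 have [measurable]: "h \<in> borel_measurable borel" by (rule S_ev_measurable[OF h])
 have "(\<lambda>z. bint \<gamma> t z h) field_differentiable (at z0)" if z0: "Re z0 > 1" for z0
 proof -
  define K where "K = 2 + (t\<^sup>2 + 1) powr (Re z0 + 1/2 + 1)"
  have "((\<lambda>z. \<integral>x. (ow \<gamma> x * h x) *\<^sub>R cpow z (t\<^sup>2 - (norm x)\<^sup>2) \<partial>lborel) has_field_derivative
    (LBINT x. (ow \<gamma> x * h x) *\<^sub>R (cpow z0 (t\<^sup>2 - (norm x)\<^sup>2) * of_real (ln (t\<^sup>2 - (norm x)\<^sup>2))))) (at z0)"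
  proof (rule deriv_under_integral[where d="1/2" and B="\<lambda>x. K * (ow \<gamma> x * \<bar>h x\<bar>)"])
   fix z assume z: "dist z z0 < 1/2"
   have "\<bar>Re z - Re z0\<bar> < 1/2" using abs_Re_le_cmod[of "z - z0"] z by (simp add: dist_norm)
   then have "Re z > -1" using z0 by linarith
   then show "integrable lborel (\<lambda>x. (ow \<gamma> x * h x) *\<^sub>R cpow z (t\<^sup>2 - (norm x)\<^sup>2))"
    by (intro bint_integrable' \<gamma> t S_ev_continuous h)
  next
   fix x :: "real^'a"
   show "((\<lambda>z. (ow \<gamma> x * h x) *\<^sub>R cpow z (t\<^sup>2 - (norm x)\<^sup>2)) has_field_derivative
     (ow \<gamma> x * h x) *\<^sub>R (cpow z0 (t\<^sup>2 - (norm x)\<^sup>2) * of_real (ln (t\<^sup>2 - (norm x)\<^sup>2)))) (at z0)"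
    unfolding scaleR_conv_of_real by (intro DERIV_cmult cpow_has_field_derivative)
  next
   fix z and x :: "real^'a" assume z: "dist z z0 < 1/2"
   let ?u = "t\<^sup>2 - (norm x)\<^sup>2"
   have "norm (cpow z ?u - cpow z0 ?u) \<le> K * norm (z - z0)"
   proof (rule field_differentiable_bound[where S="ball z0 (1/2)" and f'="\<lambda>z. cpow z ?u * of_real (ln ?u)"])
    fix w assume w: "w \<in> ball z0 (1/2)"
    show "((\<lambda>z. cpow z ?u) has_field_derivative cpow w ?u * of_real (ln ?u)) (at w within ball z0 (1/2))"
     using cpow_has_field_derivative DERIV_subset by blast
    have w': "\<bar>Re w - Re z0\<bar> < 1/2" using abs_Re_le_cmod[of "w - z0"] w by (simp add: dist_norm norm_minus_commute)
    show "norm (cpow w ?u * of_real (ln ?u)) \<le> K"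
    proof (cases "?u > 0")
     case True
     have "?u powr Re w * \<bar>ln ?u\<bar> \<le> 2 + (t\<^sup>2 + 1) powr (Re z0 + 1/2 + 1)"
     proof (rule log_power_bound[OF True])
      show "?u \<le> t\<^sup>2 + 1" using zero_le_power2[of "norm x"] by linarith
      show "1 \<le> t\<^sup>2 + 1" by simp
      show "1/2 < Re w" "Re w \<le> Re z0 + 1/2" using w' z0 by linarith+
     qed
     then show ?thesis using True by (simp add: norm_mult norm_cpow K_def)
    qed (simp add: cpow_def K_def add_nonneg_nonneg)
   qed (use z in \<open>auto simp: dist_commute\<close>)
   then have "(ow \<gamma> x * \<bar>h x\<bar>) * norm (cpow z ?u - cpow z0 ?u) \<le> (ow \<gamma> x * \<bar>h x\<bar>) * (K * norm (z - z0))"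
    by (intro mult_left_mono) (auto simp: ow_nonneg)
   then show "norm ((ow \<gamma> x * h x) *\<^sub>R cpow z ?u - (ow \<gamma> x * h x) *\<^sub>R cpow z0 ?u) \<le> K * (ow \<gamma> x * \<bar>h x\<bar>) * norm (z - z0)"
    by (simp add: scaleR_diff_right[symmetric] abs_mult ow_nonneg ac_simps)
  next
   have "integrable lborel (\<lambda>x. \<bar>ow \<gamma> x * h x\<bar>)" using integrable_ow_S_ev[OF \<gamma> h] by (rule integrable_abs)
   then have "integrable lborel (\<lambda>x. ow \<gamma> x * \<bar>h x\<bar>)" by (simp add: abs_mult ow_nonneg)
   then show "integrable lborel (\<lambda>x. K * (ow \<gamma> x * \<bar>h x\<bar>))" by (rule Bochner_Integration.integrable_mult_right)
  qed simp
  then show ?thesis unfolding bint_def field_differentiable_def by blast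
 qed
 then show ?thesis unfolding holomorphic_on_def by (auto intro: field_differentiable_at_within)
qed

lemma GG_holomorphic:
 assumes \<gamma>: "allpos \<gamma>" and t: "t > 0"
 shows "h \<in> S_ev \<Longrightarrow> (\<lambda>z. GG \<gamma> t m z h) holomorphic_on {z. Re z > 1 - real m}"
proof (induction m arbitrary: h)
 case 0
 then show ?case using bint_holomorphic[OF \<gamma> t 0] by (auto intro!: holomorphic_intros)
next
 case (Suc m)
 have s: "(\<lambda>z. GG \<gamma> t m (z + c) g) holomorphic_on {z. Re z > 1 - real (Suc m)}" if "g \<in> S_ev" "Re c \<ge> 1" for c g
 proof -
  have "(\<lambda>z. z + c) holomorphic_on {z. Re z > 1 - real (Suc m)}" by (intro holomorphic_intros)
  moreover have "(\<lambda>z. z + c) ` {z. Re z > 1 - real (Suc m)} \<subseteq> {z. Re z > 1 - real m}" using that(2) by auto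
  ultimately show ?thesis
   using holomorphic_on_compose_gen[OF _ Suc.IH[OF that(1)]] unfolding comp_def by blast
 qed
 show ?case unfolding GG.simps(2)
  by (intro holomorphic_intros s Suc.prems bessel_lap_S_ev) (use t in auto)
qed

lemma ker_int_eq_bint:
 assumes \<gamma>: "allpos \<gamma>" and t: "t > 0" and h: "h \<in> S_ev" and z: "Re z > -1"
 shows "ker_int \<gamma> t z h = bint \<gamma> t z h"
proof -
 let ?S = "{x::real^'a. x \<in> orth \<and> norm x < t}"
 let ?f = "\<lambda>x. (complex_of_real (t^2 - (norm x)^2)) powr z * complex_of_real (h x * wgt \<gamma> x)"
 have e: "indicator ?S x *\<^sub>R ?f x = (ow \<gamma> x * h x) *\<^sub>R cpow z (t\<^sup>2 - (norm x)\<^sup>2)" for x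
  using ball_pos_iff[OF t, of x] by (auto simp: ow_def cpow_def scaleR_conv_of_real indicator_def)
 have "set_integrable lborel ?S ?f"
  unfolding set_integrable_def e by (intro bint_integrable' \<gamma> t z S_ev_continuous h)
 from set_borel_integral_eq_integral(2)[OF this] show ?thesis
  unfolding ker_int_def bint_def set_lebesgue_integral_def e by simp
qed

text \<open>The definite description in \<open>ker_norm\<close> needs existence and uniqueness. The
  functions \<open>GG\<close> agree where they are valid and glue to an entire function; two entire
  functions that agree for Re z > -1 are equal.\<close>

theorem ker_norm_eq_GG:
 fixes lam :: real
 assumes \<gamma>: "allpos \<gamma>" and t: "t > 0" and h: "h \<in> S_ev" and M: "lam > 1 - real M"
 shows "ker_norm \<gamma> t lam h = Re (GG \<gamma> t M (of_real lam) h)"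
proof -
 \<comment> \<open>The number of steps is chosen so that Re z > 1 - N. By \<open>GG_stable\<close> a
   larger number gives the same value, so on each half plane e is one holomorphic
   \<open>GG\<close>.\<close>
 define e where "e = (\<lambda>z. GG \<gamma> t (nat \<lceil>2 - Re z\<rceil>) z h)"
 have e: "e z = GG \<gamma> t N z h" if "Re z > 1 - real N" for z N
 proof -
  let ?k = "nat \<lceil>2 - Re z\<rceil>"
  have "real ?k \<ge> 2 - Re z" by (rule real_nat_ceiling_ge)
  then have k: "Re z > - 1 - real ?k" by linarith
  show ?thesis
  proof (cases "N \<le> ?k")
   case True
   then show ?thesis unfolding e_def using GG_stable[OF \<gamma> t h, of N z ?k] that by simp
  next
   case False
   then have "?k \<le> N" using nat_le_linear by blast
   from GG_stable[OF \<gamma> t h k this] show ?thesis unfolding e_def by simp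
  qed
 qed
 have "e holomorphic_on (\<Union>N\<in>UNIV. {z. Re z > 1 - real N})"
 proof (rule holomorphic_on_UN_open)
  show "e holomorphic_on {z. Re z > 1 - real N}" for N
   by (rule holomorphic_transform[OF GG_holomorphic[OF \<gamma> t h, of N]]) (use e in auto)
  show "open {z. Re z > 1 - real N}" for N by (rule open_halfspace_Re_gt)
 qed
 moreover have "(\<Union>N\<in>UNIV. {z. Re z > 1 - real N}) = UNIV"
 proof (intro set_eqI iffI UNIV_I)
  fix z :: complex
  obtain N where "real N > 1 - Re z" using reals_Archimedean2 by blast
  then show "z \<in> (\<Union>N\<in>UNIV. {z. Re z > 1 - real N})" by (intro UN_I[of N]) auto
 qed
 ultimately have eh: "e holomorphic_on UNIV" by simp
 have ek: "e z = rGamma (z + 1) * ker_int \<gamma> t z h" if z: "-1 < Re z" for z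
 proof -
  have "e z = GG \<gamma> t 2 z h" using z by (intro e) auto
  also have "... = GG \<gamma> t 0 z h" by (rule GG_stable[OF \<gamma> t h]) (use z in auto)
  finally show ?thesis using ker_int_eq_bint[OF \<gamma> t h z] by simp
 qed
 have "(THE g. g holomorphic_on UNIV \<and> (\<forall>z. -1 < Re z \<longrightarrow> g z = rGamma (z + 1) * ker_int \<gamma> t z h)) = e"
 proof (rule the_equality)
  show "e holomorphic_on UNIV \<and> (\<forall>z. -1 < Re z \<longrightarrow> e z = rGamma (z + 1) * ker_int \<gamma> t z h)" using eh ek by blast
  fix g assume g: "g holomorphic_on UNIV \<and> (\<forall>z. -1 < Re z \<longrightarrow> g z = rGamma (z + 1) * ker_int \<gamma> t z h)"
  show "g = e"
  proof
   fix z
   show "g z = e z"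
   proof (rule analytic_continuation_open[where s="{z. Re z > -1}" and s'=UNIV and f=g and g=e and z=z])
    show "{z. Re z > -1} \<noteq> {}" by (auto intro!: exI[of _ 0])
    show "g z = e z" if "z \<in> {z. Re z > -1}" for z using g ek that by auto
   qed (use g eh open_halfspace_Re_gt in auto)
  qed
 qed
 then show ?thesis unfolding ker_norm_def using e[of M "of_real lam"] M by simp
qed

subsection \<open>Curves of test functions\<close>

text \<open>Curves in the space of test functions: derivatives jointly continuous in t and x, each
  seminorm locally bounded in t. With \<open>deriv_fam\<close>, which asks only for pointwise
  derivatives in t, this suffices to differentiate a functional along the curve.\<close>

definition cfam :: "(real \<Rightarrow> real^'n::finite \<Rightarrow> real) \<Rightarrow> bool" where
 "cfam H \<longleftrightarrow> (\<forall>t. H t \<in> S_ev) \<and> (\<forall>is. continuous_on UNIV (\<lambda>z. pds is (H (fst z)) (snd z))) \<and>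
   (\<forall>N R. \<exists>B. \<forall>t. \<bar>t\<bar> \<le> R \<longrightarrow> sn N (H t) \<le> B)"

definition deriv_fam :: "(real \<Rightarrow> real^'n::finite \<Rightarrow> real) \<Rightarrow> (real \<Rightarrow> real^'n \<Rightarrow> real) \<Rightarrow> bool" where
 "deriv_fam H H' \<longleftrightarrow> (\<forall>t>0. \<forall>y. ((\<lambda>s. H s y) has_real_derivative H' t y) (at t))"

lemma cfam_lin:
 assumes H: "cfam H" and G: "cfam G" and a: "continuous_on UNIV a" and b: "continuous_on UNIV b"
 shows "cfam (\<lambda>t y. a t * H t y + b t * G t y)"
 unfolding cfam_def
proof (intro conjI allI)
 have HS: "H t \<in> S_ev" "G t \<in> S_ev" for t using H G by (auto simp: cfam_def)
 show "(\<lambda>y. a t * H t y + b t * G t y) \<in> S_ev" for t by (rule S_ev_lin[OF HS])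
 show "continuous_on UNIV (\<lambda>z. pds is (\<lambda>y. a (fst z) * H (fst z) y + b (fst z) * G (fst z) y) (snd z))" for "is"
 proof -
  have "pds is (\<lambda>y. a t * H t y + b t * G t y) = (\<lambda>y. a t * pds is (H t) y + b t * pds is (G t) y)" for t
   by (rule pds_lin[OF S_evD(1)[OF HS(1)] S_evD(1)[OF HS(2)]])
  then show ?thesis using H G
   by (auto simp: cfam_def intro!: continuous_intros continuous_on_compose2[OF a] continuous_on_compose2[OF b])
 qed
 fix N R
 obtain BH BG where B: "\<And>t. \<bar>t\<bar> \<le> R \<Longrightarrow> sn N (H t) \<le> BH" "\<And>t. \<bar>t\<bar> \<le> R \<Longrightarrow> sn N (G t) \<le> BG"
  using H G unfolding cfam_def by metis
 have bdd: "\<exists>A. \<forall>t. \<bar>t\<bar> \<le> R \<longrightarrow> \<bar>c t\<bar> \<le> A" if "continuous_on UNIV c" for c :: "real \<Rightarrow> real"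
 proof -
  have "compact (c ` {-R..R})" by (intro compact_continuous_image continuous_on_subset[OF that]) auto
  then obtain A where "\<And>y. y \<in> c ` {-R..R} \<Longrightarrow> norm y \<le> A" using compact_imp_bounded bounded_iff by metis
  moreover have "c t \<in> c ` {-R..R}" if "\<bar>t\<bar> \<le> R" for t using that by (intro imageI) auto
  ultimately show ?thesis by (intro exI[of _ A]) auto
 qed
 obtain A A' where A: "\<And>t. \<bar>t\<bar> \<le> R \<Longrightarrow> \<bar>a t\<bar> \<le> A" "\<And>t. \<bar>t\<bar> \<le> R \<Longrightarrow> \<bar>b t\<bar> \<le> A'"
  using bdd[OF a] bdd[OF b] by metis
 have "sn N (\<lambda>y. a t * H t y + b t * G t y) \<le> sn_count TYPE('a) N * (A * BH + A' * BG)" if t: "\<bar>t\<bar> \<le> R" for t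
 proof -
  have "sn N (\<lambda>y. a t * H t y + b t * G t y) \<le> sn_count TYPE('a) N * (\<bar>a t\<bar> * sn N (H t) + \<bar>b t\<bar> * sn N (G t))"
   by (rule sn_lin_le[OF HS])
  also have "... \<le> sn_count TYPE('a) N * (A * BH + A' * BG)"
  proof (intro mult_left_mono add_mono mult_mono sn_count_nonneg)
   show "0 \<le> A" "0 \<le> A'" using A t abs_ge_zero order_trans by blast+
  qed (use A B t sn_nonneg[OF HS(1)] sn_nonneg[OF HS(2)] in auto)
  finally show ?thesis .
 qed
 then show "\<exists>B. \<forall>t. \<bar>t\<bar> \<le> R \<longrightarrow> sn N (\<lambda>y. a t * H t y + b t * G t y) \<le> B" by blast
qed

text \<open>The order of differentiation is exchanged by differentiating \<open>F s = F a + \<integral> F'\<close> under the integral.\<close>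
lemma deriv_fam_pds:
 assumes H: "cfam H" and H': "cfam H'" and d: "deriv_fam H H'" and "t > 0"
 shows "((\<lambda>s. pds is (H s) y) has_real_derivative pds is (H' t) y) (at t)"
 using \<open>t > 0\<close>
proof (induction "is" arbitrary: t y)
 case Nil
 then show ?case using d by (simp add: deriv_fam_def)
next
 case (Cons i "is")
 \<comment> \<open>Derivatives in t are given for positive times only, so the integration starts at
   a positive base point below t.\<close>
 define a where "a = t / 2"
 have a: "0 < a" "a < t" using Cons.prems by (auto simp: a_def)
 let ?e = "axis i 1 :: real^'a"
 have sm: "smooth_fn (H s)" "smooth_fn (H' s)" for s using H H' S_evD(1) by (auto simp: cfam_def)
 have cH': "continuous_on UNIV (\<lambda>z. pds js (H' (fst z)) (snd z))" for js using H' by (simp add: cfam_def)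
 have ci: "continuous_on A (\<lambda>\<tau>. pds js (H' \<tau>) z)" for A js z
 proof -
  have "continuous_on A (\<lambda>\<tau>. (\<tau>, z))" by (intro continuous_intros)
  from continuous_on_compose2[OF cH'[of js] this] show ?thesis by simp
 qed
 have ftc: "pds is (H s) z = pds is (H a) z + integral {a..s} (\<lambda>\<tau>. pds is (H' \<tau>) z)" if "s \<ge> a" for s z
 proof -
  have "((\<lambda>\<tau>. pds is (H' \<tau>) z) has_integral pds is (H s) z - pds is (H a) z) {a..s}"
  proof (rule fundamental_theorem_of_calculus[OF that])
   fix x assume "x \<in> {a..s}"
   then have "((\<lambda>s. pds is (H s) z) has_real_derivative pds is (H' x) z) (at x)" using a by (intro Cons.IH) auto
   then show "((\<lambda>s. pds is (H s) z) has_vector_derivative pds is (H' x) z) (at x within {a..s})"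
    unfolding has_real_derivative_iff_has_vector_derivative by (rule has_vector_derivative_at_within)
  qed
  from integral_unique[OF this] show ?thesis by simp
 qed
 have key: "pds (i # is) (H s) y = pds (i # is) (H a) y + integral {a..s} (\<lambda>\<tau>. pds (i # is) (H' \<tau>) y)" if s: "s \<ge> a" for s
 proof -
  have "((\<lambda>r. integral (cbox a s) (\<lambda>\<tau>. pds is (H' \<tau>) (y + r *\<^sub>R ?e))) has_field_derivative
    integral (cbox a s) (\<lambda>\<tau>. pds (i # is) (H' \<tau>) (y + 0 *\<^sub>R ?e))) (at 0 within UNIV)"
  proof (rule leibniz_rule_field_derivative)
   show "((\<lambda>r. pds is (H' \<tau>) (y + r *\<^sub>R ?e)) has_field_derivative pds (i # is) (H' \<tau>) (y + r *\<^sub>R ?e)) (at r within UNIV)" for r \<tau>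
    using has_pd_line[OF smooth_fn_has_pd[OF sm(2)]] by simp
   show "(\<lambda>\<tau>. pds is (H' \<tau>) (y + r *\<^sub>R ?e)) integrable_on cbox a s" for r
    by (intro integrable_continuous ci)
   have "continuous_on (UNIV \<times> cbox a s) (\<lambda>z. pds (i # is) (H' (snd z)) (y + fst z *\<^sub>R ?e))"
   proof -
    have "continuous_on (UNIV \<times> cbox a s) (\<lambda>z. (snd z, y + fst z *\<^sub>R ?e))" by (intro continuous_intros)
    from continuous_on_compose2[OF cH'[of "i # is"] this] show ?thesis by (simp del: pds.simps)
   qed
   then show "continuous_on (UNIV \<times> cbox a s) (\<lambda>(r, \<tau>). pds (i # is) (H' \<tau>) (y + r *\<^sub>R ?e))"
    by (simp add: case_prod_beta)
  qed auto
  moreover have "((\<lambda>r. pds is (H a) (y + r *\<^sub>R ?e)) has_field_derivative pds (i # is) (H a) (y + 0 *\<^sub>R ?e)) (at 0)"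
   by (rule has_pd_line[OF smooth_fn_has_pd[OF sm(1)]])
  ultimately have "((\<lambda>r. pds is (H a) (y + r *\<^sub>R ?e) + integral {a..s} (\<lambda>\<tau>. pds is (H' \<tau>) (y + r *\<^sub>R ?e))) has_field_derivative
    pds (i # is) (H a) y + integral {a..s} (\<lambda>\<tau>. pds (i # is) (H' \<tau>) y)) (at 0)"
   unfolding box_real scaleR_zero_left add_0_right by (rule DERIV_add[rotated])
  then have "((\<lambda>r. pds is (H s) (y + r *\<^sub>R ?e)) has_field_derivative
    pds (i # is) (H a) y + integral {a..s} (\<lambda>\<tau>. pds (i # is) (H' \<tau>) y)) (at 0)"
   unfolding ftc[OF s, symmetric] .
  moreover have "((\<lambda>r. pds is (H s) (y + r *\<^sub>R ?e)) has_field_derivative pds (i # is) (H s) (y + 0 *\<^sub>R ?e)) (at 0)"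
   by (rule has_pd_line[OF smooth_fn_has_pd[OF sm(1)]])
  ultimately show ?thesis using DERIV_unique[of "\<lambda>r. pds is (H s) (y + r *\<^sub>R ?e)" _ 0] by (simp del: pds.simps)
 qed
 have "((\<lambda>s. integral {a..s} (\<lambda>\<tau>. pds (i # is) (H' \<tau>) y)) has_real_derivative pds (i # is) (H' t) y) (at t within {a..t + 1})"
  by (rule integral_has_real_derivative[OF ci]) (use a in auto)
 then have di: "((\<lambda>s. integral {a..s} (\<lambda>\<tau>. pds (i # is) (H' \<tau>) y)) has_real_derivative pds (i # is) (H' t) y) (at t)"
  using a by (subst (asm) at_within_interior) auto
 have "((\<lambda>s. pds (i # is) (H a) y + integral {a..s} (\<lambda>\<tau>. pds (i # is) (H' \<tau>) y)) has_real_derivative pds (i # is) (H' t) y) (at t)"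
  using DERIV_add[OF DERIV_const[of "pds (i # is) (H a) y"] di] by (simp only: add_0)
 then show ?case
 proof (rule has_field_derivative_transform_within_open[where S="{a<..}"])
  show "pds (i # is) (H a) y + integral {a..s} (\<lambda>\<tau>. pds (i # is) (H' \<tau>) y) = pds (i # is) (H s) y" if "s \<in> {a<..}" for s
   using key[of s] that by (simp del: pds.simps)
 qed (use a in auto)
qed

section \<open>Functionals along curves of test functions\<close>

lemma dualD:
 assumes "f \<in> S_ev_dual"
 shows "\<phi> \<in> S_ev \<Longrightarrow> \<psi> \<in> S_ev \<Longrightarrow> f (\<lambda>x. a * \<phi> x + b * \<psi> x) = a * f \<phi> + b * f \<psi>"
  and "\<exists>C N. C \<ge> 0 \<and> (\<forall>\<phi>\<in>S_ev. \<bar>f \<phi>\<bar> \<le> C * sn N \<phi>)"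
proof -
 show "\<phi> \<in> S_ev \<Longrightarrow> \<psi> \<in> S_ev \<Longrightarrow> f (\<lambda>x. a * \<phi> x + b * \<psi> x) = a * f \<phi> + b * f \<psi>"
  using assms unfolding S_ev_dual_def by blast
 obtain C N where C: "\<forall>\<phi>\<in>S_ev. \<bar>f \<phi>\<bar> \<le> C * sn N \<phi>"
  using assms unfolding S_ev_dual_def sn_def by blast
 have "\<bar>f \<phi>\<bar> \<le> \<bar>C\<bar> * sn N \<phi>" if "\<phi> \<in> S_ev" for \<phi>
  using C that sn_nonneg[OF that, of N] by (meson abs_ge_self mult_right_mono order_trans)
 then show "\<exists>C N. C \<ge> 0 \<and> (\<forall>\<phi>\<in>S_ev. \<bar>f \<phi>\<bar> \<le> C * sn N \<phi>)"
  by (intro exI[of _ "\<bar>C\<bar>"] exI[of _ N]) auto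
qed

lemma dual_scale: "f \<in> S_ev_dual \<Longrightarrow> \<phi> \<in> S_ev \<Longrightarrow> f (\<lambda>x. a * \<phi> x) = a * f \<phi>"
 using dualD(1)[of f \<phi> \<phi> a 0] by simp

lemma dualI:
 assumes "\<And>\<phi> \<psi> a b. \<phi> \<in> S_ev \<Longrightarrow> \<psi> \<in> S_ev \<Longrightarrow> f (\<lambda>x. a * \<phi> x + b * \<psi> x) = a * f \<phi> + b * f \<psi>"
  and "\<And>\<phi>. \<phi> \<in> S_ev \<Longrightarrow> \<bar>f \<phi>\<bar> \<le> C * sn N \<phi>"
 shows "f \<in> S_ev_dual"
 using assms unfolding S_ev_dual_def sn_def by blast

lemma dual_lin:
 assumes f: "f \<in> S_ev_dual" and g: "g \<in> S_ev_dual"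
 shows "(\<lambda>\<phi>. a * f \<phi> + b * g \<phi>) \<in> S_ev_dual"
proof -
 obtain C N where C: "C \<ge> 0" "\<And>\<phi>. \<phi> \<in> S_ev \<Longrightarrow> \<bar>f \<phi>\<bar> \<le> C * sn N \<phi>" using dualD(2)[OF f] by blast
 obtain D M where D: "D \<ge> 0" "\<And>\<phi>. \<phi> \<in> S_ev \<Longrightarrow> \<bar>g \<phi>\<bar> \<le> D * sn M \<phi>" using dualD(2)[OF g] by blast
 show ?thesis
 proof (rule dualI[where C="\<bar>a\<bar> * C + \<bar>b\<bar> * D" and N="max N M"])
  fix \<phi> \<psi> :: "real^'a \<Rightarrow> real" and p q :: real assume "\<phi> \<in> S_ev" "\<psi> \<in> S_ev"
  then show "a * f (\<lambda>x. p * \<phi> x + q * \<psi> x) + b * g (\<lambda>x. p * \<phi> x + q * \<psi> x)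
    = p * (a * f \<phi> + b * g \<phi>) + q * (a * f \<psi> + b * g \<psi>)"
   by (simp add: dualD(1)[OF f] dualD(1)[OF g] algebra_simps)
 next
  fix \<phi> :: "real^'a \<Rightarrow> real" assume \<phi>: "\<phi> \<in> S_ev"
  have "\<bar>a * f \<phi> + b * g \<phi>\<bar> \<le> \<bar>a\<bar> * \<bar>f \<phi>\<bar> + \<bar>b\<bar> * \<bar>g \<phi>\<bar>"
   using abs_triangle_ineq[of "a * f \<phi>" "b * g \<phi>"] by (simp add: abs_mult)
  also have "... \<le> \<bar>a\<bar> * (C * sn (max N M) \<phi>) + \<bar>b\<bar> * (D * sn (max N M) \<phi>)"
   by (intro add_mono mult_left_mono abs_ge_zero order_trans[OF C(2)[OF \<phi>]] order_trans[OF D(2)[OF \<phi>]] sn_mono[OF \<phi>] C(1) D(1)) auto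
  finally show "\<bar>a * f \<phi> + b * g \<phi>\<bar> \<le> (\<bar>a\<bar> * C + \<bar>b\<bar> * D) * sn (max N M) \<phi>" by (simp add: algebra_simps)
 qed
qed

lemma pds_S_ev_lin: "\<phi> \<in> S_ev \<Longrightarrow> \<psi> \<in> S_ev \<Longrightarrow> pds is (\<lambda>x. a * \<phi> x + b * \<psi> x) = (\<lambda>x. a * pds is \<phi> x + b * pds is \<psi> x)"
 by (intro pds_lin S_evD)

lemma sn_diff_le:
 assumes H: "cfam H" and H': "cfam H'" and d: "deriv_fam H H'"
  and B: "\<And>\<tau>. 0 < \<tau> \<Longrightarrow> \<tau> \<le> R \<Longrightarrow> sn N (H' \<tau>) \<le> B"
  and st: "0 < s" "s \<le> R" "0 < t" "t \<le> R" and a: "\<forall>i. \<alpha> i \<le> N" "length is \<le> N"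
 shows "\<bar>monom \<alpha> y * pds is (H s) y - monom \<alpha> y * pds is (H t) y\<bar> \<le> B * \<bar>s - t\<bar>"
 unfolding real_norm_def[symmetric]
proof (rule field_differentiable_bound[where S="{0<..R}" and f'="\<lambda>\<tau>. monom \<alpha> y * pds is (H' \<tau>) y"])
 fix \<tau> assume \<tau>: "\<tau> \<in> {0<..R}"
 have "((\<lambda>\<tau>. monom \<alpha> y * pds is (H \<tau>) y) has_field_derivative monom \<alpha> y * pds is (H' \<tau>) y) (at \<tau>)"
  using \<tau> by (intro DERIV_cmult deriv_fam_pds[OF H H' d]) auto
 then show "((\<lambda>\<tau>. monom \<alpha> y * pds is (H \<tau>) y) has_field_derivative monom \<alpha> y * pds is (H' \<tau>) y) (at \<tau> within {0<..R})"
  using DERIV_subset by blast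
 have "H' \<tau> \<in> S_ev" using H' by (simp add: cfam_def)
 from sn_upper[OF this a, of y] B[of \<tau>] \<tau> show "norm (monom \<alpha> y * pds is (H' \<tau>) y) \<le> B" by auto
qed (use st in auto)

text \<open>A functional is bounded by one \<open>sn N\<close>, so it is enough that the first-order
  Taylor remainder of the curve is of order (s - t)^2 in that norm; the second derivative curve
  provides this.\<close>

lemma dual_deriv:
 fixes H :: "real \<Rightarrow> real^'n::finite \<Rightarrow> real"
 assumes f: "f \<in> S_ev_dual" and H: "cfam H" and H': "cfam H'" and H'': "cfam H''"
  and d: "deriv_fam H H'" "deriv_fam H' H''" and t: "t > 0"
 shows "((\<lambda>s. f (H s)) has_real_derivative f (H' t)) (at t)"
proof -
 obtain C N where C: "C \<ge> 0" "\<And>\<phi>. \<phi> \<in> S_ev \<Longrightarrow> \<bar>f \<phi>\<bar> \<le> C * sn N \<phi>" using dualD(2)[OF f] by blast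
 define R where "R = t + 1"
 obtain B where B: "\<And>\<tau>. \<bar>\<tau>\<bar> \<le> R \<Longrightarrow> sn N (H'' \<tau>) \<le> B" using H'' unfolding cfam_def by metis
 have HS: "H s \<in> S_ev" "H' s \<in> S_ev" for s using H H' by (auto simp: cfam_def)
 define K where "K = C * (sn_count TYPE('n) N * B)"
 have main: "\<bar>f (H s) - f (H t) - (s - t) * f (H' t)\<bar> \<le> K * \<bar>s - t\<bar> * \<bar>s - t\<bar>" if s: "0 < s" "s \<le> R" for s
 proof -
  define r where "r = (\<lambda>y. 1 * (1 * H s y + (-1) * H t y) + (- (s - t)) * H' t y)"
  have r1: "(\<lambda>y. 1 * H s y + (-1) * H t y) \<in> S_ev" by (rule S_ev_lin[OF HS(1) HS(1)])
  have rS: "r \<in> S_ev" unfolding r_def by (rule S_ev_lin[OF r1 HS(2)])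
  have fr: "f r = f (H s) - f (H t) - (s - t) * f (H' t)"
   unfolding r_def dualD(1)[OF f r1 HS(2)] dualD(1)[OF f HS(1) HS(1)] by (simp add: left_diff_distrib)
  have "sn N r \<le> sn_count TYPE('n) N * (B * \<bar>s - t\<bar> * \<bar>s - t\<bar>)"
  proof (rule sn_least)
   fix \<alpha> :: "'n \<Rightarrow> nat" and "is" :: "'n list" and y assume a: "\<forall>i. \<alpha> i \<le> N" "length is \<le> N"
   let ?F = "\<lambda>s. monom \<alpha> y * pds is (H s) y" and ?F' = "\<lambda>s. monom \<alpha> y * pds is (H' s) y"
   have lip: "\<bar>?F' \<tau> - ?F' t\<bar> \<le> B * \<bar>\<tau> - t\<bar>" if "0 < \<tau>" "\<tau> \<le> R" for \<tau>
    by (rule sn_diff_le[OF H' H'' d(2) _ that _ _ a]) (use B t in \<open>auto simp: R_def\<close>)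
   have "norm ((?F s - (s - t) * ?F' t) - (?F t - (t - t) * ?F' t)) \<le> B * \<bar>s - t\<bar> * norm (s - t)"
   proof (rule field_differentiable_bound[where S="{min s t..max s t}" and f'="\<lambda>\<tau>. ?F' \<tau> - ?F' t"])
    fix \<tau> assume \<tau>: "\<tau> \<in> {min s t..max s t}"
    then have \<tau>p: "0 < \<tau>" "\<tau> \<le> R" "\<bar>\<tau> - t\<bar> \<le> \<bar>s - t\<bar>" using s t by (auto simp: R_def)
    have "((\<lambda>s. ?F s - (s - t) * ?F' t) has_field_derivative ?F' \<tau> - ?F' t) (at \<tau>)"
     using \<tau>p by (auto intro!: derivative_eq_intros deriv_fam_pds[OF H H' d(1)])
    then show "((\<lambda>s. ?F s - (s - t) * ?F' t) has_field_derivative ?F' \<tau> - ?F' t) (at \<tau> within {min s t..max s t})"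
     using DERIV_subset by blast
    have B0: "B \<ge> 0" using B[of t] t sn_nonneg[of "H'' t" N] H'' by (force simp: R_def cfam_def)
    show "norm (?F' \<tau> - ?F' t) \<le> B * \<bar>s - t\<bar>"
     using lip[OF \<tau>p(1,2)] mult_left_mono[OF \<tau>p(3) B0] by simp
   qed auto
   moreover have "monom \<alpha> y * pds is r y = (?F s - (s - t) * ?F' t) - (?F t - (t - t) * ?F' t)"
    unfolding r_def pds_S_ev_lin[OF r1 HS(2)] pds_S_ev_lin[OF HS(1) HS(1)] by (simp add: algebra_simps)
   ultimately show "\<bar>monom \<alpha> y * pds is r y\<bar> \<le> B * \<bar>s - t\<bar> * \<bar>s - t\<bar>" by simp
  qed
  then have "C * sn N r \<le> C * (sn_count TYPE('n) N * (B * \<bar>s - t\<bar> * \<bar>s - t\<bar>))" using C(1) by (rule mult_left_mono)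
  with C(2)[OF rS] show ?thesis unfolding fr by (simp add: K_def ac_simps)
 qed
 have "((\<lambda>s. (f (H s) - f (H t)) / (s - t) - f (H' t)) \<longlongrightarrow> 0) (at t)"
 proof (rule Lim_null_comparison)
  have "((\<lambda>s. K * \<bar>s - t\<bar>) \<longlongrightarrow> K * \<bar>t - t\<bar>) (at t)" by (intro tendsto_intros)
  then show "((\<lambda>s. K * \<bar>s - t\<bar>) \<longlongrightarrow> 0) (at t)" by simp
  have "\<forall>\<^sub>F s in at t. s \<in> {0<..<R}"
   by (rule eventually_at_in_open') (use t in \<open>auto simp: R_def\<close>)
  moreover have "\<forall>\<^sub>F s in at t. s \<noteq> t" by (simp add: eventually_at_filter)
  ultimately show "\<forall>\<^sub>F s in at t. norm ((f (H s) - f (H t)) / (s - t) - f (H' t)) \<le> K * \<bar>s - t\<bar>"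
  proof eventually_elim
   case (elim s)
   have "(f (H s) - f (H t)) / (s - t) - f (H' t) = (f (H s) - f (H t) - (s - t) * f (H' t)) / (s - t)"
    using elim by (simp add: field_simps)
   moreover have "\<bar>f (H s) - f (H t) - (s - t) * f (H' t)\<bar> \<le> K * \<bar>s - t\<bar> * \<bar>s - t\<bar>" using main[of s] elim by simp
   ultimately show ?case using elim by (simp add: abs_divide divide_le_eq)
  qed
 qed
 then show ?thesis unfolding has_field_derivative_iff by (rule LIM_zero_cancel)
qed

text \<open>Derivatives are available for t > 0 only. The Lipschitz estimate between two positive
  times extends to the time 0 by continuity of the curve, for each point and each seminorm.\<close>

lemma dual_limit:
 fixes H :: "real \<Rightarrow> real^'n::finite \<Rightarrow> real"
 assumes f: "f \<in> S_ev_dual" and H: "cfam H" and H': "cfam H'" and d: "deriv_fam H H'"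
 shows "((\<lambda>s. f (H s)) \<longlongrightarrow> f (H 0)) (at_right 0)"
proof -
 obtain C N where C: "C \<ge> 0" "\<And>\<phi>. \<phi> \<in> S_ev \<Longrightarrow> \<bar>f \<phi>\<bar> \<le> C * sn N \<phi>" using dualD(2)[OF f] by blast
 obtain B where B: "\<And>\<tau>. \<bar>\<tau>\<bar> \<le> 1 \<Longrightarrow> sn N (H' \<tau>) \<le> B" using H' unfolding cfam_def by metis
 have HS: "H s \<in> S_ev" for s using H by (auto simp: cfam_def)
 have main: "\<bar>f (H s) - f (H 0)\<bar> \<le> C * (sn_count TYPE('n) N * (B * s))" if s: "0 < s" "s \<le> 1" for s
 proof -
  define r where "r = (\<lambda>y. 1 * H s y + (-1) * H 0 y)"
  have rS: "r \<in> S_ev" unfolding r_def by (rule S_ev_lin[OF HS HS])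
  have fr: "f r = f (H s) - f (H 0)" unfolding r_def dualD(1)[OF f HS HS] by simp
  have "sn N r \<le> sn_count TYPE('n) N * (B * s)"
  proof (rule sn_least)
   fix \<alpha> :: "'n \<Rightarrow> nat" and "is" :: "'n list" and y assume a: "\<forall>i. \<alpha> i \<le> N" "length is \<le> N"
   let ?F = "\<lambda>s. monom \<alpha> y * pds is (H s) y"
   have "continuous_on UNIV (\<lambda>z. pds is (H (fst z)) (snd z))" using H by (simp add: cfam_def)
   from continuous_on_compose2[OF this, of UNIV "\<lambda>s. (s, y)"]
   have "continuous_on UNIV (\<lambda>s. pds is (H s) y)" by (simp add: continuous_intros)
   then have "continuous (at_right 0) (\<lambda>s. pds is (H s) y)"
    by (simp add: continuous_on_eq_continuous_within continuous_at_imp_continuous_at_within)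
   then have "((\<lambda>u. \<bar>?F s - ?F u\<bar>) \<longlongrightarrow> \<bar>?F s - ?F 0\<bar>) (at_right 0)"
    unfolding continuous_within by (intro tendsto_intros)
   moreover have "((\<lambda>u. B * \<bar>s - u\<bar>) \<longlongrightarrow> B * \<bar>s - 0\<bar>) (at_right 0)" by (intro tendsto_intros)
   moreover have "\<forall>\<^sub>F u in at_right 0. \<bar>?F s - ?F u\<bar> \<le> B * \<bar>s - u\<bar>"
    using eventually_at_right_real[OF zero_less_one]
   proof (eventually_elim)
    case (elim u)
    show ?case by (rule sn_diff_le[OF H H' d _ s _ _ a]) (use B elim in auto)
   qed
   ultimately have "\<bar>?F s - ?F 0\<bar> \<le> B * \<bar>s - 0\<bar>" by (intro tendsto_le[OF trivial_limit_at_right_real])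
   moreover have "monom \<alpha> y * pds is r y = ?F s - ?F 0"
    unfolding r_def pds_S_ev_lin[OF HS HS] by (simp add: algebra_simps)
   ultimately show "\<bar>monom \<alpha> y * pds is r y\<bar> \<le> B * s" using s by simp
  qed
  then have "C * sn N r \<le> C * (sn_count TYPE('n) N * (B * s))" using C(1) by (rule mult_left_mono)
  with C(2)[OF rS] show ?thesis unfolding fr by simp
 qed
 have "((\<lambda>s. f (H s) - f (H 0)) \<longlongrightarrow> 0) (at_right 0)"
 proof (rule Lim_null_comparison)
  have "((\<lambda>s. C * (sn_count TYPE('n) N * (B * s))) \<longlongrightarrow> C * (sn_count TYPE('n) N * (B * 0))) (at_right 0)"
   by (intro tendsto_intros)
  then show "((\<lambda>s. C * (sn_count TYPE('n) N * (B * s))) \<longlongrightarrow> 0) (at_right 0)" by simp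
  show "\<forall>\<^sub>F s in at_right 0. norm (f (H s) - f (H 0)) \<le> C * (sn_count TYPE('n) N * (B * s))"
   using eventually_at_right_real[OF zero_less_one]
   by eventually_elim (use main in auto)
 qed
 then show ?thesis by (rule LIM_zero_cancel)
qed

subsection \<open>Radial averages and their derivative in the scaling parameter\<close>

definition rdec :: "(real^'n::finite \<Rightarrow> real) \<Rightarrow> bool" where
 "rdec g \<longleftrightarrow> (\<forall>N. \<exists>C. \<forall>x. (1 + norm x) ^ N * \<bar>g x\<bar> \<le> C)"

lemma rdec_lin:
 assumes "rdec f" "rdec g" shows "rdec (\<lambda>x. a * f x + b * g x)"
 unfolding rdec_def
proof
 fix N
 obtain C D where C: "\<And>x. (1 + norm x) ^ N * \<bar>f x\<bar> \<le> C" "\<And>x. (1 + norm x) ^ N * \<bar>g x\<bar> \<le> D"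
  using assms unfolding rdec_def by metis
 have "(1 + norm x) ^ N * \<bar>a * f x + b * g x\<bar> \<le> \<bar>a\<bar> * C + \<bar>b\<bar> * D" for x
 proof -
  have "(1 + norm x) ^ N * \<bar>a * f x + b * g x\<bar> \<le> (1 + norm x) ^ N * (\<bar>a\<bar> * \<bar>f x\<bar> + \<bar>b\<bar> * \<bar>g x\<bar>)"
   using abs_triangle_ineq[of "a * f x" "b * g x"] by (intro mult_left_mono) (auto simp: abs_mult)
  also have "... = \<bar>a\<bar> * ((1 + norm x) ^ N * \<bar>f x\<bar>) + \<bar>b\<bar> * ((1 + norm x) ^ N * \<bar>g x\<bar>)" by (simp add: algebra_simps)
  also have "... \<le> \<bar>a\<bar> * C + \<bar>b\<bar> * D" by (intro add_mono mult_left_mono C) auto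
  finally show ?thesis .
 qed
 then show "\<exists>C. \<forall>x. (1 + norm x) ^ N * \<bar>a * f x + b * g x\<bar> \<le> C" by blast
qed

lemma rdec_coord:
 assumes "rdec f" shows "rdec (\<lambda>x. x$i * f x)"
 unfolding rdec_def
proof
 fix N
 obtain C where C: "\<And>x. (1 + norm x) ^ Suc N * \<bar>f x\<bar> \<le> C" using assms unfolding rdec_def by metis
 have "(1 + norm x) ^ N * \<bar>x$i * f x\<bar> \<le> C" for x
 proof -
  have "(1 + norm x) ^ N * \<bar>f x\<bar> * \<bar>x$i\<bar> \<le> (1 + norm x) ^ N * \<bar>f x\<bar> * (1 + norm x)"
   using component_le_norm_cart[of x i] by (intro mult_left_mono) auto
  with C[of x] show ?thesis by (simp add: abs_mult ac_simps)
 qed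
 then show "\<exists>C. \<forall>x. (1 + norm x) ^ N * \<bar>x$i * f x\<bar> \<le> C" by blast
qed

lemma rdec_mult_bounded:
 assumes "rdec f" "\<And>x. \<bar>g x\<bar> \<le> B" shows "rdec (\<lambda>x. f x * g x)"
 unfolding rdec_def
proof
 fix N
 obtain C where C: "\<And>x. (1 + norm x) ^ N * \<bar>f x\<bar> \<le> C" using assms(1) unfolding rdec_def by metis
 have "(1 + norm x) ^ N * \<bar>f x * g x\<bar> \<le> C * B" for x
 proof -
  have "(1 + norm x) ^ N * \<bar>f x\<bar> * \<bar>g x\<bar> \<le> C * B"
  proof (intro mult_mono C assms(2))
   have "0 \<le> (1 + norm x) ^ N * \<bar>f x\<bar>" by simp
   then show "0 \<le> C" using C[of x] by linarith
  qed auto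
  then show ?thesis by (simp add: abs_mult ac_simps)
 qed
 then show "\<exists>C. \<forall>x. (1 + norm x) ^ N * \<bar>f x * g x\<bar> \<le> C" by blast
qed

lemma rdec_integrable:
 assumes "allpos \<gamma>" "rdec f" "f \<in> borel_measurable borel"
 shows "integrable lborel (\<lambda>x. ow \<gamma> x * f x)"
 using integrable_ow[of \<gamma> f] assms unfolding rdec_def by simp

lemma has_pd_scale:
 assumes "has_pd i f f'" shows "has_pd i (\<lambda>x. f (t *\<^sub>R x)) (\<lambda>x. t * f' (t *\<^sub>R x))"
 unfolding has_pd_def
proof
 fix x
 have "((\<lambda>s. f (t *\<^sub>R x + ax i s)) has_real_derivative f' (t *\<^sub>R x)) (at (t * 0))"
  using assms unfolding has_pd_def by (simp only: mult_zero_right)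
 moreover have "((\<lambda>s. t * s) has_real_derivative t) (at 0)" by (auto intro!: derivative_eq_intros)
 ultimately have "((\<lambda>s. f (t *\<^sub>R x + ax i (t * s))) has_real_derivative f' (t *\<^sub>R x) * t) (at 0)"
  by (rule DERIV_chain2)
 then show "((\<lambda>s. f (t *\<^sub>R (x + ax i s))) has_real_derivative t * f' (t *\<^sub>R x)) (at 0)"
  by (simp only: scaleR_add_right scaleR_scaleR mult.commute)
qed

text \<open>Continuous partial derivatives give the derivative along a ray: one coordinate direction
  is added at a time, its increment being written with an intermediate point by the mean value
  theorem.\<close>

lemma has_pd_ray:
 assumes d: "\<And>i. has_pd i G (G' i)" and c: "\<And>i. continuous_on UNIV (G' i)"
 shows "((\<lambda>s. G (s *\<^sub>R x)) has_real_derivative (\<Sum>i\<in>UNIV. x$i * G' i (t *\<^sub>R x))) (at t)"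
proof -
 have "((\<lambda>s. G (t *\<^sub>R x + (s - t) *\<^sub>R (\<Sum>i\<in>S. x$i *\<^sub>R axis i 1))) has_real_derivative (\<Sum>i\<in>S. x$i * G' i (t *\<^sub>R x))) (at t)"
  if "finite S" for S
  using that
 proof induction
  case empty
  show ?case by simp
 next
  case (insert i S)
  define c where "c = (\<lambda>s. t *\<^sub>R x + (s - t) *\<^sub>R (\<Sum>i\<in>S. x$i *\<^sub>R axis i 1 :: real^'a))"
  define D where "D = (\<lambda>s. G (c s + ax i ((s - t) * x$i)) - G (c s))"
  have "\<exists>\<xi>. \<bar>\<xi>\<bar> \<le> \<bar>(s - t) * x$i\<bar> \<and> D s = ((s - t) * x$i) * G' i (c s + \<xi> *\<^sub>R axis i 1)" for s
  proof -
   have der: "((\<lambda>r. G (c s + ax i r)) has_real_derivative G' i (c s + ax i r)) (at r)" for r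
    by (rule has_pd_line[OF d])
   consider "(s - t) * x$i = 0" | "0 < (s - t) * x$i" | "(s - t) * x$i < 0" by linarith
   then show ?thesis
   proof cases
    case 1 then show ?thesis by (intro exI[of _ 0]) (auto simp: D_def)
   next
    case 2
    from MVT2[OF 2 der] obtain z where z: "0 < z" "z < (s - t) * x$i"
     "G (c s + ax i ((s - t) * x$i)) - G (c s + ax i 0) = ((s - t) * x$i - 0) * G' i (c s + ax i z)"
     by blast
    then show ?thesis unfolding D_def by (intro exI[of _ z]) auto
   next
    case 3
    from MVT2[OF 3 der] obtain z where z: "(s - t) * x$i < z" "z < 0"
     "G (c s + ax i 0) - G (c s + ax i ((s - t) * x$i)) = (0 - (s - t) * x$i) * G' i (c s + ax i z)"
     by blast
    then show ?thesis unfolding D_def by (intro exI[of _ z]) (auto simp: algebra_simps)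
   qed
  qed
  then obtain \<xi> where \<xi>: "\<And>s. \<bar>\<xi> s\<bar> \<le> \<bar>(s - t) * x$i\<bar>" "\<And>s. D s = ((s - t) * x$i) * G' i (c s + \<xi> s *\<^sub>R axis i 1)"
   by metis
  have "(\<xi> \<longlongrightarrow> 0) (at t)"
  proof (rule Lim_null_comparison)
   have "((\<lambda>s. \<bar>(s - t) * x$i\<bar>) \<longlongrightarrow> \<bar>(t - t) * x$i\<bar>) (at t)" by (intro tendsto_intros)
   then show "((\<lambda>s. \<bar>(s - t) * x$i\<bar>) \<longlongrightarrow> 0) (at t)" by simp
  qed (use \<xi>(1) in auto)
  then have "((\<lambda>s. c s + \<xi> s *\<^sub>R axis i 1) \<longlongrightarrow> (t *\<^sub>R x + (t - t) *\<^sub>R (\<Sum>i\<in>S. x$i *\<^sub>R axis i 1)) + ax i 0) (at t)"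
   unfolding c_def by (intro tendsto_intros)
  moreover have "isCont (G' i) (t *\<^sub>R x)" using c[of i] by (simp add: continuous_on_eq_continuous_at)
  ultimately have "((\<lambda>s. G' i (c s + \<xi> s *\<^sub>R axis i 1)) \<longlongrightarrow> G' i (t *\<^sub>R x)) (at t)"
   by (intro isCont_tendsto_compose[where g="G' i"]) auto
  then have "((\<lambda>s. x$i * G' i (c s + \<xi> s *\<^sub>R axis i 1)) \<longlongrightarrow> x$i * G' i (t *\<^sub>R x)) (at t)" by (intro tendsto_intros)
  moreover have "\<forall>\<^sub>F s in at t. x$i * G' i (c s + \<xi> s *\<^sub>R axis i 1) = (D s - D t) / (s - t)"
   unfolding eventually_at_filter by (intro always_eventually) (auto simp: \<xi>(2))
  ultimately have "(D has_real_derivative x$i * G' i (t *\<^sub>R x)) (at t)"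
   unfolding has_field_derivative_iff by (rule Lim_transform_eventually)
  from DERIV_add[OF this insert.IH] show ?case
   using insert.hyps by (simp add: D_def c_def algebra_simps)
 qed
 from this[OF finite] have "((\<lambda>s. G (t *\<^sub>R x + (s - t) *\<^sub>R (\<Sum>i\<in>UNIV. x$i *\<^sub>R axis i 1))) has_real_derivative (\<Sum>i\<in>UNIV. x$i * G' i (t *\<^sub>R x))) (at t)" .
 moreover have "(\<Sum>i\<in>UNIV. x$i *\<^sub>R axis i 1) = x" using basis_expansion[of x] by (simp add: scalar_mult_eq_scaleR)
 ultimately show ?thesis by (simp add: algebra_simps)
qed

definition rw :: "real^'n::finite \<Rightarrow> (real^'n \<Rightarrow> real) \<Rightarrow> (real^'n) measure" where
 "rw \<gamma> w = density lborel (\<lambda>x. ennreal (ow \<gamma> x * w x))"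

text \<open>Two instances occur: the indicator \<open>bw 0\<close> of the unit ball for existence,
  and the half Gaussian \<open>hw\<close> for uniqueness.\<close>

definition weight :: "(real^'n::finite \<Rightarrow> real) \<Rightarrow> bool" where
 "weight w \<longleftrightarrow> w \<in> borel_measurable borel \<and> (\<forall>x. 0 \<le> w x) \<and> rdec w"

lemma moments_rw:
 assumes \<gamma>: "allpos \<gamma>" and w: "weight w"
 shows "moments (rw \<gamma> w)"
 unfolding moments_def
proof (intro conjI allI)
 have [measurable]: "w \<in> borel_measurable borel" and w0: "\<And>x. 0 \<le> w x" and wr: "rdec w" using w by (auto simp: weight_def)
 show "sets (rw \<gamma> w) = sets borel" by (simp add: rw_def)
 fix N
 have "integrable lborel (\<lambda>x. ow \<gamma> x *\<^sub>R (w x * (1 + norm x) ^ N))"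
 proof (rule integrable_ow[OF \<gamma>])
  fix M
  obtain C where "\<And>x. (1 + norm x) ^ (M + N) * \<bar>w x\<bar> \<le> C" using wr unfolding rdec_def by metis
  then show "\<exists>C. \<forall>x. (1 + norm x) ^ M * norm (w x * (1 + norm x) ^ N) \<le> C"
   by (intro exI[of _ C]) (simp add: abs_mult power_add ac_simps)
 qed measurable
 then show "integrable (rw \<gamma> w) (\<lambda>x. (1 + norm x) ^ N)"
  unfolding rw_def using w0 ow_nonneg[of \<gamma>] by (subst integrable_density) (auto simp: ac_simps)
qed

lemma avg_rw:
 assumes \<gamma>: "allpos \<gamma>" and w: "weight w" and p: "(t, \<sigma>, \<phi>) \<in> prm"
 shows "avg (rw \<gamma> w) \<gamma> (t, \<sigma>, \<phi>) y = (LBINT x. ow \<gamma> x * (w x * \<sigma> x * TK \<gamma> \<phi> (t *\<^sub>R x) y))"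
proof -
 have [measurable]: "w \<in> borel_measurable borel" and w0: "\<And>x. 0 \<le> w x" using w by (auto simp: weight_def)
 have [measurable]: "\<sigma> \<in> borel_measurable borel" and \<phi>: "\<phi> \<in> S_ev" using prmD[OF p] by auto
 have [measurable]: "(\<lambda>x. TK \<gamma> \<phi> (t *\<^sub>R x) y) \<in> borel_measurable borel"
  by (intro borel_measurable_continuous_onI continuous_intros \<gamma> \<phi>)
 show ?thesis unfolding avg_def rw_def using w0 ow_nonneg[of \<gamma>] by (subst integral_density) (auto simp: ac_simps)
qed

lemma avg_lin:
 assumes \<delta>: "allpos \<delta>" and \<mu>: "moments \<mu>" and p: "(t, \<sigma>, \<phi>) \<in> prm" "(t, \<sigma>, \<psi>) \<in> prm"
 shows "avg \<mu> \<delta> (t, \<sigma>, \<lambda>x. a * \<phi> x + b * \<psi> x) y = a * avg \<mu> \<delta> (t, \<sigma>, \<phi>) y + b * avg \<mu> \<delta> (t, \<sigma>, \<psi>) y"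
proof -
 have "avg \<mu> \<delta> (t, \<sigma>, \<lambda>x. a * \<phi> x + b * \<psi> x) y =
   (\<integral>x. a * (\<sigma> x * TK \<delta> \<phi> (t *\<^sub>R x) y) + b * (\<sigma> x * TK \<delta> \<psi> (t *\<^sub>R x) y) \<partial>\<mu>)"
  unfolding avg_def using prmD(3)[OF p(1)] prmD(3)[OF p(2)] by (simp add: TK_lin[OF \<delta>] algebra_simps)
 then show ?thesis
  using avg_integrable[OF \<delta> \<mu> p(1)] avg_integrable[OF \<delta> \<mu> p(2)] by (simp add: avg_def)
qed

text \<open>With \<open>\<nabla>q = - x p\<close>, integration by parts turns the radial derivative into the Bessel Laplacian.\<close>
lemma avg_deriv:
 fixes \<gamma> :: "real^'n::finite"
 assumes \<gamma>: "allpos \<gamma>" and w: "weight w" and p: "(t, \<sigma>, \<phi>) \<in> prm" and q: "(t, \<sigma>', \<phi>) \<in> prm"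
  and cp: "continuous_on UNIV (\<lambda>x. w x * \<sigma> x)" and cq: "continuous_on UNIV (\<lambda>x. w x * \<sigma>' x)"
  and d: "\<And>i. has_pd i (\<lambda>x. w x * \<sigma>' x) (\<lambda>x. - (x$i * (w x * \<sigma> x)))"
 shows "((\<lambda>s. avg (rw \<gamma> w) \<gamma> (s, \<sigma>, \<phi>) y) has_real_derivative t * avg (rw \<gamma> w) \<gamma> (t, \<sigma>', bessel_lap \<gamma> \<phi>) y) (at t)"
proof -
 define P where "P = (\<lambda>x. w x * \<sigma> x)"
 define Q where "Q = (\<lambda>x. w x * \<sigma>' x)"
 define G where "G = (\<lambda>z. TK \<gamma> \<phi> z y)"
 have \<phi>: "\<phi> \<in> S_ev" using prmD[OF p] by auto
 have wr: "rdec w" using w by (simp add: weight_def)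
 have PQ: "rdec P" "rdec Q" unfolding P_def Q_def using rdec_mult_bounded[OF wr] prmD(2)[OF p] prmD(2)[OF q] by auto
 have [measurable]: "P \<in> borel_measurable borel" "Q \<in> borel_measurable borel"
  using cp cq unfolding P_def Q_def by (auto intro: borel_measurable_continuous_onI)
 have G: "G \<in> S_ev" unfolding G_def by (rule TK_S_ev(2)[OF \<gamma> \<phi>])
 have [measurable]: "(\<lambda>x. g (s *\<^sub>R x)) \<in> borel_measurable borel" if "g \<in> S_ev" for s and g :: "real^'n \<Rightarrow> real"
  by (intro borel_measurable_continuous_onI continuous_on_compose2[OF S_ev_continuous[OF that, of UNIV]] continuous_intros) auto
 have cg: "continuous_on UNIV (\<lambda>x. g (t *\<^sub>R x))" if "g \<in> S_ev" for g :: "real^'n \<Rightarrow> real"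
  by (intro continuous_on_compose2[OF S_ev_continuous[OF that, of UNIV]] continuous_intros) auto
 define K where "K = sn 1 G"
 have K: "\<bar>z$i * Dq i G z\<bar> \<le> K" for i z
 proof -
  have "pds [i] G z = z$i * Dq i G z" using pd_eq_Dq[OF S_evD(1,2)[OF G]] by (simp add: fun_eq_iff)
  with sn_upper[OF G, of "\<lambda>_. 0" 1 "[i]" z] show ?thesis by (simp add: K_def monom_def)
 qed
 have ray: "((\<lambda>s. G (s *\<^sub>R x)) has_real_derivative (\<Sum>i\<in>UNIV. x$i * ((r *\<^sub>R x)$i * Dq i G (r *\<^sub>R x)))) (at r)" for x r
  by (rule has_pd_ray[OF has_pd_S_ev[OF G]]) (intro continuous_intros S_ev_continuous Dq_S_ev G)
 have "((\<lambda>s. \<integral>x. ow \<gamma> x * (P x * G (s *\<^sub>R x)) \<partial>lborel) has_real_derivative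
   (LBINT x. ow \<gamma> x * (P x * (\<Sum>i\<in>UNIV. x$i * ((t *\<^sub>R x)$i * Dq i G (t *\<^sub>R x)))))) (at t)"
 proof (rule deriv_under_integral[where d=1])
  show "integrable lborel (\<lambda>x. ow \<gamma> x * (P x * G (s *\<^sub>R x)))" for s
   by (rule rdec_integrable[OF \<gamma> rdec_mult_bounded[OF PQ(1) S_ev_bounded[OF G]]]) (use G in measurable)
  show "((\<lambda>s. ow \<gamma> x * (P x * G (s *\<^sub>R x))) has_real_derivative
    ow \<gamma> x * (P x * (\<Sum>i\<in>UNIV. x$i * ((t *\<^sub>R x)$i * Dq i G (t *\<^sub>R x))))) (at t)" for x
   by (intro DERIV_cmult ray)
  show "norm (ow \<gamma> x * (P x * G (s *\<^sub>R x)) - ow \<gamma> x * (P x * G (t *\<^sub>R x)))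
    \<le> ow \<gamma> x * (\<Sum>i\<in>UNIV. \<bar>x$i * P x\<bar> * K) * norm (s - t)" for s x
  proof -
   have "norm (G (s *\<^sub>R x) - G (t *\<^sub>R x)) \<le> (\<Sum>i\<in>UNIV. \<bar>x$i\<bar> * K) * norm (s - t)"
   proof (rule field_differentiable_bound[where S=UNIV])
    show "((\<lambda>s. G (s *\<^sub>R x)) has_field_derivative (\<Sum>i\<in>UNIV. x$i * ((r *\<^sub>R x)$i * Dq i G (r *\<^sub>R x)))) (at r within UNIV)" for r
     by (rule ray)
    show "norm (\<Sum>i\<in>UNIV. x$i * ((r *\<^sub>R x)$i * Dq i G (r *\<^sub>R x))) \<le> (\<Sum>i\<in>UNIV. \<bar>x$i\<bar> * K)" for r
     unfolding real_norm_def
     by (rule order_trans[OF sum_abs]) (unfold abs_mult[of "x$_"], intro sum_mono mult_left_mono K abs_ge_zero)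
   qed auto
   then have "ow \<gamma> x * \<bar>P x\<bar> * norm (G (s *\<^sub>R x) - G (t *\<^sub>R x)) \<le> ow \<gamma> x * \<bar>P x\<bar> * ((\<Sum>i\<in>UNIV. \<bar>x$i\<bar> * K) * norm (s - t))"
    using ow_nonneg[of \<gamma> x] by (intro mult_left_mono) auto
   also have "... = ow \<gamma> x * (\<Sum>i\<in>UNIV. \<bar>x$i * P x\<bar> * K) * norm (s - t)"
    by (simp add: sum_distrib_left sum_distrib_right abs_mult ac_simps)
   finally show ?thesis using ow_nonneg[of \<gamma> x]
    by (simp add: right_diff_distrib[symmetric] abs_mult ac_simps)
  qed
  have "integrable lborel (\<lambda>x. \<Sum>i\<in>UNIV. ow \<gamma> x * \<bar>x$i * P x\<bar> * K)"
  proof (intro Bochner_Integration.integrable_sum integrable_mult_left)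
   show "integrable lborel (\<lambda>x. ow \<gamma> x * \<bar>x$i * P x\<bar>)" for i
   proof (rule rdec_integrable[OF \<gamma>])
    show "rdec (\<lambda>x. \<bar>x$i * P x\<bar>)" using rdec_coord[OF PQ(1), of i] unfolding rdec_def by simp
   qed measurable
  qed
  then show "integrable lborel (\<lambda>x. ow \<gamma> x * (\<Sum>i\<in>UNIV. \<bar>x$i * P x\<bar> * K))"
   by (simp add: sum_distrib_left ac_simps)
 qed simp
 moreover have "(LBINT x. ow \<gamma> x * (P x * (\<Sum>i\<in>UNIV. x$i * ((t *\<^sub>R x)$i * Dq i G (t *\<^sub>R x))))) =
   t * (LBINT x. ow \<gamma> x * (Q x * bessel_lap \<gamma> G (t *\<^sub>R x)))"
 proof -
  define E where "E = (\<lambda>i x. Q x * Dq i G (t *\<^sub>R x))"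
  define E' where "E' = (\<lambda>i x. - (x$i * P x) * Dq i G (t *\<^sub>R x) + Q x * (t * ((t *\<^sub>R x)$i * Dq i (Dq i G) (t *\<^sub>R x))))"
  have DG: "Dq i G \<in> S_ev" "Dq i (Dq i G) \<in> S_ev" for i by (intro Dq_S_ev G)+
  have hE: "has_pd i (E i) (E' i)" for i
  proof -
   have "has_pd i (\<lambda>x. Dq i G (t *\<^sub>R x)) (\<lambda>x. t * ((t *\<^sub>R x)$i * Dq i (Dq i G) (t *\<^sub>R x)))"
    by (rule has_pd_scale[OF has_pd_S_ev[OF DG(1)]])
   from has_pd_mult[OF d[of i] this] show ?thesis by (simp add: E_def E'_def P_def Q_def)
  qed
  have rE: "rdec (E i)" for i unfolding E_def by (rule rdec_mult_bounded[OF PQ(2) S_ev_bounded[OF DG(1)]])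
  have rPx: "rdec (\<lambda>x. x$i * P x * Dq i G (t *\<^sub>R x))" for i
   by (rule rdec_mult_bounded[OF rdec_coord[OF PQ(1)] S_ev_bounded[OF DG(1)]])
  have rQx: "rdec (\<lambda>x. x$i * Q x * Dq i (Dq i G) (t *\<^sub>R x))" for i
   by (rule rdec_mult_bounded[OF rdec_coord[OF PQ(2)] S_ev_bounded[OF DG(2)]])
  have E'e: "E' i = (\<lambda>x. (-1) * (x$i * P x * Dq i G (t *\<^sub>R x)) + t\<^sup>2 * (x$i * Q x * Dq i (Dq i G) (t *\<^sub>R x)))" for i
   by (simp add: E'_def fun_eq_iff power2_eq_square)
  have rE': "rdec (E' i)" for i unfolding E'e by (rule rdec_lin[OF rPx rQx])
  have cE: "continuous_on UNIV (E i)" "continuous_on UNIV (E' i)" for i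
   using cp cq cg[OF DG(1)[of i]] cg[OF DG(2)[of i]] unfolding E_def E'e P_def[symmetric] Q_def[symmetric] by (auto intro!: continuous_intros)
  then have [measurable]: "E i \<in> borel_measurable borel" "E' i \<in> borel_measurable borel" for i
   by (auto intro: borel_measurable_continuous_onI)
  have z: "(LBINT x. ow \<gamma> x * ((1 + \<gamma>$i) * E i x + x$i * E' i x)) = 0" for i
   by (rule orth_ibp[OF \<gamma> hE cE]) (use rE rE' in \<open>auto simp: rdec_def\<close>)
  have iz: "integrable lborel (\<lambda>x. ow \<gamma> x * ((1 + \<gamma>$i) * E i x + x$i * E' i x))" for i
   using rdec_integrable[OF \<gamma> rdec_lin[OF rE[of i] rdec_coord[OF rE'[of i], of i], of "1 + \<gamma>$i" 1]] by simp
  define L where "L = (\<lambda>x. P x * (\<Sum>i\<in>UNIV. x$i * ((t *\<^sub>R x)$i * Dq i G (t *\<^sub>R x))))"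
  define R where "R = (\<lambda>x. Q x * bessel_lap \<gamma> G (t *\<^sub>R x))"
  have BG: "bessel_lap \<gamma> G \<in> S_ev" by (rule bessel_lap_S_ev[OF G])
  have iR: "integrable lborel (\<lambda>x. ow \<gamma> x * R x)" unfolding R_def
   by (rule rdec_integrable[OF \<gamma> rdec_mult_bounded[OF PQ(2) S_ev_bounded[OF BG]]]) (use BG in measurable)
  \<comment> \<open>The integrands that vanish by \<open>orth_ibp\<close>, summed and multiplied by
    t, are exactly the difference of the two integrands to be compared.\<close>
  have eq: "(\<Sum>i\<in>UNIV. ow \<gamma> x * ((1 + \<gamma>$i) * E i x + x$i * E' i x)) * t = t * (ow \<gamma> x * R x) - ow \<gamma> x * L x" for x
   unfolding E_def E'e R_def L_def bessel_lap_eq[OF G]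
   by (simp add: sum_distrib_left sum_distrib_right sum_subtractf[symmetric] algebra_simps power2_eq_square)
  have "(LBINT x. t * (ow \<gamma> x * R x) - ow \<gamma> x * L x) = 0"
   unfolding eq[symmetric] using iz z by simp
  moreover have "integrable lborel (\<lambda>x. ow \<gamma> x * L x)"
  proof -
   have "integrable lborel (\<lambda>x. t * (ow \<gamma> x * R x) - (\<Sum>i\<in>UNIV. ow \<gamma> x * ((1 + \<gamma>$i) * E i x + x$i * E' i x)) * t)"
    using iR iz by auto
   then show ?thesis unfolding eq by simp
  qed
  ultimately show ?thesis using iR unfolding L_def R_def by simp
 qed
 ultimately have main: "((\<lambda>s. \<integral>x. ow \<gamma> x * (P x * G (s *\<^sub>R x)) \<partial>lborel) has_real_derivative
   t * (LBINT x. ow \<gamma> x * (Q x * bessel_lap \<gamma> G (t *\<^sub>R x)))) (at t)" by simp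
 have "avg (rw \<gamma> w) \<gamma> (s, \<sigma>, \<phi>) y = (LBINT x. ow \<gamma> x * (P x * G (s *\<^sub>R x)))" for s
  using avg_rw[OF \<gamma> w prm_cong_t[OF p]] by (simp add: P_def G_def)
 moreover have "(t, \<sigma>', bessel_lap \<gamma> \<phi>) \<in> prm" using q bessel_lap_S_ev[OF \<phi>] by (simp add: prm_def)
 then have "avg (rw \<gamma> w) \<gamma> (t, \<sigma>', bessel_lap \<gamma> \<phi>) y = (LBINT x. ow \<gamma> x * (Q x * bessel_lap \<gamma> G (t *\<^sub>R x)))"
  using avg_rw[OF \<gamma> w] TK_bessel_lap'[OF \<gamma> \<phi>] by (simp add: Q_def G_def)
 ultimately show ?thesis using main by simp
qed

lemma cfam_avg:
 assumes \<delta>: "allpos \<delta>" and \<mu>: "moments \<mu>" and p: "\<And>t. (t, \<sigma>, \<phi>) \<in> prm"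
 shows "cfam (\<lambda>t. avg \<mu> \<delta> (t, \<sigma>, \<phi>))"
 unfolding cfam_def
proof (intro conjI allI)
 show "avg \<mu> \<delta> (t, \<sigma>, \<phi>) \<in> S_ev" for t by (rule avg_S_ev[OF \<delta> \<mu> p])
 show "continuous_on UNIV (\<lambda>z. pds is (avg \<mu> \<delta> (fst z, \<sigma>, \<phi>)) (snd z))" for "is" by (rule avg_pds_continuous[OF \<delta> \<mu> p])
 fix N R
 obtain C M where "\<forall>t \<sigma> \<phi>. (t, \<sigma>, \<phi>) \<in> prm \<longrightarrow> \<bar>t\<bar> \<le> \<bar>R\<bar> \<longrightarrow> sn N (avg \<mu> \<delta> (t, \<sigma>, \<phi>)) \<le> C * sn M \<phi>"
  using avg_bound[OF \<delta> \<mu> abs_ge_zero[of R], of N] by blast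
 then show "\<exists>B. \<forall>t. \<bar>t\<bar> \<le> R \<longrightarrow> sn N (avg \<mu> \<delta> (t, \<sigma>, \<phi>)) \<le> B"
  using p by (intro exI[of _ "C * sn M \<phi>"]) auto
qed

text \<open>At scale 0 every \<open>gdist\<close> is the vector of the absolute values of the
  coordinates of y, whatever the angles, and \<phi> is even in each coordinate.\<close>

lemma avg_zero:
 assumes \<gamma>: "allpos \<gamma>" and w: "weight w" and p: "(0, \<sigma>, \<phi>) \<in> prm"
 shows "avg (rw \<gamma> w) \<gamma> (0, \<sigma>, \<phi>) y = (LBINT x. ow \<gamma> x * (w x * \<sigma> x)) * (nu_mass \<gamma> * \<phi> y)"
proof -
 have \<phi>: "\<phi> \<in> S_ev" using prmD[OF p] by auto
 have abs: "\<phi> (\<chi> i. if i \<in> S then \<bar>y$i\<bar> else y$i) = \<phi> y" if "finite S" for S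
  using that
 proof induction
  case (insert i S)
  let ?z = "\<chi> j. if j \<in> S then \<bar>y$j\<bar> else y$j"
  have "(\<chi> j. if j \<in> insert i S then \<bar>y$j\<bar> else y$j) = (if y$i < 0 then mirror i ?z else ?z)"
   using insert.hyps by (auto simp: vec_eq_iff mirror_component)
  moreover have "\<phi> (mirror i ?z) = \<phi> ?z" using S_evD(2)[OF \<phi>] unfolding even_fn_mirror by blast
  ultimately show ?case using insert.IH by simp
 qed simp
 have "gdist 0 y a = (\<chi> i. \<bar>y$i\<bar>)" for a by (simp add: gdist_def vec_eq_iff)
 then have "TK \<gamma> \<phi> 0 y = nu_mass \<gamma> * \<phi> y"
  using abs[OF finite_class.finite_UNIV] measure_nu[OF \<gamma>] by (simp add: TK_def nu_def)
 then show ?thesis unfolding avg_rw[OF \<gamma> w p] by (simp add: mult.assoc[symmetric])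
qed

subsection \<open>The solution operators\<close>

lemma pos_powr_deriv:
 assumes "(l::real) > 0"
 shows "((\<lambda>u. if u > 0 then u powr (l + 1) else 0) has_real_derivative (l + 1) * (if u > 0 then u powr l else 0)) (at u)"
proof (cases "u = 0")
 case True
 have "((\<lambda>h. (if h > 0 then h powr (l + 1) else 0) / h) \<longlongrightarrow> 0) (at 0)"
 proof (rule Lim_null_comparison)
  show "\<forall>\<^sub>F h in at 0. norm ((if h > 0 then h powr (l + 1) else 0) / h) \<le> \<bar>h\<bar> powr l"
   by (intro always_eventually) (auto simp: powr_add)
  have "((\<lambda>h. \<bar>h\<bar> powr l) \<longlongrightarrow> \<bar>0\<bar> powr l) (at 0)"
   using assms by (intro tendsto_powr' tendsto_intros) auto
  then show "((\<lambda>h. \<bar>h\<bar> powr l) \<longlongrightarrow> 0) (at (0::real))" by simp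
 qed
 then show ?thesis by (simp add: True has_field_derivative_iff)
next
 case False
 then consider "u > 0" | "u < 0" by linarith
 then show ?thesis
 proof cases
  case 1
  then have "((\<lambda>u. u powr (l + 1)) has_real_derivative (l + 1) * u powr l) (at u)"
   by (auto intro!: derivative_eq_intros)
  then have "((\<lambda>u. if u > 0 then u powr (l + 1) else 0) has_real_derivative (l + 1) * u powr l) (at u)"
   by (rule has_field_derivative_transform_within_open[where S="{0<..}"]) (use 1 in auto)
  then show ?thesis using 1 by simp
 next
  case 2
  have "((\<lambda>u. 0) has_real_derivative 0) (at u)" by simp
  then have "((\<lambda>u. if u > 0 then u powr (l + 1) else 0) has_real_derivative 0) (at u)"
   by (rule has_field_derivative_transform_within_open[where S="{..<0}"]) (use 2 in auto)
  then show ?thesis using 2 by simp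
 qed
qed

lemma bw_pos_part: "bw l x = (if 1 - (norm x)\<^sup>2 > 0 then (1 - (norm x)\<^sup>2) powr l else 0)"
 using ball_pos_iff[of 1 x] by (auto simp: bw_def)

lemma norm_line_sq_deriv:
 "((\<lambda>s. (norm (x + ax i s :: real^'n::finite))\<^sup>2) has_real_derivative 2 * x$i) (at 0)"
proof -
 have "(norm (x + ax i s))\<^sup>2 = (norm x)\<^sup>2 + 2 * s * x$i + s\<^sup>2" for s
  unfolding power2_norm_eq_inner
  by (simp add: inner_add_left inner_add_right inner_axis inner_axis' inner_axis_axis power2_eq_square algebra_simps)
 then show ?thesis by (auto intro!: derivative_eq_intros)
qed

text \<open>This pair of densities is the one fed into \<open>avg_deriv\<close>: differentiation in
  t raises the exponent of the kernel by one and yields the factor 1 / (2 (l + 1)).\<close>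

lemma has_pd_bw:
 assumes "l > 0"
 shows "has_pd i (\<lambda>x. bw (l + 1) x / (2 * (l + 1))) (\<lambda>x. - (x$i * bw l x))"
 unfolding has_pd_def
proof
 fix x
 let ?g = "\<lambda>u::real. if u > 0 then u powr (l + 1) else 0"
 have "((\<lambda>s. 1 - (norm (x + ax i s))\<^sup>2) has_real_derivative - (2 * x$i)) (at 0)"
  using DERIV_diff[OF DERIV_const norm_line_sq_deriv[of x i], of 1] by simp
 from DERIV_chain2[OF _ this, of ?g "(l + 1) * bw l x"] pos_powr_deriv[OF assms, of "1 - (norm x)\<^sup>2"]
 have "((\<lambda>s. bw (l + 1) (x + ax i s)) has_real_derivative (l + 1) * bw l x * - (2 * x$i)) (at 0)"
  by (simp add: bw_pos_part)
 moreover have "(l + 1) * bw l x * - (2 * x$i) / (2 * (l + 1)) = - (x$i * bw l x)" using assms by (simp add: field_simps)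
 ultimately show "((\<lambda>s. bw (l + 1) (x + ax i s) / (2 * (l + 1))) has_real_derivative - (x$i * bw l x)) (at 0)"
  using DERIV_cdivide[of "\<lambda>s. bw (l + 1) (x + ax i s)" _ 0 UNIV "2 * (l + 1)"] by metis
qed

lemma continuous_bw:
 assumes "l > 0" shows "continuous_on UNIV (bw l)"
proof -
 have e: "bw l = (\<lambda>x. (max 0 (1 - (norm x)\<^sup>2)) powr l)" using assms by (auto simp: bw_pos_part max_def fun_eq_iff)
 show ?thesis unfolding e using assms by (intro continuous_on_powr' continuous_intros) auto
qed

lemma bw_le_one: "l \<ge> 0 \<Longrightarrow> \<bar>bw l x\<bar> \<le> 1"
 by (simp add: bw_pos_part powr_le1)

lemma weight_ball: "weight (bw 0)"
 unfolding weight_def rdec_def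
proof (intro conjI allI)
 fix N
 have "(1 + norm x) ^ N * \<bar>bw 0 x\<bar> \<le> 2 ^ N" for x :: "real^'n"
  by (auto simp: bw_def intro!: power_mono)
 then show "\<exists>C. \<forall>x. (1 + norm x) ^ N * \<bar>bw 0 (x::real^'n)\<bar> \<le> C" by blast
qed (auto simp: bw_nonneg)

text \<open>The average over the ball of radius t with kernel exponent l, scaled to the unit ball.
  The kernel is split into the measure with weight \<open>bw 0\<close> and the density
  \<open>bw l\<close>, which is at most 1 for l \<ge> 0.\<close>

definition bavg :: "real^'n::finite \<Rightarrow> real \<Rightarrow> real \<Rightarrow> (real^'n \<Rightarrow> real) \<Rightarrow> real^'n \<Rightarrow> real" where
 "bavg \<gamma> l t \<phi> = avg (rw \<gamma> (bw 0)) \<gamma> (t, bw l, \<phi>)"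

lemma bw_prm: "l \<ge> 0 \<Longrightarrow> \<phi> \<in> S_ev \<Longrightarrow> (t, bw l, \<phi>) \<in> prm"
 by (simp add: prm_def bw_le_one)

lemma bw_mult: "bw 0 x * bw l x = bw l x" by (auto simp: bw_def)

lemma bavg_eq:
 assumes "allpos \<gamma>" "l \<ge> 0" "\<phi> \<in> S_ev"
 shows "bavg \<gamma> l t \<phi> y = (LBINT x. ow \<gamma> x * (bw l x * TK \<gamma> \<phi> (t *\<^sub>R x) y))"
 unfolding bavg_def avg_rw[OF assms(1) weight_ball bw_prm[OF assms(2,3)]] by (simp add: bw_mult)

lemma bavg_deriv:
 fixes \<gamma> :: "real^'n::finite"
 assumes \<gamma>: "allpos \<gamma>" and l: "l > 0" and \<phi>: "\<phi> \<in> S_ev"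
 shows "((\<lambda>s. bavg \<gamma> l s \<phi> y) has_real_derivative t / (2 * (l + 1)) * bavg \<gamma> (l + 1) t (bessel_lap \<gamma> \<phi>) y) (at t)"
proof -
 define \<sigma>' where "\<sigma>' = (\<lambda>x::real^'n. bw (l + 1) x / (2 * (l + 1)))"
 have b: "\<bar>\<sigma>' x\<bar> \<le> 1" for x
 proof -
  have "\<bar>bw (l + 1) x\<bar> \<le> 1" by (rule bw_le_one) (use l in simp)
  then have "\<bar>bw (l + 1) x\<bar> \<le> 2 * (l + 1)" by (rule order_trans) (use l in simp)
  then show ?thesis using l by (simp add: \<sigma>'_def)
 qed
 have [measurable]: "\<sigma>' \<in> borel_measurable borel" unfolding \<sigma>'_def by measurable
 have e: "(\<lambda>x. bw 0 x * \<sigma>' x) = \<sigma>'" by (simp add: \<sigma>'_def bw_mult fun_eq_iff)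
 have q: "(t, \<sigma>', \<phi>) \<in> prm" "(t, \<sigma>', bessel_lap \<gamma> \<phi>) \<in> prm"
  using \<phi> b bessel_lap_S_ev[OF \<phi>] by (auto simp: prm_def)
 have p: "(t, bw l, \<phi>) \<in> prm" using l \<phi> by (intro bw_prm) auto
 have "((\<lambda>s. avg (rw \<gamma> (bw 0)) \<gamma> (s, bw l, \<phi>) y) has_real_derivative t * avg (rw \<gamma> (bw 0)) \<gamma> (t, \<sigma>', bessel_lap \<gamma> \<phi>) y) (at t)"
 proof (rule avg_deriv[OF \<gamma> weight_ball p q(1)])
  show "continuous_on UNIV (\<lambda>x. bw 0 x * bw l x)" unfolding bw_mult by (rule continuous_bw[OF l])
  show "continuous_on UNIV (\<lambda>x. bw 0 x * \<sigma>' x)" unfolding e unfolding \<sigma>'_def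
   using l by (intro continuous_intros continuous_bw) auto
  show "has_pd i (\<lambda>x. bw 0 x * \<sigma>' x) (\<lambda>x. - (x$i * (bw 0 x * bw l x)))" for i
   unfolding e bw_mult unfolding \<sigma>'_def by (rule has_pd_bw[OF l])
 qed
 moreover have "avg (rw \<gamma> (bw 0)) \<gamma> (t, \<sigma>', bessel_lap \<gamma> \<phi>) y = 1 / (2 * (l + 1)) * bavg \<gamma> (l + 1) t (bessel_lap \<gamma> \<phi>) y"
  unfolding avg_rw[OF \<gamma> weight_ball q(2)] using l
  by (subst bavg_eq[OF \<gamma> _ bessel_lap_S_ev[OF \<phi>]]) (auto simp: \<sigma>'_def bw_mult)
 ultimately show ?thesis by (simp add: bavg_def)
qed

definition lamk :: "real^'n::finite \<Rightarrow> real \<Rightarrow> real" where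
 "lamk \<gamma> k = (k - hdim \<gamma> - 1) / 2"

text \<open>The excluded values are the poles of Gamma((k + 1) / 2). The condition persists under k
  + 2, which the recursion relies on.\<close>

definition okk :: "real \<Rightarrow> bool" where
 "okk k \<longleftrightarrow> (\<forall>m::nat. k \<noteq> - real (2 * m + 1))"

lemma okk_shift: "okk k \<Longrightarrow> okk (k + 2)"
 unfolding okk_def
proof
 fix m assume a: "\<forall>m::nat. k \<noteq> - real (2 * m + 1)"
 from a[rule_format, of "Suc m"] show "k + 2 \<noteq> - real (2 * m + 1)" by simp
qed

lemma okk_nz: "okk k \<Longrightarrow> k + 1 \<noteq> 0" unfolding okk_def using allE[where x=0 and P="\<lambda>m. k \<noteq> - real (2 * m + 1)"] by fastforce

lemma okk_shifts:
 assumes "okk k"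
 shows "okk (k + 2)" "okk (k + 4)" "k + 1 \<noteq> 0" "k + 3 \<noteq> 0" "k + 5 \<noteq> 0"
proof -
 have "k + 2 + 2 = k + 4" by simp
 then show *: "okk (k + 2)" "okk (k + 4)" using okk_shift assms by metis+
 show "k + 1 \<noteq> 0" "k + 3 \<noteq> 0" "k + 5 \<noteq> 0" using okk_nz[OF assms] okk_nz[OF *(1)] okk_nz[OF *(2)] by auto
qed

lemma okk_Gamma: "okk k \<Longrightarrow> (k + 1) / 2 \<notin> \<int>\<^sub>\<le>\<^sub>0"
proof
 assume k: "okk k" and "(k + 1) / 2 \<in> \<int>\<^sub>\<le>\<^sub>0"
 then obtain m where "(k + 1) / 2 = - real m" by (elim nonpos_Ints_cases') auto
 then have "k = - real (2 * m + 1)" by (simp add: field_simps)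
 with k show False unfolding okk_def by blast
qed

text \<open>The constant of the solution formula: 2^n over the product of Gamma((\<gamma>_i + 1) /
  2) is 1 / \<open>gmass\<close>, and \<open>nu_mass\<close> accounts for the passage from
  \<open>TK\<close> to \<open>gtrans\<close>. Scaling the ball to radius one cancels the power of
  t.\<close>

definition cB :: "real^'n::finite \<Rightarrow> real \<Rightarrow> real" where
 "cB \<gamma> k = Gamma ((k + 1) / 2) * rGamma (lamk \<gamma> k + 1) / (gmass \<gamma> * nu_mass \<gamma>)"

text \<open>\<open>VV \<gamma> m k t \<phi>\<close> is the test function to which the initial datum is applied in the solution formula.
 The exponent \<open>lamk \<gamma> k\<close> is raised by \<open>m\<close> to reach convergent integrals.\<close>
fun VV :: "real^'n::finite \<Rightarrow> nat \<Rightarrow> real \<Rightarrow> real \<Rightarrow> (real^'n \<Rightarrow> real) \<Rightarrow> real^'n \<Rightarrow> real" where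
 "VV \<gamma> 0 k t \<phi> y = cB \<gamma> k * bavg \<gamma> (lamk \<gamma> k) t \<phi> y"
| "VV \<gamma> (Suc m) k t \<phi> y = VV \<gamma> m (k + 2) t \<phi> y + t\<^sup>2 / ((k + 1) * (k + 3)) * VV \<gamma> m (k + 4) t (bessel_lap \<gamma> \<phi>) y"

lemma lamk_shift: "lamk \<gamma> (k + 2) = lamk \<gamma> k + 1" "lamk \<gamma> (k + 4) = lamk \<gamma> k + 2"
 by (simp_all add: lamk_def field_simps)

lemma cB_shift:
 assumes "okk k" "lamk \<gamma> k > 0"
 shows "cB \<gamma> (k + 2) = cB \<gamma> k * ((k + 1) / (2 * (lamk \<gamma> k + 1)))"
proof -
 have "(k + 2 + 1) / 2 = (k + 1) / 2 + 1" by (simp add: field_simps)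
 then have 1: "Gamma ((k + 2 + 1) / 2) = (k + 1) / 2 * Gamma ((k + 1) / 2)"
  using Gamma_plus1[OF okk_Gamma[OF assms(1)]] by (simp only:)
 have 2: "rGamma (lamk \<gamma> k + 1 + 1) = rGamma (lamk \<gamma> k + 1) / (lamk \<gamma> k + 1)"
  using rGamma_plus1[of "lamk \<gamma> k + 1"] assms(2) by (simp add: field_simps)
 show ?thesis unfolding cB_def lamk_shift 1 2 using assms(2) by (simp add: field_simps)
qed

lemma hdim_pos: "allpos \<gamma> \<Longrightarrow> 0 < hdim \<gamma>"
 unfolding hdim_def by (intro add_pos_nonneg sum_nonneg) (auto intro: less_imp_le)

lemma VV_cfam:
 assumes \<gamma>: "allpos \<gamma>"
 shows "lamk \<gamma> k + real m > 1 \<Longrightarrow> \<phi> \<in> S_ev \<Longrightarrow> cfam (\<lambda>t. VV \<gamma> m k t \<phi>)"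
proof (induction m arbitrary: k \<phi>)
 case 0
 then have "cfam (\<lambda>t. bavg \<gamma> (lamk \<gamma> k) t \<phi>)"
  unfolding bavg_def by (intro cfam_avg[OF \<gamma> moments_rw[OF \<gamma> weight_ball]] bw_prm) auto
 from cfam_lin[OF this this continuous_on_const continuous_on_const, of "cB \<gamma> k" 0]
 show ?case by (simp add: fun_eq_iff[symmetric])
next
 case (Suc m)
 have 1: "cfam (\<lambda>t. VV \<gamma> m (k + 2) t \<phi>)" using Suc.prems by (intro Suc.IH) (auto simp: lamk_shift)
 have 2: "cfam (\<lambda>t. VV \<gamma> m (k + 4) t (bessel_lap \<gamma> \<phi>))"
  using Suc.prems by (intro Suc.IH bessel_lap_S_ev) (auto simp: lamk_shift)
 have "continuous_on UNIV (\<lambda>t. t\<^sup>2 / ((k + 1) * (k + 3)))"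
  unfolding divide_inverse by (intro continuous_intros)
 from cfam_lin[OF 1 2 continuous_on_const[of _ 1] this] show ?case by simp
qed

lemma VV_S_ev: "allpos \<gamma> \<Longrightarrow> lamk \<gamma> k + real m > 1 \<Longrightarrow> \<phi> \<in> S_ev \<Longrightarrow> VV \<gamma> m k t \<phi> \<in> S_ev"
 using VV_cfam[of \<gamma> k m \<phi>] unfolding cfam_def by blast

lemma VV_lin:
 assumes \<gamma>: "allpos \<gamma>"
 shows "lamk \<gamma> k + real m > 1 \<Longrightarrow> \<phi> \<in> S_ev \<Longrightarrow> \<psi> \<in> S_ev \<Longrightarrow>
  VV \<gamma> m k t (\<lambda>x. a * \<phi> x + b * \<psi> x) y = a * VV \<gamma> m k t \<phi> y + b * VV \<gamma> m k t \<psi> y"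
proof (induction m arbitrary: k \<phi> \<psi>)
 case 0
 then show ?case
  by (simp add: bavg_def avg_lin[OF \<gamma> moments_rw[OF \<gamma> weight_ball] bw_prm bw_prm] algebra_simps)
next
 case (Suc m)
 have l: "lamk \<gamma> (k + 2) + real m > 1" "lamk \<gamma> (k + 4) + real m > 1" using Suc.prems by (auto simp: lamk_shift)
 have S: "bessel_lap \<gamma> \<phi> \<in> S_ev" "bessel_lap \<gamma> \<psi> \<in> S_ev" using Suc.prems bessel_lap_S_ev by blast+
 show ?case
  using Suc.IH[OF l(1) Suc.prems(2,3)] Suc.IH[OF l(2) S] bessel_lap_lin[OF Suc.prems(2,3)]
  by (simp add: algebra_simps)
qed

lemma VV_bound:
 fixes \<gamma> :: "real^'n::finite"
 assumes \<gamma>: "allpos \<gamma>" and R: "R \<ge> 0"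
 shows "lamk \<gamma> k + real m > 1 \<Longrightarrow> \<exists>C M. C \<ge> 0 \<and> (\<forall>t \<phi>. \<bar>t\<bar> \<le> R \<longrightarrow> \<phi> \<in> S_ev \<longrightarrow> sn N (VV \<gamma> m k t \<phi>) \<le> C * sn M \<phi>)"
proof (induction m arbitrary: k)
 case 0
 obtain C M where C: "C \<ge> 0" "\<And>t \<sigma> \<phi>. (t, \<sigma>, \<phi>) \<in> prm \<Longrightarrow> \<bar>t\<bar> \<le> R \<Longrightarrow> sn N (avg (rw \<gamma> (bw 0)) \<gamma> (t, \<sigma>, \<phi>)) \<le> C * sn M \<phi>"
  using avg_bound[OF \<gamma> moments_rw[OF \<gamma> weight_ball] R] by meson
 have "sn N (VV \<gamma> 0 k t \<phi>) \<le> sn_count TYPE('n) N * \<bar>cB \<gamma> k\<bar> * C * sn M \<phi>" if "\<bar>t\<bar> \<le> R" "\<phi> \<in> S_ev" for t \<phi>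
 proof -
  have p: "(t, bw (lamk \<gamma> k), \<phi>) \<in> prm" using 0 that by (intro bw_prm) auto
  have S: "bavg \<gamma> (lamk \<gamma> k) t \<phi> \<in> S_ev" unfolding bavg_def by (rule avg_S_ev[OF \<gamma> moments_rw[OF \<gamma> weight_ball] p])
  have "VV \<gamma> 0 k t \<phi> = (\<lambda>y. cB \<gamma> k * bavg \<gamma> (lamk \<gamma> k) t \<phi> y + 0 * bavg \<gamma> (lamk \<gamma> k) t \<phi> y)" by (simp add: fun_eq_iff)
  then have "sn N (VV \<gamma> 0 k t \<phi>) \<le> sn_count TYPE('n) N * (\<bar>cB \<gamma> k\<bar> * sn N (bavg \<gamma> (lamk \<gamma> k) t \<phi>))"
   using sn_lin_le[OF S S, of N "cB \<gamma> k" 0] by simp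
  also have "... \<le> sn_count TYPE('n) N * (\<bar>cB \<gamma> k\<bar> * (C * sn M \<phi>))"
   unfolding bavg_def by (intro mult_left_mono C(2)[OF p that(1)] sn_count_nonneg) auto
  finally show ?thesis by (simp add: ac_simps)
 qed
 then show ?case
  by (intro exI[of _ "sn_count TYPE('n) N * \<bar>cB \<gamma> k\<bar> * C"] exI[of _ M] conjI allI impI
   mult_nonneg_nonneg sn_count_nonneg abs_ge_zero C(1))
next
 case (Suc m)
 have l: "lamk \<gamma> (k + 2) + real m > 1" "lamk \<gamma> (k + 4) + real m > 1" using Suc.prems by (auto simp: lamk_shift)
 obtain C M where C: "C \<ge> 0" "\<And>t \<phi>. \<bar>t\<bar> \<le> R \<Longrightarrow> \<phi> \<in> S_ev \<Longrightarrow> sn N (VV \<gamma> m (k + 2) t \<phi>) \<le> C * sn M \<phi>"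
  using Suc.IH[OF l(1)] by meson
 obtain C' M' where C': "C' \<ge> 0" "\<And>t \<phi>. \<bar>t\<bar> \<le> R \<Longrightarrow> \<phi> \<in> S_ev \<Longrightarrow> sn N (VV \<gamma> m (k + 4) t \<phi>) \<le> C' * sn M' \<phi>"
  using Suc.IH[OF l(2)] by meson
 obtain D L where D: "D \<ge> 0" "\<And>\<phi>. \<phi> \<in> S_ev \<Longrightarrow> sn M' (bessel_lap \<gamma> \<phi>) \<le> D * sn L \<phi>"
  using cop_bessel_lap[of \<gamma>] unfolding cop_def by meson
 define E where "E = R\<^sup>2 / \<bar>(k + 1) * (k + 3)\<bar>"
 have E: "E \<ge> 0" by (simp add: E_def)
 have "sn N (VV \<gamma> (Suc m) k t \<phi>) \<le> sn_count TYPE('n) N * (C + E * (C' * D)) * sn (max M L) \<phi>"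
  if t: "\<bar>t\<bar> \<le> R" and \<phi>: "\<phi> \<in> S_ev" for t \<phi>
 proof -
  define a where "a = t\<^sup>2 / ((k + 1) * (k + 3))"
  have B: "bessel_lap \<gamma> \<phi> \<in> S_ev" by (rule bessel_lap_S_ev[OF \<phi>])
  have aE: "\<bar>a\<bar> \<le> E" unfolding a_def E_def abs_divide
   using t R by (intro divide_right_mono) (auto simp: abs_le_square_iff[symmetric])
  have "VV \<gamma> (Suc m) k t \<phi> = (\<lambda>y. 1 * VV \<gamma> m (k + 2) t \<phi> y + a * VV \<gamma> m (k + 4) t (bessel_lap \<gamma> \<phi>) y)"
   by (simp add: fun_eq_iff a_def)
  then have "sn N (VV \<gamma> (Suc m) k t \<phi>) \<le> sn_count TYPE('n) N * (\<bar>1\<bar> * sn N (VV \<gamma> m (k + 2) t \<phi>) + \<bar>a\<bar> * sn N (VV \<gamma> m (k + 4) t (bessel_lap \<gamma> \<phi>)))"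
   using sn_lin_le[OF VV_S_ev[OF \<gamma> l(1) \<phi>, of t] VV_S_ev[OF \<gamma> l(2) B, of t], where N=N and a=1 and b=a] by (simp only:)
  also have "... \<le> sn_count TYPE('n) N * (C * sn (max M L) \<phi> + E * (C' * (D * sn (max M L) \<phi>)))"
  proof -
   have "sn N (VV \<gamma> m (k + 2) t \<phi>) \<le> C * sn M \<phi>" by (rule C(2)[OF t \<phi>])
   also have "... \<le> C * sn (max M L) \<phi>" by (intro mult_left_mono sn_mono \<phi> C(1)) simp
   finally have 1: "\<bar>1\<bar> * sn N (VV \<gamma> m (k + 2) t \<phi>) \<le> C * sn (max M L) \<phi>" by simp
   have "sn N (VV \<gamma> m (k + 4) t (bessel_lap \<gamma> \<phi>)) \<le> C' * sn M' (bessel_lap \<gamma> \<phi>)" by (rule C'(2)[OF t B])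
   also have "... \<le> C' * (D * sn L \<phi>)" by (intro mult_left_mono D(2) \<phi> C'(1))
   also have "... \<le> C' * (D * sn (max M L) \<phi>)" by (intro mult_left_mono sn_mono \<phi> C'(1) D(1)) simp
   finally have "\<bar>a\<bar> * sn N (VV \<gamma> m (k + 4) t (bessel_lap \<gamma> \<phi>)) \<le> E * (C' * (D * sn (max M L) \<phi>))"
    by (intro mult_mono aE E sn_nonneg[OF VV_S_ev[OF \<gamma> l(2) B]])
   from mult_left_mono[OF add_mono[OF 1 this] sn_count_nonneg] show ?thesis .
  qed
  finally show ?thesis by (simp add: algebra_simps)
 qed
 then show ?case
  by (intro exI[of _ "sn_count TYPE('n) N * (C + E * (C' * D))"] exI[of _ "max M L"] conjI allI impI
   mult_nonneg_nonneg add_nonneg_nonneg sn_count_nonneg C(1) C'(1) D(1) E)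
qed

text \<open>For m = 0 this is \<open>bavg_deriv\<close> with the ratio of constants from
  \<open>cB_shift\<close>. The recursion respects it because 1 / (k + 3) + 2 / ((k + 1) (k + 3)) = 1
  / (k + 1).\<close>

lemma VV_deriv:
 assumes \<gamma>: "allpos \<gamma>"
 shows "okk k \<Longrightarrow> lamk \<gamma> k + real m > 1 \<Longrightarrow> \<phi> \<in> S_ev \<Longrightarrow>
  ((\<lambda>s. VV \<gamma> m k s \<phi> y) has_real_derivative t / (k + 1) * VV \<gamma> m (k + 2) t (bessel_lap \<gamma> \<phi>) y) (at t)"
proof (induction m arbitrary: k \<phi>)
 case 0
 then have l: "lamk \<gamma> k > 0" by simp
 have "((\<lambda>s. cB \<gamma> k * bavg \<gamma> (lamk \<gamma> k) s \<phi> y) has_real_derivative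
   cB \<gamma> k * (t / (2 * (lamk \<gamma> k + 1)) * bavg \<gamma> (lamk \<gamma> k + 1) t (bessel_lap \<gamma> \<phi>) y)) (at t)"
  by (rule DERIV_cmult[OF bavg_deriv[OF \<gamma> l 0(3)]])
 moreover have "cB \<gamma> k * (t / (2 * (lamk \<gamma> k + 1)) * bavg \<gamma> (lamk \<gamma> k + 1) t (bessel_lap \<gamma> \<phi>) y)
   = t / (k + 1) * VV \<gamma> 0 (k + 2) t (bessel_lap \<gamma> \<phi>) y"
  using cB_shift[OF 0(1) l] l okk_shifts(3)[OF 0(1)] by (simp add: lamk_shift)
 ultimately show ?case by simp
next
 case (Suc m)
 note k = okk_shifts[OF Suc.prems(1)]
 have l: "lamk \<gamma> (k + 2) + real m > 1" "lamk \<gamma> (k + 4) + real m > 1" using Suc.prems by (auto simp: lamk_shift)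
 note B = bessel_lap_S_ev[OF Suc.prems(3), of \<gamma>]
 have e: "k + 2 + 1 = k + 3" "k + 2 + 2 = k + 4" "k + 4 + 1 = k + 5" "k + 4 + 2 = k + 6" "k + 2 + 3 = k + 5" "k + 2 + 4 = k + 6" by auto
 define X where "X = VV \<gamma> m (k + 4) t (bessel_lap \<gamma> \<phi>) y"
 define Y where "Y = VV \<gamma> m (k + 6) t (bessel_lap \<gamma> (bessel_lap \<gamma> \<phi>)) y"
 have 1: "((\<lambda>s. VV \<gamma> m (k + 2) s \<phi> y) has_real_derivative t / (k + 3) * X) (at t)"
  using Suc.IH[OF k(1) l(1) Suc.prems(3)] unfolding e X_def .
 have 2: "((\<lambda>s. VV \<gamma> m (k + 4) s (bessel_lap \<gamma> \<phi>) y) has_real_derivative t / (k + 5) * Y) (at t)"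
  using Suc.IH[OF k(2) l(2) B] unfolding e Y_def .
 have 3: "((\<lambda>s. s\<^sup>2 / ((k + 1) * (k + 3))) has_real_derivative 2 * t / ((k + 1) * (k + 3))) (at t)"
  by (rule DERIV_cdivide) (auto intro!: derivative_eq_intros)
 have "((\<lambda>s. VV \<gamma> (Suc m) k s \<phi> y) has_real_derivative
   t / (k + 3) * X + (2 * t / ((k + 1) * (k + 3)) * X + t / (k + 5) * Y * (t\<^sup>2 / ((k + 1) * (k + 3))))) (at t)"
  using DERIV_add[OF 1 DERIV_mult[OF 3 2]] by (simp only: VV.simps X_def)
 also have "t / (k + 3) * X + (2 * t / ((k + 1) * (k + 3)) * X + t / (k + 5) * Y * (t\<^sup>2 / ((k + 1) * (k + 3)))) =
   t / (k + 1) * (X + t\<^sup>2 / ((k + 3) * (k + 5)) * Y)"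
 proof -
  have "t / (k + 3) * X + 2 * t / ((k + 1) * (k + 3)) * X = t / (k + 1) * X"
  proof -
   have "t / b * X + 2 * t / (a * b) * X = t / a * X" if "a \<noteq> 0" "b \<noteq> 0" "b = a + 2" for a b
   proof -
    have "t / b + (b - a) * t / (a * b) = t / a" using that(1,2) by (simp add: field_simps)
    then have "t / b + 2 * t / (a * b) = t / a" using that(3) by simp
    then show ?thesis unfolding distrib_right[symmetric] by (rule arg_cong)
   qed
   from this[OF k(3,4)] show ?thesis by simp
  qed
  then show ?thesis by (simp add: algebra_simps)
 qed
 also have "... = t / (k + 1) * VV \<gamma> (Suc m) (k + 2) t (bessel_lap \<gamma> \<phi>) y"
  by (simp only: VV.simps e X_def Y_def)
 finally show ?case .
qed

lemma VV_zero:
 assumes \<gamma>: "allpos \<gamma>"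
 shows "okk k \<Longrightarrow> lamk \<gamma> k + real m > 1 \<Longrightarrow> \<phi> \<in> S_ev \<Longrightarrow> VV \<gamma> m k 0 \<phi> y = \<phi> y"
proof (induction m arbitrary: k \<phi>)
 case 0
 define l where "l = lamk \<gamma> k"
 have l: "l > 0" using 0 by (simp add: l_def)
 have b: "bmass \<gamma> l = gmass \<gamma> * Gamma (l + 1) / Gamma ((k + 1) / 2)"
  unfolding bmass_def by (simp add: l_def lamk_def field_simps)
 have b0: "bmass \<gamma> l \<ge> 0"
 proof -
  have "0 < Gamma (l + 1 + hdim \<gamma> / 2)" using l hdim_pos[OF \<gamma>] by (intro Gamma_real_pos) auto
  then show ?thesis unfolding bmass_def using l gmass_pos[OF \<gamma>] by (auto intro!: divide_nonneg_pos mult_nonneg_nonneg less_imp_le Gamma_real_pos)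
 qed
 have "(LBINT x. ow \<gamma> x * bw l x) = bmass \<gamma> l"
  using ow_ball_nn_integral[OF \<gamma>, of l] l b0 by (subst integral_eq_nn_integral) (auto simp: ow_nonneg bw_nonneg)
 then have "bavg \<gamma> l 0 \<phi> y = bmass \<gamma> l * (nu_mass \<gamma> * \<phi> y)"
  unfolding bavg_def using l 0 by (subst avg_zero[OF \<gamma> weight_ball bw_prm]) (auto simp: bw_mult)
 moreover have "cB \<gamma> k * bmass \<gamma> l * nu_mass \<gamma> = 1"
 proof -
  have "Gamma (l + 1) > 0" using l by (intro Gamma_real_pos) auto
  moreover have "Gamma ((k + 1) / 2) \<noteq> 0" using Gamma_nonzero[OF okk_Gamma[OF 0(1)]] .
  ultimately show ?thesis unfolding cB_def b l_def[symmetric] using gmass_pos[OF \<gamma>] nu_mass_pos[OF \<gamma>]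
   by (simp add: rGamma_inverse_Gamma field_simps)
 qed
 ultimately show ?case by (simp add: l_def[symmetric] mult.assoc[symmetric])
next
 case (Suc m)
 have "VV \<gamma> m (k + 2) 0 \<phi> y = \<phi> y"
  using Suc.prems okk_shift by (intro Suc.IH) (auto simp: lamk_shift)
 then show ?case by simp
qed

text \<open>Both sides obey the same recursion once Gamma((k + 1) / 2) t^(1 - k) is split off; for m
  = 0 the ball of radius t is scaled to radius one. This ties the expression that can be
  differentiated in t to the analytic continuation in the formula.\<close>

lemma VV_link:
 fixes \<gamma> :: "real^'n::finite"
 assumes \<gamma>: "allpos \<gamma>" and t: "t > 0"
 shows "okk k \<Longrightarrow> lamk \<gamma> k + real m > 1 \<Longrightarrow> \<phi> \<in> S_ev \<Longrightarrow> VV \<gamma> m k t \<phi> y =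
   Gamma ((k + 1) / 2) / gmass \<gamma> * t powr (1 - k) * Re (GG \<gamma> t m (of_real (lamk \<gamma> k)) (\<lambda>x. 1 / nu_mass \<gamma> * TK \<gamma> \<phi> x y))"
proof (induction m arbitrary: k \<phi>)
 case 0
 define l where "l = lamk \<gamma> k"
 have l: "l > 0" using 0 by (simp add: l_def)
 define F where "F = (\<lambda>x. (ow \<gamma> x * TK \<gamma> \<phi> x y) *\<^sub>R cpow (of_real l) (t\<^sup>2 - (norm x)\<^sup>2))"
 have [measurable]: "(\<lambda>x. TK \<gamma> \<phi> x y) \<in> borel_measurable borel"
  by (intro borel_measurable_continuous_onI continuous_intros \<gamma> 0)
 have "bint \<gamma> t (of_real l) (\<lambda>x. TK \<gamma> \<phi> x y) = t ^ CARD('n) *\<^sub>R (LBINT x. F (t *\<^sub>R x))"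
  unfolding bint_def F_def[symmetric] using t by (intro integral_lborel_scale) (auto simp: F_def)
 also have "(LBINT x. F (t *\<^sub>R x)) = (LBINT x. of_real (t powr (\<Sum>i\<in>UNIV. \<gamma>$i) * t powr (2 * l) * (ow \<gamma> x * (bw l x * TK \<gamma> \<phi> (t *\<^sub>R x) y))))"
 proof (rule Bochner_Integration.integral_cong[OF refl])
  fix x :: "real^'n"
  have "t\<^sup>2 - (norm (t *\<^sub>R x))\<^sup>2 = t\<^sup>2 * (1 - (norm x)\<^sup>2)" using t by (simp add: power_mult_distrib algebra_simps)
  then have "cpow (of_real l) (t\<^sup>2 - (norm (t *\<^sub>R x))\<^sup>2) = of_real (t powr (2 * l) * bw l x)"
   using t by (simp add: cpow_of_real bw_pos_part zero_less_mult_iff powr_mult powr_numeral[symmetric] powr_powr del: powr_numeral)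
  then show "F (t *\<^sub>R x) = of_real (t powr (\<Sum>i\<in>UNIV. \<gamma>$i) * t powr (2 * l) * (ow \<gamma> x * (bw l x * TK \<gamma> \<phi> (t *\<^sub>R x) y)))"
   unfolding F_def ow_scaleR[OF t] by (simp add: scaleR_conv_of_real)
 qed
 also have "... = of_real (t powr (\<Sum>i\<in>UNIV. \<gamma>$i) * t powr (2 * l) * bavg \<gamma> l t \<phi> y)"
  using l by (subst bavg_eq[OF \<gamma> _ 0(3)]) (auto simp: integral_complex_of_real simp del: of_real_mult)
 finally have "bint \<gamma> t (of_real l) (\<lambda>x. TK \<gamma> \<phi> x y) = of_real (t ^ CARD('n) * (t powr (\<Sum>i\<in>UNIV. \<gamma>$i) * t powr (2 * l)) * bavg \<gamma> l t \<phi> y)"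
  by (simp add: scaleR_conv_of_real)
 \<comment> \<open>The sum of \<open>hdim \<gamma>\<close> and 2 \<open>lamk \<gamma> k\<close> is k
   - 1; this is where the factor t^(1 - k) of the formula comes from.\<close>
 also have "t ^ CARD('n) * (t powr (\<Sum>i\<in>UNIV. \<gamma>$i) * t powr (2 * l)) = t powr (k - 1)"
 proof -
  have "real CARD('n) + ((\<Sum>i\<in>UNIV. \<gamma>$i) + 2 * l) = k - 1" by (simp add: l_def lamk_def hdim_def field_simps)
  then show ?thesis using t by (simp add: powr_realpow[symmetric] powr_add[symmetric])
 qed
 finally have b: "bint \<gamma> t (of_real l) (\<lambda>x. TK \<gamma> \<phi> x y) = of_real (t powr (k - 1) * bavg \<gamma> l t \<phi> y)" .
 have G: "GG \<gamma> t 0 (of_real l) (\<lambda>x. 1 / nu_mass \<gamma> * TK \<gamma> \<phi> x y) = of_real (rGamma (l + 1) * (1 / nu_mass \<gamma> * (t powr (k - 1) * bavg \<gamma> l t \<phi> y)))"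
  unfolding GG.simps bint_scale b using rGamma_complex_of_real[of "l + 1"] by simp
 have "t powr (1 - k) * t powr (k - 1) = 1" using t by (simp add: powr_add[symmetric])
 then have "Gamma ((k + 1) / 2) / gmass \<gamma> * t powr (1 - k) * (rGamma (l + 1) * (1 / nu_mass \<gamma> * (t powr (k - 1) * bavg \<gamma> l t \<phi> y))) = cB \<gamma> k * bavg \<gamma> l t \<phi> y"
  unfolding cB_def l_def[symmetric] by (simp add: field_simps)
 then show ?case unfolding l_def[symmetric] G Re_complex_of_real by (simp add: l_def)
next
 case (Suc m)
 note k = okk_shifts[OF Suc.prems(1)]
 have l: "lamk \<gamma> (k + 2) + real m > 1" "lamk \<gamma> (k + 4) + real m > 1" using Suc.prems by (auto simp: lamk_shift)
 define h where "h = (\<lambda>x. 1 / nu_mass \<gamma> * TK \<gamma> \<phi> x y)"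
 have TS: "(\<lambda>x. TK \<gamma> \<phi> x y) \<in> S_ev" by (rule TK_S_ev(2)[OF \<gamma> Suc.prems(3)])
 have h': "bessel_lap \<gamma> h = (\<lambda>x. 1 / nu_mass \<gamma> * TK \<gamma> (bessel_lap \<gamma> \<phi>) x y)"
  unfolding h_def using bessel_lap_lin[OF TS TS, of \<gamma> "1 / nu_mass \<gamma>" 0] TK_bessel_lap'[OF \<gamma> Suc.prems(3)] by simp
 define A where "A = Re (GG \<gamma> t m (of_real (lamk \<gamma> k) + 1) h)"
 define B where "B = Re (GG \<gamma> t m (of_real (lamk \<gamma> k) + 2) (bessel_lap \<gamma> h))"
 define \<Gamma> where "\<Gamma> = Gamma ((k + 1) / 2)"
 have G3: "Gamma ((k + 3) / 2) = (k + 1) / 2 * \<Gamma>"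
 proof -
  have "(k + 3) / 2 = (k + 1) / 2 + 1" by (simp add: field_simps)
  then show ?thesis using Gamma_plus1[OF okk_Gamma[OF Suc.prems(1)]] by (simp only: \<Gamma>_def)
 qed
 have G5: "Gamma ((k + 5) / 2) = (k + 3) / 2 * ((k + 1) / 2 * \<Gamma>)"
 proof -
  have e3: "k + 2 + 1 = k + 3" by simp
  have "(k + 3) / 2 \<notin> \<int>\<^sub>\<le>\<^sub>0" using okk_Gamma[OF k(1)] unfolding e3 .
  note g = Gamma_plus1[OF this]
  have e5: "(k + 5) / 2 = (k + 3) / 2 + 1" by (simp add: field_simps)
  show ?thesis unfolding e5 g G3 ..
 qed
 have e: "k + 2 + 1 = k + 3" "k + 4 + 1 = k + 5" by auto
 have o: "complex_of_real (lamk \<gamma> k + 1) = of_real (lamk \<gamma> k) + 1" "complex_of_real (lamk \<gamma> k + 2) = of_real (lamk \<gamma> k) + 2" by simp_all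
 have 1: "VV \<gamma> m (k + 2) t \<phi> y = (k + 1) / 2 * \<Gamma> / gmass \<gamma> * t powr (1 - (k + 2)) * A"
  using Suc.IH[OF k(1) l(1) Suc.prems(3)] unfolding e lamk_shift h_def[symmetric] A_def G3 o .
 have 2: "VV \<gamma> m (k + 4) t (bessel_lap \<gamma> \<phi>) y = (k + 3) / 2 * ((k + 1) / 2 * \<Gamma>) / gmass \<gamma> * t powr (1 - (k + 4)) * B"
  using Suc.IH[OF k(2) l(2) bessel_lap_S_ev[OF Suc.prems(3), of \<gamma>]] unfolding e lamk_shift h'[symmetric] B_def G5 o .
 have p: "t powr (1 - (k + 2)) = t powr (1 - k) / t\<^sup>2" "t powr (1 - (k + 4)) = t powr (1 - k) / t ^ 4"
  using t powr_realpow[OF t, of 2] powr_realpow[OF t, of 4] powr_diff[of t "1 - k" 2] powr_diff[of t "1 - k" 4]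
  by (simp_all add: algebra_simps)
 have gr: "Re (GG \<gamma> t (Suc m) (of_real (lamk \<gamma> k)) h) = ((k + 1) * A + B / 2) / (2 * t\<^sup>2)"
 proof -
  have "GG \<gamma> t (Suc m) (of_real (lamk \<gamma> k)) h = (of_real (k + 1) * GG \<gamma> t m (of_real (lamk \<gamma> k) + 1) h
   + GG \<gamma> t m (of_real (lamk \<gamma> k) + 2) (bessel_lap \<gamma> h) / 2) / of_real (2 * t\<^sup>2)"
   by (simp add: lamk_def field_simps)
  then show ?thesis by (simp only: Re_divide_of_real plus_complex.sel Re_complex_of_real Re_divide_numeral) (simp add: A_def B_def)
 qed
 \<comment> \<open>Used with a = k + 1, b = k + 3, g = \<open>gmass \<gamma>\<close> and P = t^(1 -
   k).\<close>
 have alg: "a / 2 * \<Gamma> / g * (P / t\<^sup>2) * A + t\<^sup>2 / (a * b) * (b / 2 * (a / 2 * \<Gamma>) / g * (P / t ^ 4) * B)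
   = \<Gamma> / g * P * ((a * A + B / 2) / (2 * t\<^sup>2))" if "a \<noteq> 0" "b \<noteq> 0" "g \<noteq> 0" for a b g P :: real
  using that t by (simp add: field_simps power2_eq_square power4_eq_xxxx)
 show ?case unfolding h_def[symmetric] \<Gamma>_def[symmetric] gr unfolding VV.simps 1 2 p
  by (rule alg) (use k(3,4) gmass_pos[OF \<gamma>] in auto)
qed

subsection \<open>Existence\<close>

lemma is_solutionI:
 fixes \<gamma> :: "real^'n::finite" and w' w'' :: "(real^'n \<Rightarrow> real) \<Rightarrow> real \<Rightarrow> real"
 assumes dual: "\<And>t. t > 0 \<Longrightarrow> u t \<in> S_ev_dual"
  and w: "\<And>\<phi> t. \<phi> \<in> S_ev \<Longrightarrow> t > 0 \<Longrightarrow> ((\<lambda>s. u s \<phi>) has_real_derivative w' \<phi> t) (at t)"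
  and w': "\<And>\<phi> t. \<phi> \<in> S_ev \<Longrightarrow> t > 0 \<Longrightarrow> (w' \<phi> has_real_derivative w'' \<phi> t) (at t)"
  and c: "\<And>\<phi>. \<phi> \<in> S_ev \<Longrightarrow> continuous_on {0<..} (w'' \<phi>)"
  and ode: "\<And>\<phi> t. \<phi> \<in> S_ev \<Longrightarrow> t > 0 \<Longrightarrow> w'' \<phi> t + k / t * w' \<phi> t = u t (bessel_lap \<gamma> \<phi>)"
  and lim: "\<And>\<phi>. \<phi> \<in> S_ev \<Longrightarrow> ((\<lambda>s. u s \<phi>) \<longlongrightarrow> f \<phi>) (at_right 0)" "\<And>\<phi>. \<phi> \<in> S_ev \<Longrightarrow> (w' \<phi> \<longlongrightarrow> 0) (at_right 0)"
 shows "is_solution \<gamma> k f u"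
 unfolding is_solution_def
proof (intro conjI ballI)
 show "\<forall>t>0. u t \<in> S_ev_dual" using dual by blast
 fix \<phi> :: "real^'n \<Rightarrow> real" assume \<phi>: "\<phi> \<in> S_ev"
 let ?d = "deriv (\<lambda>s. u s \<phi>)"
 have d1: "?d t = w' \<phi> t" if "t > 0" for t by (rule DERIV_imp_deriv[OF w[OF \<phi> that]])
 have d2: "(?d has_real_derivative w'' \<phi> t) (at t)" if "t > 0" for t
  by (rule has_field_derivative_transform_within_open[OF w'[OF \<phi> that], of "{0<..}"]) (use that d1 in auto)
 have d3: "deriv ?d t = w'' \<phi> t" if "t > 0" for t by (rule DERIV_imp_deriv[OF d2[OF that]])
 show "\<forall>t>0. (\<lambda>s. u s \<phi>) differentiable (at t) \<and> ?d differentiable (at t)"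
  using w[OF \<phi>] d2 unfolding real_differentiable_def by blast
 show "continuous_on {0<..} (deriv ?d)" using c[OF \<phi>] by (rule continuous_on_eq) (simp add: d3)
 show "\<forall>t>0. deriv ?d t + k / t * ?d t = u t (bessel_lap \<gamma> \<phi>)" using d1 d3 ode[OF \<phi>] by simp
 show "((\<lambda>s. u s \<phi>) \<longlongrightarrow> f \<phi>) (at_right 0)" by (rule lim(1)[OF \<phi>])
 show "(?d \<longlongrightarrow> 0) (at_right 0)"
  by (rule Lim_transform_eventually[OF lim(2)[OF \<phi>]]) (use d1 in \<open>auto simp: eventually_at_filter\<close>)
qed

lemma is_solutionD:
 assumes "is_solution \<gamma> k f u"
 shows "t > 0 \<Longrightarrow> u t \<in> S_ev_dual"
  and "\<phi> \<in> S_ev \<Longrightarrow> t > 0 \<Longrightarrow> ((\<lambda>s. u s \<phi>) has_real_derivative deriv (\<lambda>s. u s \<phi>) t) (at t)"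
  and "\<phi> \<in> S_ev \<Longrightarrow> t > 0 \<Longrightarrow> (deriv (\<lambda>s. u s \<phi>) has_real_derivative deriv (deriv (\<lambda>s. u s \<phi>)) t) (at t)"
  and "\<phi> \<in> S_ev \<Longrightarrow> continuous_on {0<..} (deriv (deriv (\<lambda>s. u s \<phi>)))"
  and "\<phi> \<in> S_ev \<Longrightarrow> t > 0 \<Longrightarrow> deriv (deriv (\<lambda>s. u s \<phi>)) t + k / t * deriv (\<lambda>s. u s \<phi>) t = u t (bessel_lap \<gamma> \<phi>)"
  and "\<phi> \<in> S_ev \<Longrightarrow> ((\<lambda>s. u s \<phi>) \<longlongrightarrow> f \<phi>) (at_right 0)"
  and "\<phi> \<in> S_ev \<Longrightarrow> (deriv (\<lambda>s. u s \<phi>) \<longlongrightarrow> 0) (at_right 0)"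
 using assms by (auto simp: is_solution_def DERIV_deriv_iff_real_differentiable)

text \<open>Unfolding the left-hand side gives the identity between V_k, V_(k+2) and V_(k+4), now in
  a form to which the functional can be applied; it is \<open>GG_step\<close> seen through
  \<open>VV_link\<close>. The differential equation follows from it.\<close>

lemma VV_step_eq:
 assumes \<gamma>: "allpos \<gamma>" and t: "t > 0" and k: "okk k" "lamk \<gamma> k + real m > 1" and \<phi>: "\<phi> \<in> S_ev"
 shows "VV \<gamma> (Suc m) k t \<phi> = VV \<gamma> m k t \<phi>"
proof
 fix y
 have h: "(\<lambda>x. 1 / nu_mass \<gamma> * TK \<gamma> \<phi> x y) \<in> S_ev" by (intro S_ev_scale TK_S_ev(2) \<gamma> \<phi>)
 have m: "lamk \<gamma> k + real (Suc m) > 1" "Re (complex_of_real (lamk \<gamma> k)) > - 1 - real m" using k(2) by auto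
 show "VV \<gamma> (Suc m) k t \<phi> y = VV \<gamma> m k t \<phi> y"
  by (simp only: VV_link[OF \<gamma> t k(1) m(1) \<phi>] VV_link[OF \<gamma> t k \<phi>] GG_step[OF \<gamma> t m(2) h])
qed

lemma dual_VV_deriv:
 assumes \<gamma>: "allpos \<gamma>" and k: "okk k" "lamk \<gamma> k + real m > 1" and \<phi>: "\<phi> \<in> S_ev" and f: "f \<in> S_ev_dual"
 shows "t > 0 \<Longrightarrow> ((\<lambda>s. f (VV \<gamma> m k s \<phi>)) has_real_derivative t / (k + 1) * f (VV \<gamma> m (k + 2) t (bessel_lap \<gamma> \<phi>))) (at t)"
  and "((\<lambda>s. f (VV \<gamma> m k s \<phi>)) \<longlongrightarrow> f \<phi>) (at_right 0)"
proof -
 note ok = okk_shifts[OF k(1)]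
 have l: "lamk \<gamma> (k + 2) + real m > 1" "lamk \<gamma> (k + 4) + real m > 1" using k(2) by (auto simp: lamk_shift)
 note B = bessel_lap_S_ev[OF \<phi>, of \<gamma>]
 note BB = bessel_lap_S_ev[OF B, of \<gamma>]
 define H' where "H' = (\<lambda>t y. t / (k + 1) * VV \<gamma> m (k + 2) t (bessel_lap \<gamma> \<phi>) y)"
 \<comment> \<open>A second derivative of the curve, which \<open>dual_deriv\<close> asks for in its
   remainder estimate.\<close>
 define H'' where "H'' = (\<lambda>t y. 1 / (k + 1) * VV \<gamma> m (k + 2) t (bessel_lap \<gamma> \<phi>) y
   + t / (k + 1) * (t / (k + 3)) * VV \<gamma> m (k + 4) t (bessel_lap \<gamma> (bessel_lap \<gamma> \<phi>)) y)"
 note c0 = VV_cfam[OF \<gamma> k(2) \<phi>] and c1 = VV_cfam[OF \<gamma> l(1) B] and c2 = VV_cfam[OF \<gamma> l(2) BB]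
 have ct: "continuous_on UNIV (\<lambda>t. t / (k + 1))" "continuous_on UNIV (\<lambda>t. t / (k + 1) * (t / (k + 3)))"
  unfolding divide_inverse by (intro continuous_intros)+
 have cH': "cfam H'" unfolding H'_def using cfam_lin[OF c1 c1 ct(1) continuous_on_const[of _ 0]] by simp
 have cH'': "cfam H''" unfolding H''_def by (rule cfam_lin[OF c1 c2 continuous_on_const ct(2)])
 have d1: "deriv_fam (\<lambda>t. VV \<gamma> m k t \<phi>) H'" unfolding deriv_fam_def H'_def using VV_deriv[OF \<gamma> k \<phi>] by blast
 have e: "k + 2 + 1 = k + 3" "k + 2 + 2 = k + 4" by auto
 have d2: "deriv_fam H' H''" unfolding deriv_fam_def
 proof (intro allI impI)
  fix t :: real and y assume "t > 0"
  have 1: "((\<lambda>s. s / (k + 1)) has_real_derivative 1 / (k + 1)) (at t)" by (rule DERIV_cdivide) simp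
  from DERIV_mult[OF 1 VV_deriv[OF \<gamma> ok(1) l(1) B, of y t, unfolded e]]
  show "((\<lambda>s. H' s y) has_real_derivative H'' t y) (at t)" unfolding H'_def H''_def by (simp add: algebra_simps)
 qed
 have fH': "f (H' t) = t / (k + 1) * f (VV \<gamma> m (k + 2) t (bessel_lap \<gamma> \<phi>))" for t
  unfolding H'_def by (rule dual_scale[OF f VV_S_ev[OF \<gamma> l(1) B]])
 show "t > 0 \<Longrightarrow> ((\<lambda>s. f (VV \<gamma> m k s \<phi>)) has_real_derivative t / (k + 1) * f (VV \<gamma> m (k + 2) t (bessel_lap \<gamma> \<phi>))) (at t)"
  using dual_deriv[OF f c0 cH' cH'' d1 d2, of t] unfolding fH' .
 have "VV \<gamma> m k 0 \<phi> = \<phi>" by (rule ext) (rule VV_zero[OF \<gamma> k \<phi>])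
 then show "((\<lambda>s. f (VV \<gamma> m k s \<phi>)) \<longlongrightarrow> f \<phi>) (at_right 0)"
  using dual_limit[OF f c0 cH' d1] by (simp only:)
qed

lemma gtrans_eq:
 fixes \<gamma> :: "real^'n::finite"
 assumes \<gamma>: "allpos \<gamma>" and \<phi>: "\<phi> \<in> S_ev"
 shows "gtrans \<gamma> y \<phi> = (\<lambda>x. 1 / nu_mass \<gamma> * TK \<gamma> \<phi> x y)"
proof
 fix x
 have "Gamma ((a + 1) / 2) / (Gamma (a / 2) * Gamma (1/2)) * (Gamma (a / 2) * Gamma (1/2) / Gamma ((a + 1) / 2)) = 1"
  if "a > 0" for a :: real
 proof -
  have aux: "u / (v * w) * (v * w / u) = 1" if "0 < u" "0 < v" "0 < w" for u v w :: real using that by simp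
  show ?thesis by (rule aux) (use that in \<open>auto intro!: Gamma_real_pos\<close>)
 qed
 then have "(\<Prod>i\<in>UNIV. Gamma ((\<gamma>$i + 1) / 2) / (Gamma (\<gamma>$i / 2) * Gamma (1/2))) * nu_mass \<gamma> = (\<Prod>i\<in>(UNIV::'n set). 1)"
  unfolding nu_mass_def prod.distrib[symmetric] using \<gamma> by (intro prod.cong refl) blast
 then have c: "(\<Prod>i\<in>UNIV. Gamma ((\<gamma>$i + 1) / 2) / (Gamma (\<gamma>$i / 2) * Gamma (1/2))) = 1 / nu_mass \<gamma>"
  using nu_mass_pos[OF \<gamma>] by (simp add: field_simps)
 have pw: "(if a \<in> cbox 0 (\<chi> i. pi) then \<phi> (gdist x y a) * (\<Prod>i\<in>UNIV. sin (a$i) powr (\<gamma>$i - 1)) else 0) = sinw \<gamma> a * \<phi> (gdist x y a)" for a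
 proof (cases "a \<in> cbox 0 (\<chi> i. pi)")
  case True
  then have "0 \<le> a$i \<and> a$i \<le> pi" for i by (simp add: mem_box_cart)
  then have "indicator {0<..<pi} (a$i) * sin (a$i) powr (\<gamma>$i - 1) = sin (a$i) powr (\<gamma>$i - 1)" for i
   by (cases "a$i = 0 \<or> a$i = pi") (auto simp: less_le)
  then have "sinw \<gamma> a = (\<Prod>i\<in>UNIV. sin (a$i) powr (\<gamma>$i - 1))" unfolding sinw_def by (intro prod.cong refl)
  then show ?thesis using True by simp
 next
  case False
  then obtain i where "a$i < 0 \<or> pi < a$i" by (auto simp: mem_box_cart not_le)
  then have "indicator {0<..<pi} (a$i) * sin (a$i) powr (\<gamma>$i - 1) = 0" by auto
  then have "sinw \<gamma> a = 0" unfolding sinw_def by (intro prod_zero bexI[of _ i]) auto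
  with False show ?thesis by simp
 qed
 have "integral (cbox 0 (\<chi> i. pi)) (\<lambda>a. \<phi> (gdist x y a) * (\<Prod>i\<in>UNIV. sin (a$i) powr (\<gamma>$i - 1)))
   = integral UNIV (\<lambda>a. sinw \<gamma> a * \<phi> (gdist x y a))"
  unfolding integral_restrict_UNIV[of "cbox 0 (\<chi> i. pi)", symmetric] pw ..
 also have "... = TK \<gamma> \<phi> x y"
  unfolding TK_def integral_nu[OF S_ev_gdist_measurable[OF \<phi>]]
  by (rule integral_unique[OF has_integral_integral_lborel[OF integrable_nu_lborel[OF \<gamma> S_ev_gdist_measurable[OF \<phi>] S_ev_bounded[OF \<phi>]]]])
 finally show "gtrans \<gamma> y \<phi> x = 1 / nu_mass \<gamma> * TK \<gamma> \<phi> x y"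
  unfolding gtrans_def c gdist_def[symmetric] by simp
qed

text \<open>The translation and the continued kernel produce VV divided by the outer constant c of
  the formula; homogeneity of f cancels the two.\<close>

lemma sol_formula_eq:
 fixes \<gamma> :: "real^'n::finite"
 assumes \<gamma>: "allpos \<gamma>" and k: "okk k" "lamk \<gamma> k + real m > 1" and f: "f \<in> S_ev_dual"
  and t: "t > 0" and \<phi>: "\<phi> \<in> S_ev"
 shows "sol_formula \<gamma> k f t \<phi> = f (VV \<gamma> m k t \<phi>)"
proof -
 define c where "c = Gamma ((k + 1) / 2) / gmass \<gamma> * t powr (1 - k)"
 have c0: "c \<noteq> 0" using Gamma_nonzero[OF okk_Gamma[OF k(1)]] gmass_pos[OF \<gamma>] t by (simp add: c_def)
 have ce: "2 ^ CARD('n) * t powr (1 - k) * Gamma ((k + 1) / 2) / (\<Prod>i\<in>UNIV. Gamma ((\<gamma>$i + 1) / 2)) = c"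
  unfolding c_def gmass_def prod_dividef by (simp add: field_simps)
 have le: "(k - real CARD('n) - (\<Sum>i\<in>UNIV. \<gamma>$i) - 1) / 2 = lamk \<gamma> k" by (simp add: lamk_def hdim_def)
 have lm: "lamk \<gamma> k > 1 - real m" using k(2) by simp
 have "ker_norm \<gamma> t (lamk \<gamma> k) (gtrans \<gamma> y \<phi>) = 1 / c * VV \<gamma> m k t \<phi> y" for y
 proof -
  have h: "(\<lambda>x. 1 / nu_mass \<gamma> * TK \<gamma> \<phi> x y) \<in> S_ev" by (intro S_ev_scale TK_S_ev(2) \<gamma> \<phi>)
  show ?thesis unfolding gtrans_eq[OF \<gamma> \<phi>] ker_norm_eq_GG[OF \<gamma> t h lm] VV_link[OF \<gamma> t k \<phi>] c_def[symmetric]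
   using c0 by simp
 qed
 then have "sol_formula \<gamma> k f t \<phi> = c * f (\<lambda>y. 1 / c * VV \<gamma> m k t \<phi> y)"
  unfolding sol_formula_def Let_def le ce gconv_def by (simp only:)
 also have "... = f (VV \<gamma> m k t \<phi>)" unfolding dual_scale[OF f VV_S_ev[OF \<gamma> k(2) \<phi>]] using c0 by simp
 finally show ?thesis .
qed

lemma dual_VV:
 assumes \<gamma>: "allpos \<gamma>" and k: "lamk \<gamma> k + real m > 1" and f: "f \<in> S_ev_dual" and t: "t > 0"
 shows "(\<lambda>\<phi>. f (VV \<gamma> m k t \<phi>)) \<in> S_ev_dual"
proof -
 obtain C N where C: "C \<ge> 0" "\<And>\<phi>. \<phi> \<in> S_ev \<Longrightarrow> \<bar>f \<phi>\<bar> \<le> C * sn N \<phi>" using dualD(2)[OF f] by blast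
 obtain D M where D: "\<And>s \<phi>. \<bar>s\<bar> \<le> t \<Longrightarrow> \<phi> \<in> S_ev \<Longrightarrow> sn N (VV \<gamma> m k s \<phi>) \<le> D * sn M \<phi>"
  using VV_bound[OF \<gamma> less_imp_le[OF t] k, of N] by blast
 show ?thesis
 proof (rule dualI[where C="C * D" and N=M])
  fix \<phi> \<psi> :: "real^'a \<Rightarrow> real" and a b :: real assume "\<phi> \<in> S_ev" "\<psi> \<in> S_ev"
  note S = this
  have e: "VV \<gamma> m k t (\<lambda>x. a * \<phi> x + b * \<psi> x) = (\<lambda>y. a * VV \<gamma> m k t \<phi> y + b * VV \<gamma> m k t \<psi> y)"
   by (rule ext) (rule VV_lin[OF \<gamma> k S])
  show "f (VV \<gamma> m k t (\<lambda>x. a * \<phi> x + b * \<psi> x)) = a * f (VV \<gamma> m k t \<phi>) + b * f (VV \<gamma> m k t \<psi>)"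
   unfolding e by (rule dualD(1)[OF f VV_S_ev[OF \<gamma> k S(1)] VV_S_ev[OF \<gamma> k S(2)]])
 next
  fix \<phi> :: "real^'a \<Rightarrow> real" assume \<phi>: "\<phi> \<in> S_ev"
  have "\<bar>f (VV \<gamma> m k t \<phi>)\<bar> \<le> C * sn N (VV \<gamma> m k t \<phi>)" by (rule C(2)[OF VV_S_ev[OF \<gamma> k \<phi>]])
  also have "... \<le> C * (D * sn M \<phi>)" using t by (intro mult_left_mono D \<phi> C(1)) auto
  finally show "\<bar>f (VV \<gamma> m k t \<phi>)\<bar> \<le> C * D * sn M \<phi>" by (simp add: ac_simps)
 qed
qed

text \<open>Membership in \<open>S_ev_dual\<close> constrains a functional on test functions only,
  and only there the solution formula is identified with VV.\<close>

lemma S_ev_dual_cong: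
 assumes "g \<in> S_ev_dual" "\<And>\<phi>. \<phi> \<in> S_ev \<Longrightarrow> f \<phi> = g \<phi>" shows "f \<in> S_ev_dual"
proof -
 obtain C N where C: "\<And>\<phi>. \<phi> \<in> S_ev \<Longrightarrow> \<bar>g \<phi>\<bar> \<le> C * sn N \<phi>" using dualD(2)[OF assms(1)] by blast
 show ?thesis
 proof (rule dualI[where C=C and N=N])
  fix \<phi> \<psi> :: "real^'a \<Rightarrow> real" and a b :: real assume S: "\<phi> \<in> S_ev" "\<psi> \<in> S_ev"
  show "f (\<lambda>x. a * \<phi> x + b * \<psi> x) = a * f \<phi> + b * f \<psi>"
   unfolding assms(2)[OF S_ev_lin[OF S]] assms(2)[OF S(1)] assms(2)[OF S(2)] by (rule dualD(1)[OF assms(1) S])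
 qed (use assms(2) C in auto)
qed

text \<open>Let A and B be f applied to V_(k+2) of the Laplacian and to V_(k+4) of its square. Then
  u' = t A / (k + 1) and u'' = A / (k + 1) + t^2 B / ((k + 1) (k + 3)), so the terms with A in u'' +
  k u' / t add up to A, and \<open>VV_step_eq\<close> recognizes the result as u of the
  Laplacian.\<close>

theorem existence:
 assumes \<gamma>: "allpos \<gamma>" and k: "okk k" and f: "f \<in> S_ev_dual"
 shows "is_solution \<gamma> k f (sol_formula \<gamma> k f)"
proof -
 obtain m :: nat where "1 - lamk \<gamma> k < real m" using reals_Archimedean2 by blast
 then have l0: "lamk \<gamma> k + real m > 1" by simp
 have l: "lamk \<gamma> (k + 2) + real m > 1" "lamk \<gamma> (k + 4) + real m > 1" using l0 by (auto simp: lamk_shift)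
 note ok = okk_shifts[OF k]
 note sol = sol_formula_eq[OF \<gamma> k l0 f]
 define A where "A = (\<lambda>\<phi> t. f (VV \<gamma> m (k + 2) t (bessel_lap \<gamma> \<phi>)))"
 define B where "B = (\<lambda>\<phi> t. f (VV \<gamma> m (k + 4) t (bessel_lap \<gamma> (bessel_lap \<gamma> \<phi>))))"
 have e: "k + 2 + 1 = k + 3" "k + 2 + 2 = k + 4" by auto
 have dA: "(A \<phi> has_real_derivative t / (k + 3) * B \<phi> t) (at t)" if "\<phi> \<in> S_ev" "t > 0" for \<phi> t
  unfolding A_def B_def
  by (rule dual_VV_deriv(1)[OF \<gamma> ok(1) l(1) bessel_lap_S_ev[OF that(1)] f that(2), unfolded e])
 show ?thesis
 proof (rule is_solutionI[where w'="\<lambda>\<phi> t. t / (k + 1) * A \<phi> t" and w''="\<lambda>\<phi> t. 1 / (k + 1) * A \<phi> t + t\<^sup>2 / ((k + 1) * (k + 3)) * B \<phi> t"])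
  show "sol_formula \<gamma> k f t \<in> S_ev_dual" if "t > 0" for t
   by (rule S_ev_dual_cong[OF dual_VV[OF \<gamma> l0 f that] sol[OF that]])
  fix \<phi> :: "real^'a \<Rightarrow> real" assume \<phi>: "\<phi> \<in> S_ev"
  note S1 = bessel_lap_S_ev[OF \<phi>, of \<gamma>]
  note S2 = bessel_lap_S_ev[OF S1, of \<gamma>]
  show "((\<lambda>s. sol_formula \<gamma> k f s \<phi>) has_real_derivative t / (k + 1) * A \<phi> t) (at t)" if "t > 0" for t
  proof (rule has_field_derivative_transform_within_open)
   show "((\<lambda>s. f (VV \<gamma> m k s \<phi>)) has_real_derivative t / (k + 1) * A \<phi> t) (at t)"
    unfolding A_def by (rule dual_VV_deriv(1)[OF \<gamma> k l0 \<phi> f that])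
   show "open {0::real<..}" by simp
  qed (use that sol[OF _ \<phi>] in auto)
  show "((\<lambda>t. t / (k + 1) * A \<phi> t) has_real_derivative 1 / (k + 1) * A \<phi> t + t\<^sup>2 / ((k + 1) * (k + 3)) * B \<phi> t) (at t)" if "t > 0" for t
  proof -
   have 1: "((\<lambda>s. s / (k + 1)) has_real_derivative 1 / (k + 1)) (at t)" by (rule DERIV_cdivide) simp
   from DERIV_mult[OF 1 dA[OF \<phi> that]] show ?thesis by (simp add: power2_eq_square ac_simps)
  qed
  have "continuous_on {0<..} (A \<phi>)" "continuous_on {0<..} (B \<phi>)"
   unfolding continuous_on_eq_continuous_within
   using dA[OF \<phi>] dual_VV_deriv(1)[OF \<gamma> ok(2) l(2) S2 f] unfolding B_def
   by (auto intro!: continuous_at_imp_continuous_at_within DERIV_isCont)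
  then show "continuous_on {0<..} (\<lambda>t. 1 / (k + 1) * A \<phi> t + t\<^sup>2 / ((k + 1) * (k + 3)) * B \<phi> t)"
   unfolding divide_inverse by (intro continuous_intros)
  show "1 / (k + 1) * A \<phi> t + t\<^sup>2 / ((k + 1) * (k + 3)) * B \<phi> t + k / t * (t / (k + 1) * A \<phi> t) = sol_formula \<gamma> k f t (bessel_lap \<gamma> \<phi>)" if t: "t > 0" for t
  proof -
   have "VV \<gamma> m k t (bessel_lap \<gamma> \<phi>) = (\<lambda>y. 1 * VV \<gamma> m (k + 2) t (bessel_lap \<gamma> \<phi>) y + t\<^sup>2 / ((k + 1) * (k + 3)) * VV \<gamma> m (k + 4) t (bessel_lap \<gamma> (bessel_lap \<gamma> \<phi>)) y)"
    unfolding VV_step_eq[OF \<gamma> t k l0 S1, symmetric] by (simp add: fun_eq_iff)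
   then have "sol_formula \<gamma> k f t (bessel_lap \<gamma> \<phi>) = 1 * A \<phi> t + t\<^sup>2 / ((k + 1) * (k + 3)) * B \<phi> t"
    unfolding sol[OF t S1] A_def B_def by (simp only: dualD(1)[OF f VV_S_ev[OF \<gamma> l(1) S1] VV_S_ev[OF \<gamma> l(2) S2]])
   moreover have "1 / (k + 1) * A \<phi> t + k / t * (t / (k + 1) * A \<phi> t) = A \<phi> t"
   proof -
    have "1 / c * a + (c - 1) / c * a = a" if "c \<noteq> 0" for a c :: real using that by (simp add: field_simps)
    from this[OF ok(3), of "A \<phi> t"] show ?thesis using t by simp
   qed
   ultimately show ?thesis by simp
  qed
  show "((\<lambda>s. sol_formula \<gamma> k f s \<phi>) \<longlongrightarrow> f \<phi>) (at_right 0)"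
   by (rule Lim_transform_eventually[OF dual_VV_deriv(2)[OF \<gamma> k l0 \<phi> f]]) (use sol[OF _ \<phi>] in \<open>auto simp: eventually_at_filter\<close>)
  have "((\<lambda>t. t / (k + 1) * A \<phi> t) \<longlongrightarrow> 0 / (k + 1) * f (bessel_lap \<gamma> \<phi>)) (at_right 0)"
   unfolding A_def divide_inverse by (intro tendsto_intros dual_VV_deriv(2)[OF \<gamma> ok(1) l(1) S1 f])
  then show "((\<lambda>t. t / (k + 1) * A \<phi> t) \<longlongrightarrow> 0) (at_right 0)" by simp
 qed
qed

subsection \<open>Non-uniqueness for negative \<open>k\<close>\<close>

lemma ow_integral_dual:
 fixes \<gamma> :: "real^'n::finite"
 assumes \<gamma>: "allpos \<gamma>"
 shows "(\<lambda>\<phi>. \<integral>x. ow \<gamma> x * \<phi> x \<partial>lborel) \<in> S_ev_dual"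
proof -
 define p where "p = nat \<lceil>\<Sum>i\<in>UNIV. \<gamma>$i\<rceil>"
 define N where "N = p + 2 * CARD('n)"
 define c where "c = (real CARD('n) + 1) ^ (N + 1)"
 show ?thesis
 proof (rule dualI)
  fix \<phi> \<psi> :: "real^'n \<Rightarrow> real" and a b :: real assume S: "\<phi> \<in> S_ev" "\<psi> \<in> S_ev"
  have "(LBINT x. ow \<gamma> x * (a * \<phi> x + b * \<psi> x)) = (LBINT x. a * (ow \<gamma> x * \<phi> x) + b * (ow \<gamma> x * \<psi> x))"
   by (simp add: algebra_simps)
  then show "(LBINT x. ow \<gamma> x * (a * \<phi> x + b * \<psi> x)) = a * (LBINT x. ow \<gamma> x * \<phi> x) + b * (LBINT x. ow \<gamma> x * \<psi> x)"
   using integrable_ow_S_ev[OF \<gamma> S(1)] integrable_ow_S_ev[OF \<gamma> S(2)] by simp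
 next
  fix \<phi> :: "real^'n \<Rightarrow> real" assume \<phi>: "\<phi> \<in> S_ev"
  have pw: "norm (ow \<gamma> x * \<phi> x) \<le> c * sn N \<phi> * (1 / (1 + norm x) ^ (2 * CARD('n)))" for x
  proof -
   have "ow \<gamma> x * \<bar>\<phi> x\<bar> * (1 + norm x) ^ (2 * CARD('n)) \<le> (1 + norm x) ^ p * \<bar>\<phi> x\<bar> * (1 + norm x) ^ (2 * CARD('n))"
    unfolding p_def by (intro mult_right_mono ow_bound[OF \<gamma>]) auto
   also have "... = (1 + norm x) ^ N * \<bar>\<phi> x\<bar>" by (simp add: N_def power_add)
   also have "... \<le> c * sn N \<phi>" unfolding c_def by (rule S_ev_decay[OF \<phi>])
   finally have "ow \<gamma> x * \<bar>\<phi> x\<bar> * (1 + norm x) ^ (2 * CARD('n)) \<le> c * sn N \<phi>" .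
   moreover have "0 < (1 + norm x) ^ (2 * CARD('n))" by (simp add: add_pos_nonneg)
   ultimately have "ow \<gamma> x * \<bar>\<phi> x\<bar> \<le> c * sn N \<phi> / (1 + norm x) ^ (2 * CARD('n))" by (simp only: pos_le_divide_eq)
   then show ?thesis using ow_nonneg[of \<gamma> x] by (simp add: abs_mult)
  qed
  have "norm (LBINT x. ow \<gamma> x * \<phi> x) \<le> (LBINT x. c * sn N \<phi> * (1 / (1 + norm (x::real^'n)) ^ (2 * CARD('n))))"
   by (rule Bochner_Integration.integral_norm_bound_integral[OF integrable_ow_S_ev[OF \<gamma> \<phi>] integrable_mult_right[OF integrable_inverse_power_norm] pw])
  then have "\<bar>\<integral>x. ow \<gamma> x * \<phi> x \<partial>lborel\<bar> \<le> c * sn N \<phi> * (LBINT x. 1 / (1 + norm (x::real^'n)) ^ (2 * CARD('n)))"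
   by (simp only: integral_mult_right_zero real_norm_def)
  then show "\<bar>\<integral>x. ow \<gamma> x * \<phi> x \<partial>lborel\<bar> \<le> c * (LBINT x. 1 / (1 + norm (x::real^'n)) ^ (2 * CARD('n))) * sn N \<phi>"
   by (simp add: ac_simps)
 qed
qed

definition gauss :: "real^'n::finite \<Rightarrow> real" where
 "gauss x = exp (- (norm x)\<^sup>2)"

text \<open>From (1 + y / N)^N \<le> exp y with y = r^2, after 1 + r \<le> 2 + 2 r^2.\<close>

lemma exp_square_bound:
 assumes "r \<ge> 0" shows "(1 + r) ^ N * exp (- r\<^sup>2) \<le> (2 * real N + 1) ^ N"
proof (cases "N = 0")
 case False
 have "1 + r \<le> (2 * real N) * (1 + r\<^sup>2 / real N)"
 proof -
  have "0 \<le> (r - 1 / 4)\<^sup>2" by simp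
  then have "1 + r \<le> 2 + 2 * r\<^sup>2" by (simp add: power2_eq_square algebra_simps)
  moreover have "2 \<le> 2 * real N" using False by simp
  ultimately have "1 + r \<le> 2 * real N + 2 * r\<^sup>2" by linarith
  moreover have "2 * real N * (1 + r\<^sup>2 / real N) = 2 * real N + 2 * r\<^sup>2" using False by (simp add: field_simps)
  ultimately show ?thesis by simp
 qed
 then have "(1 + r) ^ N \<le> ((2 * real N) * (1 + r\<^sup>2 / real N)) ^ N" using assms by (intro power_mono) auto
 also have "... = (2 * real N) ^ N * (1 + r\<^sup>2 / real N) ^ N" by (rule power_mult_distrib)
 also have "... \<le> (2 * real N) ^ N * exp (r\<^sup>2)"
  using False assms by (intro mult_left_mono exp_ge_one_plus_x_over_n_power_n) (auto intro: order_trans[of _ 0])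
 finally have "(1 + r) ^ N * exp (- r\<^sup>2) \<le> (2 * real N) ^ N" by (simp add: exp_minus field_simps)
 also have "... \<le> (2 * real N + 1) ^ N" by (intro power_mono) auto
 finally show ?thesis .
qed simp

lemma has_pd_exp_norm:
 assumes "has_pd i f f'" "\<And>x. ((\<lambda>s. g s) has_real_derivative g' (f x)) (at (f x))"
 shows "has_pd i (\<lambda>x. g (f x)) (\<lambda>x. g' (f x) * f' x)"
 unfolding has_pd_def
proof
 fix x
 have "((\<lambda>s. f (x + ax i s)) has_real_derivative f' x) (at 0)" using assms(1) by (simp add: has_pd_def)
 from DERIV_chain2[OF _ this, of g "g' (f x)"] assms(2)[of x]
 show "((\<lambda>s. g (f (x + ax i s))) has_real_derivative g' (f x) * f' x) (at 0)" by simp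
qed

lemma has_pd_norm_sq: "has_pd i (\<lambda>x. (norm x)\<^sup>2) (\<lambda>x. 2 * x$i)"
 unfolding has_pd_def using norm_line_sq_deriv by blast

lemma has_pd_gauss: "has_pd i gauss (\<lambda>x. x$i * (- 2 * gauss x))"
proof -
 have "has_pd i (\<lambda>x. exp (- (norm x)\<^sup>2)) (\<lambda>x. - exp (- (norm x)\<^sup>2) * (2 * x$i))"
  by (rule has_pd_exp_norm[OF has_pd_norm_sq, where g="\<lambda>s. exp (- s)" and g'="\<lambda>s. - exp (- s)"])
   (auto intro!: derivative_eq_intros)
 then show ?thesis by (simp add: gauss_def[abs_def] ac_simps)
qed

text \<open>The span of this single generator consists of polynomials times the Gaussian, with a
  trivial parameter. Evenness is a separate hypothesis because odd polynomials belong to the span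
  too.\<close>

lemma pspan_gauss_S_ev:
 fixes G :: "unit \<Rightarrow> real^'n::finite \<Rightarrow> real"
 assumes G: "G \<in> pspan {\<lambda>_. gauss}" and e: "even_fn (G ())"
 shows "G () \<in> S_ev"
proof (rule pspan_S_ev(2)[where B="{\<lambda>_. gauss}" and P=UNIV and \<nu>="\<lambda>_ _. 1"])
 show "pd_closed {\<lambda>_::unit. gauss :: real^'n \<Rightarrow> real} UNIV"
  unfolding pd_closed_def
 proof (intro ballI allI)
  fix H :: "unit \<Rightarrow> real^'n \<Rightarrow> real" and i assume "H \<in> {\<lambda>_. gauss}"
  then have H: "H = (\<lambda>_. gauss)" by simp
  have "(\<lambda>_ x. x$i * (- 2 * gauss x)) \<in> pspan {\<lambda>_::unit. gauss :: real^'n \<Rightarrow> real}"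
   by (rule pspan.coord[OF pspan_scale[OF pspan.base]]) simp
  then show "\<exists>G'\<in>pspan {\<lambda>_. gauss}. \<forall>p\<in>UNIV. has_pd i (H p) (G' p)"
   unfolding H by (rule rev_bexI) (intro ballI has_pd_gauss)
 qed
 show "continuous_on UNIV (H p)" if "H \<in> {\<lambda>_. gauss}" for H :: "unit \<Rightarrow> real^'n \<Rightarrow> real" and p
  using that by (auto simp: gauss_def[abs_def] intro!: continuous_intros)
 show "norm_scale UNIV (\<lambda>_ _::unit. 1)" by (simp add: norm_scale_def)
 show "unif_bd UNIV (\<lambda>_ _. 1) H" if "H \<in> {\<lambda>_. gauss}" for H :: "unit \<Rightarrow> real^'n \<Rightarrow> real"
  unfolding unif_bd_def
 proof
  fix \<alpha> :: "'n \<Rightarrow> nat"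
  let ?N = "\<Sum>i\<in>UNIV. \<alpha> i"
  have "\<bar>monom \<alpha> x * gauss x\<bar> \<le> (2 * real ?N + 1) ^ ?N" for x
  proof -
   have "\<bar>monom \<alpha> x * gauss x\<bar> \<le> (1 + norm x) ^ ?N * gauss x"
    unfolding abs_mult by (simp add: gauss_def mult_right_mono[OF abs_monom_le])
   also have "... \<le> (2 * real ?N + 1) ^ ?N" unfolding gauss_def by (rule exp_square_bound) simp
   finally show ?thesis .
  qed
  then show "\<exists>C M. 0 \<le> C \<and> (\<forall>p\<in>UNIV. \<forall>x. \<bar>monom \<alpha> x * H p x\<bar> \<le> C * 1)"
   using that by (intro exI[of _ "(2 * real ?N + 1) ^ ?N"]) (auto intro!: zero_le_power add_nonneg_nonneg sum_nonneg)
 qed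
qed (use G e in auto)

lemma norm_mirror: "norm (mirror i x) = norm x"
proof -
 have "(\<Sum>j\<in>UNIV. mirror i x $ j * mirror i x $ j) = (\<Sum>j\<in>UNIV. x $ j * x $ j)"
  by (rule sum.cong) (auto simp: mirror_component)
 then show ?thesis by (simp add: norm_eq_sqrt_inner inner_vec_def)
qed

lemma gauss_S_ev: "gauss \<in> S_ev"
 using pspan_gauss_S_ev[of "\<lambda>_. gauss", OF pspan.base] by (simp add: even_fn_mirror gauss_def norm_mirror)

text \<open>For k < 0 both t^(1 - k) and its derivative, a multiple of t^(- k), tend to 0, so adding
  the null solution keeps the initial data. The Gaussian at time 1 tells the two solutions
  apart.\<close>

theorem nonuniqueness:
 assumes \<gamma>: "allpos \<gamma>" and k: "k < 0" and u: "is_solution \<gamma> k f u"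
 shows "\<exists>v. is_solution \<gamma> k f v \<and> \<not> (\<forall>t>0. \<forall>\<phi>\<in>S_ev. v t \<phi> = u t \<phi>)"
proof -
 define F where "F = (\<lambda>\<phi>. \<integral>x. ow \<gamma> x * \<phi> x \<partial>lborel)"
 have F: "F \<in> S_ev_dual" unfolding F_def by (rule ow_integral_dual[OF \<gamma>])
 define v where "v = (\<lambda>t \<phi>. u t \<phi> + t powr (1 - k) * F \<phi>)"
 note uD = is_solutionD[OF u]
 let ?d = "\<lambda>\<phi>. deriv (\<lambda>s. u s \<phi>)"
 have "is_solution \<gamma> k f v"
 proof (rule is_solutionI[where w'="\<lambda>\<phi> t. ?d \<phi> t + (1 - k) * t powr (- k) * F \<phi>"
    and w''="\<lambda>\<phi> t. deriv (?d \<phi>) t + (1 - k) * (- k) * t powr (- k - 1) * F \<phi>"])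
  show "v t \<in> S_ev_dual" if t: "t > 0" for t
   using dual_lin[OF uD(1)[OF t] F, of 1 "t powr (1 - k)"] by (simp add: v_def)
  fix \<phi> :: "real^'a \<Rightarrow> real" assume \<phi>: "\<phi> \<in> S_ev"
  have FB: "F (bessel_lap \<gamma> \<phi>) = 0" unfolding F_def by (rule bessel_lap_integral_zero[OF \<gamma> \<phi>])
  have p: "((\<lambda>s. s powr a) has_real_derivative a * t powr (a - 1)) (at t)" if "t > 0" for a t
   using has_real_derivative_powr[OF that] by simp
  show "((\<lambda>s. v s \<phi>) has_real_derivative ?d \<phi> t + (1 - k) * t powr (- k) * F \<phi>) (at t)" if "t > 0" for t
   unfolding v_def using DERIV_add[OF uD(2)[OF \<phi> that] DERIV_cmult_right[OF p[OF that, of "1 - k"], of "F \<phi>"]] by simp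
  show "((\<lambda>t. ?d \<phi> t + (1 - k) * t powr (- k) * F \<phi>) has_real_derivative
    deriv (?d \<phi>) t + (1 - k) * (- k) * t powr (- k - 1) * F \<phi>) (at t)" if "t > 0" for t
   using DERIV_add[OF uD(3)[OF \<phi> that] DERIV_cmult_right[OF DERIV_cmult[OF p[OF that, of "- k"], of "1 - k"], of "F \<phi>"]] by (simp add: ac_simps)
  have cp: "continuous_on {0<..} (\<lambda>t::real. t powr (- k - 1))" by (intro continuous_on_powr continuous_intros) auto
  show "continuous_on {0<..} (\<lambda>t. deriv (?d \<phi>) t + (1 - k) * (- k) * t powr (- k - 1) * F \<phi>)"
   by (intro continuous_on_add continuous_on_mult continuous_on_const cp uD(4)[OF \<phi>])
  show "deriv (?d \<phi>) t + (1 - k) * (- k) * t powr (- k - 1) * F \<phi> + k / t * (?d \<phi> t + (1 - k) * t powr (- k) * F \<phi>) = v t (bessel_lap \<gamma> \<phi>)" if t: "t > 0" for t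
  proof -
   have "t powr (- k) = t powr (- k - 1) * t" using t powr_add[of t "- k - 1" 1] by simp
   then have "(1 - k) * (- k) * t powr (- k - 1) * F \<phi> + k / t * ((1 - k) * t powr (- k) * F \<phi>) = 0" using t by (simp add: field_simps)
   then show ?thesis using uD(5)[OF \<phi> t] unfolding v_def FB by (simp add: distrib_left)
  qed
  have pl: "((\<lambda>t. t powr a) \<longlongrightarrow> 0) (at_right (0::real))" if "a > 0" for a
   using tendsto_powr'[of "\<lambda>t. t" 0 "at_right 0" "\<lambda>_. a" a] that by (auto simp: eventually_at_filter)
  have "((\<lambda>s. v s \<phi>) \<longlongrightarrow> f \<phi> + 0 * F \<phi>) (at_right 0)"
   unfolding v_def using k by (intro tendsto_intros uD(6)[OF \<phi>] pl) auto
  then show "((\<lambda>s. v s \<phi>) \<longlongrightarrow> f \<phi>) (at_right 0)" by simp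
  have "((\<lambda>t. ?d \<phi> t + (1 - k) * t powr (- k) * F \<phi>) \<longlongrightarrow> 0 + (1 - k) * 0 * F \<phi>) (at_right 0)"
   using k by (intro tendsto_intros uD(7)[OF \<phi>] pl) auto
  then show "((\<lambda>t. ?d \<phi> t + (1 - k) * t powr (- k) * F \<phi>) \<longlongrightarrow> 0) (at_right 0)" by simp
 qed
 moreover have "v 1 gauss \<noteq> u 1 gauss"
 proof -
  have "F gauss = gmass \<gamma>" unfolding F_def using ow_gaussian_nn_integral[OF \<gamma>] gmass_pos[OF \<gamma>]
   by (subst integral_eq_nn_integral) (auto simp: gauss_def ow_nonneg intro!: borel_measurable_continuous_onI continuous_intros)
  then show ?thesis using gmass_pos[OF \<gamma>] by (simp add: v_def)
 qed
 ultimately show ?thesis using gauss_S_ev zero_less_one by blast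
qed

subsection \<open>Uniqueness for \<open>k \<ge> 0\<close>: uniform boundedness and growth of iterated Bessel equations\<close>

text \<open>Baire category over an arbitrary index set: the closed sets \<open>E n\<close> cover the
  space, so one of them contains a ball of radius r, and the difference of two of its points gives
  the constant 2 n / r.\<close>

lemma banach_steinhaus:
 fixes L :: "'t \<Rightarrow> 'a::{real_normed_vector,complete_space} \<Rightarrow> real"
 assumes L: "\<And>t. t \<in> T \<Longrightarrow> bounded_linear (L t)" and pb: "\<And>x. \<exists>B. \<forall>t\<in>T. \<bar>L t x\<bar> \<le> B"
 shows "\<exists>K. \<forall>t\<in>T. \<forall>x. \<bar>L t x\<bar> \<le> K * norm x"
proof -
 define E where "E = (\<lambda>n::nat. {x. \<forall>t\<in>T. \<bar>L t x\<bar> \<le> real n})"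
 have clE: "closed (E n)" for n
 proof -
  have "E n = (\<Inter>t\<in>T. {x. \<bar>L t x\<bar> \<le> real n})" by (auto simp: E_def)
  moreover have "closed {x. \<bar>L t x\<bar> \<le> real n}" if "t \<in> T" for t
   by (intro closed_Collect_le continuous_intros bounded_linear.continuous_on[OF L[OF that]])
  ultimately show ?thesis by auto
 qed
 have un: "\<Union>(range E) = UNIV"
 proof -
  have "\<exists>n. x \<in> E n" for x
  proof -
   obtain B where B: "\<forall>t\<in>T. \<bar>L t x\<bar> \<le> B" using pb by blast
   obtain n where "B \<le> real n" using real_arch_simple by blast
   then have "x \<in> E n" using B by (fastforce simp: E_def)
   then show ?thesis by blast
  qed
  then show ?thesis by blast
 qed
 have "\<exists>n. interior (E n) \<noteq> {}"
 proof (rule ccontr)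
  assume "\<not> ?thesis"
  then have "euclidean interior_of \<Union>(range E) = {}"
   by (intro Baire_category_alt disjI1 completely_metrizable_space_euclidean) (auto simp: clE)
  then show False unfolding un by simp
 qed
 then obtain n x0 where "x0 \<in> interior (E n)" by blast
 then obtain r where r: "r > 0" "cball x0 r \<subseteq> E n" unfolding mem_interior_cball by blast
 have "\<bar>L t x\<bar> \<le> (2 * real n / r) * norm x" if t: "t \<in> T" for t x
 proof (cases "x = 0")
  case True
  then show ?thesis using linear_0[OF bounded_linear.linear[OF L[OF t]]] by simp
 next
  case False
  define y where "y = (r / norm x) *\<^sub>R x"
  have "norm y = r" using False r by (simp add: y_def)
  then have "x0 + y \<in> E n" "x0 \<in> E n" using r by (auto simp: dist_norm intro!: subsetD[OF r(2)])
  then have "\<bar>L t (x0 + y)\<bar> \<le> real n" "\<bar>L t x0\<bar> \<le> real n" using t by (auto simp: E_def)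
  moreover have "L t (x0 + y) = L t x0 + r / norm x * L t x"
   using linear_add[OF bounded_linear.linear[OF L[OF t]]] linear_scale[OF bounded_linear.linear[OF L[OF t]]] by (simp add: y_def)
  ultimately have "\<bar>r / norm x * L t x\<bar> \<le> 2 * real n" by linarith
  then have "r / norm x * \<bar>L t x\<bar> \<le> 2 * real n" using r by (simp add: abs_mult)
  then show ?thesis using r False by (simp add: field_simps)
 qed
 then show ?thesis by blast
qed

lemma nonneg_from_limit:
 assumes d: "\<And>t. 0 < t \<Longrightarrow> t \<le> T \<Longrightarrow> (h has_real_derivative h' t) (at t)"
  and h': "\<And>t. 0 < t \<Longrightarrow> t \<le> T \<Longrightarrow> 0 \<le> h' t" and lim: "(h \<longlongrightarrow> 0) (at_right 0)" and t: "0 < t" "t \<le> T"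
 shows "0 \<le> h (t::real)"
proof (rule tendsto_upperbound[OF lim _ trivial_limit_at_right_real])
 show "\<forall>\<^sub>F s in at_right 0. h s \<le> h t"
  using eventually_at_right_real[OF t(1)]
 proof eventually_elim
  case (elim s)
  show ?case
  proof (rule DERIV_nonneg_imp_nondecreasing[of s t h])
   fix x assume "s \<le> x" "x \<le> t"
   then have "0 < x" "x \<le> T" using elim t by auto
   then show "\<exists>y. (h has_real_derivative y) (at x) \<and> 0 \<le> y" using d h' by blast
  qed (use elim in auto)
 qed
qed

lemma abs_bound_from_limit:
 assumes d: "\<And>t. 0 < t \<Longrightarrow> t \<le> T \<Longrightarrow> (h has_real_derivative h' t) (at t)"
  and g: "\<And>t. 0 < t \<Longrightarrow> t \<le> T \<Longrightarrow> (g has_real_derivative g' t) (at t)"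
  and b: "\<And>t. 0 < t \<Longrightarrow> t \<le> T \<Longrightarrow> \<bar>h' t\<bar> \<le> g' t"
  and lim: "(h \<longlongrightarrow> 0) (at_right 0)" "(g \<longlongrightarrow> 0) (at_right 0)" and t: "0 < t" "t \<le> T"
 shows "\<bar>h t\<bar> \<le> g (t::real)"
proof -
 have "0 \<le> g t - h t"
 proof (rule nonneg_from_limit[where h="\<lambda>t. g t - h t" and h'="\<lambda>t. g' t - h' t" and T=T])
  show "((\<lambda>t. g t - h t) \<longlongrightarrow> 0) (at_right 0)" using tendsto_diff[OF lim(2,1)] by simp
  show "0 \<le> g' t - h' t" if "0 < t" "t \<le> T" for t using b[OF that] by simp
  show "((\<lambda>t. g t - h t) has_real_derivative g' t - h' t) (at t)" if "0 < t" "t \<le> T" for t by (rule DERIV_diff[OF g[OF that] d[OF that]])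
 qed (use t in auto)
 moreover have "0 \<le> g t + h t"
 proof (rule nonneg_from_limit[where h="\<lambda>t. g t + h t" and h'="\<lambda>t. g' t + h' t" and T=T])
  show "((\<lambda>t. g t + h t) \<longlongrightarrow> 0) (at_right 0)" using tendsto_add[OF lim(2,1)] by simp
  show "0 \<le> g' t + h' t" if "0 < t" "t \<le> T" for t using b[OF that] by simp
  show "((\<lambda>t. g t + h t) has_real_derivative g' t + h' t) (at t)" if "0 < t" "t \<le> T" for t by (rule DERIV_add[OF g[OF that] d[OF that]])
 qed (use t in auto)
 ultimately show ?thesis by linarith
qed

lemma tendsto_monomial_0: "n > 0 \<Longrightarrow> ((\<lambda>t::real. c * t ^ n) \<longlongrightarrow> 0) (at_right 0)"
proof -
 assume "n > 0"
 have "((\<lambda>t::real. c * t ^ n) \<longlongrightarrow> c * 0 ^ n) (at_right 0)" by (intro tendsto_intros)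
 with \<open>n > 0\<close> show ?thesis by (simp add: zero_power)
qed

text \<open>t^k is an integrating factor: the derivative of t^k a1 is t^k b. The sign of k enters
  twice: t^k a1 tends to 0 at the origin, and 1 / (k + p + 1) is at most 1 / (p + 1). A second
  integration gives the bound for a.\<close>

lemma bessel_ode_gain:
 assumes k: "k \<ge> 0" and M: "M \<ge> 0"
  and d1: "\<And>t. 0 < t \<Longrightarrow> t \<le> T \<Longrightarrow> (a has_real_derivative a1 t) (at t)"
  and d2: "\<And>t. 0 < t \<Longrightarrow> t \<le> T \<Longrightarrow> (a1 has_real_derivative b t - k / t * a1 t) (at t)"
  and lim: "(a \<longlongrightarrow> 0) (at_right 0)" "(a1 \<longlongrightarrow> 0) (at_right 0)"
  and b: "\<And>t. 0 < t \<Longrightarrow> t \<le> T \<Longrightarrow> \<bar>b t\<bar> \<le> M * t ^ p" and t: "0 < t" "t \<le> (T::real)"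
 shows "\<bar>a t\<bar> \<le> M / ((real p + 1) * (real p + 2)) * t ^ (p + 2)"
proof -
 have a1: "\<bar>a1 t\<bar> \<le> M / (real p + 1) * t ^ (p + 1)" if t: "0 < t" "t \<le> T" for t
 proof -
  have "\<bar>t powr k * a1 t\<bar> \<le> M / (k + real p + 1) * t powr (k + real p + 1)"
  proof (rule abs_bound_from_limit[where T=T and h="\<lambda>t. t powr k * a1 t" and h'="\<lambda>t. t powr k * b t" and g'="\<lambda>t. M * t powr (k + real p)"])
   show "((\<lambda>t. t powr k * a1 t) has_real_derivative t powr k * b t) (at t)" if "0 < t" "t \<le> T" for t
   proof -
    have "((\<lambda>t. t powr k * a1 t) has_real_derivative k * t powr (k - 1) * a1 t + (b t - k / t * a1 t) * t powr k) (at t)"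
     by (rule DERIV_mult[OF has_real_derivative_powr[OF that(1)] d2[OF that]])
    moreover have "k * t powr (k - 1) * a1 t + (b t - k / t * a1 t) * t powr k = t powr k * b t"
     using that powr_diff[of t k 1] by (simp add: field_simps)
    ultimately show ?thesis by simp
   qed
   show "((\<lambda>t. M / (k + real p + 1) * t powr (k + real p + 1)) has_real_derivative M * t powr (k + real p)) (at t)" if "0 < t" "t \<le> T" for t
   proof -
    have "k + real p + 1 \<noteq> 0" using k by simp
    then show ?thesis using DERIV_cmult[OF has_real_derivative_powr[OF that(1), of "k + real p + 1"], of "M / (k + real p + 1)"] by simp
   qed
   show "\<bar>t powr k * b t\<bar> \<le> M * t powr (k + real p)" if "0 < t" "t \<le> T" for t
    using mult_left_mono[OF b[OF that], of "t powr k"] that by (simp add: abs_mult powr_add powr_realpow ac_simps)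
   have bd: "\<forall>\<^sub>F t in at_right 0. norm (t powr k * a1 t) \<le> \<bar>a1 t\<bar>"
    using eventually_at_right_real[OF zero_less_one]
   proof eventually_elim
    case (elim t)
    have "t powr k \<le> 1" using elim k by (intro powr_le1) auto
    from mult_right_mono[OF this, of "\<bar>a1 t\<bar>"] show ?case by (simp add: abs_mult)
   qed
   show "((\<lambda>t. t powr k * a1 t) \<longlongrightarrow> 0) (at_right 0)"
    by (rule Lim_null_comparison[OF bd]) (use tendsto_rabs[OF lim(2)] in simp)
   have "((\<lambda>t. t powr (k + real p + 1)) \<longlongrightarrow> 0 powr (k + real p + 1)) (at_right 0)"
    using k by (intro tendsto_powr' tendsto_intros) (auto simp: eventually_at_filter)
   from tendsto_mult_left[OF this, of "M / (k + real p + 1)"]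
   show "((\<lambda>t. M / (k + real p + 1) * t powr (k + real p + 1)) \<longlongrightarrow> 0) (at_right 0)" by simp
  qed (use t in auto)
  also have "... = t powr k * (M / (k + real p + 1) * t ^ (p + 1))"
   using t powr_realpow[OF t(1), of "p + 1"] powr_add[of t k "real (p + 1)"] by (simp add: ac_simps)
  finally have "t powr k * \<bar>a1 t\<bar> \<le> t powr k * (M / (k + real p + 1) * t ^ (p + 1))" by (simp add: abs_mult)
  moreover have "0 < t powr k" using t by simp
  ultimately have "\<bar>a1 t\<bar> \<le> M / (k + real p + 1) * t ^ (p + 1)" using mult_le_cancel_left_pos by blast
  also have "... \<le> M / (real p + 1) * t ^ (p + 1)"
   using k M t by (intro mult_right_mono divide_left_mono mult_pos_pos) auto
  finally show ?thesis .
 qed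
 show ?thesis
 proof (rule abs_bound_from_limit[OF d1 _ a1 lim(1) tendsto_monomial_0])
  show "((\<lambda>t. M / ((real p + 1) * (real p + 2)) * t ^ (p + 2)) has_real_derivative M / (real p + 1) * t ^ (p + 1)) (at t)" for t
  proof -
   have "((\<lambda>t. t ^ (p + 2)) has_real_derivative (real p + 2) * t ^ (p + 1)) (at t)"
    using DERIV_pow[of "p + 2" t] by (simp add: add.commute)
   moreover have "M / (c * e) * (e * x) = M / c * x" if "e \<noteq> 0" for c e x :: real using that by simp
   from this[of "real p + 2" "real p + 1" "t ^ (p + 1)"]
   have "M / ((real p + 1) * (real p + 2)) * ((real p + 2) * t ^ (p + 1)) = M / (real p + 1) * t ^ (p + 1)" by linarith
   ultimately show ?thesis using DERIV_cmult[of "\<lambda>t. t ^ (p + 2)" _ t UNIV "M / ((real p + 1) * (real p + 2))"] by metis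
  qed
 qed (use t in auto)
qed

text \<open>In the application \<open>a n\<close> is the solution tested against the n-th Laplacian.
  A bound on the last one only is carried down to the first; each level gains t^2 / ((2 m + 1) (2 m
  + 2)) because the zero data hold at every level.\<close>

lemma bessel_iterate:
 fixes a :: "nat \<Rightarrow> real \<Rightarrow> real"
 assumes k: "k \<ge> 0" and M: "M \<ge> 0"
 shows "(\<And>n t. 0 < t \<Longrightarrow> (a n has_real_derivative a1 n t) (at t)) \<Longrightarrow>
  (\<And>n t. 0 < t \<Longrightarrow> (a1 n has_real_derivative a (Suc n) t - k / t * a1 n t) (at t)) \<Longrightarrow>
  (\<And>n. (a n \<longlongrightarrow> 0) (at_right 0)) \<Longrightarrow> (\<And>n. (a1 n \<longlongrightarrow> 0) (at_right 0)) \<Longrightarrow>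
  (\<And>t. 0 < t \<Longrightarrow> t \<le> T \<Longrightarrow> \<bar>a m t\<bar> \<le> M) \<Longrightarrow> 0 < t \<Longrightarrow> t \<le> T \<Longrightarrow> \<bar>a 0 t\<bar> \<le> M / fact (2 * m) * t ^ (2 * m)"
proof (induction m arbitrary: a a1 t)
 case 0
 then show ?case by simp
next
 case (Suc m)
 have IH: "\<bar>a (Suc 0) t\<bar> \<le> M / fact (2 * m) * t ^ (2 * m)" if "0 < t" "t \<le> T" for t
  by (rule Suc.IH[of "\<lambda>n. a (Suc n)" "\<lambda>n. a1 (Suc n)"]) (use Suc.prems that in auto)
 have "\<bar>a 0 t\<bar> \<le> (M / fact (2 * m)) / ((real (2 * m) + 1) * (real (2 * m) + 2)) * t ^ (2 * m + 2)"
  by (rule bessel_ode_gain[OF k _ Suc.prems(1) Suc.prems(2) Suc.prems(3,4) IH Suc.prems(6,7)]) (use M in auto)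
 also have "(M / fact (2 * m)) / ((real (2 * m) + 1) * (real (2 * m) + 2)) = M / fact (2 * Suc m)"
  by (simp add: field_simps)
 finally show ?case by simp
qed

subsection \<open>Iterated Laplacians of the Gaussian\<close>

text \<open>Radial profiles in s = |x|^2. Division by j! makes the coefficients of the Laplacian
  linear in j, so that m applications cost m!; \<open>E1\<close> and \<open>E2\<close> are the first
  two derivatives in s.\<close>

definition E :: "nat \<Rightarrow> real \<Rightarrow> real" where
 "E j s = s ^ j / fact j * exp (- s)"

definition E1 :: "nat \<Rightarrow> real \<Rightarrow> real" where
 "E1 j s = (if j = 0 then 0 else E (j - 1) s) - E j s"

definition E2 :: "nat \<Rightarrow> real \<Rightarrow> real" where
 "E2 j s = (if j = 0 then 0 else E1 (j - 1) s) - E1 j s"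

lemma E_deriv: "(E j has_real_derivative E1 j s) (at s)"
proof (cases j)
 case 0
 have "((\<lambda>s. exp (- s)) has_real_derivative - exp (- s)) (at s)" by (auto intro!: derivative_eq_intros)
 then show ?thesis by (simp add: 0 E1_def E_def[abs_def])
next
 case (Suc i)
 have "((\<lambda>s. s ^ Suc i) has_real_derivative real (Suc i) * s ^ i) (at s)" using DERIV_pow[of "Suc i" s] by simp
 moreover have "((\<lambda>s. exp (- s)) has_real_derivative - exp (- s)) (at s)" by (auto intro!: derivative_eq_intros)
 ultimately have "((\<lambda>s. s ^ Suc i / fact (Suc i) * exp (- s)) has_real_derivative
   real (Suc i) * s ^ i / fact (Suc i) * exp (- s) + - exp (- s) * (s ^ Suc i / fact (Suc i))) (at s)"
  by (intro DERIV_mult DERIV_cdivide)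
 moreover have "real (Suc i) * s ^ i / fact (Suc i) * exp (- s) + - exp (- s) * (s ^ Suc i / fact (Suc i)) = E1 j s"
  by (simp add: Suc E1_def E_def del: power_Suc)
 ultimately show ?thesis by (simp add: Suc E_def[abs_def])
qed

lemma E1_deriv: "(E1 j has_real_derivative E2 j s) (at s)"
proof (cases j)
 case 0
 then show ?thesis using DERIV_minus[OF E_deriv[of 0 s]] by (simp add: E1_def[abs_def] E2_def)
next
 case (Suc i)
 then show ?thesis using DERIV_diff[OF E_deriv[of i s] E_deriv[of j s]] by (simp add: E1_def[abs_def] E2_def)
qed

lemma E_mult: "s * E j s = (real j + 1) * E (Suc j) s"
proof -
 have "(real j + 1) * (s ^ Suc j / ((real j + 1) * fact j)) = s ^ Suc j / fact j" by simp
 moreover have "fact (Suc j) = (real j + 1) * fact j" by simp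
 ultimately show ?thesis by (simp only: E_def mult.assoc[symmetric]) simp
qed

text \<open>On a radial function F(|x|^2) the Bessel Laplacian acts as 2 d F' + 4 s F'' with d =
  \<open>hdim \<gamma>\<close>; on these profiles it is a three-term recurrence.\<close>

lemma E_radial: "2 * d * E1 j s + 4 * (s * E2 j s) =
  (if j = 0 then 0 else (2 * d + 4 * (real j - 1)) * E (j - 1) s) + (- (2 * d) - 8 * real j) * E j s + 4 * (real j + 1) * E (Suc j) s"
proof -
 consider "j = 0" | "j = 1" | i where "j = Suc (Suc i)" by (metis One_nat_def not0_implies_Suc)
 then show ?thesis
 proof cases
  case 1 then show ?thesis using E_mult[of s 0] by (simp add: E1_def E2_def algebra_simps)
 next
  case 2 then show ?thesis using E_mult[of s 0] E_mult[of s 1] by (simp add: E1_def E2_def algebra_simps)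
 next
  case 3
  have "s * E2 j s = s * E i s - 2 * (s * E (Suc i) s) + s * E j s" by (simp add: 3 E1_def E2_def algebra_simps)
  also have "... = (real i + 1) * E (Suc i) s - 2 * ((real i + 2) * E j s) + (real j + 1) * E (Suc j) s"
   unfolding E_mult by (simp add: 3)
  finally show ?thesis by (simp add: 3 E1_def algebra_simps)
 qed
qed

text \<open>(s / 2)^j / j! is a single term of the exponential series of s / 2: half of the
  exponential pays for the power.\<close>

lemma E_bound:
 assumes "s \<ge> 0" shows "\<bar>E j s\<bar> \<le> 2 ^ j * exp (- s / 2)"
proof -
 have "(s / 2) ^ j / fact j \<le> exp (s / 2)"
 proof -
  have "(\<Sum>n\<in>{j}. (s / 2) ^ n /\<^sub>R fact n) \<le> (\<Sum>n. (s / 2) ^ n /\<^sub>R fact n)"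
  proof (rule sum_le_suminf[OF summable_exp_generic])
   show "0 \<le> (s / 2) ^ n /\<^sub>R fact n" for n using assms by (simp add: zero_le_power)
  qed simp
  moreover have "inverse a * b = b / a" for a b :: real by (simp add: field_simps)
  ultimately show ?thesis unfolding exp_def real_scaleR_def by simp
 qed
 then have "2 ^ j * ((s / 2) ^ j / fact j) \<le> 2 ^ j * exp (s / 2)" by (rule mult_left_mono) simp
 moreover have "2 ^ j * ((s / 2) ^ j / fact j) = s ^ j / fact j" by (simp add: power_divide)
 ultimately have "s ^ j / fact j \<le> 2 ^ j * exp (s / 2)" by (simp only:)
 then have "s ^ j / fact j * exp (- s) \<le> 2 ^ j * exp (s / 2) * exp (- s)" by (rule mult_right_mono) simp
 also have "... = 2 ^ j * exp (- s / 2)" by (simp add: exp_add[symmetric] mult.assoc)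
 finally show ?thesis using assms by (simp add: E_def)
qed

definition eg :: "nat \<Rightarrow> real^'n::finite \<Rightarrow> real" where
 "eg j x = E j ((norm x)\<^sup>2)"

lemma eg_0: "eg 0 = gauss" by (simp add: eg_def E_def gauss_def fun_eq_iff)

lemma eg_S_ev: "eg j \<in> S_ev"
proof -
 have "(\<lambda>_. eg j) \<in> pspan {\<lambda>_::unit. gauss :: real^'n \<Rightarrow> real}"
 proof (induction j)
  case 0
  show ?case unfolding eg_0 by (rule pspan.base) simp
 next
  case (Suc j)
  have "eg (Suc j) x = 1 / (real j + 1) * (\<Sum>i\<in>UNIV. x$i * (x$i * eg j x))" for x :: "real^'n"
  proof -
   have "(\<Sum>i\<in>UNIV. x$i * (x$i * eg j x)) = (norm x)\<^sup>2 * eg j x"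
    by (simp add: power2_norm_eq_inner inner_vec_def sum_distrib_right mult.assoc)
   also have "... = (real j + 1) * eg (Suc j) x" unfolding eg_def by (rule E_mult)
   finally show ?thesis by simp
  qed
  then have e: "(\<lambda>_. eg (Suc j)) = (\<lambda>(_::unit) x::real^'n. 1 / (real j + 1) * (\<Sum>i\<in>UNIV. x$i * (x$i * eg j x)))" by (simp add: fun_eq_iff)
  show ?case unfolding e by (intro pspan_scale pspan_sum pspan.coord Suc) auto
 qed
 from pspan_gauss_S_ev[OF this] show ?thesis by (simp add: even_fn_mirror eg_def norm_mirror)
qed

lemma bessel_lap_eg:
 fixes \<gamma> :: "real^'n::finite"
 shows "bessel_lap \<gamma> (eg j) x = 2 * hdim \<gamma> * E1 j ((norm x)\<^sup>2) + 4 * ((norm x)\<^sup>2 * E2 j ((norm x)\<^sup>2))"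
proof -
 have c: "has_pd i (\<lambda>x. F ((norm x)\<^sup>2)) (\<lambda>x::real^'n. x$i * (2 * F' ((norm x)\<^sup>2)))"
  if "\<And>s. (F has_real_derivative F' s) (at s)" for i and F F' :: "real \<Rightarrow> real"
  using has_pd_exp_norm[OF has_pd_norm_sq[of i], where g=F and g'=F', OF that] by (simp add: ac_simps)
 have c2: "has_pd i (\<lambda>x. 2 * F ((norm x)\<^sup>2)) (\<lambda>x::real^'n. x$i * (2 * (2 * F' ((norm x)\<^sup>2))))"
  if "\<And>s. (F has_real_derivative F' s) (at s)" for i and F F' :: "real \<Rightarrow> real"
  using has_pd_lin[OF c[OF that] c[OF that], where a=2 and b=0] by (simp add: ac_simps)
 \<comment> \<open>\<open>Dq_unique\<close> asks for a derivative of the candidate, so computing the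
   second \<open>Dq\<close> takes a third derivative of the profile.\<close>
 have e3: "\<exists>F'. \<forall>s. (E2 j has_real_derivative F' s) (at s)"
 proof (cases "j = 0")
  case True
  then have e: "E2 j = (\<lambda>s. - E1 j s)" by (simp add: E2_def fun_eq_iff)
  show ?thesis unfolding e by (rule exI[of _ "\<lambda>s. - E2 j s"], rule allI, rule DERIV_minus, rule E1_deriv)
 next
  case False
  then have e: "E2 j = (\<lambda>s. E1 (j - 1) s - E1 j s)" by (simp add: E2_def fun_eq_iff)
  show ?thesis unfolding e by (rule exI[of _ "\<lambda>s. E2 (j - 1) s - E2 j s"], rule allI, rule DERIV_diff; rule E1_deriv)
 qed
 then obtain F' where F': "\<And>s. (E2 j has_real_derivative F' s) (at s)" by blast
 have D1: "Dq i (eg j) = (\<lambda>x::real^'n. 2 * E1 j ((norm x)\<^sup>2))" for i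
  unfolding eg_def[abs_def] by (rule Dq_unique[OF c[OF E_deriv] c2[OF E1_deriv]])
 have c4: "has_pd i (\<lambda>x. 2 * (2 * E2 j ((norm x)\<^sup>2))) (\<lambda>x::real^'n. 2 * (x$i * (2 * (2 * F' ((norm x)\<^sup>2)))))" for i
  using has_pd_lin[OF c2[OF F'] c2[OF F'], where a=2 and b=0] by simp
 have D2: "Dq i (Dq i (eg j)) = (\<lambda>x::real^'n. 2 * (2 * E2 j ((norm x)\<^sup>2)))" for i
  unfolding D1 by (rule Dq_unique[OF c2[OF E1_deriv] c4])
 have n: "(\<Sum>i\<in>UNIV. (x$i)\<^sup>2) = (norm x)\<^sup>2"
  unfolding power2_norm_eq_inner inner_vec_def by (simp add: power2_eq_square)
 have "bessel_lap \<gamma> (eg j) x = (\<Sum>i\<in>UNIV. (1 + \<gamma>$i)) * (2 * E1 j ((norm x)\<^sup>2)) + (\<Sum>i\<in>UNIV. (x$i)\<^sup>2) * (2 * (2 * E2 j ((norm x)\<^sup>2)))"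
  unfolding bessel_lap_eq[OF eg_S_ev] D1 D2[unfolded D1] sum_distrib_right by (rule sum.distrib)
 then show ?thesis unfolding n by (simp add: hdim_def sum.distrib)
qed

text \<open>Linear combinations of the profiles up to index m. B bounds the sum of the absolute
  values of the coefficients in one representation.\<close>

inductive comb :: "nat \<Rightarrow> real \<Rightarrow> (real^'n::finite \<Rightarrow> real) \<Rightarrow> bool" where
 base: "j \<le> m \<Longrightarrow> comb m 1 (eg j)"
| lin: "comb m B g \<Longrightarrow> comb m C h \<Longrightarrow> comb m (\<bar>a\<bar> * B + \<bar>b\<bar> * C) (\<lambda>x. a * g x + b * h x)"

lemma comb_nonneg: "comb m B g \<Longrightarrow> 0 \<le> B"
 by (induction rule: comb.induct) auto

lemma comb_S_ev: "comb m B g \<Longrightarrow> g \<in> S_ev"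
 by (induction rule: comb.induct) (auto intro: eg_S_ev S_ev_lin)

text \<open>The square root of the Gaussian: what \<open>E_bound\<close> leaves over after absorbing
  the powers. It also serves as the weight of the averages.\<close>

definition hw :: "real^'n::finite \<Rightarrow> real" where
 "hw x = exp (- (norm x)\<^sup>2 / 2)"

lemma comb_bound: "comb m B g \<Longrightarrow> \<bar>g x\<bar> \<le> B * 2 ^ m * hw x"
proof (induction rule: comb.induct)
 case (base j m)
 have "\<bar>eg j x\<bar> \<le> 2 ^ j * hw x" unfolding eg_def hw_def by (rule E_bound) simp
 also have "... \<le> 2 ^ m * hw x" using base by (intro mult_right_mono power_increasing) (auto simp: hw_def)
 finally show ?case by simp
next
 case (lin m B g C h a b)
 have "\<bar>a * g x + b * h x\<bar> \<le> \<bar>a\<bar> * \<bar>g x\<bar> + \<bar>b\<bar> * \<bar>h x\<bar>" using abs_triangle_ineq[of "a * g x" "b * h x"] by (simp add: abs_mult)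
 also have "... \<le> \<bar>a\<bar> * (B * 2 ^ m * hw x) + \<bar>b\<bar> * (C * 2 ^ m * hw x)" using lin.IH by (intro add_mono mult_left_mono) auto
 finally show ?case by (simp add: algebra_simps)
qed

text \<open>By \<open>E_radial\<close> the coefficients for index j add up in absolute value to at
  most 4 \<open>hdim \<gamma>\<close> + 16 j + 4, whence the constant.\<close>

lemma comb_bessel_lap:
 fixes \<gamma> :: "real^'n::finite"
 assumes \<gamma>: "allpos \<gamma>"
 shows "comb m B g \<Longrightarrow> \<exists>B'. comb (Suc m) B' (bessel_lap \<gamma> g) \<and> B' \<le> (4 * hdim \<gamma> + 16) * (real m + 1) * B"
proof (induction rule: comb.induct)
 case (base j m)
 note h = hdim_pos[OF \<gamma>]
 define a where "a = (if j = 0 then 0 else 2 * hdim \<gamma> + 4 * (real j - 1))"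
 define b where "b = - (2 * hdim \<gamma>) - 8 * real j"
 define c where "c = 4 * (real j + 1)"
 have e: "bessel_lap \<gamma> (eg j) = (\<lambda>x. a * eg (j - 1) x + 1 * (b * eg j x + c * eg (Suc j) x))"
  unfolding bessel_lap_eg fun_eq_iff E_radial by (auto simp: a_def b_def c_def eg_def)
 have "comb (Suc m) (\<bar>a\<bar> * 1 + \<bar>1\<bar> * (\<bar>b\<bar> * 1 + \<bar>c\<bar> * 1)) (bessel_lap \<gamma> (eg j))"
  unfolding e using base by (intro comb.intros) auto
 moreover have "\<bar>a\<bar> \<le> 2 * hdim \<gamma> + 4 * real j" "\<bar>b\<bar> = 2 * hdim \<gamma> + 8 * real j" "\<bar>c\<bar> = 4 * real j + 4" using h by (auto simp: a_def b_def c_def)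
 then have "\<bar>a\<bar> * 1 + \<bar>1\<bar> * (\<bar>b\<bar> * 1 + \<bar>c\<bar> * 1) \<le> 4 * hdim \<gamma> + 16 * real j + 4" by simp
 moreover have "4 * hdim \<gamma> + 16 * real j + 4 \<le> (4 * hdim \<gamma> + 16) * (real m + 1) * 1"
 proof -
  have "0 \<le> 4 * hdim \<gamma> * real m" using h by simp
  moreover have "real j \<le> real m" using base by simp
  ultimately show ?thesis by (simp add: algebra_simps)
 qed
 ultimately show ?case by (intro exI conjI) (assumption, linarith)
next
 case (lin m B g C h a b)
 let ?K = "(4 * hdim \<gamma> + 16) * (real m + 1)"
 obtain B' C' where B: "comb (Suc m) B' (bessel_lap \<gamma> g)" "B' \<le> ?K * B" and C: "comb (Suc m) C' (bessel_lap \<gamma> h)" "C' \<le> ?K * C"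
  using lin.IH by blast
 have "\<bar>a\<bar> * B' + \<bar>b\<bar> * C' \<le> \<bar>a\<bar> * (?K * B) + \<bar>b\<bar> * (?K * C)" by (intro add_mono mult_left_mono B C) auto
 also have "... = ?K * (\<bar>a\<bar> * B + \<bar>b\<bar> * C)" by (simp add: algebra_simps)
 finally show ?case
  using comb.lin[OF B(1) C(1), of a b] unfolding bessel_lap_lin[OF comb_S_ev[OF lin.hyps(1)] comb_S_ev[OF lin.hyps(2)]] by blast
qed

lemma comb_iterate:
 fixes \<gamma> :: "real^'n::finite"
 assumes \<gamma>: "allpos \<gamma>"
 shows "\<exists>B. comb m B ((bessel_lap \<gamma> ^^ m) gauss) \<and> B \<le> (4 * hdim \<gamma> + 16) ^ m * fact m"
proof (induction m)
 case 0
 show ?case using comb.base[of 0 0] by (auto simp: eg_0)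
next
 case (Suc m)
 then obtain B where B: "comb m B ((bessel_lap \<gamma> ^^ m) gauss)" "B \<le> (4 * hdim \<gamma> + 16) ^ m * fact m" by blast
 obtain B' where B': "comb (Suc m) B' (bessel_lap \<gamma> ((bessel_lap \<gamma> ^^ m) gauss))" "B' \<le> (4 * hdim \<gamma> + 16) * (real m + 1) * B"
  using comb_bessel_lap[OF \<gamma> B(1)] by blast
 note B'(2)
 also have "(4 * hdim \<gamma> + 16) * (real m + 1) * B \<le> (4 * hdim \<gamma> + 16) * (real m + 1) * ((4 * hdim \<gamma> + 16) ^ m * fact m)"
  using hdim_pos[OF \<gamma>] by (intro mult_left_mono B(2)) auto
 finally show ?case using B'(1) by (intro exI[of _ B'] conjI) (simp_all add: algebra_simps)
qed

subsection \<open>Gaussian averages\<close>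

lemma S_ev_dilate:
 fixes G :: "real^'n::finite \<Rightarrow> real"
 assumes G: "G \<in> S_ev" and t: "t > 0"
 shows "(\<lambda>x. G (t *\<^sub>R x)) \<in> S_ev"
proof -
 have p: "has_pd i (\<lambda>x. t ^ l * pds is G (t *\<^sub>R x)) (\<lambda>x. t ^ Suc l * pds (i # is) G (t *\<^sub>R x))" for i "is" l
  using has_pd_lin[OF has_pd_scale has_pd_scale, OF smooth_fn_has_pd smooth_fn_has_pd, OF S_evD(1)[OF G] S_evD(1)[OF G], of i "t ^ l" "is" t 0]
  by (simp add: ac_simps del: pds.simps)
 have pe: "pds is (\<lambda>x. G (t *\<^sub>R x)) = (\<lambda>x. t ^ length is * pds is G (t *\<^sub>R x))" for "is"
 proof (induction "is")
  case (Cons i "is")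
  then show ?case using has_pd_imp_pd[OF p[of i "length is" "is"]] by (simp only: pds.simps list.size add_0_right add_Suc_right)
 qed simp
 show ?thesis
 proof (rule S_evI)
  show "smooth_fn (\<lambda>x. G (t *\<^sub>R x))"
   unfolding smooth_fn_def pe
  proof (intro allI conjI)
   show "continuous_on UNIV (\<lambda>x. t ^ length is * pds is G (t *\<^sub>R x))" for "is"
    by (intro continuous_intros continuous_on_compose2[OF smooth_fn_continuous[OF S_evD(1)[OF G], of UNIV]]) auto
   show "(\<lambda>s. t ^ length is * pds is G (t *\<^sub>R (x + ax i s))) differentiable at 0" for "is" i x
    using p[of i "length is" "is"] unfolding has_pd_def real_differentiable_def by blast
  qed
  have "mirror i (t *\<^sub>R x) = t *\<^sub>R mirror i x" for i and x :: "real^'n" by (simp add: vec_eq_iff mirror_component)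
  then show "even_fn (\<lambda>x. G (t *\<^sub>R x))" using S_evD(2)[OF G] unfolding even_fn_mirror by metis
  fix \<alpha> :: "'n \<Rightarrow> nat" and "is" :: "'n list"
  have m: "monom \<alpha> (t *\<^sub>R x) = t ^ (\<Sum>i\<in>UNIV. \<alpha> i) * monom \<alpha> x" for x
   by (simp add: monom_def power_mult_distrib prod.distrib power_sum)
  let ?c = "t ^ length is / t ^ (\<Sum>i\<in>UNIV. \<alpha> i)"
  have "\<bar>monom \<alpha> x * pds is (\<lambda>x. G (t *\<^sub>R x)) x\<bar> \<le> ?c * snorm \<alpha> is G" for x
  proof -
   have "monom \<alpha> x * pds is (\<lambda>x. G (t *\<^sub>R x)) x = ?c * (monom \<alpha> (t *\<^sub>R x) * pds is G (t *\<^sub>R x))"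
    using t unfolding pe m by simp
   then have "\<bar>monom \<alpha> x * pds is (\<lambda>x. G (t *\<^sub>R x)) x\<bar> = ?c * \<bar>monom \<alpha> (t *\<^sub>R x) * pds is G (t *\<^sub>R x)\<bar>"
    using t by (simp add: abs_mult)
   also have "... \<le> ?c * snorm \<alpha> is G" using t by (intro mult_left_mono snorm_upper[OF G]) auto
   finally show ?thesis .
  qed
  then show "\<exists>B. \<forall>x. \<bar>monom \<alpha> x * pds is (\<lambda>x. G (t *\<^sub>R x)) x\<bar> \<le> B" by blast
 qed
qed

lemma bessel_lap_dilate:
 assumes G: "G \<in> S_ev" and t: "t > 0"
 shows "bessel_lap \<gamma> (\<lambda>x. G (t *\<^sub>R x)) x = t\<^sup>2 * bessel_lap \<gamma> G (t *\<^sub>R x)"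
proof -
 have sc: "has_pd i (\<lambda>x. c * H (t *\<^sub>R x)) (\<lambda>x. x$i * (c * t\<^sup>2 * Dq i H (t *\<^sub>R x)))" if "H \<in> S_ev" for H :: "real^'a \<Rightarrow> real" and i c
  using has_pd_lin[OF has_pd_scale[where t=t, OF has_pd_S_ev[OF that, of i]] has_pd_scale[where t=t, OF has_pd_S_ev[OF that, of i]], where a=c and b=0]
  by (simp add: power2_eq_square ac_simps)
 have D: "Dq i (\<lambda>x. c * H (t *\<^sub>R x)) = (\<lambda>x. c * t\<^sup>2 * Dq i H (t *\<^sub>R x))" if "H \<in> S_ev" for H :: "real^'a \<Rightarrow> real" and i c
  by (rule Dq_unique[OF sc[OF that] sc[OF Dq_S_ev[OF that]]])
 have D1: "Dq i (\<lambda>x. G (t *\<^sub>R x)) = (\<lambda>x. t\<^sup>2 * Dq i G (t *\<^sub>R x))" for i using D[OF G, of i 1] by simp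
 show ?thesis
  unfolding bessel_lap_eq[OF S_ev_dilate[OF G t]] bessel_lap_eq[OF G] D1 D[OF Dq_S_ev[OF G]]
  by (simp add: sum_distrib_left algebra_simps power2_eq_square)
qed

lemma S_ev_rdec: "\<phi> \<in> S_ev \<Longrightarrow> rdec \<phi>"
 unfolding rdec_def using S_ev_rapid0 by blast

text \<open>The difference of the integrands is a sum of integrands of \<open>orth_ibp\<close> with
  G = g \<open>Dq i h\<close> minus those with g and h exchanged; the products of two first-order
  terms cancel by symmetry.\<close>

lemma bessel_lap_self_adjoint:
 fixes \<gamma> :: "real^'n::finite"
 assumes \<gamma>: "allpos \<gamma>" and g: "g \<in> S_ev" and h: "h \<in> S_ev"
 shows "(LBINT x. ow \<gamma> x * (g x * bessel_lap \<gamma> h x)) = (LBINT x. ow \<gamma> x * (bessel_lap \<gamma> g x * h x))"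
proof -
 have part: "integrable lborel (\<lambda>x. ow \<gamma> x * ((1 + \<gamma>$i) * (g x * Dq i h x) + x$i * (x$i * (Dq i g x * Dq i h x + g x * Dq i (Dq i h) x)))) \<and>
  (LBINT x. ow \<gamma> x * ((1 + \<gamma>$i) * (g x * Dq i h x) + x$i * (x$i * (Dq i g x * Dq i h x + g x * Dq i (Dq i h) x)))) = 0"
  if g: "g \<in> S_ev" and h: "h \<in> S_ev" for g h :: "real^'n \<Rightarrow> real" and i
 proof -
  let ?G = "\<lambda>x. g x * Dq i h x" and ?G' = "\<lambda>x. x$i * (Dq i g x * Dq i h x + g x * Dq i (Dq i h) x)"
  note S = Dq_S_ev[OF g, of i] Dq_S_ev[OF h, of i] Dq_S_ev[OF Dq_S_ev[OF h, of i], of i]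
  have d: "has_pd i ?G ?G'" using has_pd_mult[OF has_pd_S_ev[OF g] has_pd_S_ev[OF S(2)], of i] by (simp add: algebra_simps)
  have r1: "rdec ?G" by (rule rdec_mult_bounded[OF S_ev_rdec[OF g] S_ev_bounded[OF S(2)]])
  have r2: "rdec ?G'"
   using rdec_coord[OF rdec_lin[OF rdec_mult_bounded[OF S_ev_rdec[OF S(1)] S_ev_bounded[OF S(2)]]
    rdec_mult_bounded[OF S_ev_rdec[OF g] S_ev_bounded[OF S(3)]], where a=1 and b=1], of i] by simp
  have c: "continuous_on UNIV ?G" "continuous_on UNIV ?G'" by (intro continuous_intros S_ev_continuous S g h)+
  have [measurable]: "?G \<in> borel_measurable borel" "?G' \<in> borel_measurable borel" using c by (auto intro: borel_measurable_continuous_onI)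
  have "integrable lborel (\<lambda>x. ow \<gamma> x * ((1 + \<gamma>$i) * ?G x + 1 * (x$i * ?G' x)))"
   by (rule rdec_integrable[OF \<gamma> rdec_lin[OF r1 rdec_coord[OF r2]]]) measurable
  moreover have "(LBINT x. ow \<gamma> x * ((1 + \<gamma>$i) * ?G x + x$i * ?G' x)) = 0"
   by (rule orth_ibp[OF \<gamma> d c]) (use r1 r2 in \<open>auto simp: rdec_def\<close>)
  ultimately show ?thesis by simp
 qed
 let ?F = "\<lambda>g h i x. ow \<gamma> x * ((1 + \<gamma>$i) * (g x * Dq i h x) + x$i * (x$i * (Dq i g x * Dq i h x + g x * Dq i (Dq i h) x)))"
 have eq: "ow \<gamma> x * (g x * bessel_lap \<gamma> h x) - ow \<gamma> x * (bessel_lap \<gamma> g x * h x) = (\<Sum>i\<in>UNIV. ?F g h i x - ?F h g i x)" for x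
  unfolding bessel_lap_eq[OF g] bessel_lap_eq[OF h]
  by (simp add: sum_distrib_left sum_distrib_right sum_subtractf[symmetric] algebra_simps power2_eq_square)
 have "(LBINT x. ow \<gamma> x * (g x * bessel_lap \<gamma> h x) - ow \<gamma> x * (bessel_lap \<gamma> g x * h x)) = 0"
  unfolding eq using part[OF g h] part[OF h g] by simp
 moreover have i: "integrable lborel (\<lambda>x. ow \<gamma> x * (a x * b x))" if "a \<in> S_ev" "b \<in> S_ev" for a b :: "real^'n \<Rightarrow> real"
  by (rule rdec_integrable[OF \<gamma> rdec_mult_bounded[OF S_ev_rdec[OF that(1)] S_ev_bounded[OF that(2)]]])
   (use that S_ev_measurable in \<open>intro borel_measurable_times; blast\<close>)
 ultimately show ?thesis using i[OF g bessel_lap_S_ev[OF h, of \<gamma>]] i[OF bessel_lap_S_ev[OF g, of \<gamma>] h] by simp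
qed

lemma hw_pos: "0 < hw x" by (simp add: hw_def)

lemma hw_nz: "hw x \<noteq> 0" by (simp add: hw_def)

lemma hw_le_one: "hw x \<le> 1" by (simp add: hw_def)

lemma hw_mult: "hw x * hw x = gauss x" by (simp add: hw_def gauss_def exp_add[symmetric])

lemma hw_continuous: "continuous_on UNIV hw" unfolding hw_def[abs_def] by (intro continuous_intros) auto

lemma hw_measurable [measurable]: "hw \<in> borel_measurable borel" by (rule borel_measurable_continuous_onI[OF hw_continuous])

lemma weight_hw: "weight (hw :: real^'n::finite \<Rightarrow> real)"
 unfolding weight_def
proof (intro conjI allI)
 show "rdec (hw :: real^'n \<Rightarrow> real)" unfolding rdec_def
 proof
  fix N
  have "(1 + norm x) ^ N * \<bar>hw x\<bar> \<le> sqrt ((2 * real (2 * N) + 1) ^ (2 * N))" for x :: "real^'n"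
  proof (rule real_le_rsqrt)
   have "((1 + norm x) ^ N * \<bar>hw x\<bar>)\<^sup>2 = (1 + norm x) ^ (2 * N) * exp (- (norm x)\<^sup>2)"
   proof -
    have "(hw x)\<^sup>2 = exp (- (norm x)\<^sup>2)" using hw_mult[of x] by (simp add: power2_eq_square gauss_def)
    then show ?thesis by (simp add: power_mult_distrib power_mult[symmetric] mult.commute[of N])
   qed
   then show "((1 + norm x) ^ N * \<bar>hw x\<bar>)\<^sup>2 \<le> (2 * real (2 * N) + 1) ^ (2 * N)"
    using exp_square_bound[of "norm x" "2 * N"] by simp
  qed
  then show "\<exists>C. \<forall>x. (1 + norm x) ^ N * \<bar>hw (x::real^'n)\<bar> \<le> C" by blast
 qed
qed (auto simp: less_imp_le[OF hw_pos])

text \<open>The mollification of \<phi> at scale t with profile g, up to a constant factor.\<close>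

definition gav :: "real^'n::finite \<Rightarrow> real \<Rightarrow> (real^'n \<Rightarrow> real) \<Rightarrow> (real^'n \<Rightarrow> real) \<Rightarrow> real^'n \<Rightarrow> real" where
 "gav \<gamma> t \<phi> g y = (LBINT x. ow \<gamma> x * (g x * TK \<gamma> \<phi> (t *\<^sub>R x) y))"

definition hwb :: "real \<Rightarrow> (real^'n::finite \<Rightarrow> real) \<Rightarrow> bool" where
 "hwb b g \<longleftrightarrow> g \<in> borel_measurable borel \<and> 0 < b \<and> (\<forall>x. \<bar>g x\<bar> \<le> b * hw x)"

text \<open>Dividing the profile by b \<open>hw\<close> makes it an admissible density of modulus at
  most 1, so the results on \<open>avg\<close> with the weight \<open>hw\<close> apply.\<close>

lemma gav_avg:
 assumes \<gamma>: "allpos \<gamma>" and \<phi>: "\<phi> \<in> S_ev" and g: "hwb b g"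
 shows "(t, \<lambda>x. g x / (b * hw x), \<phi>) \<in> prm"
  and "gav \<gamma> t \<phi> g = (\<lambda>y. b * avg (rw \<gamma> hw) \<gamma> (t, \<lambda>x. g x / (b * hw x), \<phi>) y)"
  and "gav \<gamma> t \<phi> g \<in> S_ev"
  and "integrable lborel (\<lambda>x. ow \<gamma> x * (g x * TK \<gamma> \<phi> (t *\<^sub>R x) y))"
proof -
 have b: "b > 0" and [measurable]: "g \<in> borel_measurable borel" and gb: "\<And>x. \<bar>g x\<bar> \<le> b * hw x" using g by (auto simp: hwb_def)
 have "\<bar>g x / (b * hw x)\<bar> \<le> 1" for x using gb[of x] b hw_pos[of x] by (simp add: abs_mult)
 then show p: "(t, \<lambda>x. g x / (b * hw x), \<phi>) \<in> prm" using \<phi> by (auto simp: prm_def)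
 show e: "gav \<gamma> t \<phi> g = (\<lambda>y. b * avg (rw \<gamma> hw) \<gamma> (t, \<lambda>x. g x / (b * hw x), \<phi>) y)"
 proof
  fix y
  have "b * (ow \<gamma> x * (hw x * (g x / (b * hw x)) * TK \<gamma> \<phi> (t *\<^sub>R x) y)) = ow \<gamma> x * (g x * TK \<gamma> \<phi> (t *\<^sub>R x) y)" for x
   using b hw_pos[of x] by simp
  then show "gav \<gamma> t \<phi> g y = b * avg (rw \<gamma> hw) \<gamma> (t, \<lambda>x. g x / (b * hw x), \<phi>) y"
   unfolding avg_rw[OF \<gamma> weight_hw p] gav_def by (simp only: integral_mult_right_zero[symmetric])
 qed
 show "gav \<gamma> t \<phi> g \<in> S_ev" unfolding e by (rule S_ev_scale[OF avg_S_ev[OF \<gamma> moments_rw[OF \<gamma> weight_hw] p]])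
 have "rdec g" unfolding rdec_def
 proof
  fix N
  obtain C where C: "\<And>x::real^'a. (1 + norm x) ^ N * \<bar>hw x\<bar> \<le> C" using weight_hw unfolding weight_def rdec_def by meson
  have "(1 + norm x) ^ N * \<bar>g x\<bar> \<le> b * C" for x
  proof -
   have "(1 + norm x) ^ N * \<bar>g x\<bar> \<le> (1 + norm x) ^ N * (b * hw x)" by (intro mult_left_mono gb) simp
   also have "... = b * ((1 + norm x) ^ N * \<bar>hw x\<bar>)" using hw_pos[of x] by simp
   also have "... \<le> b * C" using b by (intro mult_left_mono C) simp
   finally show ?thesis .
  qed
  then show "\<exists>C. \<forall>x. (1 + norm x) ^ N * \<bar>g x\<bar> \<le> C" by blast
 qed
 moreover have [measurable]: "(\<lambda>x. TK \<gamma> \<phi> (t *\<^sub>R x) y) \<in> borel_measurable borel"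
  by (intro borel_measurable_continuous_onI continuous_intros \<gamma> \<phi>)
 ultimately show "integrable lborel (\<lambda>x. ow \<gamma> x * (g x * TK \<gamma> \<phi> (t *\<^sub>R x) y))"
  by (intro rdec_integrable \<gamma> rdec_mult_bounded[OF _ TK_bounded[OF \<gamma> \<phi>]]) measurable
qed

lemma gav_lin:
 assumes "allpos \<gamma>" "\<phi> \<in> S_ev" "hwb b g" "hwb c h"
 shows "gav \<gamma> t \<phi> (\<lambda>x. p * g x + q * h x) y = p * gav \<gamma> t \<phi> g y + q * gav \<gamma> t \<phi> h y"
proof -
 have "gav \<gamma> t \<phi> (\<lambda>x. p * g x + q * h x) y =
   (LBINT x. p * (ow \<gamma> x * (g x * TK \<gamma> \<phi> (t *\<^sub>R x) y)) + q * (ow \<gamma> x * (h x * TK \<gamma> \<phi> (t *\<^sub>R x) y)))"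
  unfolding gav_def by (simp add: algebra_simps)
 then show ?thesis using gav_avg(4)[OF assms(1-3)] gav_avg(4)[OF assms(1,2,4)] by (simp add: gav_def)
qed

text \<open>The constant depends on f, \<phi> and t but is the same for all profiles, which makes
  the functional continuous in the profile. Uniformity over a family of functionals is a further
  step, supplied by \<open>banach_steinhaus\<close>.\<close>

lemma gav_bound:
 assumes \<gamma>: "allpos \<gamma>" and \<phi>: "\<phi> \<in> S_ev" and f: "f \<in> S_ev_dual"
 shows "\<exists>K. \<forall>b g. hwb b g \<longrightarrow> \<bar>f (gav \<gamma> t \<phi> g)\<bar> \<le> K * b"
proof -
 obtain C N where C: "C \<ge> 0" "\<And>\<phi>. \<phi> \<in> S_ev \<Longrightarrow> \<bar>f \<phi>\<bar> \<le> C * sn N \<phi>" using dualD(2)[OF f] by blast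
 obtain D M where D: "\<And>s \<sigma> \<phi>. (s, \<sigma>, \<phi>) \<in> prm \<Longrightarrow> \<bar>s\<bar> \<le> \<bar>t\<bar> \<Longrightarrow> sn N (avg (rw \<gamma> hw) \<gamma> (s, \<sigma>, \<phi>)) \<le> D * sn M \<phi>"
  using avg_bound[OF \<gamma> moments_rw[OF \<gamma> weight_hw] abs_ge_zero[of t], of N] by blast
 have "\<bar>f (gav \<gamma> t \<phi> g)\<bar> \<le> C * (D * sn M \<phi>) * b" if g: "hwb b g" for b g
 proof -
  note p = gav_avg(1)[OF \<gamma> \<phi> g, of t]
  let ?A = "avg (rw \<gamma> hw) \<gamma> (t, \<lambda>x. g x / (b * hw x), \<phi>)"
  have S: "?A \<in> S_ev" by (rule avg_S_ev[OF \<gamma> moments_rw[OF \<gamma> weight_hw] p])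
  have b: "b > 0" using g by (simp add: hwb_def)
  have "\<bar>f (gav \<gamma> t \<phi> g)\<bar> = b * \<bar>f ?A\<bar>" unfolding gav_avg(2)[OF \<gamma> \<phi> g] dual_scale[OF f S] using b by (simp add: abs_mult)
  also have "... \<le> b * (C * (D * sn M \<phi>))"
   using b by (intro mult_left_mono order_trans[OF C(2)[OF S]] D p C(1)) auto
  finally show ?thesis by (simp add: ac_simps)
 qed
 then show ?thesis by blast
qed

text \<open>Self-adjointness moves the Laplacian from the test function to the mollifier.\<close>
lemma bessel_lap_gav:
 assumes \<gamma>: "allpos \<gamma>" and \<phi>: "\<phi> \<in> S_ev" and t: "t > 0" and g: "hwb b g" "g \<in> S_ev"
 shows "bessel_lap \<gamma> (gav \<gamma> t \<phi> g) = (\<lambda>y. 1 / t\<^sup>2 * gav \<gamma> t \<phi> (bessel_lap \<gamma> g) y)"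
proof
 fix y
 define G where "G = (\<lambda>z. TK \<gamma> \<phi> z y)"
 have G: "G \<in> S_ev" unfolding G_def by (rule TK_S_ev(2)[OF \<gamma> \<phi>])
 note p = gav_avg(1)[OF \<gamma> \<phi> g(1), of t]
 let ?A = "avg (rw \<gamma> hw) \<gamma> (t, \<lambda>x. g x / (b * hw x), \<phi>)"
 have S: "?A \<in> S_ev" by (rule avg_S_ev[OF \<gamma> moments_rw[OF \<gamma> weight_hw] p])
 have "bessel_lap \<gamma> (gav \<gamma> t \<phi> g) y = b * bessel_lap \<gamma> ?A y"
  unfolding gav_avg(2)[OF \<gamma> \<phi> g(1)] using bessel_lap_lin[OF S S, of \<gamma> b 0] by simp
 also have "... = gav \<gamma> t (bessel_lap \<gamma> \<phi>) g y"
  unfolding avg_bessel_lap[OF \<gamma> moments_rw[OF \<gamma> weight_hw] p] gav_avg(2)[OF \<gamma> bessel_lap_S_ev[OF \<phi>] g(1)] ..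
 also have "... = (LBINT x. 1 / t\<^sup>2 * (ow \<gamma> x * (g x * bessel_lap \<gamma> (\<lambda>x. G (t *\<^sub>R x)) x)))"
  unfolding gav_def bessel_lap_dilate[OF G t] using t TK_bessel_lap'[OF \<gamma> \<phi>] by (simp add: G_def)
 also have "... = 1 / t\<^sup>2 * gav \<gamma> t \<phi> (bessel_lap \<gamma> g) y"
  unfolding integral_mult_right_zero bessel_lap_self_adjoint[OF \<gamma> g(2) S_ev_dilate[OF G t]] by (simp add: gav_def G_def)
 finally show "bessel_lap \<gamma> (gav \<gamma> t \<phi> g) y = 1 / t\<^sup>2 * gav \<gamma> t \<phi> (bessel_lap \<gamma> g) y" .
qed

text \<open>The constant is B + 1 because \<open>hwb\<close> asks for a positive bound, while B may
  vanish.\<close>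

lemma comb_hwb: "comb m B g \<Longrightarrow> hwb ((B + 1) * 2 ^ m) g"
 unfolding hwb_def
proof (intro conjI allI)
 assume c: "comb m B g"
 show "g \<in> borel_measurable borel" by (rule S_ev_measurable[OF comb_S_ev[OF c]])
 show "0 < (B + 1) * 2 ^ m" using comb_nonneg[OF c] by simp
 fix x
 have "\<bar>g x\<bar> \<le> B * 2 ^ m * hw x" by (rule comb_bound[OF c])
 also have "... \<le> (B + 1) * 2 ^ m * hw x" using hw_pos[of x] by (intro mult_right_mono) auto
 finally show "\<bar>g x\<bar> \<le> (B + 1) * 2 ^ m * hw x" .
qed

lemma iterate_bessel_lap_gav:
 assumes \<gamma>: "allpos \<gamma>" and \<phi>: "\<phi> \<in> S_ev" and t: "t > 0"
 shows "(bessel_lap \<gamma> ^^ m) (gav \<gamma> t \<phi> gauss) = (\<lambda>y. (1 / t\<^sup>2) ^ m * gav \<gamma> t \<phi> ((bessel_lap \<gamma> ^^ m) gauss) y)"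
proof (induction m)
 case (Suc m)
 let ?g = "(bessel_lap \<gamma> ^^ m) gauss"
 obtain B where B: "comb m B ?g" using comb_iterate[OF \<gamma>] by blast
 note S = gav_avg(3)[OF \<gamma> \<phi> comb_hwb[OF B], of t]
 have "(bessel_lap \<gamma> ^^ Suc m) (gav \<gamma> t \<phi> gauss) = bessel_lap \<gamma> (\<lambda>y. (1 / t\<^sup>2) ^ m * gav \<gamma> t \<phi> ?g y)" using Suc by simp
 also have "... = (\<lambda>y. (1 / t\<^sup>2) ^ m * bessel_lap \<gamma> (gav \<gamma> t \<phi> ?g) y)"
  using bessel_lap_lin[OF S S, of \<gamma> "(1 / t\<^sup>2) ^ m" 0] by simp
 also have "... = (\<lambda>y. (1 / t\<^sup>2) ^ Suc m * gav \<gamma> t \<phi> ((bessel_lap \<gamma> ^^ Suc m) gauss) y)"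
  unfolding bessel_lap_gav[OF \<gamma> \<phi> t comb_hwb[OF B] comb_S_ev[OF B]] by simp
 finally show ?case .
qed simp

text \<open>As t tends to 0 the functional along these mollifications tends to its value at the
  constant multiple \<open>gmass\<close> \<open>nu_mass\<close> of \<phi>, by
  \<open>dual_limit\<close> and \<open>avg_zero\<close>. Vanishing on them therefore forces
  vanishing at \<phi>.\<close>

lemma gav_approx:
 fixes \<gamma> :: "real^'n::finite"
 assumes \<gamma>: "allpos \<gamma>" and \<phi>: "\<phi> \<in> S_ev" and f: "f \<in> S_ev_dual"
  and z: "\<And>t. t > 0 \<Longrightarrow> f (gav \<gamma> t \<phi> gauss) = 0"
 shows "f \<phi> = 0"
proof -
 have p: "(t, hw, \<psi>) \<in> prm" if "\<psi> \<in> S_ev" for t and \<psi> :: "real^'n \<Rightarrow> real"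
 proof -
  have "\<bar>hw x\<bar> \<le> 1" for x :: "real^'n" using hw_pos[of x] hw_le_one[of x] by simp
  then show ?thesis using that by (simp add: prm_def)
 qed
 \<comment> \<open>The partner density of \<open>hw\<close> in \<open>avg_deriv\<close>: times the
   weight it is half the Gaussian, whose gradient is - x times the Gaussian.\<close>
 define hh where "hh = (\<lambda>x::real^'n. hw x / 2)"
 have p': "(t, hh, \<psi>) \<in> prm" if "\<psi> \<in> S_ev" for t and \<psi> :: "real^'n \<Rightarrow> real"
 proof -
  have "\<bar>hh x\<bar> \<le> 1" for x using hw_pos[of x] hw_le_one[of x] by (simp add: hh_def)
  then show ?thesis using that by (auto simp: prm_def hh_def)
 qed
 note mm = moments_rw[OF \<gamma> weight_hw]
 define H where "H = (\<lambda>t. avg (rw \<gamma> hw) \<gamma> (t, hw, \<phi>))"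
 define H' where "H' = (\<lambda>t y. t * avg (rw \<gamma> hw) \<gamma> (t, hh, bessel_lap \<gamma> \<phi>) y)"
 have cH: "cfam H" unfolding H_def by (rule cfam_avg[OF \<gamma> mm p[OF \<phi>]])
 have cH': "cfam H'"
 proof -
  have "cfam (\<lambda>t. avg (rw \<gamma> hw) \<gamma> (t, hh, bessel_lap \<gamma> \<phi>))" by (rule cfam_avg[OF \<gamma> mm p'[OF bessel_lap_S_ev[OF \<phi>]]])
  from cfam_lin[OF this this continuous_on_id continuous_on_const[of _ 0]] show ?thesis by (simp add: H'_def)
 qed
 have d: "deriv_fam H H'"
  unfolding deriv_fam_def H_def H'_def
 proof (intro allI impI avg_deriv[OF \<gamma> weight_hw p[OF \<phi>] p'[OF \<phi>]])
  show "continuous_on UNIV (\<lambda>x::real^'n. hw x * hw x)" "continuous_on UNIV (\<lambda>x::real^'n. hw x * hh x)"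
   unfolding hh_def by (intro continuous_intros hw_continuous; simp)+
  show "has_pd i (\<lambda>x. hw x * hh x) (\<lambda>x::real^'n. - (x$i * (hw x * hw x)))" for i
   unfolding hh_def hw_mult times_divide_eq_right
   using has_pd_lin[OF has_pd_gauss[of i] has_pd_gauss[of i], where a="1/2" and b=0] by simp
 qed
 have "gav \<gamma> t \<phi> gauss = H t" for t
  unfolding H_def by (rule ext) (simp add: gav_def avg_rw[OF \<gamma> weight_hw p[OF \<phi>]] hw_mult)
 then have "((\<lambda>s. f (H s)) \<longlongrightarrow> 0) (at_right 0)"
  using z by (intro tendsto_eventually) (auto simp: eventually_at_filter)
 then have fH0: "f (H 0) = 0"
  using dual_limit[OF f cH cH' d] tendsto_unique[OF trivial_limit_at_right_real] by blast
 have "(LBINT x. ow \<gamma> x * gauss x) = gmass \<gamma>" using ow_gaussian_nn_integral[OF \<gamma>] gmass_pos[OF \<gamma>]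
  by (subst integral_eq_nn_integral) (auto simp: gauss_def ow_nonneg intro!: borel_measurable_continuous_onI continuous_intros)
 then have "H 0 = (\<lambda>y. gmass \<gamma> * nu_mass \<gamma> * \<phi> y)"
  unfolding H_def fun_eq_iff by (simp add: avg_zero[OF \<gamma> weight_hw p[OF \<phi>]] hw_mult)
 then have "gmass \<gamma> * nu_mass \<gamma> * f \<phi> = 0" using fH0 dual_scale[OF f \<phi>] by simp
 then show ?thesis using gmass_pos[OF \<gamma>] nu_mass_pos[OF \<gamma>] by simp
qed

section \<open>The uniqueness theorem\<close>

theorem uniqueness:
 fixes \<gamma> :: "real^'n::finite"
 assumes \<gamma>: "allpos \<gamma>" and k: "k \<ge> 0" and u: "is_solution \<gamma> k f u" and v: "is_solution \<gamma> k f v"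
  and T: "T > 0" and \<phi>: "\<phi> \<in> S_ev"
 shows "v T \<phi> = u T \<phi>"
proof -
 define w where "w = (\<lambda>t \<psi>. v t \<psi> - u t \<psi>)"
 define w1 where "w1 = (\<lambda>\<psi> t. deriv (\<lambda>s. v s \<psi>) t - deriv (\<lambda>s. u s \<psi>) t)"
 note uD = is_solutionD[OF u] and vD = is_solutionD[OF v]
 have wd: "w t \<in> S_ev_dual" if t: "t > 0" for t
  using dual_lin[OF vD(1)[OF t] uD(1)[OF t], of 1 "-1"] by (simp add: w_def)
 have d1: "((\<lambda>s. w s \<psi>) has_real_derivative w1 \<psi> t) (at t)" if "\<psi> \<in> S_ev" "t > 0" for \<psi> t
  unfolding w_def w1_def by (rule DERIV_diff[OF vD(2)[OF that] uD(2)[OF that]])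
 have d2: "(w1 \<psi> has_real_derivative w t (bessel_lap \<gamma> \<psi>) - k / t * w1 \<psi> t) (at t)" if "\<psi> \<in> S_ev" "t > 0" for \<psi> t
 proof -
  have "w t (bessel_lap \<gamma> \<psi>) - k / t * w1 \<psi> t = deriv (deriv (\<lambda>s. v s \<psi>)) t - deriv (deriv (\<lambda>s. u s \<psi>)) t"
   using uD(5)[OF that] vD(5)[OF that] by (simp add: w_def w1_def right_diff_distrib)
  then show ?thesis using DERIV_diff[OF vD(3)[OF that] uD(3)[OF that]] by (simp add: w1_def[abs_def])
 qed
 have l1: "((\<lambda>s. w s \<psi>) \<longlongrightarrow> 0) (at_right 0)" "(w1 \<psi> \<longlongrightarrow> 0) (at_right 0)" if "\<psi> \<in> S_ev" for \<psi>
  unfolding w_def w1_def[abs_def] using tendsto_diff[OF vD(6)[OF that] uD(6)[OF that]] tendsto_diff[OF vD(7)[OF that] uD(7)[OF that]] by simp_all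
 \<comment> \<open>Near time 0 the vanishing limit bounds the difference, and on the rest of the
   interval compactness does.\<close>
 have pb: "\<exists>B. \<forall>t\<in>{0<..T}. \<bar>w t \<psi>\<bar> \<le> B" if \<psi>: "\<psi> \<in> S_ev" for \<psi>
 proof -
  have "\<forall>\<^sub>F s in at_right 0. \<bar>w s \<psi>\<bar> < 1"
   using tendstoD[OF l1(1)[OF \<psi>], of 1] by (simp add: dist_real_def)
  then obtain d where d: "d > 0" "\<And>s. 0 < s \<Longrightarrow> s < d \<Longrightarrow> \<bar>w s \<psi>\<bar> < 1" unfolding eventually_at_right_field by auto
  have "continuous_on {d/2..T} (\<lambda>s. w s \<psi>)"
   using d(1) by (intro continuous_at_imp_continuous_on ballI DERIV_isCont[OF d1[OF \<psi>]]) auto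
  then have "bounded ((\<lambda>s. w s \<psi>) ` {d/2..T})" by (intro compact_imp_bounded compact_continuous_image) auto
  then obtain B where "\<forall>s\<in>{d/2..T}. \<bar>w s \<psi>\<bar> \<le> B" unfolding bounded_iff by auto
  then have B: "\<bar>w s \<psi>\<bar> \<le> B" if "s \<in> {d/2..T}" for s using that by blast
  have "\<bar>w t \<psi>\<bar> \<le> max 1 B" if "t \<in> {0<..T}" for t
   using d(2)[of t] B[of t] that by (cases "t < d") (auto simp: le_max_iff_disj)
  then show ?thesis by blast
 qed
 have "w T (gav \<gamma> t \<phi> gauss) = 0" if t: "t > 0" for t
 proof -
  \<comment> \<open>The functionals are transported to the Banach space of bounded continuous
    \<sigma>, for fixed \<phi> and t. There each one is continuous, whatever the order of the
    functional at that time, and \<open>pb\<close> bounds them pointwise in \<tau>.\<close>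
  define L where "L = (\<lambda>\<tau> (\<sigma> :: (real^'n) \<Rightarrow>\<^sub>C real). w \<tau> (gav \<gamma> t \<phi> (\<lambda>x. apply_bcontfun \<sigma> x * hw x)))"
  have hb: "hwb (norm \<sigma> + 1) (\<lambda>x. apply_bcontfun \<sigma> x * hw x)" for \<sigma> :: "(real^'n) \<Rightarrow>\<^sub>C real"
   unfolding hwb_def
  proof (intro conjI allI)
   show "(\<lambda>x. apply_bcontfun \<sigma> x * hw x) \<in> borel_measurable borel"
    by (intro borel_measurable_continuous_onI continuous_intros hw_continuous continuous_on_apply_bcontfun)
   show "0 < norm \<sigma> + 1" by (simp add: add_nonneg_pos)
   have "norm (apply_bcontfun \<sigma> x) \<le> norm \<sigma> + 1" for x using norm_bounded[of \<sigma> x] by simp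
   then show "\<bar>apply_bcontfun \<sigma> x * hw x\<bar> \<le> (norm \<sigma> + 1) * hw x" for x
    using hw_pos[of x] by (simp add: abs_mult mult_right_mono)
  qed
  note gS = gav_avg(3)[OF \<gamma> \<phi> hb, of t]
  have Llin: "L \<tau> (p *\<^sub>R \<sigma> + q *\<^sub>R \<sigma>') = p * L \<tau> \<sigma> + q * L \<tau> \<sigma>'" if "\<tau> > 0" for \<tau> p q \<sigma> \<sigma>'
  proof -
   have "(\<lambda>x. apply_bcontfun (p *\<^sub>R \<sigma> + q *\<^sub>R \<sigma>') x * hw x) = (\<lambda>x. p * (apply_bcontfun \<sigma> x * hw x) + q * (apply_bcontfun \<sigma>' x * hw x))"
    by (simp add: plus_bcontfun.rep_eq scaleR_bcontfun.rep_eq algebra_simps)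
   note e = this
   have "gav \<gamma> t \<phi> (\<lambda>x. apply_bcontfun (p *\<^sub>R \<sigma> + q *\<^sub>R \<sigma>') x * hw x) =
     (\<lambda>y. p * gav \<gamma> t \<phi> (\<lambda>x. apply_bcontfun \<sigma> x * hw x) y + q * gav \<gamma> t \<phi> (\<lambda>x. apply_bcontfun \<sigma>' x * hw x) y)"
    unfolding e by (rule ext) (rule gav_lin[OF \<gamma> \<phi> hb hb])
   then show ?thesis unfolding L_def by (simp only: dualD(1)[OF wd[OF that] gS gS])
  qed
  have bl: "bounded_linear (L \<tau>)" if "\<tau> \<in> {0<..T}" for \<tau>
  proof -
   have \<tau>: "\<tau> > 0" using that by simp
   obtain K where K: "\<And>b g. hwb b g \<Longrightarrow> \<bar>w \<tau> (gav \<gamma> t \<phi> g)\<bar> \<le> K * b" using gav_bound[OF \<gamma> \<phi> wd[OF \<tau>]] by blast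
   have lin: "L \<tau> (\<sigma> + \<sigma>') = L \<tau> \<sigma> + L \<tau> \<sigma>'" "L \<tau> (p *\<^sub>R \<sigma>) = p *\<^sub>R L \<tau> \<sigma>" for \<sigma> \<sigma>' p
    using Llin[OF \<tau>, of 1 \<sigma> 1 \<sigma>'] Llin[OF \<tau>, of p \<sigma> 0 \<sigma>] by simp_all
   show ?thesis
   proof (rule bounded_linear_intro[where K="2 * K"])
    fix \<sigma> :: "(real^'n) \<Rightarrow>\<^sub>C real"
    show "norm (L \<tau> \<sigma>) \<le> norm \<sigma> * (2 * K)"
    proof (cases "\<sigma> = 0")
     case True
     then show ?thesis using lin(2)[of 0 0] by simp
    next
     case False
     \<comment> \<open>The bound from \<open>hb\<close> is the norm plus 1; evaluated at a unit
       vector it is 2, which by homogeneity gives the linear estimate with 2 K.\<close>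
     have "\<bar>L \<tau> (\<sigma> /\<^sub>R norm \<sigma>)\<bar> \<le> K * (norm (\<sigma> /\<^sub>R norm \<sigma>) + 1)" unfolding L_def by (rule K[OF hb])
     then have "\<bar>L \<tau> \<sigma>\<bar> / norm \<sigma> \<le> 2 * K" using False unfolding lin(2) by (simp add: abs_mult divide_inverse mult.commute)
     then show ?thesis using False by (simp add: field_simps)
    qed
   qed (rule lin)+
  qed
  have "\<exists>K. \<forall>\<tau>\<in>{0<..T}. \<forall>\<sigma>. \<bar>L \<tau> \<sigma>\<bar> \<le> K * norm \<sigma>"
   by (rule banach_steinhaus[OF bl]) (use pb gS in \<open>auto simp: L_def\<close>)
  then obtain K0 where K0: "\<And>\<tau> \<sigma>. 0 < \<tau> \<Longrightarrow> \<tau> \<le> T \<Longrightarrow> \<bar>L \<tau> \<sigma>\<bar> \<le> K0 * norm \<sigma>" by fastforce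
  define K where "K = \<bar>K0\<bar>"
  define A where "A = 4 * hdim \<gamma> + 16"
  have A: "A > 0" using hdim_pos[OF \<gamma>] by (simp add: A_def)
  have bnd: "\<bar>w \<tau> ((bessel_lap \<gamma> ^^ m) (gav \<gamma> t \<phi> gauss))\<bar> \<le> K * ((2 * A / t\<^sup>2) ^ m * fact m)"
   if \<tau>: "0 < \<tau>" "\<tau> \<le> T" for \<tau> m
  proof -
   let ?g = "(bessel_lap \<gamma> ^^ m) gauss :: real^'n \<Rightarrow> real"
   obtain B where B: "comb m B ?g" "B \<le> A ^ m * fact m" using comb_iterate[OF \<gamma>, of m] unfolding A_def by blast
   \<comment> \<open>The quotient is bounded because every iterated Laplacian of the Gaussian is
     dominated by the half Gaussian; this places it in the range of the uniform bound.\<close>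
   define \<sigma> where "\<sigma> = Bcontfun (\<lambda>x. ?g x / hw x)"
   have b: "norm (?g x / hw x) \<le> B * 2 ^ m" for x
    using comb_bound[OF B(1), of x] hw_pos[of x] by (simp add: field_simps)
   have "(\<lambda>x. ?g x / hw x) \<in> bcontfun"
    by (rule bcontfun_normI[OF _ b]) (intro continuous_on_divide S_ev_continuous[OF comb_S_ev[OF B(1)]] hw_continuous, simp add: hw_nz)
   then have ap: "apply_bcontfun \<sigma> = (\<lambda>x. ?g x / hw x)" unfolding \<sigma>_def by (rule Bcontfun_inverse)
   have n\<sigma>: "norm \<sigma> \<le> B * 2 ^ m" by (rule norm_bound) (simp only: ap b)
   have g: "(\<lambda>x. apply_bcontfun \<sigma> x * hw x) = ?g" unfolding ap by (simp add: hw_nz)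
   have "w \<tau> ((bessel_lap \<gamma> ^^ m) (gav \<gamma> t \<phi> gauss)) = (1 / t\<^sup>2) ^ m * L \<tau> \<sigma>"
    unfolding iterate_bessel_lap_gav[OF \<gamma> \<phi> t] L_def g
    by (rule dual_scale[OF wd[OF \<tau>(1)] gav_avg(3)[OF \<gamma> \<phi> comb_hwb[OF B(1)]]])
   then have "\<bar>w \<tau> ((bessel_lap \<gamma> ^^ m) (gav \<gamma> t \<phi> gauss))\<bar> = (1 / t\<^sup>2) ^ m * \<bar>L \<tau> \<sigma>\<bar>" using t by (simp add: abs_mult)
   also have "... \<le> (1 / t\<^sup>2) ^ m * (K * (A ^ m * fact m * 2 ^ m))"
   proof (rule mult_left_mono)
    have "\<bar>L \<tau> \<sigma>\<bar> \<le> K0 * norm \<sigma>" by (rule K0[OF \<tau>])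
    also have "... \<le> K * norm \<sigma>" unfolding K_def by (intro mult_right_mono) auto
    also have "... \<le> K * (B * 2 ^ m)" by (intro mult_left_mono n\<sigma>) (simp add: K_def)
    also have "... \<le> K * (A ^ m * fact m * 2 ^ m)" by (intro mult_left_mono mult_right_mono B(2)) (auto simp: K_def)
    finally show "\<bar>L \<tau> \<sigma>\<bar> \<le> K * (A ^ m * fact m * 2 ^ m)" .
   qed (use t in auto)
   also have "... = K * ((2 * A / t\<^sup>2) ^ m * fact m)" by (simp add: power_divide power_mult_distrib)
   finally show ?thesis .
  qed
  have chi: "gav \<gamma> t \<phi> gauss \<in> S_ev"
   using gav_avg(3)[OF \<gamma> \<phi> comb_hwb[OF comb.base[of 0 0]]] by (simp add: eg_0)
  have itS: "(bessel_lap \<gamma> ^^ n) (gav \<gamma> t \<phi> gauss) \<in> S_ev" for n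
   by (induction n) (auto intro: chi bessel_lap_S_ev)
  \<comment> \<open>Collects the geometric factors, those of the iterated Laplacians and those of
    the 2 m integrations, so that the m-th estimate is a term of an exponential series.\<close>
  define x where "x = 2 * A / t\<^sup>2 * T\<^sup>2"
  have est: "\<bar>w T (gav \<gamma> t \<phi> gauss)\<bar> \<le> K * (x ^ m / fact m)" for m
  proof -
   let ?M = "K * ((2 * A / t\<^sup>2) ^ m * fact m)"
   have M0: "?M \<ge> 0" using A by (simp add: K_def)
   have "\<bar>w T ((bessel_lap \<gamma> ^^ 0) (gav \<gamma> t \<phi> gauss))\<bar> \<le> ?M / fact (2 * m) * T ^ (2 * m)"
   proof (rule bessel_iterate[OF k M0, of "\<lambda>n s. w s ((bessel_lap \<gamma> ^^ n) (gav \<gamma> t \<phi> gauss))"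
      "\<lambda>n. w1 ((bessel_lap \<gamma> ^^ n) (gav \<gamma> t \<phi> gauss))" T])
    show "(w1 ((bessel_lap \<gamma> ^^ n) (gav \<gamma> t \<phi> gauss)) has_real_derivative
      w s ((bessel_lap \<gamma> ^^ Suc n) (gav \<gamma> t \<phi> gauss)) - k / s * w1 ((bessel_lap \<gamma> ^^ n) (gav \<gamma> t \<phi> gauss)) s) (at s)" if "0 < s" for n s
     using d2[OF itS that] by simp
   qed (use d1[OF itS] l1[OF itS] bnd T in auto)
   also have "?M / fact (2 * m) * T ^ (2 * m) = K * (x ^ m * (fact m / fact (2 * m)))"
    by (simp add: x_def power_mult power_mult_distrib power_divide)
   also have "... \<le> K * (x ^ m * (1 / fact m))"
   proof (intro mult_left_mono)
    \<comment> \<open>The factorial of 2 m gained by integrating outweighs the m! of the Laplacians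
      and leaves another m! in the denominator.\<close>
    have "fact m * fact m \<le> (fact (2 * m) :: nat)"
     using fact_fact_dvd_fact[of m m] by (intro dvd_imp_le) (auto simp: mult_2)
    then have "real (fact m * fact m) \<le> real (fact (2 * m))" by (rule of_nat_mono)
    then show "fact m / fact (2 * m) \<le> (1 / fact m :: real)" by (simp add: field_simps)
   qed (use A in \<open>auto simp: K_def x_def\<close>)
   finally show ?thesis by simp
  qed
  have "(\<lambda>m. x ^ m / fact m) \<longlonglongrightarrow> 0"
  proof -
   have "(\<lambda>m. x ^ m /\<^sub>R fact m) \<longlonglongrightarrow> 0" by (rule summable_LIMSEQ_zero[OF summable_exp_generic])
   then show ?thesis by (simp add: divide_inverse mult.commute)
  qed
  from tendsto_mult_left[OF this, of K] have "(\<lambda>m. K * (x ^ m / fact m)) \<longlonglongrightarrow> 0" by simp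
  then have "\<bar>w T (gav \<gamma> t \<phi> gauss)\<bar> \<le> 0" by (rule LIMSEQ_le_const) (use est in blast)
  then show ?thesis by simp
 qed
 from gav_approx[OF \<gamma> \<phi> wd[OF T] this] show ?thesis by (simp add: w_def)
qed

theorem theorem4p1:
 fixes \<gamma> :: "real^'n::finite" and k :: real
  and f :: "(real^'n \<Rightarrow> real) \<Rightarrow> real"
 assumes "\<forall>i. 0 < \<gamma>$i"
  and "\<forall>m::nat. k \<noteq> - real (2 * m + 1)"
  and "f \<in> S_ev_dual"
 shows "is_solution \<gamma> k f (sol_formula \<gamma> k f)
  \<and> (0 \<le> k \<longrightarrow> (\<forall>v. is_solution \<gamma> k f v \<longrightarrow>
      (\<forall>t>0. \<forall>\<phi>\<in>S_ev. v t \<phi> = sol_formula \<gamma> k f t \<phi>)))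
  \<and> (k < 0 \<longrightarrow> (\<exists>v. is_solution \<gamma> k f v \<and>
      \<not> (\<forall>t>0. \<forall>\<phi>\<in>S_ev. v t \<phi> = sol_formula \<gamma> k f t \<phi>)))"
proof (intro conjI impI allI ballI)
 have "okk k" using assms(2) by (simp add: okk_def)
 note ex = existence[OF assms(1) this assms(3)]
 show "is_solution \<gamma> k f (sol_formula \<gamma> k f)" by (rule ex)
 show "v t \<phi> = sol_formula \<gamma> k f t \<phi>"
  if "0 \<le> k" "is_solution \<gamma> k f v" "0 < t" "\<phi> \<in> S_ev" for v t \<phi>
  by (rule uniqueness[OF assms(1) that(1) ex that(2-4)])
 show "\<exists>v. is_solution \<gamma> k f v \<and> \<not> (\<forall>t>0. \<forall>\<phi>\<in>S_ev. v t \<phi> = sol_formula \<gamma> k f t \<phi>)" if "k < 0"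
  by (rule nonuniqueness[OF assms(1) that ex])
qed

end
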